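(* Let $G$ be a locally compact abelian group with dual group $\Gamma$ (written additively), and let $\omega=(\omega_1,\omega_2,\dots)\in\Gamma^\infty$ be a sequence in $\Gamma$. The following are equivalent: (i) $\Gamma=\overline{\{\omega_\mu\mid\mu\in\mathcal{W}_\infty\}}$. (ii) $\mathcal{O}_\infty\rtimes_{\alpha^\omega}G$ is simple. (iii) $\mathcal{O}_\infty\rtimes_{\alpha^\omega}G$ is simple and purely infinite.
   Context: $\mathcal{O}_\infty$ is the Cuntz algebra generated universally by infinitely many isometries $S_1,S_2,\dots$ satisfying $S_i^*S_j=\delta_{i,j}$. $\mathcal{W}_\infty$ is the set of all finite words $\mu=(i_1,\dots,i_k)$, $k\ge 0$, with letters in $\{1,2,\dots\}$ (including the empty word $\emptyset$); for such $\mu$, $\omega_\mu=\sum_{j=1}^k\omega_{i_j}\in\Gamma$ (so $\omega_\emptyset=0$). Denote the pairing of $t\in G$ and $\gamma\in\Gamma$ by $\langle t\,|\,\gamma\rangle\in\mathbb{T}$. The action $\alpha^\omega$ of $G$ on $\mathcal{O}_\infty$ is determined by $\alpha^\omega_t(S_i)=\langle t\,|\,\omega_i\rangle S_i$ for $t\in G$, $i=1,2,\dots$. $\mathcal{O}_\infty\rtimes_{\alpha^\omega}G$ is the crossed product (full and reduced coincide since $G$ is amenable). The closure is taken in $\Gamma$. A simple $C^*$-algebra is called purely infinite if every non-zero hereditary $C^*$-subalgebra contains an infinite projection (a projection Murray–von Neumann equivalent to a proper subprojection of itself). *)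

theory Defs
  imports "HOL-Analysis.Analysis"
begin

text \<open>Complex C*-algebras as a type class. No unit is required; a unital (nonzero) C*-algebra has
  the additional sort \<open>real_normed_algebra_1\<close>.\<close>

class cstar_algebra = real_normed_algebra + banach +
  fixes scaleC :: "complex \<Rightarrow> 'a \<Rightarrow> 'a" (infixr "*\<^sub>C" 75)
    and star :: "'a \<Rightarrow> 'a"
  assumes scaleC_add_right: "c *\<^sub>C (x + y) = c *\<^sub>C x + c *\<^sub>C y"
    and scaleC_add_left: "(c + d) *\<^sub>C x = c *\<^sub>C x + d *\<^sub>C x"
    and scaleC_scaleC: "c *\<^sub>C d *\<^sub>C x = (c * d) *\<^sub>C x"
    and scaleR_scaleC: "r *\<^sub>R x = complex_of_real r *\<^sub>C x"
    and norm_scaleC: "norm (c *\<^sub>C x) = cmod c * norm x"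
    and mult_scaleC_left: "(c *\<^sub>C x) * y = c *\<^sub>C (x * y)"
    and mult_scaleC_right: "x * (c *\<^sub>C y) = c *\<^sub>C (x * y)"
    and star_star: "star (star x) = x"
    and star_add: "star (x + y) = star x + star y"
    and star_scaleC: "star (c *\<^sub>C x) = cnj c *\<^sub>C star x"
    and star_mult: "star (x * y) = star y * star x"
    and cstar_identity: "norm (star x * x) = (norm x)\<^sup>2"

instantiation complex :: cstar_algebra
begin

definition scaleC_complex :: "complex \<Rightarrow> complex \<Rightarrow> complex" where
  "scaleC_complex c x = c * x"

definition star_complex :: "complex \<Rightarrow> complex" where
  "star_complex x = cnj x"

instance
proof
  fix x y c d :: complex and r :: real
  show "c *\<^sub>C (x + y) = c *\<^sub>C x + c *\<^sub>C y" "(c + d) *\<^sub>C x = c *\<^sub>C x + d *\<^sub>C x"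
    by (simp_all add: scaleC_complex_def distrib_left distrib_right)
  show "c *\<^sub>C d *\<^sub>C x = (c * d) *\<^sub>C x" "(c *\<^sub>C x) * y = c *\<^sub>C (x * y)"
    "x * (c *\<^sub>C y) = c *\<^sub>C (x * y)"
    by (simp_all add: scaleC_complex_def mult_ac)
  show "r *\<^sub>R x = complex_of_real r *\<^sub>C x" "norm (c *\<^sub>C x) = cmod c * norm x"
    by (simp_all add: scaleC_complex_def scaleR_conv_of_real norm_mult)
  show "star (star x) = x" "star (x + y) = star x + star y" "star (c *\<^sub>C x) = cnj c *\<^sub>C star x"
    "star (x * y) = star y * star x"
    by (simp_all add: scaleC_complex_def star_complex_def)
  show "norm (star x * x) = (norm x)\<^sup>2"
    by (simp add: star_complex_def norm_mult power2_eq_square)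
qed

end

definition star_automorphism :: "('a::cstar_algebra \<Rightarrow> 'a) \<Rightarrow> bool" where
  "star_automorphism \<phi> \<longleftrightarrow> bij \<phi> \<and>
     (\<forall>x y. \<phi> (x + y) = \<phi> x + \<phi> y) \<and> (\<forall>c x. \<phi> (c *\<^sub>C x) = c *\<^sub>C \<phi> x) \<and>
     (\<forall>x y. \<phi> (x * y) = \<phi> x * \<phi> y) \<and> (\<forall>x. \<phi> (star x) = star (\<phi> x))"

definition cstar_action ::
    "('g::topological_ab_group_add \<Rightarrow> 'a::cstar_algebra \<Rightarrow> 'a) \<Rightarrow> bool" where
  "cstar_action \<alpha> \<longleftrightarrow> (\<forall>t. star_automorphism (\<alpha> t)) \<and>
     (\<forall>s t. \<alpha> (s + t) = \<alpha> s \<circ> \<alpha> t) \<and> (\<forall>a. continuous_on UNIV (\<lambda>t. \<alpha> t a))"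

definition closed_ideal :: "'a::cstar_algebra set \<Rightarrow> bool" where
  "closed_ideal I \<longleftrightarrow> closed I \<and> 0 \<in> I \<and> (\<forall>x\<in>I. \<forall>y\<in>I. x + y \<in> I) \<and>
     (\<forall>c. \<forall>x\<in>I. c *\<^sub>C x \<in> I) \<and> (\<forall>a. \<forall>x\<in>I. a * x \<in> I \<and> x * a \<in> I)"

definition simple_cstar :: "'a::cstar_algebra itself \<Rightarrow> bool" where
  "simple_cstar A \<longleftrightarrow> (UNIV :: 'a set) \<noteq> {0} \<and>
     (\<forall>I :: 'a set. closed_ideal I \<longrightarrow> I = {0} \<or> I = UNIV)"

text \<open>The positive cone \<open>{x\<^sup>* x}\<close> coincides with the self-adjoint elements of nonnegative
  spectrum.\<close>

definition cstar_pos :: "'a::cstar_algebra \<Rightarrow> bool" where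
  "cstar_pos a \<longleftrightarrow> (\<exists>x. a = star x * x)"

definition hereditary_subalgebra :: "'a::cstar_algebra set \<Rightarrow> bool" where
  "hereditary_subalgebra H \<longleftrightarrow> closed H \<and> 0 \<in> H \<and> (\<forall>x\<in>H. \<forall>y\<in>H. x + y \<in> H) \<and>
     (\<forall>c. \<forall>x\<in>H. c *\<^sub>C x \<in> H) \<and> (\<forall>x\<in>H. \<forall>y\<in>H. x * y \<in> H) \<and> (\<forall>x\<in>H. star x \<in> H) \<and>
     (\<forall>a. \<forall>b\<in>H. cstar_pos a \<longrightarrow> cstar_pos (b - a) \<longrightarrow> a \<in> H)"

definition projection :: "'a::cstar_algebra \<Rightarrow> bool" where
  "projection p \<longleftrightarrow> star p = p \<and> p * p = p"

text \<open>The partial isometry \<open>v\<close> below satisfies \<open>v = q v p = p v p\<close>, so it lies in every hereditary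
  C*-subalgebra containing \<open>p\<close>: being infinite does not depend on whether the equivalence is taken
  there or in the whole algebra.\<close>

definition infinite_projection :: "'a::cstar_algebra \<Rightarrow> bool" where
  "infinite_projection p \<longleftrightarrow> projection p \<and>
     (\<exists>q v. projection q \<and> p * q = q \<and> q \<noteq> p \<and> star v * v = p \<and> v * star v = q)"

definition purely_infinite :: "'a::cstar_algebra itself \<Rightarrow> bool" where
  "purely_infinite A \<longleftrightarrow>
     (\<forall>H :: 'a set. hereditary_subalgebra H \<and> H \<noteq> {0} \<longrightarrow> (\<exists>p\<in>H. infinite_projection p))"

text \<open>C*-seminorms on a *-algebra whose elements are functions, with pointwise vector space
  structure, carrier \<open>V\<close>, product \<open>mul\<close> and involution \<open>adj\<close>. They are exactly the functions
  \<open>f \<mapsto> \<parallel>\<pi> f\<parallel>\<close> for *-homomorphisms \<open>\<pi>\<close> into C*-algebras, so that quantifying over them amounts to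
  quantifying over *-representations in C*-algebras of arbitrary type.\<close>

definition cstar_seminorm ::
    "('x \<Rightarrow> 'a::cstar_algebra) set \<Rightarrow> (('x \<Rightarrow> 'a) \<Rightarrow> ('x \<Rightarrow> 'a) \<Rightarrow> ('x \<Rightarrow> 'a)) \<Rightarrow>
     (('x \<Rightarrow> 'a) \<Rightarrow> ('x \<Rightarrow> 'a)) \<Rightarrow> (('x \<Rightarrow> 'a) \<Rightarrow> real) \<Rightarrow> bool" where
  "cstar_seminorm V mul adj p \<longleftrightarrow>
     (\<forall>f\<in>V. \<forall>g\<in>V. p (\<lambda>x. f x + g x) \<le> p f + p g) \<and>
     (\<forall>c. \<forall>f\<in>V. p (\<lambda>x. c *\<^sub>C f x) = cmod c * p f) \<and>
     (\<forall>f\<in>V. \<forall>g\<in>V. p (mul f g) \<le> p f * p g) \<and>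
     (\<forall>f\<in>V. p (mul (adj f) f) = (p f)\<^sup>2)"

typedef (overloaded) 'g dual =
  "{\<xi>. continuous_on UNIV (\<xi> :: 'g::topological_ab_group_add \<Rightarrow> complex) \<and>
      (\<forall>s t. \<xi> (s + t) = \<xi> s * \<xi> t) \<and> (\<forall>t. cmod (\<xi> t) = 1)}"
  morphisms char_of Abs_dual
  by (rule exI[of _ "\<lambda>_. 1"]) simp

definition pairing :: "'g::topological_ab_group_add \<Rightarrow> 'g dual \<Rightarrow> complex" where
  "pairing t \<gamma> = char_of \<gamma> t"

lemma char_of_facts:
  "continuous_on UNIV (char_of \<gamma>)" "char_of \<gamma> (s + t) = char_of \<gamma> s * char_of \<gamma> t"
  "cmod (char_of \<gamma> t) = 1"
  using char_of[of \<gamma>] by auto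

lemma dual_eqI: "(\<And>t. char_of \<gamma> t = char_of \<delta> t) \<Longrightarrow> \<gamma> = \<delta>"
  by (simp add: char_of_inject[symmetric] fun_eq_iff)

instantiation dual :: (topological_ab_group_add) ab_group_add
begin

definition zero_dual :: "'a dual" where
  "0 = Abs_dual (\<lambda>_. 1)"

definition plus_dual :: "'a dual \<Rightarrow> 'a dual \<Rightarrow> 'a dual" where
  "\<gamma> + \<delta> = Abs_dual (\<lambda>t. char_of \<gamma> t * char_of \<delta> t)"

definition uminus_dual :: "'a dual \<Rightarrow> 'a dual" where
  "- \<gamma> = Abs_dual (\<lambda>t. cnj (char_of \<gamma> t))"

definition minus_dual :: "'a dual \<Rightarrow> 'a dual \<Rightarrow> 'a dual" where
  "\<gamma> - \<delta> = \<gamma> + - (\<delta> :: 'a dual)"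

lemma char_of_zero: "char_of (0 :: 'a dual) = (\<lambda>_. 1)"
  unfolding zero_dual_def by (rule Abs_dual_inverse) simp

lemma char_of_plus: "char_of (\<gamma> + \<delta> :: 'a dual) = (\<lambda>t. char_of \<gamma> t * char_of \<delta> t)"
  unfolding plus_dual_def
  by (rule Abs_dual_inverse) (auto simp: char_of_facts norm_mult intro!: continuous_intros)

lemma char_of_uminus: "char_of (- \<gamma> :: 'a dual) = (\<lambda>t. cnj (char_of \<gamma> t))"
  unfolding uminus_dual_def
  by (rule Abs_dual_inverse) (auto simp: char_of_facts intro!: continuous_intros)

instance
proof
  fix a b c :: "'a dual"
  show "a + b + c = a + (b + c)" "a + b = b + a" "0 + a = a"
    by (auto intro!: dual_eqI simp: char_of_plus char_of_zero mult_ac)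
  have "cnj (char_of a t) * char_of a t = 1" for t
    using complex_norm_square[of "char_of a t"] by (simp add: char_of_facts mult.commute)
  then show "- a + a = 0"
    by (auto intro!: dual_eqI simp: char_of_plus char_of_zero char_of_uminus)
  show "a - b = a + - b"
    by (fact minus_dual_def)
qed

end

text \<open>The topology of uniform convergence on compact sets, i.e. the compact-open topology.\<close>

instantiation dual :: (topological_ab_group_add) topological_space
begin

definition open_dual :: "'a dual set \<Rightarrow> bool" where
  "open U \<longleftrightarrow> (\<forall>\<gamma>\<in>U. \<exists>K e. compact K \<and> e > 0 \<and>
     {\<delta>. \<forall>t\<in>K. cmod (char_of \<delta> t - char_of \<gamma> t) < e} \<subseteq> (U :: 'a dual set))"

instance
proof
  show "open (UNIV :: 'a dual set)"
    unfolding open_dual_def by (auto intro!: exI[of _ "{}"] exI[of _ 1])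
next
  fix U V :: "'a dual set"
  assume U: "open U" and V: "open V"
  show "open (U \<inter> V)"
    unfolding open_dual_def
  proof
    fix \<gamma> assume "\<gamma> \<in> U \<inter> V"
    obtain K d where K: "compact K" "d > 0"
      "{\<delta>. \<forall>t\<in>K. cmod (char_of \<delta> t - char_of \<gamma> t) < d} \<subseteq> U"
      using bspec[OF U[unfolded open_dual_def], of \<gamma>] \<open>\<gamma> \<in> U \<inter> V\<close> by auto
    obtain L e where L: "compact L" "e > 0"
      "{\<delta>. \<forall>t\<in>L. cmod (char_of \<delta> t - char_of \<gamma> t) < e} \<subseteq> V"
      using bspec[OF V[unfolded open_dual_def], of \<gamma>] \<open>\<gamma> \<in> U \<inter> V\<close> by auto
    have KL: "compact (K \<union> L)" "min d e > 0"
      using K L by auto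
    have sub: "{\<delta>. \<forall>t\<in>K \<union> L. cmod (char_of \<delta> t - char_of \<gamma> t) < min d e} \<subseteq> U \<inter> V"
      using K(3) L(3) by auto
    show "\<exists>K e. compact K \<and> e > 0 \<and>
        {\<delta>. \<forall>t\<in>K. cmod (char_of \<delta> t - char_of \<gamma> t) < e} \<subseteq> U \<inter> V"
      by (rule exI[of _ "K \<union> L"], rule exI[of _ "min d e"]) (intro conjI KL sub)
  qed
next
  fix \<U> :: "'a dual set set"
  assume \<U>: "\<forall>U\<in>\<U>. open U"
  show "open (\<Union>\<U>)"
    unfolding open_dual_def
  proof
    fix \<gamma> assume "\<gamma> \<in> \<Union>\<U>"
    then obtain U where "U \<in> \<U>" "\<gamma> \<in> U" by blast
    then obtain K e where K: "compact K" "e > 0"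
      "{\<delta>. \<forall>t\<in>K. cmod (char_of \<delta> t - char_of \<gamma> t) < e} \<subseteq> U"
      using bspec[OF bspec[OF \<U> \<open>U \<in> \<U>\<close>, unfolded open_dual_def] \<open>\<gamma> \<in> U\<close>] by auto
    have sub: "{\<delta>. \<forall>t\<in>K. cmod (char_of \<delta> t - char_of \<gamma> t) < e} \<subseteq> \<Union>\<U>"
      by (rule subset_trans[OF K(3) Union_upper[OF \<open>U \<in> \<U>\<close>]])
    show "\<exists>K e. compact K \<and> e > 0 \<and>
        {\<delta>. \<forall>t\<in>K. cmod (char_of \<delta> t - char_of \<gamma> t) < e} \<subseteq> \<Union>\<U>"
      by (rule exI[of _ K], rule exI[of _ e]) (intro conjI K(1,2) sub)
  qed
qed

end

text \<open>The free unital *-algebra on generators indexed by \<open>nat\<close>: finitely supported functions on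
  words in the letters \<open>Gen i\<close> and \<open>Adj i\<close> (standing for the generators and their adjoints), with
  convolution along concatenation of words.\<close>

datatype letter = Gen nat | Adj nat

fun flip_letter :: "letter \<Rightarrow> letter" where
  "flip_letter (Gen i) = Adj i"
| "flip_letter (Adj i) = Gen i"

definition free_alg :: "(letter list \<Rightarrow> complex) set" where
  "free_alg = {f. finite {w. f w \<noteq> 0}}"

definition free_mult ::
    "(letter list \<Rightarrow> complex) \<Rightarrow> (letter list \<Rightarrow> complex) \<Rightarrow> letter list \<Rightarrow> complex" where
  "free_mult f g w = (\<Sum>k\<le>length w. f (take k w) * g (drop k w))"

definition free_star :: "(letter list \<Rightarrow> complex) \<Rightarrow> letter list \<Rightarrow> complex" where
  "free_star f w = cnj (f (rev (map flip_letter w)))"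

text \<open>The element \<open>S\<^sub>i\<^sup>* S\<^sub>j - \<delta>\<^sub>i\<^sub>j 1\<close> of the free *-algebra.\<close>

definition cuntz_relator :: "nat \<Rightarrow> nat \<Rightarrow> letter list \<Rightarrow> complex" where
  "cuntz_relator i j w =
     (if w = [Adj i, Gen j] then 1 else if w = [] \<and> i = j then - 1 else 0)"

fun eval_letter :: "(nat \<Rightarrow> 'a::cstar_algebra) \<Rightarrow> letter \<Rightarrow> 'a" where
  "eval_letter S (Gen i) = S i"
| "eval_letter S (Adj i) = star (S i)"

definition free_eval ::
    "(nat \<Rightarrow> 'a::{cstar_algebra, real_normed_algebra_1}) \<Rightarrow> (letter list \<Rightarrow> complex) \<Rightarrow> 'a" where
  "free_eval S f = (\<Sum>w | f w \<noteq> 0. f w *\<^sub>C prod_list (map (eval_letter S) w))"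

text \<open>\<open>'a\<close> is the universal unital C*-algebra generated by isometries \<open>S 0, S 1, \<dots>\<close> subject to
  \<open>S\<^sub>i\<^sup>* S\<^sub>j = \<delta>\<^sub>i\<^sub>j 1\<close>. The last clause is universality: the norm of a polynomial in the generators
  dominates its norm at every other family satisfying the relations in any C*-algebra, so that
  mapping generators to generators extends to a *-homomorphism. The letters \<open>1, 2, \<dots>\<close> are
  numbered from 0.\<close>

definition is_cuntz_infinity ::
    "(nat \<Rightarrow> 'a::{cstar_algebra, real_normed_algebra_1}) \<Rightarrow> bool" where
  "is_cuntz_infinity S \<longleftrightarrow>
     (\<forall>i j. star (S i) * S j = (if i = j then 1 else 0)) \<and>
     closure (free_eval S ` free_alg) = UNIV \<and>
     (\<forall>p. cstar_seminorm free_alg free_mult free_star p \<and> (\<forall>i j. p (cuntz_relator i j) = 0) \<longrightarrow>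
        (\<forall>f\<in>free_alg. p f \<le> norm (free_eval S f)))"

text \<open>\<open>\<alpha>\<close> is the quasi-free action \<open>\<alpha>\<^sup>\<omega>\<close>; the condition on generators determines it uniquely.\<close>

definition is_quasi_free_action ::
    "(nat \<Rightarrow> 'a::cstar_algebra) \<Rightarrow> (nat \<Rightarrow> 'g::topological_ab_group_add dual) \<Rightarrow>
     ('g \<Rightarrow> 'a \<Rightarrow> 'a) \<Rightarrow> bool" where
  "is_quasi_free_action S \<omega> \<alpha> \<longleftrightarrow>
     cstar_action \<alpha> \<and> (\<forall>t i. \<alpha> t (S i) = pairing t (\<omega> i) *\<^sub>C S i)"

definition word_sum :: "(nat \<Rightarrow> 'g::topological_ab_group_add dual) \<Rightarrow> nat list \<Rightarrow> 'g dual" where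
  "word_sum \<omega> \<mu> = sum_list (map \<omega> \<mu>)"

text \<open>Radon measures here are outer regular on Borel sets and inner regular on open sets.\<close>

definition haar_measure :: "'g::topological_ab_group_add measure \<Rightarrow> bool" where
  "haar_measure m \<longleftrightarrow> sets m = sets borel \<and> emeasure m UNIV \<noteq> 0 \<and>
     (\<forall>K. compact K \<longrightarrow> emeasure m K < \<infinity>) \<and>
     (\<forall>B\<in>sets borel. emeasure m B = (INF U\<in>{U. open U \<and> B \<subseteq> U}. emeasure m U)) \<and>
     (\<forall>U. open U \<longrightarrow> emeasure m U = (SUP K\<in>{K. compact K \<and> K \<subseteq> U}. emeasure m K)) \<and>
     (\<forall>t. \<forall>B\<in>sets borel. emeasure m ((+) t ` B) = emeasure m B)"

definition cc :: "('g::topological_space \<Rightarrow> 'a::{topological_space, zero}) set" where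
  "cc = {f. continuous_on UNIV f \<and> (\<exists>K. compact K \<and> (\<forall>t. t \<notin> K \<longrightarrow> f t = 0))}"

definition cc_mult ::
    "'g::topological_ab_group_add measure \<Rightarrow>
     ('g \<Rightarrow> 'a::{cstar_algebra, second_countable_topology} \<Rightarrow> 'a) \<Rightarrow>
     ('g \<Rightarrow> 'a) \<Rightarrow> ('g \<Rightarrow> 'a) \<Rightarrow> 'g \<Rightarrow> 'a" where
  "cc_mult m \<alpha> f g t = (LINT s|m. f s * \<alpha> s (g (t - s)))"

definition cc_star ::
    "('g::topological_ab_group_add \<Rightarrow> 'a::cstar_algebra \<Rightarrow> 'a) \<Rightarrow> ('g \<Rightarrow> 'a) \<Rightarrow> 'g \<Rightarrow> 'a" where
  "cc_star \<alpha> f t = \<alpha> t (star (f (- t)))"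

text \<open>\<open>'b\<close>, together with \<open>j\<close>, is the (full) crossed product of \<open>'a\<close> by the action \<open>\<alpha>\<close>, i.e. the
  enveloping C*-algebra of \<open>L\<^sup>1\<close> of the group with values in \<open>'a\<close>: the completion of the *-algebra
  \<open>cc\<close> in the largest C*-seminorm dominated by the \<open>L\<^sup>1\<close>-norm.\<close>

definition is_crossed_product ::
    "'g::topological_ab_group_add measure \<Rightarrow>
     ('g \<Rightarrow> 'a::{cstar_algebra, second_countable_topology} \<Rightarrow> 'a) \<Rightarrow>
     (('g \<Rightarrow> 'a) \<Rightarrow> 'b::cstar_algebra) \<Rightarrow> bool" where
  "is_crossed_product m \<alpha> j \<longleftrightarrow>
     (\<forall>f\<in>cc. \<forall>g\<in>cc. j (\<lambda>t. f t + g t) = j f + j g) \<and>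
     (\<forall>c. \<forall>f\<in>cc. j (\<lambda>t. c *\<^sub>C f t) = c *\<^sub>C j f) \<and>
     (\<forall>f\<in>cc. \<forall>g\<in>cc. j (cc_mult m \<alpha> f g) = j f * j g) \<and>
     (\<forall>f\<in>cc. j (cc_star \<alpha> f) = star (j f)) \<and>
     closure (j ` cc) = UNIV \<and>
     (\<forall>f\<in>cc. norm (j f) \<le> (LINT t|m. norm (f t))) \<and>
     (\<forall>p. cstar_seminorm cc (cc_mult m \<alpha>) (cc_star \<alpha>) p \<and>
          (\<forall>f\<in>cc. p f \<le> (LINT t|m. norm (f t))) \<longrightarrow>
        (\<forall>f\<in>cc. p f \<le> norm (j f)))"

end

theory Submission
  imports Defs
begin

text \<open>The crossed product contains \<open>C\<^sub>0(\<Gamma>)\<close> as the closure of the functions with values in \<open>\<complex> 1\<close>, and it is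
  spanned by the elements \<open>S\<^sub>\<mu> a S\<^sub>\<nu>\<^sup>*\<close> with \<open>a \<in> C\<^sub>0(\<Gamma>)\<close>, where \<open>a S\<^sub>i\<close> is \<open>S\<^sub>i\<close> times the translate of \<open>a\<close> by
  \<open>\<omega>\<^sub>i\<close>. The vacuum state of \<open>\<O>\<^sub>\<infinity>\<close> yields for every \<open>\<gamma> \<in> \<Gamma>\<close> a state that restricts to evaluation at \<open>\<gamma>\<close> on
  \<open>C\<^sub>0(\<Gamma>)\<close>, and these states are jointly faithful because the span has a length filtration of
  polynomial growth. Compressing by a generator \<open>S\<^sub>i\<close> with \<open>i\<close> large therefore turns a nonzero positive
  element into approximately a nonzero positive \<open>h \<in> C\<^sub>0(\<Gamma>)\<close>. If the \<open>\<omega>\<^sub>\<mu>\<close> are dense, finitely many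
  translates of \<open>h\<close> by elements \<open>\<omega>\<^sub>\<mu>\<close> dominate any given \<open>a \<in> C\<^sub>0(\<Gamma>)\<close> up to a small error, so \<open>a\<close> is
  approximated by \<open>Z\<^sup>* h Z\<close> with a single \<open>Z\<close>; this gives simplicity and, together with a scaling
  element, an infinite projection in every hereditary subalgebra. If the \<open>\<omega>\<^sub>\<mu>\<close> are not dense, some
  nonzero \<open>a \<in> C\<^sub>0(\<Gamma>)\<close> vanishes at all of them and lies in the kernel of the Fock representation at
  \<open>0\<close>, which is a proper ideal. Square roots are obtained as fixed points and
  characters from minimal C*-seminorms, so that neither units nor spectra are needed.\<close>

section \<open>Elementary C*-algebra theory\<close>

text \<open>The crossed product is an arbitrary type of class \<open>cstar_algebra\<close>, so its
  multiplier algebra, unitization, quotients and GNS spaces are not at hand as objects of their own.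
  Each is replaced by data on the given type: the multipliers S_i by operators \<open>L i\<close>
  with prescribed inner products, Fock space by the seminorms \<open>snorm\<close> of the
  functionals \<open>ch \<gamma>\<close>, quotients of the commutative part by C*-seminorms, and a
  missing unit by an element that equals 1 at the point in question or by an approximate unit. The
  vacuum functionals and the dual action exist because the norm of the crossed product is maximal.
  The opposite estimate, that Fock norms control this norm, is the real obstacle. Homogeneous parts
  are estimated by treating words of equal length as matrix units, and the loss from adding up
  polynomially many parts disappears on taking roots of large powers.\<close>

lemma scaleC_zero_left [simp]: "0 *\<^sub>C (x::'a::cstar_algebra) = 0"
  using scaleR_scaleC[of 0 x] by simp

lemma scaleC_zero_right [simp]: "c *\<^sub>C (0::'a::cstar_algebra) = 0"
  using norm_scaleC[of c "0::'a"] by simp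

lemma scaleC_one [simp]: "1 *\<^sub>C (x::'a::cstar_algebra) = x"
  using scaleR_scaleC[of 1 x] by simp

lemma scaleC_minus_left: "(- c) *\<^sub>C (x::'a::cstar_algebra) = - (c *\<^sub>C x)"
  using scaleC_add_left[of c "-c" x] by (simp add: add_eq_0_iff)

lemma scaleC_minus_right: "c *\<^sub>C (- x::'a::cstar_algebra) = - (c *\<^sub>C x)"
  using scaleC_add_right[of c x "-x"] by (simp add: add_eq_0_iff)

lemma scaleC_minus_one [simp]: "(-1) *\<^sub>C (x::'a::cstar_algebra) = - x"
  by (simp add: scaleC_minus_left)

lemma scaleC_diff_right: "c *\<^sub>C (x - y::'a::cstar_algebra) = c *\<^sub>C x - c *\<^sub>C y"
  using scaleC_add_right[of c x "-y"] by (simp add: scaleC_minus_right)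

lemma scaleC_diff_left: "(c - d) *\<^sub>C (x::'a::cstar_algebra) = c *\<^sub>C x - d *\<^sub>C x"
  using scaleC_add_left[of c "-d" x] by (simp add: scaleC_minus_left)

lemma scaleC_sum_left: "(\<Sum>i\<in>I. f i) *\<^sub>C (x::'a::cstar_algebra) = (\<Sum>i\<in>I. f i *\<^sub>C x)"
  by (induction I rule: infinite_finite_induct) (auto simp: scaleC_add_left)

lemma star_zero [simp]: "star (0::'a::cstar_algebra) = 0"
  using star_scaleC[of 0 "0::'a"] by simp

lemma star_minus: "star (- x::'a::cstar_algebra) = - star x"
  using star_scaleC[of "-1" x] by simp

lemma star_diff: "star (x - y::'a::cstar_algebra) = star x - star y"
  using star_add[of x "-y"] by (simp add: star_minus)

lemma star_sum: "star (\<Sum>i\<in>I. f i) = (\<Sum>i\<in>I. star (f i::'a::cstar_algebra))"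
  by (induction I rule: infinite_finite_induct) (auto simp: star_add)

lemma star_scaleR: "star (r *\<^sub>R x::'a::cstar_algebra) = r *\<^sub>R star x"
  by (simp add: scaleR_scaleC star_scaleC)

lemma star_eq_0_iff [simp]: "star (x::'a::cstar_algebra) = 0 \<longleftrightarrow> x = 0"
  using star_star star_zero by metis

lemma norm_star [simp]: "norm (star (x::'a::cstar_algebra)) = norm x"
proof -
  have *: "norm y \<le> norm (star y)" for y :: 'a
  proof (cases "y = 0")
    case False
    have "norm y * norm y \<le> norm (star y) * norm y"
      using cstar_identity[of y] norm_mult_ineq[of "star y" y] by (simp add: power2_eq_square)
    then show ?thesis using False by simp
  qed simp
  show ?thesis using *[of x] *[of "star x"] by (simp add: star_star)
qed

lemma cstar_identity': "norm ((x::'a::cstar_algebra) * star x) = (norm x)\<^sup>2"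
  using cstar_identity[of "star x"] by (simp add: star_star)

lemma star_mult_self_eq_0: "star x * (x::'a::cstar_algebra) = 0 \<longleftrightarrow> x = 0"
  using cstar_identity[of x] by (metis norm_eq_zero power2_less_0 mult_zero_right zero_eq_power2)

lemma bounded_linear_star: "bounded_linear (star :: 'a::cstar_algebra \<Rightarrow> 'a)"
  by (rule bounded_linear_intro[of _ 1]) (auto simp: star_add star_scaleR)

lemma bounded_linear_scaleC_right: "bounded_linear (\<lambda>x::'a::cstar_algebra. c *\<^sub>C x)"
  by (rule bounded_linear_intro[of _ "cmod c"])
    (auto simp: scaleC_add_right scaleR_scaleC scaleC_scaleC mult.commute norm_scaleC)

lemma bounded_bilinear_scaleC: "bounded_bilinear (\<lambda>c (x::'a::cstar_algebra). c *\<^sub>C x)"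
proof
  show "\<exists>K. \<forall>a (b::'a). norm (a *\<^sub>C b) \<le> norm a * norm b * K"
    by (rule exI[of _ 1]) (simp add: norm_scaleC)
qed (auto simp: scaleC_add_left scaleC_add_right scaleR_scaleC[where 'a='a] scaleC_scaleC
    scaleR_conv_of_real mult.commute)

lemmas continuous_on_star [continuous_intros] = bounded_linear.continuous_on[OF bounded_linear_star]
lemmas continuous_on_scaleC [continuous_intros] =
  bounded_bilinear.continuous_on[OF bounded_bilinear_scaleC]

lemma star_one [simp]: "star (1::'a::{cstar_algebra,real_normed_algebra_1}) = 1"
  using star_mult[of 1 "star (1::'a)"] star_star[of "1::'a"] by simp

text \<open>The Banach fixed point theorem for \<open>c \<mapsto> (h + c\<^sup>2) / 2\<close> yields \<open>c = 1 - (1 - h)\<^sup>\<onehalf>\<close> without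
  spectral theory and without a unit.\<close>

lemma sqrt_fixpoint:
  fixes h :: "'a::cstar_algebra"
  assumes h: "norm h < 1" "star h = h" and C: "closed C" "0 \<in> C"
    and stable: "\<And>c. c \<in> C \<Longrightarrow> (1/2) *\<^sub>R (h + c * c) \<in> C"
  shows "\<exists>c\<in>C. star c = c \<and> 2 *\<^sub>R c - c * c = h \<and> norm c < 1"
proof -
  \<comment> \<open>The smaller root of \<open>norm h + r * r = 2 * r\<close>: the ball of radius
    \<open>r\<close> is mapped into itself, and on it the map contracts by the factor
    \<open>r\<close>.\<close>
  define r where "r = 1 - sqrt (1 - norm h)"
  have r: "0 \<le> r" "r < 1" "norm h + r * r = 2 * r"
  proof -
    show "0 \<le> r" "r < 1" using h unfolding r_def by auto
    have "(1 - r) * (1 - r) = 1 - norm h" using h unfolding r_def by simp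
    then show "norm h + r * r = 2 * r" by (simp add: algebra_simps)
  qed
  define X where "X = {c \<in> C. star c = c} \<inter> cball 0 r"
  define F where "F c = (1/2) *\<^sub>R (h + c * c)" for c
  have "closed {c::'a. star c = c}"
    by (intro closed_Collect_eq continuous_intros)
  then have "closed X" unfolding X_def using C by (auto intro!: closed_Int simp: Collect_conj_eq)
  then have "complete X" by (simp add: complete_eq_closed)
  moreover have "X \<noteq> {}" unfolding X_def using C r by auto
  moreover have "F ` X \<subseteq> X"
  proof
    fix d assume "d \<in> F ` X"
    then obtain c where c: "c \<in> X" "d = F c" by auto
    have nc: "norm c \<le> r" using c unfolding X_def by simp
    have "norm (h + c * c) \<le> norm h + r * r"
      using norm_triangle_ineq[of h "c*c"] norm_mult_ineq[of c c] mult_mono[OF nc nc] r by simp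
    then have "norm d \<le> r" unfolding c F_def using r by simp
    moreover have "star d = d"
      using c h unfolding F_def X_def by (simp add: star_scaleR star_add star_mult)
    moreover have "d \<in> C" using c stable unfolding F_def X_def by simp
    ultimately show "d \<in> X" unfolding X_def by simp
  qed
  moreover have "dist (F x) (F y) \<le> r * dist x y" if "x \<in> X" "y \<in> X" for x y
  proof -
    have n: "norm x \<le> r" "norm y \<le> r" using that unfolding X_def by simp_all
    have "F x - F y = (1/2) *\<^sub>R (x * (x - y) + (x - y) * y)"
      unfolding F_def by (simp add: algebra_simps)
    also have "norm \<dots> \<le> 1/2 * (norm x * norm (x - y) + norm (x - y) * norm y)"
      using norm_triangle_ineq[of "x * (x - y)" "(x - y) * y"]
        norm_mult_ineq[of x "x - y"] norm_mult_ineq[of "x - y" y] by simp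
    also have "\<dots> \<le> 1/2 * (r * norm (x - y) + norm (x - y) * r)"
      using n by (intro mult_left_mono add_mono mult_mono) (use r in auto)
    finally show ?thesis by (simp add: dist_norm)
  qed
  ultimately have "\<exists>!x\<in>X. F x = x"
    using r by (intro Banach_fix[of X r F]) auto
  then obtain c where c: "c \<in> X" "F c = c" by blast
  have "h + c * c = 2 *\<^sub>R F c" unfolding F_def by simp
  then have "2 *\<^sub>R c - c * c = h" using c by (simp add: algebra_simps)
  then show ?thesis using c r unfolding X_def by auto
qed

lemma sqrt_one_minus:
  fixes h :: "'a::cstar_algebra"
  assumes "norm h < 1" "star h = h"
  shows "\<exists>c. star c = c \<and> 2 *\<^sub>R c - c * c = h"
  using sqrt_fixpoint[OF assms, of UNIV] by auto

text \<open>In the unitization \<open>k\<close> is the square root of 1 - h times \<open>g\<close>,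
  that is \<open>g - c * g\<close> with \<open>c\<close> from \<open>sqrt_one_minus\<close>.
  Inequalities between positive elements are obtained in this way, by exhibiting a difference as
  \<open>star k * k\<close>.\<close>

lemma one_minus_factor:
  fixes h g :: "'a::cstar_algebra"
  assumes "norm h < 1" "star h = h"
  shows "\<exists>k. star k * k = star g * g - star g * h * g"
proof -
  obtain c where c: "star c = c" "2 *\<^sub>R c - c * c = h" using sqrt_one_minus[OF assms] by blast
  have "star (g - c * g) * (g - c * g) = star g * g - star g * (2 *\<^sub>R c - c * c) * g"
    by (simp add: star_diff star_mult c algebra_simps scaleR_2)
  then show ?thesis using c by metis
qed

section \<open>Positive functionals\<close>

text \<open>A state without a unit to normalise it: \<open>bnd\<close> takes the place of the value
  1 at the unit.\<close>

locale positive_functional =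
  fixes \<tau> :: "'a::cstar_algebra \<Rightarrow> complex"
  assumes add: "\<tau> (x + y) = \<tau> x + \<tau> y"
    and scale: "\<tau> (c *\<^sub>C x) = c * \<tau> x"
    and pos: "0 \<le> Re (\<tau> (star x * x))" "Im (\<tau> (star x * x)) = 0"
    and bnd: "cmod (\<tau> x) \<le> norm x"
begin

lemma zero [simp]: "\<tau> 0 = 0"
  using scale[of 0 0] by simp

lemma minus: "\<tau> (- x) = - \<tau> x"
  using scale[of "-1" x] by simp

lemma diff: "\<tau> (x - y) = \<tau> x - \<tau> y"
  using add[of x "-y"] by (simp add: minus)

lemma sum: "\<tau> (\<Sum>i\<in>I. f i) = (\<Sum>i\<in>I. \<tau> (f i))"
  by (induction I rule: infinite_finite_induct) (auto simp: add)

lemma bounded_linear: "bounded_linear \<tau>"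
  by (rule bounded_linear_intro[of _ 1])
    (auto simp: add bnd scaleR_scaleC[where 'a='a] scale scaleR_conv_of_real)

lemmas tendsto = bounded_linear.tendsto[OF bounded_linear]
lemmas cont = bounded_linear.continuous_on[OF bounded_linear]

text \<open>Polarization: \<tau> is real on all squares, and the squares of \<open>x + y\<close> and
  \<open>x + \<i> *\<^sub>C y\<close> yield the imaginary and the real part of the identity.\<close>

lemma hermitian: "\<tau> (star y * x) = cnj (\<tau> (star x * y))"
proof -
  have e: "Im (\<tau> (star (x + c *\<^sub>C y) * (x + c *\<^sub>C y))) = 0" for c by (rule pos)
  have x: "\<tau> (star (x + c *\<^sub>C y) * (x + c *\<^sub>C y)) = \<tau> (star x * x) + c * \<tau> (star x * y)
      + cnj c * \<tau> (star y * x) + cnj c * (c * \<tau> (star y * y))" for c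
    by (simp add: star_add star_scaleC distrib_left distrib_right mult_scaleC_left
        mult_scaleC_right add scale)
  have "Im (c * \<tau> (star x * y) + cnj c * \<tau> (star y * x)) = 0" for c
  proof -
    have "Im (cnj c * (c * \<tau> (star y * y))) = 0"
      using pos(2)[of y] by (simp add: algebra_simps)
    then show ?thesis using e[of c] pos(2)[of x] unfolding x by simp
  qed
  from this[of 1] this[of \<i>] show ?thesis by (simp add: complex_eq_iff)
qed

text \<open>The norm of the vector of \<open>x\<close> in the GNS space of \<tau>; the space itself
  is never formed.\<close>

definition snorm :: "'a \<Rightarrow> real" where
  "snorm x = sqrt (Re (\<tau> (star x * x)))"

lemma snorm_nonneg [simp]: "0 \<le> snorm x"
  by (simp add: snorm_def pos)

lemma snorm_sq: "(snorm x)\<^sup>2 = Re (\<tau> (star x * x))"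
  by (simp add: snorm_def pos)

lemma snorm_sq_complex: "complex_of_real ((snorm x)\<^sup>2) = \<tau> (star x * x)"
  using pos[of x] by (simp add: snorm_sq complex_eq_iff)

lemma snorm_expand: "(snorm (x + c *\<^sub>C y))\<^sup>2
    = (snorm x)\<^sup>2 + 2 * Re (c * \<tau> (star x * y)) + (cmod c)\<^sup>2 * (snorm y)\<^sup>2"
proof -
  have "Re (cnj c * \<tau> (star y * x)) = Re (c * \<tau> (star x * y))"
    unfolding hermitian[of y x] by simp
  moreover have "Re (cnj c * (c * \<tau> (star y * y))) = (cmod c)\<^sup>2 * (snorm y)\<^sup>2"
    unfolding snorm_sq by (simp only: cmod_power2) (simp add: power2_eq_square algebra_simps pos)
  moreover have "cnj c * (c * z) = c * (cnj c * z)" for z by (simp add: mult_ac)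
  ultimately show ?thesis unfolding snorm_sq
    by (simp del: times_complex.sel add: star_add star_scaleC distrib_left distrib_right mult_scaleC_left
        mult_scaleC_right add scale)
qed

lemma cauchy_schwarz: "cmod (\<tau> (star x * y)) \<le> snorm x * snorm y"
proof -
  define t where "t = \<tau> (star x * y)"
  define s where "s = (snorm y)\<^sup>2"
  have s0: "0 \<le> s" by (simp add: s_def)
  have q: "0 \<le> (snorm x)\<^sup>2 - 2 * r * (cmod t)\<^sup>2 + r\<^sup>2 * (cmod t)\<^sup>2 * s" for r
  proof -
    have "0 \<le> (snorm (x + (- of_real r * cnj t) *\<^sub>C y))\<^sup>2" by simp
    also have "\<dots> = (snorm x)\<^sup>2 - 2 * r * (cmod t)\<^sup>2 + r\<^sup>2 * (cmod t)\<^sup>2 * s"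
      unfolding snorm_expand t_def[symmetric] s_def
      by (simp add: norm_mult power_mult_distrib cmod_power2) (simp add: power2_eq_square algebra_simps)
    finally show ?thesis .
  qed
  have "(cmod t)\<^sup>2 \<le> (snorm x)\<^sup>2 * s"
  proof (cases "s = 0")
    case True
    have "t = 0"
    proof (rule ccontr)
      assume "t \<noteq> 0"
      then have p: "(cmod t)\<^sup>2 > 0" by simp
      \<comment> \<open>For \<open>s = 0\<close> the quadratic bound is affine in its parameter;
        this value turns it into 0 \<le> -1.\<close>
      have "2 * (((snorm x)\<^sup>2 + 1) / (2 * (cmod t)\<^sup>2)) * (cmod t)\<^sup>2 = (snorm x)\<^sup>2 + 1"
        using p by simp
      then show False using q[of "((snorm x)\<^sup>2 + 1) / (2 * (cmod t)\<^sup>2)"] True by simp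
    qed
    then show ?thesis using s0 by simp
  next
    case False
    then have "s > 0" using s0 by simp
    have "0 \<le> (snorm x)\<^sup>2 - (cmod t)\<^sup>2 / s"
      using q[of "1/s"] \<open>s > 0\<close> by (simp add: power2_eq_square field_simps)
    then show ?thesis using \<open>s > 0\<close> by (simp add: field_simps)
  qed
  then have "(cmod t)\<^sup>2 \<le> (snorm x * snorm y)\<^sup>2" by (simp add: s_def power_mult_distrib)
  then show ?thesis unfolding t_def by (rule power2_le_imp_le) simp
qed

lemma snorm_add: "snorm (x + y) \<le> snorm x + snorm y"
proof -
  have "(snorm (x + y))\<^sup>2 = (snorm x)\<^sup>2 + 2 * Re (\<tau> (star x * y)) + (snorm y)\<^sup>2"
    using snorm_expand[of x 1 y] by simp
  also have "\<dots> \<le> (snorm x + snorm y)\<^sup>2"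
    using cauchy_schwarz[of x y] complex_Re_le_cmod[of "\<tau> (star x * y)"]
    by (simp add: power2_sum)
  finally show ?thesis by (rule power2_le_imp_le) simp
qed

lemma snorm_scale: "snorm (c *\<^sub>C x) = cmod c * snorm x"
proof -
  have "(snorm (c *\<^sub>C x))\<^sup>2 = (cmod c * snorm x)\<^sup>2"
    using snorm_expand[of 0 c x] by (simp add: power_mult_distrib snorm_def)
  then show ?thesis by (simp add: power2_eq_iff_nonneg)
qed

lemma snorm_zero [simp]: "snorm 0 = 0"
  by (simp add: snorm_def)

lemma snorm_minus [simp]: "snorm (- x) = snorm x"
  using snorm_scale[of "-1" x] by simp

lemma snorm_diff: "snorm (x - y) \<le> snorm x + snorm y"
  using snorm_add[of x "-y"] by simp

lemma snorm_cont: "continuous_on S snorm"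
  unfolding snorm_def by (intro continuous_intros cont)

text \<open>For \<open>e\<close> above the square of \<open>norm a\<close>, the element
  \<open>star a * a / e\<close> has norm below 1, so \<open>one_minus_factor\<close> makes
  \<open>star g * g\<close> minus its compression by \<open>g\<close> a square, on which \<tau> is
  nonnegative. Then \<open>e\<close> decreases to the square of \<open>norm a\<close>.\<close>

lemma snorm_mult: "snorm (a * g) \<le> norm a * snorm g"
proof -
  have *: "(snorm (a * g))\<^sup>2 \<le> e * (snorm g)\<^sup>2" if e: "(norm a)\<^sup>2 < e" for e
  proof -
    have e0: "0 < e" using e zero_le_power2[of "norm a"] by linarith
    define h where "h = complex_of_real (1/e) *\<^sub>C (star a * a)"
    have "norm h < 1" using e e0 by (simp add: h_def norm_scaleC cstar_identity norm_divide field_simps)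
    moreover have "star h = h" by (simp add: h_def star_scaleC star_mult star_star)
    ultimately obtain k where k: "star k * k = star g * g - star g * h * g"
      using one_minus_factor by blast
    have hg: "star g * h * g = complex_of_real (1/e) *\<^sub>C (star (a * g) * (a * g))"
      by (simp add: h_def mult_scaleC_left mult_scaleC_right star_mult mult.assoc)
    have "(snorm k)\<^sup>2 = (snorm g)\<^sup>2 - (1/e) * (snorm (a * g))\<^sup>2"
      by (simp only: snorm_sq k hg diff scale) simp
    then have "0 \<le> (snorm g)\<^sup>2 - (1/e) * (snorm (a * g))\<^sup>2" by (metis zero_le_power2)
    then show ?thesis using e0 by (simp add: field_simps)
  qed
  have "(snorm (a * g))\<^sup>2 \<le> (norm a)\<^sup>2 * (snorm g)\<^sup>2"
  proof (rule tendsto_lowerbound)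
    show "((\<lambda>e. e * (snorm g)\<^sup>2) \<longlongrightarrow> (norm a)\<^sup>2 * (snorm g)\<^sup>2) (at_right ((norm a)\<^sup>2))"
      by (intro tendsto_intros)
    show "\<forall>\<^sub>F e in at_right ((norm a)\<^sup>2). (snorm (a * g))\<^sup>2 \<le> e * (snorm g)\<^sup>2"
      using * by (auto simp: eventually_at_filter)
  qed simp
  then have "(snorm (a * g))\<^sup>2 \<le> (norm a * snorm g)\<^sup>2" by (simp add: power_mult_distrib)
  then show ?thesis by (rule power2_le_imp_le) simp
qed

end

text \<open>A *-homomorphism is contractive because it maps the unitary \<open>h + \<i> (1 - h\<^sup>2)\<^sup>\<onehalf>\<close> to a unitary.\<close>

lemma star_hom_contractive:
  fixes \<phi> :: "'a::{cstar_algebra,real_normed_algebra_1} \<Rightarrow> 'c::{cstar_algebra,real_normed_algebra_1}"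
  assumes one: "\<phi> 1 = 1"
    and add: "\<And>x y. \<phi> (x + y) = \<phi> x + \<phi> y" and scale: "\<And>c x. \<phi> (c *\<^sub>C x) = c *\<^sub>C \<phi> x"
    and mult: "\<And>x y. \<phi> (x * y) = \<phi> x * \<phi> y" and star: "\<And>x. \<phi> (star x) = star (\<phi> x)"
  shows "norm (\<phi> x) \<le> norm x"
proof -
  have *: "norm (\<phi> h) \<le> 1" if h: "star h = h" "norm h < 1" for h
  proof -
    have hh: "norm (h * h) < 1" using norm_mult_ineq[of h h] h
      mult_strict_mono'[of "norm h" 1 "norm h" 1] by simp
    have shh: "star (h * h) = h * h" by (simp add: star_mult h)
    \<comment> \<open>The fixed point is sought in the commutant of \<open>h\<close>, so that
      \<open>s\<close> commutes with \<open>h\<close> and \<open>u\<close> is unitary.\<close>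
    have "closed {c. c * h = h * c}" by (intro closed_Collect_eq continuous_intros)
    moreover have "(1/2) *\<^sub>R (h * h + c * c) \<in> {c. c * h = h * c}" if "c \<in> {c. c * h = h * c}" for c
    proof -
      have "c * c * h = c * (h * c)" using that by (simp add: mult.assoc)
      also have "\<dots> = h * (c * c)" using that by (simp add: mult.assoc[symmetric])
      finally show ?thesis by (simp add: algebra_simps)
    qed
    ultimately obtain c where c: "c * h = h * c" "star c = c" "2 *\<^sub>R c - c * c = h * h"
      using sqrt_fixpoint[OF hh shh, of "{c. c * h = h * c}"] by auto
    define s where "s = 1 - c"
    define u where "u = h + \<i> *\<^sub>C s"
    have s: "star s = s" "s * h = h * s" "s * s = 1 - h * h"
      unfolding s_def c(3)[symmetric] by (simp_all add: star_diff c algebra_simps scaleR_2)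
    have su: "star u = h - \<i> *\<^sub>C s"
      by (simp add: u_def star_add star_scaleC h s scaleC_minus_left)
    have uu: "star u * u = 1" "u * star u = 1" unfolding su unfolding u_def
      by (simp_all add: algebra_simps mult_scaleC_left mult_scaleC_right scaleC_scaleC s
          scaleC_add_right scaleC_diff_right)
    have n1: "norm (\<phi> v) = 1" if "star v * v = 1" for v
    proof -
      have "(norm (\<phi> v))\<^sup>2 = norm (\<phi> (star v * v))" by (simp add: mult star cstar_identity)
      then show ?thesis using that one by (simp add: power2_eq_1_iff)
        (use norm_ge_zero[of "\<phi> v"] in linarith)
    qed
    have "2 *\<^sub>R h = u + star u" unfolding su unfolding u_def by (simp add: scaleR_2)
    then have "\<phi> (2 *\<^sub>R h) = \<phi> u + \<phi> (star u)" by (simp add: add)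
    moreover have "norm (\<phi> (2 *\<^sub>R h)) = 2 * norm (\<phi> h)"
      by (simp add: scaleR_scaleC scale norm_scaleC)
    ultimately have "2 * norm (\<phi> h) \<le> norm (\<phi> u) + norm (\<phi> (star u))"
      using norm_triangle_ineq by metis
    then show ?thesis using n1[OF uu(1)] n1[of "star u"] uu(2) by (simp add: star_star)
  qed
  have sa: "norm (\<phi> h) \<le> norm h" if h: "star h = h" for h
  proof (rule field_le_epsilon)
    fix e :: real assume e: "e > 0"
    define k where "k = complex_of_real (1 / (norm h + e)) *\<^sub>C h"
    have p: "norm h + e > 0" using e by (simp add: add_nonneg_pos)
    have "star k = k" by (simp add: k_def star_scaleC h)
    moreover have "norm k < 1" using p e by (simp add: k_def norm_scaleC norm_divide field_simps del: of_real_add)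
    ultimately have "norm (\<phi> k) \<le> 1" by (rule *)
    then show "norm (\<phi> h) \<le> norm h + e"
      using p by (simp add: k_def scale norm_scaleC norm_divide field_simps del: of_real_add)
  qed
  have "(norm (\<phi> x))\<^sup>2 = norm (\<phi> (star x * x))" by (simp add: mult star cstar_identity)
  also have "\<dots> \<le> norm (star x * x)" by (rule sa) (simp add: star_mult star_star)
  also have "\<dots> = (norm x)\<^sup>2" by (simp add: cstar_identity)
  finally show ?thesis by (rule power2_le_imp_le) simp
qed

section \<open>Characters of commutative *-algebras with a C*-seminorm\<close>

definition cseminorm_on :: "'b::cstar_algebra set \<Rightarrow> ('b \<Rightarrow> real) \<Rightarrow> bool" where
  "cseminorm_on A q \<longleftrightarrow>
     (\<forall>x\<in>A. \<forall>y\<in>A. q (x + y) \<le> q x + q y) \<and> (\<forall>c. \<forall>x\<in>A. q (c *\<^sub>C x) = cmod c * q x) \<and>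
     (\<forall>x\<in>A. \<forall>y\<in>A. q (x * y) \<le> q x * q y) \<and> (\<forall>x\<in>A. q (star x * x) = (q x)\<^sup>2)"

locale comm_star_subalgebra =
  fixes A :: "'b::cstar_algebra set"
  assumes A_zero: "0 \<in> A"
    and A_add: "x \<in> A \<Longrightarrow> y \<in> A \<Longrightarrow> x + y \<in> A"
    and A_scale: "x \<in> A \<Longrightarrow> c *\<^sub>C x \<in> A"
    and A_mult: "x \<in> A \<Longrightarrow> y \<in> A \<Longrightarrow> x * y \<in> A"
    and A_star: "x \<in> A \<Longrightarrow> star x \<in> A"
    and A_comm: "x \<in> A \<Longrightarrow> y \<in> A \<Longrightarrow> x * y = y * x"
begin

lemma A_minus: "x \<in> A \<Longrightarrow> - x \<in> A"
  using A_scale[of x "-1"] by simp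

lemma A_diff: "x \<in> A \<Longrightarrow> y \<in> A \<Longrightarrow> x - y \<in> A"
  using A_add[of x "-y"] A_minus[of y] by simp

lemma A_scaleR: "x \<in> A \<Longrightarrow> r *\<^sub>R x \<in> A"
  by (simp add: scaleR_scaleC A_scale)

lemma A_sum: "(\<And>i. i \<in> I \<Longrightarrow> f i \<in> A) \<Longrightarrow> (\<Sum>i\<in>I. f i) \<in> A"
  by (induction I rule: infinite_finite_induct) (auto simp: A_zero A_add)

lemma A_left_comm: "x \<in> A \<Longrightarrow> y \<in> A \<Longrightarrow> x * (y * z) = y * (x * z)"
  using A_comm[of x y] by (simp add: mult.assoc[symmetric])

lemma norm_cseminorm_on: "cseminorm_on A norm"
  by (simp add: cseminorm_on_def norm_triangle_ineq norm_scaleC norm_mult_ineq cstar_identity)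

context
  fixes q assumes q: "cseminorm_on A q"
begin

lemma q_add: "x \<in> A \<Longrightarrow> y \<in> A \<Longrightarrow> q (x + y) \<le> q x + q y"
  and q_scale: "x \<in> A \<Longrightarrow> q (c *\<^sub>C x) = cmod c * q x"
  and q_mult: "x \<in> A \<Longrightarrow> y \<in> A \<Longrightarrow> q (x * y) \<le> q x * q y"
  and q_cstar: "x \<in> A \<Longrightarrow> q (star x * x) = (q x)\<^sup>2"
  using q by (auto simp: cseminorm_on_def)

lemma q_zero: "q 0 = 0"
  using q_scale[of 0 0] A_zero by simp

lemma q_minus: "x \<in> A \<Longrightarrow> q (- x) = q x"
  using q_scale[of x "-1"] by simp

lemma q_nonneg: "x \<in> A \<Longrightarrow> 0 \<le> q x"
  using q_add[of x "-x"] q_minus[of x] q_zero A_minus[of x] by simp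

lemma q_diff: "x \<in> A \<Longrightarrow> y \<in> A \<Longrightarrow> q (x - y) \<le> q x + q y"
  using q_add[of x "-y"] q_minus[of y] A_minus[of y] by simp

lemma q_diff_ge: "x \<in> A \<Longrightarrow> y \<in> A \<Longrightarrow> q x - q y \<le> q (x - y)"
  using q_add[of "x - y" y] A_diff[of x y] by simp

end

text \<open>Infima over suitably directed families of norms \<open>x \<mapsto> \<parallel>k x\<parallel>\<close> are again C*-seminorms; this
  replaces the passage to quotient algebras.\<close>

lemma cseminorm_on_INF:
  fixes F :: "('b \<Rightarrow> real) set"
  assumes ne: "F \<noteq> {}"
    and nonneg: "\<And>f x. f \<in> F \<Longrightarrow> x \<in> A \<Longrightarrow> 0 \<le> f x"
    and scale: "\<And>f x c. f \<in> F \<Longrightarrow> x \<in> A \<Longrightarrow> f (c *\<^sub>C x) = cmod c * f x"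
    and dir: "\<And>f g. f \<in> F \<Longrightarrow> g \<in> F \<Longrightarrow>
      \<exists>h\<in>F. \<forall>x\<in>A. \<forall>y\<in>A. h (x + y) \<le> f x + g y \<and> h (x * y) \<le> f x * g y"
    and sq1: "\<And>f. f \<in> F \<Longrightarrow> \<exists>h\<in>F. \<forall>x\<in>A. (h x)\<^sup>2 \<le> f (star x * x)"
    and sq2: "\<And>f. f \<in> F \<Longrightarrow> \<exists>h\<in>F. \<forall>x\<in>A. h (star x * x) \<le> (f x)\<^sup>2"
  shows "cseminorm_on A (\<lambda>x. INF f\<in>F. f x)"
proof -
  define u where "u x = (INF f\<in>F. f x)" for x
  have bdd: "bdd_below ((\<lambda>f. f x) ` F)" if "x \<in> A" for x
    using nonneg that by (intro bdd_belowI[of _ 0]) auto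
  have le: "u x \<le> f x" if "f \<in> F" "x \<in> A" for f x
    unfolding u_def by (rule cINF_lower[OF bdd[OF that(2)] that(1)])
  have ge: "c \<le> u x" if "\<And>f. f \<in> F \<Longrightarrow> c \<le> f x" for c x
    unfolding u_def using that by (intro cINF_greatest[OF ne]) auto
  have u0: "0 \<le> u x" if "x \<in> A" for x
    using nonneg that by (intro ge) auto
  have app: "\<exists>f\<in>F. f x < u x + e" if "x \<in> A" "e > 0" for x e
    using cInf_lessD[of "(\<lambda>f. f x) ` F" "u x + e"] that ne by (auto simp: u_def)
  have "u (x + y) \<le> u x + u y" if xy: "x \<in> A" "y \<in> A" for x y
  proof (rule field_le_epsilon)
    fix e :: real assume e: "e > 0"
    obtain f g where fg: "f \<in> F" "g \<in> F" "f x < u x + e/2" "g y < u y + e/2"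
      using app[OF xy(1), of "e/2"] app[OF xy(2), of "e/2"] e by auto
    obtain h where "h \<in> F" "h (x + y) \<le> f x + g y" using dir[OF fg(1,2)] xy by blast
    then show "u (x + y) \<le> u x + u y + e" using le[of h "x + y"] A_add[OF xy] fg by simp
  qed
  moreover have "u (x * y) \<le> u x * u y" if xy: "x \<in> A" "y \<in> A" for x y
  proof -
    have *: "u (x * y) \<le> f x * g y" if "f \<in> F" "g \<in> F" for f g
      using dir[OF that] xy le A_mult[OF xy] by (meson order_trans)
    have **: "u (x * y) \<le> (u x + e) * (u y + e)" if e: "e > 0" for e
    proof -
      obtain f g where fg: "f \<in> F" "g \<in> F" "f x < u x + e" "g y < u y + e"
        using app[OF xy(1) e] app[OF xy(2) e] by auto
      have "f x * g y \<le> (u x + e) * (u y + e)"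
        using fg nonneg xy u0[OF xy(1)] e by (intro mult_mono) auto
      then show ?thesis using *[OF fg(1,2)] by simp
    qed
    show ?thesis
    proof (rule tendsto_lowerbound)
      have "((\<lambda>e. (u x + e) * (u y + e)) \<longlongrightarrow> (u x + 0) * (u y + 0)) (at_right 0)"
        by (intro tendsto_intros)
      then show "((\<lambda>e. (u x + e) * (u y + e)) \<longlongrightarrow> u x * u y) (at_right 0)" by simp
      show "\<forall>\<^sub>F e in at_right 0. u (x * y) \<le> (u x + e) * (u y + e)"
        using ** by (auto simp: eventually_at_filter)
    qed simp
  qed
  moreover have "u (c *\<^sub>C x) = cmod c * u x" if x: "x \<in> A" for c x
  proof (cases "c = 0")
    case True
    have "u 0 = 0"
    proof (rule antisym)
      obtain f where "f \<in> F" using ne by auto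
      then show "u 0 \<le> 0" using le[of f 0] scale[of f 0 0] A_zero by simp
    qed (rule u0[OF A_zero])
    then show ?thesis using True by simp
  next
    case False
    have 1: "cmod c * u x \<le> u (c *\<^sub>C x)" if x: "x \<in> A" and c: "c \<noteq> 0" for c x
      using scale[OF _ x] le[OF _ x] by (intro ge) (metis mult_left_mono norm_ge_zero)
    have "cmod (inverse c) * u (c *\<^sub>C x) \<le> u (inverse c *\<^sub>C (c *\<^sub>C x))"
      using False x by (intro 1 A_scale) auto
    then have "u (c *\<^sub>C x) \<le> cmod c * u x"
      using False by (simp add: scaleC_scaleC norm_inverse norm_divide field_simps)
    then show ?thesis using 1[OF x False] by simp
  qed
  moreover have "u (star x * x) = (u x)\<^sup>2" if x: "x \<in> A" for x
  proof (rule antisym)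
    have sx: "star x * x \<in> A" using x by (intro A_mult A_star)
    show "(u x)\<^sup>2 \<le> u (star x * x)"
    proof (rule ge)
      fix f assume "f \<in> F"
      then obtain h where "h \<in> F" "(h x)\<^sup>2 \<le> f (star x * x)" using sq1 x by blast
      then show "(u x)\<^sup>2 \<le> f (star x * x)"
        using le[of h x] u0[OF x] x power_mono[of "u x" "h x" 2] by linarith
    qed
    have "sqrt (u (star x * x)) \<le> u x"
    proof (rule ge)
      fix f assume f: "f \<in> F"
      then obtain h where "h \<in> F" "h (star x * x) \<le> (f x)\<^sup>2" using sq2 x by blast
      then have "u (star x * x) \<le> (f x)\<^sup>2" using le[OF _ sx] by force
      then show "sqrt (u (star x * x)) \<le> f x" using nonneg[OF f x] real_le_lsqrt by blast
    qed
    then have "(sqrt (u (star x * x)))\<^sup>2 \<le> (u x)\<^sup>2" by (intro power_mono) (auto simp: u0[OF sx])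
    then show "u (star x * x) \<le> (u x)\<^sup>2" by (simp add: u0[OF sx])
  qed
  ultimately show ?thesis unfolding cseminorm_on_def u_def by blast
qed

text \<open>\<open>kp k n\<close> is the power \<open>k\<^sup>n\<^sup>+\<^sup>1\<close>, as there is no unit.\<close>

primrec kp :: "'b \<Rightarrow> nat \<Rightarrow> 'b" where
  "kp k 0 = k"
| "kp k (Suc n) = k * kp k n"

lemma kp_in: "k \<in> A \<Longrightarrow> kp k n \<in> A"
  by (induction n) (auto intro: A_mult)

lemma kp_mult: "kp k n * kp k m = kp k (Suc (n + m))"
  by (induction n) (auto simp: mult.assoc)

lemma kp_star: "k \<in> A \<Longrightarrow> star k = k \<Longrightarrow> star (kp k n) = kp k n"
  by (induction n) (auto simp: star_mult A_comm kp_in)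

context
  fixes q k assumes q: "cseminorm_on A q" and k: "k \<in> A" "star k = k" "q k = 1"
begin

lemma q_kp_le: "q (kp k n) \<le> 1"
proof (induction n)
  case (Suc n)
  then show ?case using q_mult[OF q k(1) kp_in[OF k(1)], of n] k by simp
qed (simp add: k)

text \<open>The C*-identity gives the value 1 for the exponents 2^j. Every other power is a factor
  of one of these, and submultiplicativity with \<open>q_kp_le\<close> leaves only the value
  1.\<close>

lemma q_kp: "q (kp k n) = 1"
proof -
  have two: "q (kp k (2 ^ j - 1)) = 1" for j
  proof (induction j)
    case (Suc j)
    have "Suc ((2 ^ j - 1) + (2 ^ j - 1)) = 2 ^ Suc j - 1"
      using one_le_power[of "2::nat" j] unfolding power_Suc by linarith
    then have "q (kp k (2 ^ Suc j - 1)) = q (star (kp k (2 ^ j - 1)) * kp k (2 ^ j - 1))"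
      by (simp add: kp_star k kp_mult)
    then show ?case using q_cstar[OF q kp_in[OF k(1)]] Suc by simp
  qed (simp add: k)
  have n: "n < 2 ^ n" by simp
  show ?thesis
  \<comment> \<open>In this case the cofactor would be the zeroth power of \<open>k\<close>, which
    needs a unit.\<close>
  proof (cases "n = 2 ^ n - 1")
    case True
    then show ?thesis using two[of n] by metis
  next
    case False
    then have "Suc (n + (2 ^ n - 2 - n)) = 2 ^ n - 1" using n by linarith
    then have "kp k (2 ^ n - 1) = kp k n * kp k (2 ^ n - 2 - n)" by (simp only: kp_mult)
    then have "1 \<le> q (kp k n) * q (kp k (2 ^ n - 2 - n))"
      using two[of n] q_mult[OF q kp_in[OF k(1)] kp_in[OF k(1)], of n] by metis
    also have "\<dots> \<le> q (kp k n) * 1"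
      using q_kp_le q_nonneg[OF q kp_in[OF k(1)]] by (intro mult_left_mono)
    finally show ?thesis using q_kp_le[of n] by simp
  qed
qed

text \<open>Read on the spectrum, multiplying by high powers of \<open>k\<close> suppresses
  everything off the set where \<open>k\<close> has modulus 1, so the infimum is the supremum norm
  over this peak set. It serves as the competitor in the minimality argument of
  \<open>minimal_cseminorm_mult\<close>.\<close>

lemma cseminorm_on_peak: "cseminorm_on A (\<lambda>x. INF f\<in>range (\<lambda>n x. q (kp k n * x)). f x)"
proof (rule cseminorm_on_INF)
  note kp = kp_in[OF k(1)]
  have le: "q (kp k n * x) \<le> q x" if "x \<in> A" for n x
    using q_mult[OF q kp that, of n] q_kp[of n] by simp
  fix f assume "f \<in> range (\<lambda>n x. q (kp k n * x))"
  then obtain n where f: "f = (\<lambda>x. q (kp k n * x))" by auto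
  show "0 \<le> f x" if "x \<in> A" for x unfolding f using that by (intro q_nonneg[OF q] A_mult kp)
  show "f (c *\<^sub>C x) = cmod c * f x" if "x \<in> A" for x c
    unfolding f using q_scale[OF q A_mult[OF kp that]] by (simp add: mult_scaleC_right)
  have sq: "q (kp k (Suc (n + n)) * (star x * x)) = (q (kp k n * x))\<^sup>2" if "x \<in> A" for x
  proof -
    have "kp k (Suc (n + n)) * (star x * x) = star (kp k n * x) * (kp k n * x)"
      unfolding kp_mult[symmetric] star_mult kp_star[OF k(1,2)]
      using kp A_star[OF that] that by (simp add: A_comm A_left_comm A_mult mult.assoc)
    then show ?thesis using q_cstar[OF q A_mult[OF kp that]] by simp
  qed
  show "\<exists>h\<in>range (\<lambda>n x. q (kp k n * x)). \<forall>x\<in>A. h (star x * x) \<le> (f x)\<^sup>2"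
    unfolding f using sq by (intro bexI[of _ "\<lambda>x. q (kp k (Suc (n + n)) * x)"]) (auto simp del: kp.simps)
  show "\<exists>h\<in>range (\<lambda>n x. q (kp k n * x)). \<forall>x\<in>A. (h x)\<^sup>2 \<le> f (star x * x)"
  proof (intro bexI ballI)
    fix x assume x: "x \<in> A"
    show "(q (kp k (Suc n) * x))\<^sup>2 \<le> f (star x * x)"
    proof -
      have "(q (kp k (Suc n) * x))\<^sup>2 \<le> (q (kp k n * x))\<^sup>2"
        using q_mult[OF q k(1) A_mult[OF kp x], of n] k q_nonneg[OF q A_mult[OF kp x]]
        by (intro power_mono) (auto simp: mult.assoc intro!: q_nonneg[OF q] A_mult kp x k)
      also have "\<dots> = q (kp k (Suc (n + n)) * (star x * x))" using sq[OF x] by simp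
      also have "\<dots> = q (kp k n * (kp k n * (star x * x)))"
        by (simp only: kp_mult[symmetric] mult.assoc)
      also have "\<dots> \<le> q (kp k n * (star x * x))"
        by (intro le A_mult kp A_star x)
      finally show ?thesis by (simp add: f)
    qed
  qed (rule range_eqI, rule refl)
  fix g assume "g \<in> range (\<lambda>n x. q (kp k n * x))"
  then obtain m where g: "g = (\<lambda>x. q (kp k m * x))" by auto
  show "\<exists>h\<in>range (\<lambda>n x. q (kp k n * x)). \<forall>x\<in>A. \<forall>y\<in>A. h (x + y) \<le> f x + g y \<and> h (x * y) \<le> f x * g y"
  proof (intro bexI ballI conjI)
    fix x y assume xy: "x \<in> A" "y \<in> A"
    have "kp k (Suc (n + m)) * (x + y) = kp k m * (kp k n * x) + kp k n * (kp k m * y)"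
      unfolding kp_mult[symmetric] using A_left_comm[OF kp kp] by (simp add: distrib_left mult.assoc)
    then have "q (kp k (Suc (n + m)) * (x + y)) \<le> q (kp k m * (kp k n * x)) + q (kp k n * (kp k m * y))"
      using q_add[OF q] xy by (simp add: A_mult kp)
    then show "q (kp k (Suc (n + m)) * (x + y)) \<le> f x + g y"
      using le[of "kp k n * x" m] le[of "kp k m * y" n] xy by (simp add: f g A_mult kp)
    have "kp k (Suc (n + m)) * (x * y) = (kp k n * x) * (kp k m * y)"
      unfolding kp_mult[symmetric] using A_left_comm[OF kp xy(1)] by (simp add: mult.assoc)
    then show "q (kp k (Suc (n + m)) * (x * y)) \<le> f x * g y"
      using q_mult[OF q A_mult[OF kp xy(1)] A_mult[OF kp xy(2)]] by (simp add: f g)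
  qed (rule range_eqI, rule refl)
qed auto

end

text \<open>Zorn's lemma on the seminorms below \<open>q\<close> that keep the value at
  \<open>a\<close>. The infimum of a chain is again admissible by \<open>cseminorm_on_INF\<close>,
  since of two members of a chain the smaller one serves as common refinement.\<close>

lemma minimal_cseminorm_exists:
  assumes q: "cseminorm_on A q" and a: "a \<in> A"
  shows "\<exists>r. cseminorm_on A r \<and> (\<forall>x\<in>A. r x \<le> q x) \<and> r a = q a \<and>
    (\<forall>s. cseminorm_on A s \<longrightarrow> (\<forall>x\<in>A. s x \<le> r x) \<longrightarrow> s a = q a \<longrightarrow> (\<forall>x\<in>A. s x = r x))"
proof -
  define Q where "Q = {r. cseminorm_on A r \<and> (\<forall>x\<in>A. r x \<le> q x) \<and> r a = q a \<and> (\<forall>x. x \<notin> A \<longrightarrow> r x = 0)}"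
  \<comment> \<open>The order is reversed, so that maximal elements are minimal seminorms. Members
    of \<open>Q\<close> are set to 0 off \<open>A\<close>, so that equality of functions means
    equality on \<open>A\<close>.\<close>
  define R where "R = (\<lambda>r s. s \<le> (r :: 'b \<Rightarrow> real))"
  have restr: "cseminorm_on A (\<lambda>x. if x \<in> A then r x else 0)" if "cseminorm_on A r" for r
    using that by (simp add: cseminorm_on_def A_add A_scale A_mult A_star)
  have "\<exists>m\<in>Q. \<forall>r\<in>Q. R m r \<longrightarrow> r = m"
  proof (rule predicate_Zorn)
    show "partial_order_on Q (relation_of R Q)"
      by (rule partial_order_on_relation_ofI) (auto simp: R_def)
    fix C assume C: "C \<in> Chains (relation_of R Q)"
    have CQ: "C \<subseteq> Q" and lin: "\<And>r s. r \<in> C \<Longrightarrow> s \<in> C \<Longrightarrow> r \<le> s \<or> s \<le> r"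
      using C by (auto simp: Chains_def relation_of_def R_def)
    show "\<exists>u\<in>Q. \<forall>r\<in>C. R r u"
    proof (cases "C = {}")
      case True
      then show ?thesis using restr[OF q] a unfolding Q_def
        by (intro bexI[of _ "\<lambda>x. if x \<in> A then q x else 0"]) auto
    next
      case False
      have cs: "cseminorm_on A r" if "r \<in> C" for r using that CQ by (auto simp: Q_def)
      have u: "cseminorm_on A (\<lambda>x. INF r\<in>C. r x)"
      proof (rule cseminorm_on_INF[OF False])
        fix f assume f: "f \<in> C"
        note fs = cs[OF f]
        show "0 \<le> f x" if "x \<in> A" for x using q_nonneg[OF fs that] .
        show "f (c *\<^sub>C x) = cmod c * f x" if "x \<in> A" for x c using q_scale[OF fs that] .
        show "\<exists>h\<in>C. \<forall>x\<in>A. h (star x * x) \<le> (f x)\<^sup>2"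
          using q_cstar[OF fs] f by (intro bexI[of _ f]) auto
        show "\<exists>h\<in>C. \<forall>x\<in>A. (h x)\<^sup>2 \<le> f (star x * x)"
          using q_cstar[OF fs] f by (intro bexI[of _ f]) auto
        fix g assume g: "g \<in> C"
        obtain h where h: "h \<in> C" "h \<le> f" "h \<le> g" using lin[OF f g] f g by blast
        show "\<exists>h\<in>C. \<forall>x\<in>A. \<forall>y\<in>A. h (x + y) \<le> f x + g y \<and> h (x * y) \<le> f x * g y"
        proof (intro bexI[OF _ h(1)] ballI conjI)
          fix x y assume xy: "x \<in> A" "y \<in> A"
          have le: "h x \<le> f x" "h y \<le> g y" using h by (auto simp: le_fun_def)
          show "h (x + y) \<le> f x + g y" using q_add[OF cs[OF h(1)] xy] le by linarith
          have "h x * h y \<le> f x * g y"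
            using le q_nonneg[OF cs[OF h(1)]] q_nonneg[OF fs] xy by (intro mult_mono) auto
          then show "h (x * y) \<le> f x * g y" using q_mult[OF cs[OF h(1)] xy] by linarith
        qed
      qed
      define u where "u = (\<lambda>x. if x \<in> A then (INF r\<in>C. r x) else 0)"
      have le: "u x \<le> r x" if "r \<in> C" for r x
      proof (cases "x \<in> A")
        case True
        have "bdd_below ((\<lambda>r. r x) ` C)"
          using q_nonneg[OF cs True] by (intro bdd_belowI[of _ 0]) auto
        then show ?thesis using cINF_lower[of "\<lambda>r. r x" C r] that True by (simp add: u_def)
      qed (use that CQ in \<open>auto simp: u_def Q_def\<close>)
      obtain r where r: "r \<in> C" using False by auto
      have "r a = q a" if "r \<in> C" for r using CQ that by (auto simp: Q_def)
      then have "(\<lambda>r. r a) ` C = {q a}" using False by (auto cong: image_cong_simp)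
      then have "u a = q a" using a by (simp add: u_def)
      moreover have "\<forall>x\<in>A. u x \<le> q x" using le[OF r] r CQ by (force simp: Q_def intro: order_trans)
      moreover have "cseminorm_on A u" unfolding u_def by (rule restr[OF u])
      ultimately have "u \<in> Q" by (auto simp: Q_def u_def)
      moreover have "\<forall>r\<in>C. R r u" using le by (auto simp: R_def le_fun_def)
      ultimately show ?thesis by blast
    qed
  qed
  then obtain m where m: "m \<in> Q" and min: "\<And>r. r \<in> Q \<Longrightarrow> r \<le> m \<Longrightarrow> r = m"
    by (auto simp: R_def)
  have "\<forall>x\<in>A. s x = m x" if s: "cseminorm_on A s" "\<forall>x\<in>A. s x \<le> m x" "s a = q a" for s
  proof -
    let ?s = "\<lambda>x. if x \<in> A then s x else 0"
    have "?s \<in> Q" using m restr[OF s(1)] s a by (auto simp: Q_def intro: order_trans)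
    moreover have "?s \<le> m" using s m by (auto simp: le_fun_def Q_def)
    ultimately have e: "?s = m" by (rule min)
    have "s x = m x" if "x \<in> A" for x using fun_cong[OF e, of x] that by simp
    then show ?thesis by simp
  qed
  then show ?thesis using m unfolding Q_def mem_Collect_eq by (intro exI[of _ m]) blast
qed

text \<open>If the powers of a normalised self-adjoint \<open>k\<close> do not lower the value at
  \<open>a\<close>, the peak seminorm of \<open>k\<close> competes with \<open>r\<close> and hence
  equals it, so multiplication by \<open>k\<close> preserves \<open>r\<close>. This applies to the
  normalised \<open>a\<close>, called \<open>b\<close>; and once \<open>b\<close> acts
  isometrically, it applies to every normalised self-adjoint \<open>k\<close>. The general case
  follows by the C*-identity.\<close>

lemma minimal_cseminorm_mult:
  assumes r: "cseminorm_on A r" and a: "a \<in> A" "star a = a" "r a > 0"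
    and min: "\<And>s. cseminorm_on A s \<Longrightarrow> (\<forall>x\<in>A. s x \<le> r x) \<Longrightarrow> s a = r a \<Longrightarrow> (\<forall>x\<in>A. s x = r x)"
    and xy: "x \<in> A" "y \<in> A"
  shows "r (x * y) = r x * r y"
proof -
  have peak: "r (k * x) = r x" if k: "k \<in> A" "star k = k" "r k = 1"
    and ka: "\<And>n. r (kp k n * a) = r a" and x: "x \<in> A" for k x
  proof -
    define s where "s = (\<lambda>x. INF f\<in>range (\<lambda>n x. r (kp k n * x)). f x)"
    have s: "cseminorm_on A s" unfolding s_def by (rule cseminorm_on_peak[OF r k])
    have bdd: "bdd_below ((\<lambda>f. f x) ` range (\<lambda>n x. r (kp k n * x)))" if "x \<in> A" for x
      using q_nonneg[OF r A_mult[OF kp_in[OF k(1)] that]] by (intro bdd_belowI[of _ 0]) auto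
    have sle: "s x \<le> r (kp k n * x)" if "x \<in> A" for n x
      unfolding s_def by (rule cINF_lower2[OF bdd[OF that]]) auto
    have le: "r (kp k n * x) \<le> r x" if "x \<in> A" for n x
      using q_mult[OF r kp_in[OF k(1)] that, of n] q_kp[OF r k, of n] by simp
    have "s a = r a" unfolding s_def image_image by (simp add: ka)
    then have "s x = r x" using min[OF s] sle le x order_trans by metis
    then have "r x \<le> r (k * x)" using sle[OF x, of 0] by simp
    then show ?thesis using le[OF x, of 0] by simp
  qed
  define b where "b = complex_of_real (1 / r a) *\<^sub>C a"
  have b: "b \<in> A" "star b = b" "r b = 1"
    using a by (simp_all add: b_def A_scale star_scaleC q_scale[OF r] norm_divide)
  have ab: "a = complex_of_real (r a) *\<^sub>C b" using a by (simp add: b_def scaleC_scaleC)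
  have ka: "r (kp b n * a) = r a" for n
  proof -
    have "r (kp b n * a) = r a * r (kp b n * b)"
      using a q_scale[OF r A_mult[OF kp_in[OF b(1)] b(1)], of "complex_of_real (r a)" n]
      by (subst ab) (simp add: mult_scaleC_right)
    also have "kp b n * b = kp b (Suc n)" using A_comm[OF kp_in[OF b(1)] b(1)] by simp
    finally show ?thesis using q_kp[OF r b, of "Suc n"] by simp
  qed
  have b_unit: "r (b * x) = r x" if "x \<in> A" for x using peak[OF b ka that] .
  have kmult1: "r (k * x) = r x" if k: "k \<in> A" "star k = k" "r k = 1" and x: "x \<in> A" for k x
  proof (rule peak[OF k _ x])
    fix n
    have "r (kp k n * a) = r a * r (kp k n * b)"
      using a q_scale[OF r A_mult[OF kp_in[OF k(1)] b(1)], of "complex_of_real (r a)" n]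
      by (subst ab) (simp add: mult_scaleC_right)
    also have "kp k n * b = b * kp k n" using A_comm[OF kp_in[OF k(1)] b(1)] by simp
    finally show "r (kp k n * a) = r a" using b_unit[OF kp_in[OF k(1)]] q_kp[OF r k] by simp
  qed
  have kmult: "r (k * x) = r k * r x" if k: "k \<in> A" "star k = k" and x: "x \<in> A" for k x
  proof (cases "r k = 0")
    case True
    then show ?thesis using q_mult[OF r k(1) x] q_nonneg[OF r A_mult[OF k(1) x]] by simp
  next
    case False
    then have p: "r k > 0" using q_nonneg[OF r k(1)] by simp
    let ?k = "complex_of_real (1 / r k) *\<^sub>C k"
    have "r (?k * x) = r x"
      using k p by (intro kmult1 x) (auto simp: A_scale star_scaleC q_scale[OF r] norm_divide)
    then show ?thesis using p q_scale[OF r A_mult[OF k(1) x], of "complex_of_real (1 / r k)"]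
      by (simp add: mult_scaleC_left norm_divide field_simps)
  qed
  note sx = A_star[OF xy(1)] and sy = A_star[OF xy(2)]
  have "(r (x * y))\<^sup>2 = r (star (x * y) * (x * y))" using q_cstar[OF r A_mult[OF xy]] by simp
  also have "star (x * y) * (x * y) = (star x * x) * (star y * y)"
    using A_comm[OF sy sx] A_left_comm[OF sy xy(1)] by (simp add: star_mult mult.assoc A_left_comm[OF sy])
  also have "r \<dots> = r (star x * x) * r (star y * y)"
    by (intro kmult) (simp_all add: A_mult sx sy xy star_mult star_star)
  also have "\<dots> = (r x * r y)\<^sup>2" by (simp add: q_cstar[OF r] xy power_mult_distrib)
  finally show ?thesis using q_nonneg[OF r] xy by (simp add: A_mult power2_eq_iff_nonneg)
qed

text \<open>Mazur's theorem for a multiplicative seminorm \<open>r\<close>: a positive minimum of \<open>z \<mapsto> r (h - z b)\<close>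
  would be attained on an open set, by factoring \<open>h\<^sup>n - z\<^sup>n b\<^sup>n\<close> for \<open>n = 2\<^sup>k\<close>.\<close>

lemma mazur:
  assumes r: "cseminorm_on A r" and mult: "\<And>x y. x \<in> A \<Longrightarrow> y \<in> A \<Longrightarrow> r (x * y) = r x * r y"
    and b: "b \<in> A" "r b = 1" and h: "h \<in> A"
  shows "\<exists>z. r (h - z *\<^sub>C b) = 0"
proof (rule ccontr)
  assume no: "\<not> ?thesis"
  define \<psi> where "\<psi> z = r (h - z *\<^sub>C b)" for z
  have inA: "x - z *\<^sub>C b \<in> A" if "x \<in> A" for x z using that b by (intro A_diff A_scale)
  have nz: "\<psi> z > 0" for z
    using no q_nonneg[OF r inA[OF h], of z] by (auto simp: \<psi>_def less_le)
  have lip: "\<bar>\<psi> z - \<psi> w\<bar> \<le> cmod (z - w)" for z w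
  proof -
    have *: "\<psi> z - \<psi> w \<le> cmod (z - w)" for z w
      using q_diff_ge[OF r inA[OF h] inA[OF h], of z w] b
        q_scale[OF r b(1), of "w - z"] by (simp add: \<psi>_def scaleC_diff_left norm_minus_commute)
    show ?thesis using *[of z w] *[of w z] by (simp add: norm_minus_commute abs_le_iff)
  qed
  have cont: "continuous_on S \<psi>" for S
    unfolding continuous_on_iff dist_norm using lip by (metis le_less_trans real_norm_def)
  have grow: "cmod z - r h \<le> \<psi> z" for z
    using q_diff_ge[OF r A_scale[OF b(1)] h, of z] q_scale[OF r b(1), of z] b(2)
      q_minus[OF r inA[OF h], of z] by (simp add: \<psi>_def)
  \<comment> \<open>Outside this disc \<open>\<psi> z \<ge> cmod z - r h\<close> exceeds
    \<open>\<psi> 0 = r h\<close>, so the minimum over the disc is global.\<close>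
  obtain z0 where z0: "\<And>z. cmod z \<le> 2 * r h + 1 \<Longrightarrow> \<psi> z0 \<le> \<psi> z"
    using continuous_attains_inf[of "cball (0::complex) (2 * r h + 1)" \<psi>] cont q_nonneg[OF r h]
    by (force simp: dist_norm)
  define \<rho> where "\<rho> = \<psi> z0"
  have \<rho>: "\<rho> > 0" using nz by (simp add: \<rho>_def)
  have min: "\<rho> \<le> \<psi> z" for z
  proof (cases "cmod z \<le> 2 * r h + 1")
    case False
    have "\<psi> 0 = r h" by (simp add: \<psi>_def)
    then show ?thesis using False grow[of z] z0[of 0] q_nonneg[OF r h] by (simp add: \<rho>_def)
  qed (simp add: \<rho>_def z0)
  have ball: "\<psi> z = \<rho>" if z1: "\<psi> z1 = \<rho>" and zz: "cmod (z - z1) < \<rho>" for z z1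
  proof -
    define g where "g = h - z1 *\<^sub>C b"
    define w where "w = z - z1"
    \<comment> \<open>\<open>H n\<close> and \<open>B n\<close> are the powers of \<open>g\<close>
      and \<open>b\<close> with exponent 2^n; repeated squaring avoids the zeroth power and lets the
      difference of powers be factored by square roots alone.\<close>
    define H where "H = rec_nat g (\<lambda>_ x. x * x)"
    define B where "B = rec_nat b (\<lambda>_ x. x * x)"
    have HS: "H 0 = g" "H (Suc n) = H n * H n" for n by (simp_all add: H_def)
    have BS: "B 0 = b" "B (Suc n) = B n * B n" for n by (simp_all add: B_def)
    have HA: "H n \<in> A" for n by (induction n) (auto simp: HS g_def inA h A_mult)
    have BA: "B n \<in> A" for n by (induction n) (auto simp: BS b A_mult)
    have rB: "r (B n) = 1" for n by (induction n) (auto simp: BS b mult BA)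
    have rH: "r (H n) = \<rho> ^ (2 ^ n)" for n
    proof (induction n)
      case 0
      then show ?case using z1 by (simp add: HS g_def \<psi>_def)
    next
      case (Suc n)
      then show ?case by (simp add: HS mult HA power_add[symmetric] mult_2)
    qed
    have fac: "H (Suc n) - v\<^sup>2 *\<^sub>C B (Suc n) = (H n - v *\<^sub>C B n) * (H n - (- v) *\<^sub>C B n)" for n v
      using A_comm[OF HA[of n] BA[of n]]
      by (simp add: HS BS algebra_simps mult_scaleC_left mult_scaleC_right scaleC_scaleC
          scaleC_minus_left scaleC_diff_right power2_eq_square)
    have iA: "H n - v *\<^sub>C B n \<in> A" for n v by (intro A_diff A_scale HA BA)
    have lower: "\<rho> ^ (2 ^ n) \<le> r (H n - v *\<^sub>C B n)" for n v
    proof (induction n arbitrary: v)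
      case 0
      have "g - v *\<^sub>C b = h - (z1 + v) *\<^sub>C b" by (simp add: g_def scaleC_add_left)
      then show ?case using min[of "z1 + v"] by (simp add: HS BS \<psi>_def)
    next
      case (Suc n)
      have "\<rho> ^ (2 ^ n) * \<rho> ^ (2 ^ n)
          \<le> r (H n - csqrt v *\<^sub>C B n) * r (H n - (- csqrt v) *\<^sub>C B n)"
        using Suc \<rho> by (intro mult_mono) (auto intro: q_nonneg[OF r iA])
      also have "\<dots> = r (H (Suc n) - v *\<^sub>C B (Suc n))"
        using fac[of n "csqrt v"] mult[OF iA iA, of n _ n] by simp
      finally show ?case by (simp add: power_add[symmetric] mult_2)
    qed
    \<comment> \<open>\<open>g - w b\<close> is one of the 2^n linear factors of the difference of
      powers, and the other 2^n - 1 factors have seminorm at least \<rho>.\<close>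
    have step: "r (g - w *\<^sub>C b) * \<rho> ^ (2 ^ n - 1) \<le> r (H n - (w ^ (2 ^ n)) *\<^sub>C B n)" for n
    proof (induction n)
      case 0
      then show ?case by (simp add: HS BS)
    next
      case (Suc n)
      have e: "(2::nat) ^ Suc n - 1 = (2 ^ n - 1) + 2 ^ n"
        using one_le_power[of "2::nat" n] by simp
      have "r (g - w *\<^sub>C b) * \<rho> ^ (2 ^ Suc n - 1) = (r (g - w *\<^sub>C b) * \<rho> ^ (2 ^ n - 1)) * \<rho> ^ (2 ^ n)"
        unfolding e power_add by simp
      also have "\<dots> \<le> r (H n - (w ^ (2 ^ n)) *\<^sub>C B n) * r (H n - (- (w ^ (2 ^ n))) *\<^sub>C B n)"
        using Suc lower[of n] \<rho> by (intro mult_mono) (auto intro: q_nonneg[OF r iA])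
      also have "\<dots> = r (H (Suc n) - (w ^ (2 ^ n))\<^sup>2 *\<^sub>C B (Suc n))"
        using fac[of n "w ^ (2 ^ n)"] mult[OF iA iA] by simp
      finally show ?case by (simp add: power_mult[symmetric] mult.commute)
    qed
    have up: "\<psi> z \<le> \<rho> + \<rho> * ((cmod w / \<rho>) ^ (2 ^ n))" for n
    proof -
      have "r (H n - (w ^ (2 ^ n)) *\<^sub>C B n) \<le> \<rho> ^ (2 ^ n) + cmod w ^ (2 ^ n)"
        using q_diff[OF r HA A_scale[OF BA], of n "w ^ (2 ^ n)" n] q_scale[OF r BA, of "w ^ (2 ^ n)" n]
        by (simp add: rH rB norm_power)
      with step[of n] have "r (g - w *\<^sub>C b) * \<rho> ^ (2 ^ n - 1) \<le> \<rho> ^ (2 ^ n) + cmod w ^ (2 ^ n)" by simp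
      moreover have "g - w *\<^sub>C b = h - z *\<^sub>C b" by (simp add: g_def w_def scaleC_diff_left)
      ultimately have "\<psi> z * \<rho> ^ (2 ^ n - 1) \<le> \<rho> ^ (2 ^ n) + cmod w ^ (2 ^ n)" by (simp add: \<psi>_def)
      then have "\<psi> z * \<rho> ^ (2 ^ n - 1) * \<rho> \<le> (\<rho> ^ (2 ^ n) + cmod w ^ (2 ^ n)) * \<rho>"
        using \<rho> by (intro mult_right_mono) auto
      moreover have "\<rho> ^ (2 ^ n - 1) * \<rho> = \<rho> ^ (2 ^ n)"
        using power_Suc2[of \<rho> "2 ^ n - 1"] by simp
      ultimately have "\<psi> z * \<rho> ^ (2 ^ n) \<le> (\<rho> ^ (2 ^ n) + cmod w ^ (2 ^ n)) * \<rho>" by (simp add: mult.assoc)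
      then show ?thesis using \<rho> by (simp add: field_simps power_divide)
    qed
    have "(\<lambda>n. (cmod w / \<rho>) ^ n) \<longlonglongrightarrow> 0" using zz \<rho> by (intro LIMSEQ_power_zero) (simp add: w_def)
    then have "((\<lambda>n. (cmod w / \<rho>) ^ n) \<circ> (\<lambda>n. 2 ^ n)) \<longlonglongrightarrow> 0"
      by (rule LIMSEQ_subseq_LIMSEQ) (simp add: strict_mono_def)
    then have "(\<lambda>n. \<rho> + \<rho> * ((cmod w / \<rho>) ^ (2 ^ n))) \<longlonglongrightarrow> \<rho> + \<rho> * 0"
      by (intro tendsto_intros) (simp add: o_def)
    then have "\<psi> z \<le> \<rho> + \<rho> * 0" using up by (intro LIMSEQ_le_const) auto
    then show ?thesis using min[of z] by simp
  qed
  have "open {z. \<psi> z = \<rho>}"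
    unfolding open_dist using ball \<rho> by (auto simp: dist_norm)
  moreover have "closed {z. \<psi> z = \<rho>}" using cont by (intro closed_Collect_eq) auto
  ultimately have "{z. \<psi> z = \<rho>} = {} \<or> {z. \<psi> z = \<rho>} = UNIV" by (simp only: clopen[symmetric])
  moreover have "z0 \<in> {z. \<psi> z = \<rho>}" by (simp add: \<rho>_def)
  ultimately have "\<psi> z = \<rho>" for z by blast
  then have "cmod (complex_of_real (r h + \<rho> + 1)) - r h \<le> \<rho>" using grow by metis
  moreover have "cmod (complex_of_real (r h + \<rho> + 1)) = r h + \<rho> + 1"
    using \<rho> q_nonneg[OF r h] by (simp only: norm_of_real)
  ultimately show False by simp
qed

text \<open>The minimal seminorm is taken at \<open>star a * a\<close> because multiplicativity was
  derived for a self-adjoint base point. By \<open>mazur\<close> every \<open>x\<close> is a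
  multiple \<theta>(x) of the normalised base point \<open>b\<close> modulo the null space of
  \<open>r\<close>. As \<open>b\<close> need not be idempotent modulo this null space, \<theta> is
  multiplicative only up to the unimodular factor \<open>\<beta> = \<theta> (b * b)\<close>, and
  \<open>\<kappa> = \<beta> \<theta>\<close> is the character.\<close>

theorem character_exists:
  assumes q: "cseminorm_on A q" and a: "a \<in> A" "q a > 0"
  obtains \<kappa> where "\<And>x y. x \<in> A \<Longrightarrow> y \<in> A \<Longrightarrow> \<kappa> (x + y) = \<kappa> x + (\<kappa> y :: complex)"
    "\<And>c x. x \<in> A \<Longrightarrow> \<kappa> (c *\<^sub>C x) = c * \<kappa> x"
    "\<And>x y. x \<in> A \<Longrightarrow> y \<in> A \<Longrightarrow> \<kappa> (x * y) = \<kappa> x * \<kappa> y"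
    "\<And>x. x \<in> A \<Longrightarrow> cmod (\<kappa> x) \<le> q x" "cmod (\<kappa> a) = q a"
proof -
  define a2 where "a2 = star a * a"
  have a2: "a2 \<in> A" "star a2 = a2" "q a2 = (q a)\<^sup>2" "q a2 > 0"
  proof -
    show "a2 \<in> A" unfolding a2_def by (intro A_mult A_star a)
    show "star a2 = a2" by (simp add: a2_def star_mult star_star)
    show "q a2 = (q a)\<^sup>2" unfolding a2_def by (rule q_cstar[OF q a(1)])
    then show "q a2 > 0" using a(2) by simp
  qed
  from minimal_cseminorm_exists[OF q a2(1)] obtain r where
    R: "cseminorm_on A r \<and> (\<forall>x\<in>A. r x \<le> q x) \<and> r a2 = q a2 \<and>
      (\<forall>s. cseminorm_on A s \<longrightarrow> (\<forall>x\<in>A. s x \<le> r x) \<longrightarrow> s a2 = q a2 \<longrightarrow> (\<forall>x\<in>A. s x = r x))"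
    by (elim exE)
  then have r: "cseminorm_on A r" "\<forall>x\<in>A. r x \<le> q x" "r a2 = q a2" by simp_all
  have min: "\<forall>x\<in>A. s x = r x" if "cseminorm_on A s" "\<forall>x\<in>A. s x \<le> r x" "s a2 = r a2" for s
    using R that by metis
  have mult: "r (x * y) = r x * r y" if "x \<in> A" "y \<in> A" for x y
    by (rule minimal_cseminorm_mult[OF r(1) a2(1,2) _ min that]) (use a2 r in auto)
  define b where "b = complex_of_real (1 / r a2) *\<^sub>C a2"
  have b: "b \<in> A" "r b = 1"
    using a2 r by (simp_all add: b_def A_scale q_scale[OF r(1)] norm_divide norm_power)
  define \<theta> where "\<theta> x = (SOME z. r (x - z *\<^sub>C b) = 0)" for x
  have \<theta>: "r (x - \<theta> x *\<^sub>C b) = 0" if "x \<in> A" for x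
    unfolding \<theta>_def by (rule someI_ex) (rule mazur[OF r(1) mult b that])
  have inA: "x - z *\<^sub>C b \<in> A" if "x \<in> A" for x z using that b by (intro A_diff A_scale)
  have null: "r (x + y) = r x" if "x \<in> A" "y \<in> A" "r y = 0" for x y
    using q_add[OF r(1) that(1,2)] q_diff_ge[OF r(1) that(1) A_minus[OF that(2)]] that q_minus[OF r(1) that(2)]
    by simp
  have eqI: "\<theta> x = z" if "x \<in> A" "r (x - z *\<^sub>C b) = 0" for x z
  proof -
    have "r ((x - z *\<^sub>C b) - (x - \<theta> x *\<^sub>C b)) \<le> 0"
      using q_diff[OF r(1) inA[OF that(1)] inA[OF that(1)], of z "\<theta> x"] that \<theta> by simp
    moreover have "(x - z *\<^sub>C b) - (x - \<theta> x *\<^sub>C b) = (\<theta> x - z) *\<^sub>C b" by (simp add: scaleC_diff_left)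
    ultimately show ?thesis using q_scale[OF r(1) b(1)] b(2) by simp
  qed
  have nullsum: "r (x + y) = 0" if "x \<in> A" "y \<in> A" "r x = 0" "r y = 0" for x y
    using null[OF that(1,2,4)] that by simp
  have \<theta>add: "\<theta> (x + y) = \<theta> x + \<theta> y" if "x \<in> A" "y \<in> A" for x y
  proof (rule eqI[OF A_add[OF that]])
    have "x + y - (\<theta> x + \<theta> y) *\<^sub>C b = (x - \<theta> x *\<^sub>C b) + (y - \<theta> y *\<^sub>C b)" by (simp add: scaleC_add_left)
    then show "r (x + y - (\<theta> x + \<theta> y) *\<^sub>C b) = 0"
      using nullsum[OF inA inA \<theta> \<theta>] that by metis
  qed
  have \<theta>scale: "\<theta> (c *\<^sub>C x) = c * \<theta> x" if "x \<in> A" for c x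
  proof (rule eqI[OF A_scale[OF that]])
    have "c *\<^sub>C x - (c * \<theta> x) *\<^sub>C b = c *\<^sub>C (x - \<theta> x *\<^sub>C b)" by (simp add: scaleC_diff_right scaleC_scaleC)
    then show "r (c *\<^sub>C x - (c * \<theta> x) *\<^sub>C b) = 0" using q_scale[OF r(1) inA[OF that]] \<theta>[OF that] by simp
  qed
  define \<beta> where "\<beta> = \<theta> (b * b)"
  have bb: "b * b \<in> A" using b by (intro A_mult)
  have \<theta>mult: "\<theta> (x * y) = \<beta> * \<theta> x * \<theta> y" if xy: "x \<in> A" "y \<in> A" for x y
  proof (rule eqI[OF A_mult[OF xy]])
    let ?u = "x - \<theta> x *\<^sub>C b" and ?v = "y - \<theta> y *\<^sub>C b" and ?w = "b * b - \<beta> *\<^sub>C b"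
    have "x * y - (\<beta> * \<theta> x * \<theta> y) *\<^sub>C b = (?u * y + (\<theta> x *\<^sub>C b) * ?v) + (\<theta> x * \<theta> y) *\<^sub>C ?w"
      by (simp add: algebra_simps mult_scaleC_left mult_scaleC_right scaleC_scaleC scaleC_diff_right)
    moreover have "r (?u * y) = 0" using mult[OF inA[OF xy(1)] xy(2)] \<theta>[OF xy(1)] by simp
    moreover have "r ((\<theta> x *\<^sub>C b) * ?v) = 0"
      using mult[OF A_scale[OF b(1)] inA[OF xy(2)]] \<theta>[OF xy(2)] by simp
    moreover have "r ((\<theta> x * \<theta> y) *\<^sub>C ?w) = 0"
      using q_scale[OF r(1) inA[OF bb]] \<theta>[OF bb] by (simp add: \<beta>_def)
    ultimately show "r (x * y - (\<beta> * \<theta> x * \<theta> y) *\<^sub>C b) = 0"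
      using xy b bb by (simp add: nullsum A_add A_mult A_scale inA)
  qed
  have \<theta>abs: "cmod (\<theta> x) = r x" if "x \<in> A" for x
  proof -
    have "r (\<theta> x *\<^sub>C b) = r (\<theta> x *\<^sub>C b + (x - \<theta> x *\<^sub>C b))"
      by (rule null[OF A_scale[OF b(1)] inA[OF that] \<theta>[OF that], symmetric])
    then show ?thesis using q_scale[OF r(1) b(1)] b(2) by simp
  qed
  have \<beta>1: "cmod \<beta> = 1" using \<theta>abs[OF bb] mult[OF b(1) b(1)] b by (simp add: \<beta>_def)
  define \<kappa> where "\<kappa> x = \<beta> * \<theta> x" for x
  have abs: "cmod (\<kappa> x) = r x" if "x \<in> A" for x by (simp add: \<kappa>_def norm_mult \<beta>1 \<theta>abs[OF that])
  have cmult: "\<kappa> (x * y) = \<kappa> x * \<kappa> y" if "x \<in> A" "y \<in> A" for x y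
    using \<theta>mult[OF that] by (simp add: \<kappa>_def mult_ac)
  show ?thesis
  proof (rule that)
    show "\<kappa> (x + y) = \<kappa> x + \<kappa> y" if "x \<in> A" "y \<in> A" for x y
      using \<theta>add[OF that] by (simp add: \<kappa>_def distrib_left)
    show "\<kappa> (c *\<^sub>C x) = c * \<kappa> x" if "x \<in> A" for c x
      using \<theta>scale[OF that] by (simp add: \<kappa>_def)
    show "cmod (\<kappa> x) \<le> q x" if "x \<in> A" for x using abs[OF that] r(2) that by simp
    have "(r a)\<^sup>2 = (q a)\<^sup>2" using q_cstar[OF r(1) a(1)] r(3) a2(3) by (simp add: a2_def)
    then have "r a = q a" using q_nonneg[OF r(1) a(1)] a(2) by (simp add: power2_eq_iff_nonneg)
    then show "cmod (\<kappa> a) = q a" using abs[OF a(1)] by simp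
  qed (rule cmult)
qed

end

section \<open>An axiomatic description of the crossed product\<close>

text \<open>\<open>A\<close> plays the role of \<open>C\<^sub>0(\<Gamma>)\<close> and \<open>ch \<gamma>\<close> that of the vacuum functional at \<open>\<gamma>\<close>, which restricts
  to the evaluation at \<open>\<gamma>\<close> on \<open>A\<close>; \<open>L i\<close> is left multiplication by \<open>S\<^sub>i\<close> and \<open>sh \<xi>\<close> translation.\<close>

locale core = comm_star_subalgebra A for A :: "'b::cstar_algebra set" +
  fixes ch :: "'x::ab_group_add \<Rightarrow> 'b \<Rightarrow> complex"
    and sh :: "'x \<Rightarrow> 'b \<Rightarrow> 'b" and L :: "nat \<Rightarrow> 'b \<Rightarrow> 'b" and \<omega> :: "nat \<Rightarrow> 'x"
  assumes A_closed: "closed A"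
    and ch_pf: "positive_functional (ch \<gamma>)"
    and ch_star: "ch \<gamma> (star x) = cnj (ch \<gamma> x)"
    and ch_mult: "a \<in> A \<Longrightarrow> b \<in> A \<Longrightarrow> ch \<gamma> (a * b) = ch \<gamma> a * ch \<gamma> b"
    and ch_complete: "cseminorm_on A q \<Longrightarrow> (\<And>x. x \<in> A \<Longrightarrow> q x \<le> norm x) \<Longrightarrow> a \<in> A \<Longrightarrow> q a > 0 \<Longrightarrow>
      \<exists>\<gamma>. (\<forall>x\<in>A. cmod (ch \<gamma> x) \<le> q x) \<and> cmod (ch \<gamma> a) = q a"
    and ch_unit: "\<exists>e\<in>A. ch \<gamma> e = 1"
    and sh_in: "a \<in> A \<Longrightarrow> sh \<xi> a \<in> A"
    and ch_sh: "a \<in> A \<Longrightarrow> ch \<gamma> (sh \<xi> a) = ch (\<gamma> + \<xi>) a"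
    and L_add: "L i (x + y) = L i x + L i y"
    and L_scale: "L i (c *\<^sub>C x) = c *\<^sub>C L i x"
    and L_mult: "L i x * y = L i (x * y)"
    and L_inner: "star (L i x) * L k y = (if i = k then star x * y else 0)"
    and L_comm: "a \<in> A \<Longrightarrow> a * L i x = L i (sh (\<omega> i) a * x)"
    and ch_L: "ch \<gamma> (L i x) = 0"
begin

sublocale pf: positive_functional "ch \<gamma>" for \<gamma>
  by (rule ch_pf)

lemma L_zero [simp]: "L i 0 = 0"
  using L_scale[of i 0 0] by simp

lemma L_diff: "L i (x - y) = L i x - L i y"
  using L_add[of i x "(-1) *\<^sub>C y"] L_scale[of i "-1" y] by simp

lemma norm_L [simp]: "norm (L i x) = norm x"
proof -
  have "(norm (L i x))\<^sup>2 = (norm x)\<^sup>2"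
    using L_inner[of i x i x] by (simp add: cstar_identity[symmetric])
  then show ?thesis by (simp add: power2_eq_iff_nonneg)
qed

section \<open>Words in the generators and translations of the commutative subalgebra\<close>

primrec Lw :: "nat list \<Rightarrow> 'b \<Rightarrow> 'b" where
  "Lw [] x = x"
| "Lw (i # w) x = L i (Lw w x)"

definition osum :: "nat list \<Rightarrow> 'x" where
  "osum w = sum_list (map \<omega> w)"

lemma osum_simps [simp]: "osum [] = 0" "osum (i # w) = \<omega> i + osum w" "osum (v @ w) = osum v + osum w"
  by (simp_all add: osum_def)

lemma Lw_add: "Lw w (x + y) = Lw w x + Lw w y"
  by (induction w) (simp_all add: L_add)

lemma Lw_diff: "Lw w (x - y) = Lw w x - Lw w y"
  by (induction w) (simp_all add: L_diff)

lemma Lw_zero [simp]: "Lw w 0 = 0"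
  by (induction w) simp_all

lemma Lw_mult: "Lw w x * y = Lw w (x * y)"
  by (induction w) (simp_all add: L_mult)

lemma norm_Lw [simp]: "norm (Lw w x) = norm x"
  by (induction w) simp_all

lemma Lw_append: "Lw (v @ w) x = Lw v (Lw w x)"
  by (induction v) simp_all

lemma Lw_inner_append: "star (Lw v x) * Lw (v @ w) y = star x * Lw w y"
  by (induction v) (simp_all add: L_inner)

lemma Lw_inner_same: "star (Lw v x) * Lw v y = star x * y"
  using Lw_inner_append[of v x "[]" y] by simp

lemma prefix_cases:
  obtains \<rho> where "w = v @ \<rho>" | \<rho> where "\<rho> \<noteq> []" "v = w @ \<rho>"
  | "\<And>x y. star (Lw v x) * Lw w y = 0" "\<And>\<rho>. w \<noteq> v @ \<rho>" "\<And>\<rho>. v \<noteq> w @ \<rho>"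
proof -
  have "(\<exists>\<rho>. w = v @ \<rho>) \<or> (\<exists>\<rho>. \<rho> \<noteq> [] \<and> v = w @ \<rho>) \<or>
    ((\<forall>x y. star (Lw v x) * Lw w y = 0) \<and> (\<forall>\<rho>. w \<noteq> v @ \<rho>) \<and> (\<forall>\<rho>. v \<noteq> w @ \<rho>))"
  proof (induction v arbitrary: w)
    case (Cons i v)
    show ?case
    proof (cases w)
      case w: (Cons k u)
      show ?thesis
      proof (cases "i = k")
        case True
        then show ?thesis using Cons.IH[of u] by (simp add: w L_inner)
      next
        case False
        then show ?thesis by (simp add: w L_inner)
      qed
    qed simp
  qed simp
  then show thesis using that by blast
qed

text \<open>\<open>ch_complete\<close> applied to the norm itself yields a point at which the norm
  of \<open>a\<close> is attained.\<close>

lemma norm_A_le: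
  assumes a: "a \<in> A" and C: "0 \<le> C" and le: "\<And>\<gamma>. cmod (ch \<gamma> a) \<le> C"
  shows "norm a \<le> C"
proof (cases "a = 0")
  case False
  then obtain \<gamma> where "cmod (ch \<gamma> a) = norm a"
    using ch_complete[OF norm_cseminorm_on _ a] by auto
  then show ?thesis using le[of \<gamma>] by simp
qed (simp add: C)

text \<open>The operators \<open>sh \<xi>\<close> are specified only through \<open>ch_sh\<close>;
  all their algebraic properties are checked pointwise by this rule.\<close>

lemma A_eqI:
  assumes "a \<in> A" "b \<in> A" and "\<And>\<gamma>. ch \<gamma> a = ch \<gamma> b"
  shows "a = b"
  using norm_A_le[of "a - b" 0] assms by (simp add: A_diff pf.diff)

lemma sh_add: "a \<in> A \<Longrightarrow> b \<in> A \<Longrightarrow> sh \<xi> (a + b) = sh \<xi> a + sh \<xi> b"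
  by (rule A_eqI) (simp_all add: A_add sh_in ch_sh pf.add)

lemma sh_diff: "a \<in> A \<Longrightarrow> b \<in> A \<Longrightarrow> sh \<xi> (a - b) = sh \<xi> a - sh \<xi> b"
  by (rule A_eqI) (simp_all add: A_diff sh_in ch_sh pf.diff)

lemma sh_mult: "a \<in> A \<Longrightarrow> b \<in> A \<Longrightarrow> sh \<xi> (a * b) = sh \<xi> a * sh \<xi> b"
  by (rule A_eqI) (simp_all add: A_mult sh_in ch_sh ch_mult)

lemma sh_star: "a \<in> A \<Longrightarrow> sh \<xi> (star a) = star (sh \<xi> a)"
  by (rule A_eqI) (simp_all add: A_star sh_in ch_sh ch_star)

lemma sh_sh: "a \<in> A \<Longrightarrow> sh \<xi> (sh \<eta> a) = sh (\<xi> + \<eta>) a"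
  by (rule A_eqI) (simp_all add: sh_in ch_sh add.assoc)

lemma sh_zero: "a \<in> A \<Longrightarrow> sh 0 a = a"
  by (rule A_eqI) (simp_all add: sh_in ch_sh)

lemma norm_sh: assumes "a \<in> A" shows "norm (sh \<xi> a) = norm a"
proof (rule antisym)
  show "norm (sh \<xi> a) \<le> norm a"
    using assms by (intro norm_A_le sh_in) (simp_all add: ch_sh pf.bnd)
  have "cmod (ch \<gamma> a) \<le> norm (sh \<xi> a)" for \<gamma>
    using ch_sh[OF assms, of "\<gamma> - \<xi>" \<xi>] pf.bnd[of "\<gamma> - \<xi>" "sh \<xi> a"] by simp
  then show "norm a \<le> norm (sh \<xi> a)" using assms by (intro norm_A_le) simp_all
qed

lemma Lw_comm: "a \<in> A \<Longrightarrow> a * Lw w x = Lw w (sh (osum w) a * x)"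
  by (induction w arbitrary: a)
    (simp_all add: sh_zero L_comm sh_in sh_sh add.commute)

lemma ch_Lw: "w \<noteq> [] \<Longrightarrow> ch \<gamma> (Lw w x) = 0"
  by (cases w) (simp_all add: ch_L)

lemma mult_star_Lw: "y * star (Lw w x) = star (Lw w (x * star y))"
  by (metis Lw_mult star_mult star_star)

lemma ch_star_Lw: "w \<noteq> [] \<Longrightarrow> ch \<gamma> (y * star (Lw w x)) = 0"
  by (simp add: mult_star_Lw ch_star ch_Lw)

text \<open>Orthogonality of the Fock basis vectors: once the common prefix is cancelled a nonempty
  word remains, or its adjoint, and the vacuum functional vanishes on it.\<close>

lemma ch_inner_Lw:
  assumes b: "b \<in> A" and c: "c \<in> A" and ne: "v \<noteq> w"
  shows "ch \<gamma> (star (Lw v b) * Lw w c) = 0"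
proof (cases rule: prefix_cases[of w v])
  case (1 \<rho>)
  then have "\<rho> \<noteq> []" using ne by auto
  then show ?thesis using b by (simp add: 1 Lw_inner_append Lw_comm A_star ch_Lw)
next
  case (2 \<rho>)
  have "star (Lw v b) * Lw w c = star (star c * Lw \<rho> b)"
    using Lw_inner_append[of w c \<rho> b] 2 by (metis star_mult star_star)
  then show ?thesis using 2 c by (simp add: Lw_comm A_star ch_star ch_Lw)
qed simp

lemma ch_selfadj: "star a = a \<Longrightarrow> ch \<gamma> a = complex_of_real (Re (ch \<gamma> a))"
  using ch_star[of \<gamma> a] by (simp add: complex_eq_iff)

lemma selfadjI: "a \<in> A \<Longrightarrow> (\<And>\<gamma>. Im (ch \<gamma> a) = 0) \<Longrightarrow> star a = a"
  by (rule A_eqI) (simp_all add: A_star ch_star complex_eq_iff)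

subsection \<open>Continuous functional calculus in the commutative algebra\<close>

text \<open>Without a unit only \<open>p - p 0\<close> can be realised. The product case rests on fg
  - f(0)g(0) = (f - f(0))(g - g(0)) + f(0)(g - g(0)) + g(0)(f - f(0)).\<close>

lemma functional_calculus_poly:
  assumes p: "real_polynomial_function (p :: real \<Rightarrow> real)" and a: "a \<in> A" "star a = a"
  shows "\<exists>b\<in>A. \<forall>\<gamma>. ch \<gamma> b = complex_of_real (p (Re (ch \<gamma> a)) - p 0)"
  using p
proof (induction rule: real_polynomial_function.induct)
  case (linear f)
  then interpret f: bounded_linear f .
  have "f x = x * f 1" for x using f.scaleR[of x 1] by simp
  then have "ch \<gamma> (complex_of_real (f 1) *\<^sub>C a) = complex_of_real (f (Re (ch \<gamma> a)) - f 0)" for \<gamma>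
    by (subst (1) pf.scale, subst ch_selfadj[OF a(2)]) (metis f.zero diff_zero mult.commute of_real_mult)
  then show ?case using a by (intro bexI[of _ "complex_of_real (f 1) *\<^sub>C a"]) (auto intro: A_scale)
next
  case (const c)
  show ?case by (intro bexI[of _ 0]) (simp_all add: A_zero)
next
  case (add f g)
  then obtain b c where "b \<in> A" "c \<in> A"
    "\<And>\<gamma>. ch \<gamma> b = complex_of_real (f (Re (ch \<gamma> a)) - f 0)"
    "\<And>\<gamma>. ch \<gamma> c = complex_of_real (g (Re (ch \<gamma> a)) - g 0)" by blast
  then show ?case by (intro bexI[of _ "b + c"]) (auto simp: A_add pf.add)
next
  case (mult f g)
  then obtain b c where bc: "b \<in> A" "c \<in> A"
    "\<And>\<gamma>. ch \<gamma> b = complex_of_real (f (Re (ch \<gamma> a)) - f 0)"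
    "\<And>\<gamma>. ch \<gamma> c = complex_of_real (g (Re (ch \<gamma> a)) - g 0)" by blast
  show ?case
    by (intro bexI[of _ "b * c + (complex_of_real (f 0) *\<^sub>C c + complex_of_real (g 0) *\<^sub>C b)"])
      (simp_all add: bc A_add A_mult A_scale pf.add pf.scale ch_mult algebra_simps)
qed

text \<open>Polynomial approximations of \<open>F\<close> on the interval of radius
  \<open>norm a\<close> give a Cauchy sequence, because \<open>norm_A_le\<close> turns uniform
  closeness of the values into closeness in norm. Since \<open>F 0 = 0\<close>, subtracting the
  constant term costs only the approximation error.\<close>

lemma functional_calculus:
  fixes F :: "real \<Rightarrow> real"
  assumes a: "a \<in> A" "star a = a" and F: "continuous_on UNIV F" "F 0 = 0"
  shows "\<exists>b\<in>A. star b = b \<and> (\<forall>\<gamma>. ch \<gamma> b = complex_of_real (F (Re (ch \<gamma> a))))"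
proof -
  define M where "M = norm a"
  have re: "Re (ch \<gamma> a) \<in> {-M..M}" for \<gamma>
    using pf.bnd[of \<gamma> a] abs_Re_le_cmod[of "ch \<gamma> a"] by (auto simp: M_def)
  have "\<exists>b\<in>A. \<forall>\<gamma>. cmod (ch \<gamma> b - complex_of_real (F (Re (ch \<gamma> a)))) < e" if e: "e > 0" for e
  proof -
    obtain g where g: "real_polynomial_function g" "\<And>x. x \<in> {-M..M} \<Longrightarrow> \<bar>F x - g x\<bar> < e/2"
      using Stone_Weierstrass_real_polynomial_function[of "{-M..M}" F "e/2"] e
        continuous_on_subset[OF F(1)] by (metis compact_Icc half_gt_zero subset_UNIV)
    obtain b where b: "b \<in> A" "\<And>\<gamma>. ch \<gamma> b = complex_of_real (g (Re (ch \<gamma> a)) - g 0)"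
      using functional_calculus_poly[OF g(1) a] by blast
    have "\<bar>g 0\<bar> < e/2" using g(2)[of 0] F by (simp add: M_def)
    then have "\<bar>(g (Re (ch \<gamma> a)) - g 0) - F (Re (ch \<gamma> a))\<bar> < e" for \<gamma>
      using g(2)[OF re[of \<gamma>]] by linarith
    then have "cmod (ch \<gamma> b - complex_of_real (F (Re (ch \<gamma> a)))) < e" for \<gamma>
      unfolding b(2) of_real_diff[symmetric] norm_of_real .
    then show ?thesis using b(1) by blast
  qed
  then have "\<exists>b\<in>A. \<forall>\<gamma>. cmod (ch \<gamma> b - complex_of_real (F (Re (ch \<gamma> a)))) < inverse (real (Suc n))" for n
    by simp
  then obtain b where b: "\<And>n. b n \<in> A"
    "\<And>n \<gamma>. cmod (ch \<gamma> (b n) - complex_of_real (F (Re (ch \<gamma> a)))) < inverse (real (Suc n))" by metis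
  have bd: "norm (b n - b m) \<le> inverse (real (Suc n)) + inverse (real (Suc m))" for n m
  proof (rule norm_A_le)
    fix \<gamma>
    have "ch \<gamma> (b n - b m) = (ch \<gamma> (b n) - complex_of_real (F (Re (ch \<gamma> a))))
      - (ch \<gamma> (b m) - complex_of_real (F (Re (ch \<gamma> a))))" by (simp add: pf.diff)
    also have "cmod \<dots> \<le> inverse (real (Suc n)) + inverse (real (Suc m))"
      by (rule order_trans[OF norm_triangle_ineq4]) (intro add_mono less_imp_le b)
    finally show "cmod (ch \<gamma> (b n - b m)) \<le> inverse (real (Suc n)) + inverse (real (Suc m))" .
  qed (simp_all add: b A_diff)
  have "Cauchy b"
  proof (rule metric_CauchyI)
    fix e :: real assume e: "e > 0"
    obtain N where N: "inverse (real (Suc N)) < e/2" using reals_Archimedean[of "e/2"] e by auto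
    have "dist (b m) (b n) < e" if "m \<ge> N" "n \<ge> N" for m n
    proof -
      have "inverse (real (Suc m)) \<le> inverse (real (Suc N))" "inverse (real (Suc n)) \<le> inverse (real (Suc N))"
        using that by (auto intro: le_imp_inverse_le)
      then show ?thesis using bd[of m n] N unfolding dist_norm by linarith
    qed
    then show "\<exists>N. \<forall>m\<ge>N. \<forall>n\<ge>N. dist (b m) (b n) < e" by blast
  qed
  then obtain c where c: "b \<longlonglongrightarrow> c" using Cauchy_convergent convergent_def by blast
  have cA: "c \<in> A" using closed_sequentially[OF A_closed] b(1) c by blast
  have chc: "ch \<gamma> c = complex_of_real (F (Re (ch \<gamma> a)))" for \<gamma>
  proof (rule LIMSEQ_unique)
    show "(\<lambda>n. ch \<gamma> (b n)) \<longlonglongrightarrow> ch \<gamma> c" by (rule pf.tendsto[OF c])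
    have "(\<lambda>n. ch \<gamma> (b n) - complex_of_real (F (Re (ch \<gamma> a)))) \<longlonglongrightarrow> 0"
      by (rule Lim_null_comparison[OF _ LIMSEQ_inverse_real_of_nat])
        (use b(2) in \<open>auto intro!: always_eventually less_imp_le\<close>)
    then show "(\<lambda>n. ch \<gamma> (b n)) \<longlonglongrightarrow> complex_of_real (F (Re (ch \<gamma> a)))"
      by (simp add: LIM_zero_iff)
  qed
  then have "star c = c" by (intro selfadjI[OF cA]) simp
  then show ?thesis using cA chc by blast
qed

text \<open>\<open>u = t / (t + d)\<close> for the sum \<open>t\<close> of all
  \<open>star (a i) * a i\<close>. At each point the squared error is at most d^2 t / (t + d)^2,
  which is at most d / 4; the choice d = e^2 makes this (e / 2)^2.\<close>

lemma approximate_unit: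
  assumes I: "finite I" "\<And>i. i \<in> I \<Longrightarrow> a i \<in> A" and e: "e > 0"
  shows "\<exists>u\<in>A. star u = u \<and> norm u \<le> 1 \<and> (\<forall>i\<in>I. norm (a i - u * a i) < e)"
proof -
  define t where "t = (\<Sum>i\<in>I. star (a i) * a i)"
  have t: "t \<in> A" "star t = t"
    using I by (auto simp: t_def star_sum star_mult star_star intro!: A_sum A_mult A_star)
  have cht: "ch \<gamma> t = complex_of_real (\<Sum>i\<in>I. (cmod (ch \<gamma> (a i)))\<^sup>2)" for \<gamma>
  proof -
    have "ch \<gamma> t = (\<Sum>i\<in>I. cnj (ch \<gamma> (a i)) * ch \<gamma> (a i))"
      unfolding t_def pf.sum using I by (intro sum.cong) (simp_all add: ch_mult A_star ch_star)
    then show ?thesis by (simp only: of_real_sum complex_norm_square mult.commute)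
  qed
  define d where "d = e\<^sup>2"
  have d: "d > 0" using e by (simp add: d_def)
  define F where "F s = \<bar>s\<bar> / (\<bar>s\<bar> + d)" for s :: real
  have "continuous_on UNIV F" unfolding F_def using d
    by (intro continuous_intros) (metis abs_ge_zero add_nonneg_pos less_irrefl)
  then obtain u where u: "u \<in> A" "star u = u" "\<And>\<gamma>. ch \<gamma> u = complex_of_real (F (Re (ch \<gamma> t)))"
    using functional_calculus[OF t, of F] by (auto simp: F_def)
  have "norm (a i - u * a i) < e" if i: "i \<in> I" for i
  proof -
    have "norm (a i - u * a i) \<le> e / 2"
    proof (rule norm_A_le)
      fix \<gamma>
      define s where "s = Re (ch \<gamma> t)"
      have s: "(cmod (ch \<gamma> (a i)))\<^sup>2 \<le> s" "0 \<le> s"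
        using member_le_sum[OF i, of "\<lambda>i. (cmod (ch \<gamma> (a i)))\<^sup>2"] I(1)
        by (auto simp: s_def cht sum_nonneg)
      have "ch \<gamma> (a i - u * a i) = complex_of_real (1 - F s) * ch \<gamma> (a i)"
        using i I u by (simp add: pf.diff ch_mult s_def algebra_simps)
      moreover have F: "1 - F s = d / (s + d)" using s d by (simp add: F_def field_simps)
      ultimately have "(cmod (ch \<gamma> (a i - u * a i)))\<^sup>2 = (d / (s + d))\<^sup>2 * (cmod (ch \<gamma> (a i)))\<^sup>2"
        by (simp only: norm_mult norm_of_real power_mult_distrib power2_abs)
      also have "\<dots> \<le> (d / (s + d))\<^sup>2 * s" using s by (intro mult_left_mono) auto
      also have "\<dots> \<le> d / 4"
      proof -
        have "4 * (d * s) \<le> (s + d)\<^sup>2"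
          using sum_squares_bound[of s d] by (simp add: power2_sum algebra_simps)
        then have "d * (4 * (d * s)) \<le> d * (s + d)\<^sup>2" using d by (intro mult_left_mono) auto
        moreover have "(d / (s + d))\<^sup>2 * s = d * (d * s) / (s + d)\<^sup>2" by (simp add: power2_eq_square)
        moreover have "0 < (s + d)\<^sup>2" using s d by simp
        ultimately show ?thesis by (simp add: divide_le_eq)
      qed
      also have "\<dots> = (e / 2)\<^sup>2" by (simp add: d_def power2_eq_square)
      finally show "cmod (ch \<gamma> (a i - u * a i)) \<le> e / 2"
        by (rule power2_le_imp_le) (use e in simp)
    qed (use i I u e in \<open>auto intro: A_diff A_mult\<close>)
    then show ?thesis using e by simp
  qed
  moreover have "norm u \<le> 1"
  proof (rule norm_A_le[OF u(1)])
    have "0 \<le> F s \<and> F s \<le> 1" for s using d by (simp add: F_def)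
    then show "cmod (ch \<gamma> u) \<le> 1" for \<gamma> unfolding u(3) norm_of_real by (simp add: abs_le_iff)
  qed simp
  ultimately show ?thesis using u by blast
qed

subsection \<open>The elements \<open>S\<^sub>\<mu> a S\<^sub>\<nu>\<^sup>*\<close>\<close>

text \<open>Only left multiplication by generators is available, so right multiplication by the
  adjoint of S_\<nu> is a left multiplication between two stars.\<close>

definition E :: "nat list \<Rightarrow> 'b \<Rightarrow> nat list \<Rightarrow> 'b" where
  "E \<mu> a \<nu> = Lw \<mu> (star (Lw \<nu> (star a)))"

lemma norm_E [simp]: "norm (E \<mu> a \<nu>) = norm a"
  by (simp add: E_def)

lemma E_add: "E \<mu> (a + b) \<nu> = E \<mu> a \<nu> + E \<mu> b \<nu>"
  by (simp add: E_def star_add Lw_add)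

lemma E_diff: "E \<mu> (a - b) \<nu> = E \<mu> a \<nu> - E \<mu> b \<nu>"
  by (simp add: E_def star_diff Lw_diff)

lemma E_zero [simp]: "E \<mu> 0 \<nu> = 0"
  by (simp add: E_def)

lemma E_sum: "E \<mu> (\<Sum>i\<in>I. f i) \<nu> = (\<Sum>i\<in>I. E \<mu> (f i) \<nu>)"
  by (induction I rule: infinite_finite_induct) (auto simp: E_add)

text \<open>With \<open>u * a\<close> in place of \<open>a\<close> the element is a product
  \<open>Lw \<mu> u * star (Lw \<nu> (star a))\<close> of two members of the algebra, whose adjoint
  can be computed; an approximate unit \<open>u\<close> removes the extra factor in the
  limit.\<close>

lemma star_E:
  assumes a: "a \<in> A" shows "star (E \<mu> a \<nu>) = E \<nu> (star a) \<mu>"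
proof -
  have *: "norm (star (E \<mu> a \<nu>) - E \<nu> (star a) \<mu>) \<le> e" if e: "e > 0" for e
  proof -
    obtain u where u: "u \<in> A" "star u = u" "norm (a - u * a) < e/2"
      using approximate_unit[of "{0::nat}" "\<lambda>_. a" "e/2"] a e by auto
    have "E \<mu> (u * a) \<nu> = Lw \<mu> u * star (Lw \<nu> (star a))"
      unfolding E_def Lw_mult by (simp add: mult_star_Lw[of u] star_mult)
    then have "star (E \<mu> (u * a) \<nu>) = Lw \<nu> (star a) * star (Lw \<mu> u)" by (simp add: star_mult star_star)
    also have "\<dots> = E \<nu> (star (u * a)) \<mu>"
      unfolding E_def Lw_mult by (simp add: mult_star_Lw[of "star a"] star_mult star_star u)
    finally have "star (E \<mu> a \<nu>) - E \<nu> (star a) \<mu>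
        = star (E \<mu> (a - u * a) \<nu>) - E \<nu> (star (a - u * a)) \<mu>"
      by (simp add: E_diff star_diff)
    also have "norm \<dots> \<le> norm (a - u * a) + norm (a - u * a)"
      using norm_triangle_ineq4 by (metis norm_E norm_star)
    finally show ?thesis using u by simp
  qed
  have "norm (star (E \<mu> a \<nu>) - E \<nu> (star a) \<mu>) \<le> 0" by (rule field_le_epsilon) (simp add: *)
  then show ?thesis by simp
qed

lemma E_mult_prefix:
  "a \<in> A \<Longrightarrow> E \<mu> a \<nu> * E (\<nu> @ \<rho>) b \<nu>' = E (\<mu> @ \<rho>) (sh (osum \<rho>) a * b) \<nu>'"
  unfolding E_def Lw_mult Lw_inner_append
  by (simp add: star_star Lw_comm Lw_append mult_star_Lw star_mult)

lemma E_mult_prefix':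
  assumes a: "a \<in> A" and b: "b \<in> A"
  shows "E \<mu> a (\<nu> @ \<rho>) * E \<nu> b \<nu>' = E \<mu> (a * sh (osum \<rho>) b) (\<nu>' @ \<rho>)"
proof -
  have "star (E \<mu> a (\<nu> @ \<rho>) * E \<nu> b \<nu>') = E \<nu>' (star b) \<nu> * E (\<nu> @ \<rho>) (star a) \<mu>"
    by (simp add: star_mult star_E a b)
  also have "\<dots> = E (\<nu>' @ \<rho>) (star (a * sh (osum \<rho>) b)) \<mu>"
    by (simp add: E_mult_prefix A_star b star_mult sh_star)
  finally show ?thesis
    by (metis A_mult A_star a b sh_in star_E star_star)
qed

lemma E_mult_zero:
  assumes "\<And>\<rho>. \<nu>' \<noteq> \<nu> @ \<rho>" "\<And>\<rho>. \<nu> \<noteq> \<nu>' @ \<rho>"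
  shows "E \<mu> a \<nu> * E \<nu>' b \<mu>' = 0"
  unfolding E_def Lw_mult by (cases rule: prefix_cases[of \<nu>' \<nu>]) (use assms in auto)

lemma E_mult_same: "a \<in> A \<Longrightarrow> E \<mu> a \<nu> * E \<nu> b \<nu>' = E \<mu> (a * b) \<nu>'"
  using E_mult_prefix[of a \<mu> \<nu> "[]" b \<nu>'] by (simp add: sh_zero)

lemma E_mult_length:
  assumes "length \<nu> = length \<nu>'" "\<nu> \<noteq> \<nu>'"
  shows "E \<mu> a \<nu> * E \<nu>' b \<mu>' = 0"
  by (rule E_mult_zero) (use assms in auto)

lemma ch_E: "a \<in> A \<Longrightarrow> ch \<gamma> (E \<mu> a \<nu>) = (if \<mu> = [] \<and> \<nu> = [] then ch \<gamma> a else 0)"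
proof (cases "\<nu> = []")
  case True
  then show "a \<in> A \<Longrightarrow> ?thesis" by (cases "\<mu> = []") (auto simp: E_def star_star ch_Lw)
next
  case False
  assume a: "a \<in> A"
  have "ch \<gamma> (star (E \<mu> a \<nu>)) = 0" unfolding star_E[OF a] unfolding E_def using False by (rule ch_Lw)
  then show ?thesis using False by (simp add: ch_star)
qed

end

section \<open>Faithfulness of the Fock representation\<close>

text \<open>Polynomial factors vanish on taking roots of order 2^k. With x = sqrt (C / t) < 1 the
  hypothesis bounds 1 by a constant times (n x^n)^2 for n = 2^k, which tends to 0.\<close>

lemma le_of_power_growth:
  fixes t C :: real
  assumes t: "0 \<le> t" and C: "0 \<le> C" and K: "0 \<le> K"
    and le: "\<And>k::nat. t ^ (2 ^ k) \<le> K * (2 ^ k * D + 1)\<^sup>2 * C ^ (2 ^ k)" and D: "0 \<le> D"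
  shows "t \<le> C"
proof (rule ccontr)
  assume "\<not> t \<le> C"
  then have tC: "C < t" by simp
  then have t0: "t > 0" using C by simp
  define x where "x = sqrt (C / t)"
  have x: "0 \<le> x" "x < 1" using C t0 tC by (auto simp: x_def)
  have xx: "C = t * x\<^sup>2" using t0 C by (simp add: x_def)
  have le1: "1 \<le> K * (D + 1)\<^sup>2 * (real n * x ^ n)\<^sup>2" if n: "n = 2 ^ k" for n k
  proof -
    have n1: "1 \<le> real n" by (simp add: n)
    have "t ^ n \<le> K * (real n * D + 1)\<^sup>2 * (t * x\<^sup>2) ^ n" using le[of k] by (simp add: n xx)
    also have "\<dots> \<le> K * (real n * (D + 1))\<^sup>2 * (t * x\<^sup>2) ^ n"
      using K t0 D n1 by (intro mult_right_mono mult_left_mono power_mono) (auto simp: algebra_simps)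
    also have "\<dots> = t ^ n * (K * (D + 1)\<^sup>2 * (real n * x ^ n)\<^sup>2)"
      by (simp add: power_mult_distrib power2_eq_square)
    finally show ?thesis using t0 by simp
  qed
  have "(\<lambda>n. real n * x ^ n) \<longlonglongrightarrow> 0" using x by (intro powser_times_n_limit_0) simp
  then have "(\<lambda>n. K * (D + 1)\<^sup>2 * (real n * x ^ n)\<^sup>2) \<longlonglongrightarrow> K * (D + 1)\<^sup>2 * 0\<^sup>2"
    by (intro tendsto_intros)
  then have "((\<lambda>n. K * (D + 1)\<^sup>2 * (real n * x ^ n)\<^sup>2) \<circ> (\<lambda>k. 2 ^ k)) \<longlonglongrightarrow> K * (D + 1)\<^sup>2 * 0\<^sup>2"
    by (rule LIMSEQ_subseq_LIMSEQ) (simp add: strict_mono_def)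
  then have "1 \<le> K * (D + 1)\<^sup>2 * 0\<^sup>2"
    by (rule LIMSEQ_le_const) (use le1 in \<open>auto simp: o_def\<close>)
  then show False by simp
qed

definition mat_bound :: "'i set \<Rightarrow> 'k set \<Rightarrow> ('i \<Rightarrow> 'k \<Rightarrow> complex) \<Rightarrow> real \<Rightarrow> bool" where
  "mat_bound P Q a C \<longleftrightarrow> (\<forall>\<xi> \<eta>. cmod (\<Sum>i\<in>P. \<Sum>k\<in>Q. \<eta> i * a i k * \<xi> k)
     \<le> C * L2_set (\<lambda>i. cmod (\<eta> i)) P * L2_set (\<lambda>k. cmod (\<xi> k)) Q)"

lemma mat_boundD: "mat_bound P Q a C \<Longrightarrow> cmod (\<Sum>i\<in>P. \<Sum>k\<in>Q. \<eta> i * a i k * \<xi> k)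
     \<le> C * L2_set (\<lambda>i. cmod (\<eta> i)) P * L2_set (\<lambda>k. cmod (\<xi> k)) Q"
  by (simp add: mat_bound_def)

lemma L2_set_unit_vector:
  assumes "finite R" "j \<in> R"
  shows "L2_set (\<lambda>i. cmod (if i = j then 1 else 0)) R = 1"
proof -
  have "(\<Sum>i\<in>R. (cmod (if i = j then 1 else 0))\<^sup>2) = (\<Sum>i\<in>R. if i = j then 1 else 0)"
    by (intro sum.cong) auto
  then show ?thesis using assms by (simp add: L2_set_def)
qed

lemma mat_bound_entry:
  assumes b: "mat_bound P Q a C" and ik: "i \<in> P" "k \<in> Q" and fin: "finite P" "finite Q"
  shows "cmod (a i k) \<le> C"
proof -
  have "(\<Sum>i'\<in>P. \<Sum>k'\<in>Q. (if i' = i then 1 else 0) * a i' k' * (if k' = k then 1 else 0)) = a i k"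
  proof -
    have "(\<Sum>i'\<in>P. \<Sum>k'\<in>Q. (if i' = i then 1 else 0) * a i' k' * (if k' = k then 1 else 0))
      = (\<Sum>i'\<in>P. if i' = i then \<Sum>k'\<in>Q. (if k' = k then a i' k' else 0) else 0)"
      by (intro sum.cong refl) (auto intro!: sum.cong)
    then show ?thesis using ik fin by simp
  qed
  then show ?thesis
    using mat_boundD[OF b, of "\<lambda>i'. if i' = i then 1 else 0" "\<lambda>k'. if k' = k then 1 else 0"]
    by (simp only: L2_set_unit_vector[OF fin(1) ik(1)] L2_set_unit_vector[OF fin(2) ik(2)] mult_1_right)
qed

lemma mat_bound_apply:
  assumes b: "mat_bound P Q a C" and C: "0 \<le> C"
  shows "L2_set (\<lambda>i. cmod (\<Sum>k\<in>Q. a i k * \<xi> k)) P \<le> C * L2_set (\<lambda>k. cmod (\<xi> k)) Q"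
proof -
  define \<zeta> where "\<zeta> i = (\<Sum>k\<in>Q. a i k * \<xi> k)" for i
  let ?z = "L2_set (\<lambda>i. cmod (\<zeta> i)) P"
  have "complex_of_real (?z\<^sup>2) = (\<Sum>i\<in>P. \<Sum>k\<in>Q. cnj (\<zeta> i) * a i k * \<xi> k)"
  proof -
    have "complex_of_real (?z\<^sup>2) = (\<Sum>i\<in>P. cnj (\<zeta> i) * \<zeta> i)"
      by (simp only: L2_set_def real_sqrt_pow2 sum_nonneg zero_le_power2 of_real_sum complex_norm_square mult.commute)
    also have "\<dots> = (\<Sum>i\<in>P. \<Sum>k\<in>Q. cnj (\<zeta> i) * a i k * \<xi> k)"
      by (intro sum.cong refl) (simp add: \<zeta>_def[of i for i] sum_distrib_left mult.assoc)
    finally show ?thesis .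
  qed
  then have "?z\<^sup>2 = cmod (\<Sum>i\<in>P. \<Sum>k\<in>Q. cnj (\<zeta> i) * a i k * \<xi> k)"
    by (metis abs_power2 norm_of_real)
  also have "\<dots> \<le> C * ?z * L2_set (\<lambda>k. cmod (\<xi> k)) Q"
    using mat_boundD[OF b, of "\<lambda>i. cnj (\<zeta> i)" \<xi>] by simp
  finally have *: "?z * ?z \<le> ?z * (C * L2_set (\<lambda>k. cmod (\<xi> k)) Q)"
    by (simp add: power2_eq_square algebra_simps)
  have "?z \<le> C * L2_set (\<lambda>k. cmod (\<xi> k)) Q"
  proof (cases "?z = 0")
    case True
    then show ?thesis using C by (simp add: L2_set_nonneg)
  next
    case False
    then have "?z > 0" using L2_set_nonneg[of "\<lambda>i. cmod (\<zeta> i)" P] by linarith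
    then show ?thesis using * by simp
  qed
  then show ?thesis by (simp add: \<zeta>_def)
qed

lemma cmod_sum_mult_le:
  "cmod (\<Sum>i\<in>P. f i * g i) \<le> L2_set (\<lambda>i. cmod (f i)) P * L2_set (\<lambda>i. cmod (g i)) P"
proof -
  have "cmod (\<Sum>i\<in>P. f i * g i) \<le> (\<Sum>i\<in>P. \<bar>cmod (f i)\<bar> * \<bar>cmod (g i)\<bar>)"
    by (rule order_trans[OF norm_sum]) (simp add: norm_mult)
  then show ?thesis using L2_set_mult_ineq[of "\<lambda>i. cmod (f i)" "\<lambda>i. cmod (g i)" P] by linarith
qed

lemma mat_bound_square:
  assumes b: "mat_bound P Q a C" and C: "0 \<le> C"
  shows "mat_bound Q Q (\<lambda>k k'. \<Sum>i\<in>P. cnj (a i k) * a i k') (C\<^sup>2)"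
  unfolding mat_bound_def
proof (intro allI)
  fix \<xi> \<eta> :: "'b \<Rightarrow> complex"
  have "(\<Sum>k\<in>Q. \<Sum>k'\<in>Q. \<eta> k * (\<Sum>i\<in>P. cnj (a i k) * a i k') * \<xi> k')
    = (\<Sum>k\<in>Q. \<Sum>k'\<in>Q. \<Sum>i\<in>P. (\<eta> k * cnj (a i k)) * (a i k' * \<xi> k'))"
    by (simp add: sum_distrib_left sum_distrib_right mult.assoc)
  also have "\<dots> = (\<Sum>k\<in>Q. \<Sum>i\<in>P. \<Sum>k'\<in>Q. (\<eta> k * cnj (a i k)) * (a i k' * \<xi> k'))"
    by (intro sum.cong refl sum.swap)
  also have "\<dots> = (\<Sum>i\<in>P. \<Sum>k\<in>Q. \<Sum>k'\<in>Q. (\<eta> k * cnj (a i k)) * (a i k' * \<xi> k'))"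
    by (rule sum.swap)
  also have "\<dots> = (\<Sum>i\<in>P. cnj (\<Sum>k\<in>Q. a i k * cnj (\<eta> k)) * (\<Sum>k'\<in>Q. a i k' * \<xi> k'))"
    by (intro sum.cong refl) (simp add: sum_product mult.commute[of "cnj (a i k)" for i k])
  also have "cmod \<dots> \<le> L2_set (\<lambda>i. cmod (cnj (\<Sum>k\<in>Q. a i k * cnj (\<eta> k)))) P
      * L2_set (\<lambda>i. cmod (\<Sum>k'\<in>Q. a i k' * \<xi> k')) P"
    by (rule cmod_sum_mult_le)
  also have "\<dots> \<le> (C * L2_set (\<lambda>k. cmod (cnj (\<eta> k))) Q) * (C * L2_set (\<lambda>k. cmod (\<xi> k)) Q)"
    unfolding complex_mod_cnj[of "sum f A" for f A]
    by (intro mult_mono mat_bound_apply[OF b C] mult_nonneg_nonneg C L2_set_nonneg)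
  finally show "cmod (\<Sum>k\<in>Q. \<Sum>k'\<in>Q. \<eta> k * (\<Sum>i\<in>P. cnj (a i k) * a i k') * \<xi> k')
     \<le> C\<^sup>2 * L2_set (\<lambda>i. cmod (\<eta> i)) Q * L2_set (\<lambda>k. cmod (\<xi> k)) Q"
    by (simp add: power2_eq_square mult_ac)
qed

context core
begin

subsection \<open>Homogeneous elements\<close>

text \<open>Generators of distinct words of one length are orthogonal, so the
  \<open>E \<mu> a \<nu>\<close> multiply like matrix units with coefficients in
  \<open>A\<close>.\<close>

lemma homogeneous_square:
  assumes Q: "\<And>\<nu>. \<nu> \<in> Q \<Longrightarrow> length \<nu> = n" and P: "\<And>\<mu>. \<mu> \<in> P \<Longrightarrow> length \<mu> = m" "finite P"
    and a: "\<And>\<mu> \<nu>. a \<mu> \<nu> \<in> A"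
    and x: "x = (\<Sum>\<mu>\<in>P. \<Sum>\<nu>\<in>Q. E \<mu> (a \<mu> \<nu>) \<nu>)"
  shows "star x * x = (\<Sum>\<nu>\<in>Q. \<Sum>\<nu>'\<in>Q. E \<nu> (\<Sum>\<mu>\<in>P. star (a \<mu> \<nu>) * a \<mu> \<nu>') \<nu>')"
proof -
  have prod: "E \<nu> (star (a \<mu> \<nu>)) \<mu> * E \<mu>' (a \<mu>' \<nu>') \<nu>' =
      (if \<mu>' = \<mu> then E \<nu> (star (a \<mu> \<nu>) * a \<mu> \<nu>') \<nu>' else 0)" if "\<mu> \<in> P" "\<mu>' \<in> P" for \<mu> \<mu>' \<nu> \<nu>'
    using P(1)[OF that(1)] P(1)[OF that(2)] a by (auto simp: E_mult_same A_star E_mult_length)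
  have "star x * x = (\<Sum>\<mu>\<in>P. \<Sum>\<nu>\<in>Q. \<Sum>\<mu>'\<in>P. \<Sum>\<nu>'\<in>Q. E \<nu> (star (a \<mu> \<nu>)) \<mu> * E \<mu>' (a \<mu>' \<nu>') \<nu>')"
  proof -
    have "star x * x = (\<Sum>\<mu>\<in>P. \<Sum>\<nu>\<in>Q. E \<nu> (star (a \<mu> \<nu>)) \<mu> * x)"
      by (subst (1) x) (simp only: star_sum star_E[OF a] sum_distrib_right)
    then show ?thesis by (simp only: x sum_distrib_left)
  qed
  also have "\<dots> = (\<Sum>\<mu>\<in>P. \<Sum>\<nu>\<in>Q. \<Sum>\<nu>'\<in>Q. E \<nu> (star (a \<mu> \<nu>) * a \<mu> \<nu>') \<nu>')"
  proof (rule sum.cong[OF refl], rule sum.cong[OF refl])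
    fix \<mu> \<nu> assume \<mu>: "\<mu> \<in> P" and "\<nu> \<in> Q"
    have "(\<Sum>\<mu>'\<in>P. \<Sum>\<nu>'\<in>Q. E \<nu> (star (a \<mu> \<nu>)) \<mu> * E \<mu>' (a \<mu>' \<nu>') \<nu>')
      = (\<Sum>\<mu>'\<in>P. if \<mu>' = \<mu> then \<Sum>\<nu>'\<in>Q. E \<nu> (star (a \<mu> \<nu>) * a \<mu> \<nu>') \<nu>' else 0)"
      by (intro sum.cong refl) (auto simp: prod \<mu>)
    then show "(\<Sum>\<mu>'\<in>P. \<Sum>\<nu>'\<in>Q. E \<nu> (star (a \<mu> \<nu>)) \<mu> * E \<mu>' (a \<mu>' \<nu>') \<nu>')
      = (\<Sum>\<nu>'\<in>Q. E \<nu> (star (a \<mu> \<nu>) * a \<mu> \<nu>') \<nu>')" using \<mu> P(2) by simp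
  qed
  also have "\<dots> = (\<Sum>\<nu>\<in>Q. \<Sum>\<mu>\<in>P. \<Sum>\<nu>'\<in>Q. E \<nu> (star (a \<mu> \<nu>) * a \<mu> \<nu>') \<nu>')"
    by (rule sum.swap)
  also have "\<dots> = (\<Sum>\<nu>\<in>Q. \<Sum>\<nu>'\<in>Q. \<Sum>\<mu>\<in>P. E \<nu> (star (a \<mu> \<nu>) * a \<mu> \<nu>') \<nu>')"
    by (intro sum.cong refl sum.swap)
  finally show ?thesis by (simp add: E_sum)
qed

lemma homogeneous_square_bound:
  assumes C: "0 \<le> C" and a: "\<And>\<mu> \<nu>. a \<mu> \<nu> \<in> A" and P: "finite P"
    and b: "mat_bound P Q (\<lambda>\<mu> \<nu>. ch \<gamma> (a \<mu> \<nu>)) C"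
  shows "mat_bound Q Q (\<lambda>\<nu> \<nu>'. ch \<gamma> (\<Sum>\<mu>\<in>P. star (a \<mu> \<nu>) * a \<mu> \<nu>')) (C\<^sup>2)"
  using mat_bound_square[OF b C] a by (simp add: pf.sum ch_mult A_star ch_star)

text \<open>Adding up the entries gives the bound with a factor depending only on
  \<open>card Q\<close>. Passing from \<open>x\<close> to \<open>star x * x\<close> squares both
  sides but keeps the index set, so the same factor occurs for all powers and
  \<open>le_of_power_growth\<close> removes it.\<close>

lemma norm_homogeneous_square_le:
  assumes Q: "\<And>\<nu>. \<nu> \<in> Q \<Longrightarrow> length \<nu> = n" "finite Q" and a: "\<And>\<mu> \<nu>. a \<mu> \<nu> \<in> A"
    and C: "0 \<le> C" and b: "\<And>\<gamma>. mat_bound Q Q (\<lambda>\<mu> \<nu>. ch \<gamma> (a \<mu> \<nu>)) C"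
    and x: "x = (\<Sum>\<mu>\<in>Q. \<Sum>\<nu>\<in>Q. E \<mu> (a \<mu> \<nu>) \<nu>)"
  shows "norm x \<le> C"
proof -
  have "norm x ^ (2 ^ k) \<le> (real (card Q))\<^sup>2 * C ^ (2 ^ k)" for k :: nat
    using a C b x
  proof (induction k arbitrary: a C x)
    case 0
    have "norm (E \<mu> (a \<mu> \<nu>) \<nu>) \<le> C" if "\<mu> \<in> Q" "\<nu> \<in> Q" for \<mu> \<nu>
      unfolding norm_E by (rule norm_A_le[OF 0(1,2) mat_bound_entry[OF 0(3) that Q(2) Q(2)]])
    then have "norm x \<le> (\<Sum>\<mu>\<in>Q. \<Sum>\<nu>\<in>Q. C)"
      unfolding 0(4) by (intro sum_norm_le)
    then show ?case by (simp add: power2_eq_square mult.assoc)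
  next
    case (Suc k)
    have "norm (star x * x) ^ (2 ^ k) \<le> (real (card Q))\<^sup>2 * (C\<^sup>2) ^ (2 ^ k)"
    proof (rule Suc.IH[OF _ _ homogeneous_square_bound[OF Suc.prems(2,1) Q(2) Suc.prems(3)]])
      show "star x * x = (\<Sum>\<mu>\<in>Q. \<Sum>\<nu>\<in>Q. E \<mu> (\<Sum>\<mu>'\<in>Q. star (a \<mu>' \<mu>) * a \<mu>' \<nu>) \<nu>)"
        by (rule homogeneous_square[OF Q(1) Q(1,2) Suc.prems(1,4)])
    qed (auto intro!: A_sum A_mult A_star Suc.prems)
    then show ?case by (simp add: cstar_identity power_mult[symmetric])
  qed
  then show ?thesis
    by - (rule le_of_power_growth[of _ _ "(real (card Q))\<^sup>2" 0], simp_all add: C)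
qed

lemma norm_homogeneous_le:
  assumes P: "\<And>\<nu>. \<nu> \<in> P \<Longrightarrow> length \<nu> = m" "finite P"
    and Q: "\<And>\<nu>. \<nu> \<in> Q \<Longrightarrow> length \<nu> = n" "finite Q" and a: "\<And>\<mu> \<nu>. a \<mu> \<nu> \<in> A"
    and C: "0 \<le> C" and b: "\<And>\<gamma>. mat_bound P Q (\<lambda>\<mu> \<nu>. ch \<gamma> (a \<mu> \<nu>)) C"
  shows "norm (\<Sum>\<mu>\<in>P. \<Sum>\<nu>\<in>Q. E \<mu> (a \<mu> \<nu>) \<nu>) \<le> C"
proof -
  define x where "x = (\<Sum>\<mu>\<in>P. \<Sum>\<nu>\<in>Q. E \<mu> (a \<mu> \<nu>) \<nu>)"
  have "norm (star x * x) \<le> C\<^sup>2"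
    by (rule norm_homogeneous_square_le[OF Q _ _ homogeneous_square_bound[OF C a P(2) b]
          homogeneous_square[OF Q(1) P a x_def]])
      (auto intro!: A_sum A_mult A_star a)
  then have "(norm x)\<^sup>2 \<le> C\<^sup>2" by (simp add: cstar_identity)
  then have "norm x \<le> C" using C by (rule power2_le_imp_le)
  then show ?thesis by (simp add: x_def)
qed

subsection \<open>Operator bounds in the Fock representations\<close>

text \<open>\<open>C\<close> bounds the operator norm of \<open>x\<close> in all Fock
  representations simultaneously.\<close>

definition fbound :: "'b \<Rightarrow> real \<Rightarrow> bool" where
  "fbound x C \<longleftrightarrow> 0 \<le> C \<and> (\<forall>\<gamma> g. pf.snorm \<gamma> (x * g) \<le> C * pf.snorm \<gamma> g)"

lemma fbound_mult: "fbound x C \<Longrightarrow> fbound y D \<Longrightarrow> fbound (x * y) (C * D)"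
proof -
  assume x: "fbound x C" and y: "fbound y D"
  have "pf.snorm \<gamma> (x * y * g) \<le> C * D * pf.snorm \<gamma> g" for \<gamma> g
  proof -
    have "pf.snorm \<gamma> (x * (y * g)) \<le> C * pf.snorm \<gamma> (y * g)" using x by (simp add: fbound_def)
    also have "\<dots> \<le> C * (D * pf.snorm \<gamma> g)"
      using x y by (intro mult_left_mono) (simp_all add: fbound_def)
    finally show ?thesis by (simp add: mult.assoc)
  qed
  then show "fbound (x * y) (C * D)" using x y by (simp add: fbound_def)
qed

lemma fbound_star: assumes "fbound x C" shows "fbound (star x) C"
  unfolding fbound_def
proof (intro conjI allI)
  show C: "0 \<le> C" using assms by (simp add: fbound_def)
  fix \<gamma> g
  let ?s = "pf.snorm \<gamma> (star x * g)"
  have "?s\<^sup>2 = Re (ch \<gamma> (star g * (x * (star x * g))))"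
    unfolding pf.snorm_sq by (simp add: star_mult star_star mult.assoc)
  also have "\<dots> \<le> pf.snorm \<gamma> g * pf.snorm \<gamma> (x * (star x * g))"
    using pf.cauchy_schwarz complex_Re_le_cmod order_trans by blast
  also have "\<dots> \<le> pf.snorm \<gamma> g * (C * ?s)"
    using assms by (intro mult_left_mono) (auto simp: fbound_def)
  finally have *: "?s * ?s \<le> ?s * (C * pf.snorm \<gamma> g)" by (simp add: power2_eq_square algebra_simps)
  show "?s \<le> C * pf.snorm \<gamma> g"
  proof (cases "?s = 0")
    case True
    then show ?thesis using C by simp
  next
    case False
    then have "?s > 0" using pf.snorm_nonneg[of \<gamma> "star x * g"] by linarith
    then show ?thesis using * by simp
  qed
qed

section \<open>Matrix coefficients in Fock space\<close>

definition words :: "nat set \<Rightarrow> nat \<Rightarrow> nat list set" where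
  "words \<Lambda> l = {w. set w \<subseteq> \<Lambda> \<and> length w \<le> l}"

definition hwords :: "nat set \<Rightarrow> nat \<Rightarrow> nat list set" where
  "hwords \<Lambda> l = {w. set w \<subseteq> \<Lambda> \<and> length w = l}"

lemma finite_words: "finite \<Lambda> \<Longrightarrow> finite (words \<Lambda> l)"
  unfolding words_def by (rule finite_lists_length_le)

lemma finite_hwords: "finite \<Lambda> \<Longrightarrow> finite (hwords \<Lambda> l)"
  unfolding hwords_def by (rule finite_lists_length_eq)

lemma words_eq: "words \<Lambda> l = (\<Union>m\<le>l. hwords \<Lambda> m)"
  by (auto simp: words_def hwords_def)

text \<open>A finitely supported vector of Fock space; an \<open>e\<close> with
  \<open>ch \<gamma> e = 1\<close> stands in for the vacuum vector.\<close>

definition vec :: "'b \<Rightarrow> nat list set \<Rightarrow> (nat list \<Rightarrow> complex) \<Rightarrow> 'b" where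
  "vec e V \<xi> = (\<Sum>v\<in>V. \<xi> v *\<^sub>C Lw v e)"

text \<open>The entry at (w, v) of S_\<mu> a followed by the adjoint of S_\<nu>: the adjoint strips
  \<nu> from \<open>v\<close>, \<open>a\<close> acts on the vector of the remaining tail \<rho> by
  its value at \<open>\<gamma> + osum \<rho>\<close>, and S_\<mu> prepends \<mu>.\<close>

definition coef :: "'x \<Rightarrow> nat list \<Rightarrow> nat list \<Rightarrow> nat list \<Rightarrow> nat list \<Rightarrow> 'b \<Rightarrow> complex" where
  "coef \<gamma> w v \<mu> \<nu> a =
     (if \<exists>\<rho>. w = \<mu> @ \<rho> \<and> v = \<nu> @ \<rho> then ch (\<gamma> + osum (drop (length \<mu>) w)) a else 0)"

lemma snorm_vec:
  assumes e: "e \<in> A" "ch \<gamma> e = 1" and V: "finite V"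
  shows "pf.snorm \<gamma> (vec e V \<xi>) = L2_set (\<lambda>v. cmod (\<xi> v)) V"
proof -
  have inner: "ch \<gamma> (star (Lw v e) * Lw w e) = (if w = v then 1 else 0)" for v w
    using ch_inner_Lw[OF e(1) e(1), of v w] e by (auto simp: Lw_inner_same ch_mult A_star ch_star)
  have "star (vec e V \<xi>) * vec e V \<xi>
      = (\<Sum>v\<in>V. \<Sum>w\<in>V. (\<xi> w * cnj (\<xi> v)) *\<^sub>C (star (Lw v e) * Lw w e))"
    unfolding vec_def star_sum sum_distrib_right sum_distrib_left star_scaleC
    by (subst sum.swap) (simp add: mult_scaleC_left mult_scaleC_right scaleC_scaleC)
  then have "ch \<gamma> (star (vec e V \<xi>) * vec e V \<xi>)
      = (\<Sum>v\<in>V. \<Sum>w\<in>V. if w = v then \<xi> w * cnj (\<xi> v) else 0)"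
    by (simp add: pf.sum pf.scale inner) (intro sum.cong refl, auto)
  also have "\<dots> = complex_of_real (\<Sum>v\<in>V. (cmod (\<xi> v))\<^sup>2)"
    using V by (simp only: sum.delta' of_real_sum complex_norm_square) simp
  finally have "(pf.snorm \<gamma> (vec e V \<xi>))\<^sup>2 = (\<Sum>v\<in>V. (cmod (\<xi> v))\<^sup>2)"
    unfolding pf.snorm_sq by (simp only: Re_complex_of_real)
  then show ?thesis unfolding L2_set_def by (metis pf.snorm_nonneg real_sqrt_unique)
qed

lemma ch_matrix_coefficient:
  assumes e: "e \<in> A" "ch \<gamma> e = 1" and a: "a \<in> A"
  shows "ch \<gamma> (star (Lw w e) * E \<mu> a \<nu> * Lw v e) = coef \<gamma> w v \<mu> \<nu> a"
proof (cases rule: prefix_cases[of v \<nu>])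
  case (1 \<rho>)
  have "star (Lw w e) * E \<mu> a \<nu> * Lw v e = star (Lw w e) * Lw (\<mu> @ \<rho>) (sh (osum \<rho>) a * e)"
    unfolding E_def 1 mult.assoc Lw_mult Lw_inner_append by (simp add: star_star Lw_comm a Lw_append)
  moreover have "ch \<gamma> (star (Lw w e) * Lw (\<mu> @ \<rho>) (sh (osum \<rho>) a * e)) = coef \<gamma> w v \<mu> \<nu> a"
  proof (cases "w = \<mu> @ \<rho>")
    case True
    then show ?thesis using e a
      by (simp add: coef_def 1 Lw_inner_same ch_mult A_mult A_star sh_in ch_star ch_sh)
  next
    case False
    then show ?thesis
      using ch_inner_Lw[OF e(1) A_mult[OF sh_in[OF a] e(1)] False] by (simp add: coef_def 1)
  qed
  ultimately show ?thesis by simp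
next
  case (2 \<rho>)
  have no: "\<not> (\<exists>\<rho>'. w = \<mu> @ \<rho>' \<and> v = \<nu> @ \<rho>')" using 2 by auto
  have "star (Lw \<nu> (star a)) * Lw v e = star (star e * Lw \<rho> (star a))"
    by (metis 2(2) Lw_inner_append star_mult star_star)
  also have "\<dots> = star (Lw \<rho> (sh (osum \<rho>) (star e) * star a))"
    using e by (simp add: Lw_comm A_star)
  finally have "E \<mu> a \<nu> * Lw v e = E \<mu> (star (sh (osum \<rho>) (star e) * star a)) \<rho>"
    unfolding E_def Lw_mult by (simp add: star_star)
  also have "\<dots> = star (E \<rho> (sh (osum \<rho>) (star e) * star a) \<mu>)"
    using e a by (subst star_E) (simp_all add: A_mult A_star sh_in)
  finally have "star (Lw w e) * E \<mu> a \<nu> * Lw v e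
      = star (Lw w e) * star (Lw \<rho> (star (Lw \<mu> (star (sh (osum \<rho>) (star e) * star a)))))"
    by (simp add: mult.assoc E_def)
  then show ?thesis using 2 no by (simp add: coef_def ch_star_Lw)
next
  case 3
  have "E \<mu> a \<nu> * Lw v e = 0" unfolding E_def Lw_mult 3(1) by simp
  then show ?thesis using 3 by (auto simp: coef_def mult.assoc)
qed

lemma matrix_coefficients_bound:
  assumes x: "fbound x C" and e: "e \<in> A" "ch \<gamma> e = 1" and fin: "finite W" "finite V"
  shows "mat_bound W V (\<lambda>w v. ch \<gamma> (star (Lw w e) * x * Lw v e)) C"
  unfolding mat_bound_def
proof (intro allI)
  fix \<xi> \<eta> :: "nat list \<Rightarrow> complex"
  have "star (vec e W (\<lambda>w. cnj (\<eta> w))) * (x * vec e V \<xi>)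
      = (\<Sum>w\<in>W. \<Sum>v\<in>V. (\<eta> w * \<xi> v) *\<^sub>C (star (Lw w e) * x * Lw v e))"
    unfolding vec_def star_sum sum_distrib_right sum_distrib_left star_scaleC
    by (subst sum.swap) (simp add: mult_scaleC_left mult_scaleC_right scaleC_scaleC mult.assoc mult.commute)
  then have "ch \<gamma> (star (vec e W (\<lambda>w. cnj (\<eta> w))) * (x * vec e V \<xi>))
      = (\<Sum>w\<in>W. \<Sum>v\<in>V. \<eta> w * ch \<gamma> (star (Lw w e) * x * Lw v e) * \<xi> v)"
    by (simp add: pf.sum pf.scale mult_ac)
  then have "cmod (\<Sum>w\<in>W. \<Sum>v\<in>V. \<eta> w * ch \<gamma> (star (Lw w e) * x * Lw v e) * \<xi> v)
      \<le> pf.snorm \<gamma> (vec e W (\<lambda>w. cnj (\<eta> w))) * pf.snorm \<gamma> (x * vec e V \<xi>)"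
    by (metis pf.cauchy_schwarz)
  also have "\<dots> \<le> pf.snorm \<gamma> (vec e W (\<lambda>w. cnj (\<eta> w))) * (C * pf.snorm \<gamma> (vec e V \<xi>))"
    using x by (intro mult_left_mono) (auto simp: fbound_def)
  also have "\<dots> = C * L2_set (\<lambda>w. cmod (\<eta> w)) W * L2_set (\<lambda>v. cmod (\<xi> v)) V"
    using snorm_vec[OF e] fin by simp
  finally show "cmod (\<Sum>w\<in>W. \<Sum>v\<in>V. \<eta> w * ch \<gamma> (star (Lw w e) * x * Lw v e) * \<xi> v)
      \<le> C * L2_set (\<lambda>w. cmod (\<eta> w)) W * L2_set (\<lambda>v. cmod (\<xi> v)) V" .
qed

end

section \<open>Recovering homogeneous parts from Fock matrices\<close>

lemma mat_bound_diff:
  assumes "mat_bound P Q a C" "mat_bound P Q b D"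
  shows "mat_bound P Q (\<lambda>i k. a i k - b i k) (C + D)"
  unfolding mat_bound_def
proof (intro allI)
  fix \<xi> \<eta>
  have "(\<Sum>i\<in>P. \<Sum>k\<in>Q. \<eta> i * (a i k - b i k) * \<xi> k)
    = (\<Sum>i\<in>P. \<Sum>k\<in>Q. \<eta> i * a i k * \<xi> k) - (\<Sum>i\<in>P. \<Sum>k\<in>Q. \<eta> i * b i k * \<xi> k)"
    by (simp add: sum_subtractf algebra_simps)
  also have "cmod \<dots> \<le> C * L2_set (\<lambda>i. cmod (\<eta> i)) P * L2_set (\<lambda>k. cmod (\<xi> k)) Q
      + D * L2_set (\<lambda>i. cmod (\<eta> i)) P * L2_set (\<lambda>k. cmod (\<xi> k)) Q"
    using norm_triangle_ineq4 mat_boundD[OF assms(1), of \<eta> \<xi>] mat_boundD[OF assms(2), of \<eta> \<xi>]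
    by (rule order_trans[OF _ add_mono])
  finally show "cmod (\<Sum>i\<in>P. \<Sum>k\<in>Q. \<eta> i * (a i k - b i k) * \<xi> k)
      \<le> (C + D) * L2_set (\<lambda>i. cmod (\<eta> i)) P * L2_set (\<lambda>k. cmod (\<xi> k)) Q"
    by (simp add: algebra_simps)
qed

lemma mat_bound_mono: "mat_bound P Q a C \<Longrightarrow> C \<le> D \<Longrightarrow> mat_bound P Q a D"
  unfolding mat_bound_def
  by (meson L2_set_nonneg mult_right_mono order_trans)

lemma mat_bound_cong:
  "(\<And>i k. i \<in> P \<Longrightarrow> k \<in> Q \<Longrightarrow> a i k = b i k) \<Longrightarrow> mat_bound P Q a C = mat_bound P Q b C"
  unfolding mat_bound_def by (simp cong: sum.cong)

context core
begin

lemma sum_hwords_Suc: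
  "(\<Sum>w\<in>hwords \<Lambda> (Suc m). f w) = (\<Sum>i\<in>\<Lambda>. \<Sum>w\<in>hwords \<Lambda> m. f (w @ [i]))"
proof -
  have "(\<Sum>i\<in>\<Lambda>. \<Sum>w\<in>hwords \<Lambda> m. f (w @ [i])) = (\<Sum>(i, w)\<in>\<Lambda> \<times> hwords \<Lambda> m. f (w @ [i]))"
    by (simp add: sum.cartesian_product)
  also have "\<dots> = (\<Sum>w\<in>hwords \<Lambda> (Suc m). f w)"
  proof (rule sum.reindex_bij_witness[of _ "\<lambda>w. (last w, butlast w)" "\<lambda>(i, w). w @ [i]"])
    fix w assume w: "w \<in> hwords \<Lambda> (Suc m)"
    then have ne: "w \<noteq> []" by (auto simp: hwords_def)
    then show "(case (last w, butlast w) of (i, w) \<Rightarrow> w @ [i]) = w" by simp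
    show "(last w, butlast w) \<in> \<Lambda> \<times> hwords \<Lambda> m"
      using w ne last_in_set[OF ne] by (auto simp: hwords_def dest: in_set_butlastD)
  qed (auto simp: hwords_def)
  finally show ?thesis ..
qed

text \<open>A matrix that preserves the last letter is block diagonal over the letters, so its norm
  does not exceed the common bound of the blocks; the blocks are combined by the Cauchy-Schwarz
  inequality over the letters.\<close>

lemma mat_bound_blocks:
  assumes b: "\<And>i. mat_bound (hwords \<Lambda> m) (hwords \<Lambda> n) (B i) C" and \<Lambda>: "finite \<Lambda>" and C: "0 \<le> C"
  shows "mat_bound (hwords \<Lambda> (Suc m)) (hwords \<Lambda> (Suc n))
    (\<lambda>w v. if last w = last v then B (last w) (butlast w) (butlast v) else 0) C"
  unfolding mat_bound_def
proof (intro allI)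
  fix \<xi> \<eta> :: "nat list \<Rightarrow> complex"
  let ?N = "\<lambda>l f i. L2_set (\<lambda>w. cmod (f (w @ [i]))) (hwords \<Lambda> l)"
  have l2: "L2_set (?N l f) \<Lambda> = L2_set (\<lambda>w. cmod (f w)) (hwords \<Lambda> (Suc l))" for l and f :: "nat list \<Rightarrow> complex"
    by (simp add: L2_set_def sum_hwords_Suc sum_nonneg)
  have "(\<Sum>w\<in>hwords \<Lambda> (Suc m). \<Sum>v\<in>hwords \<Lambda> (Suc n).
      \<eta> w * (if last w = last v then B (last w) (butlast w) (butlast v) else 0) * \<xi> v)
    = (\<Sum>i\<in>\<Lambda>. \<Sum>w\<in>hwords \<Lambda> m. \<Sum>v\<in>hwords \<Lambda> n. \<eta> (w @ [i]) * B i w v * \<xi> (v @ [i]))"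
  proof (subst sum_hwords_Suc, rule sum.cong[OF refl], rule sum.cong[OF refl])
    fix i w assume i: "i \<in> \<Lambda>" and "w \<in> hwords \<Lambda> m"
    have "(\<Sum>v\<in>hwords \<Lambda> (Suc n). \<eta> (w @ [i]) * (if last (w @ [i]) = last v
        then B (last (w @ [i])) (butlast (w @ [i])) (butlast v) else 0) * \<xi> v)
      = (\<Sum>k\<in>\<Lambda>. if k = i then \<Sum>v\<in>hwords \<Lambda> n. \<eta> (w @ [i]) * B i w v * \<xi> (v @ [i]) else 0)"
      by (subst sum_hwords_Suc) (intro sum.cong refl, auto)
    then show "(\<Sum>v\<in>hwords \<Lambda> (Suc n). \<eta> (w @ [i]) * (if last (w @ [i]) = last v
        then B (last (w @ [i])) (butlast (w @ [i])) (butlast v) else 0) * \<xi> v)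
      = (\<Sum>v\<in>hwords \<Lambda> n. \<eta> (w @ [i]) * B i w v * \<xi> (v @ [i]))" using i \<Lambda> by simp
  qed
  also have "cmod \<dots> \<le> (\<Sum>i\<in>\<Lambda>. C * ?N m \<eta> i * ?N n \<xi> i)"
    by (rule sum_norm_le) (rule mat_boundD[OF b])
  also have "\<dots> = C * (\<Sum>i\<in>\<Lambda>. \<bar>?N m \<eta> i\<bar> * \<bar>?N n \<xi> i\<bar>)"
    by (simp add: sum_distrib_left mult.assoc L2_set_nonneg)
  also have "\<dots> \<le> C * (L2_set (?N m \<eta>) \<Lambda> * L2_set (?N n \<xi>) \<Lambda>)"
    by (intro mult_left_mono C L2_set_mult_ineq)
  finally show "cmod (\<Sum>w\<in>hwords \<Lambda> (Suc m). \<Sum>v\<in>hwords \<Lambda> (Suc n).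
      \<eta> w * (if last w = last v then B (last w) (butlast w) (butlast v) else 0) * \<xi> v)
    \<le> C * L2_set (\<lambda>i. cmod (\<eta> i)) (hwords \<Lambda> (Suc m)) * L2_set (\<lambda>k. cmod (\<xi> k)) (hwords \<Lambda> (Suc n))"
    by (simp add: l2 mult.assoc)
qed

lemma coef_empty:
  "w = [] \<or> v = [] \<Longrightarrow> coef \<gamma> w v \<mu> \<nu> a = (if \<mu> = w \<and> \<nu> = v then ch \<gamma> a else 0)"
  by (auto simp: coef_def)

text \<open>A common tail of the two words is either empty, which is the first summand, or ends in a
  common last letter; removing that letter leaves a coefficient at a translated point.\<close>

lemma coef_snoc:
  "coef \<gamma> (w @ [i]) (v @ [k]) \<mu> \<nu> a = (if \<mu> = w @ [i] \<and> \<nu> = v @ [k] then ch \<gamma> a else 0)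
     + (if i = k then coef (\<gamma> + \<omega> i) w v \<mu> \<nu> a else 0)"
proof (cases "\<mu> = w @ [i] \<and> \<nu> = v @ [k]")
  case True
  then show ?thesis by (auto simp: coef_def)
next
  case False
  have iff: "(\<exists>\<rho>. w @ [i] = \<mu> @ \<rho> \<and> v @ [k] = \<nu> @ \<rho>) \<longleftrightarrow> i = k \<and> (\<exists>\<rho>. w = \<mu> @ \<rho> \<and> v = \<nu> @ \<rho>)"
  proof
    assume "\<exists>\<rho>. w @ [i] = \<mu> @ \<rho> \<and> v @ [k] = \<nu> @ \<rho>"
    then obtain \<rho> where \<rho>: "w @ [i] = \<mu> @ \<rho>" "v @ [k] = \<nu> @ \<rho>" by blast
    then have "\<rho> \<noteq> []" using False by auto
    then obtain \<rho>' l where "\<rho> = \<rho>' @ [l]" by (metis append_butlast_last_id)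
    then show "i = k \<and> (\<exists>\<rho>. w = \<mu> @ \<rho> \<and> v = \<nu> @ \<rho>)" using \<rho> by auto
  qed auto
  show ?thesis
  proof (cases "i = k \<and> (\<exists>\<rho>. w = \<mu> @ \<rho> \<and> v = \<nu> @ \<rho>)")
    case True
    then obtain \<rho> where "w = \<mu> @ \<rho>" "v = \<nu> @ \<rho>" "i = k" by blast
    then show ?thesis using False iff by (auto simp: coef_def add_ac)
  next
    case False
    then show ?thesis using False iff by (auto simp: coef_def)
  qed
qed

definition Mat :: "nat set \<Rightarrow> nat \<Rightarrow> (nat list \<Rightarrow> nat list \<Rightarrow> 'b) \<Rightarrow> 'x \<Rightarrow> nat list \<Rightarrow> nat list \<Rightarrow> complex" where
  "Mat \<Lambda> l a \<gamma> w v = (\<Sum>\<mu>\<in>words \<Lambda> l. \<Sum>\<nu>\<in>words \<Lambda> l. coef \<gamma> w v \<mu> \<nu> (a \<mu> \<nu>))"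

definition expand :: "nat set \<Rightarrow> nat \<Rightarrow> (nat list \<Rightarrow> nat list \<Rightarrow> 'b) \<Rightarrow> 'b" where
  "expand \<Lambda> l a = (\<Sum>\<mu>\<in>words \<Lambda> l. \<Sum>\<nu>\<in>words \<Lambda> l. E \<mu> (a \<mu> \<nu>) \<nu>)"

lemma Mat_bound:
  assumes "fbound (expand \<Lambda> l a) C" "\<And>\<mu> \<nu>. a \<mu> \<nu> \<in> A" "finite W" "finite V"
  shows "mat_bound W V (Mat \<Lambda> l a \<gamma>) C"
proof -
  obtain e where e: "e \<in> A" "ch \<gamma> e = 1" using ch_unit by blast
  have "ch \<gamma> (star (Lw w e) * expand \<Lambda> l a * Lw v e) = Mat \<Lambda> l a \<gamma> w v" for w v
    unfolding expand_def Mat_def sum_distrib_left sum_distrib_right pf.sum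
    by (intro sum.cong refl ch_matrix_coefficient e assms(2))
  then show ?thesis using matrix_coefficients_bound[OF assms(1) e assms(3,4)] by simp
qed

lemma sum_delta2:
  assumes "finite P" "finite Q" "i \<in> P" "k \<in> Q"
  shows "(\<Sum>x\<in>P. \<Sum>y\<in>Q. if x = i \<and> y = k then f x y else (0::complex)) = f i k"
proof -
  have "(\<Sum>x\<in>P. \<Sum>y\<in>Q. if x = i \<and> y = k then f x y else 0)
    = (\<Sum>x\<in>P. if x = i then \<Sum>y\<in>Q. if y = k then f x y else 0 else 0)"
    by (intro sum.cong refl) auto
  then show ?thesis using assms by simp
qed

text \<open>Summing \<open>coef_snoc\<close> over \<mu> and \<nu> shows that the coefficients of
  bidegree (m, n) are a block of the Fock matrix at \<gamma> minus the block diagonal matrix formed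
  from the Fock matrices at the points \<open>\<gamma> + \<omega> i\<close>. Both have norm at most
  \<open>C\<close>. If m or n is 0 there is no last letter to remove, and the first matrix alone
  suffices.\<close>

lemma homogeneous_part_bound:
  assumes x: "fbound (expand \<Lambda> l a) C" and a: "\<And>\<mu> \<nu>. a \<mu> \<nu> \<in> A" and \<Lambda>: "finite \<Lambda>"
    and mn: "m \<le> l" "n \<le> l"
  shows "mat_bound (hwords \<Lambda> m) (hwords \<Lambda> n) (\<lambda>w v. ch \<gamma> (a w v)) (C + C)"
proof -
  have C: "0 \<le> C" using x by (simp add: fbound_def)
  note fin = finite_words[OF \<Lambda>, of l]
  have inW: "w \<in> words \<Lambda> l" if "w \<in> hwords \<Lambda> k" "k \<le> l" for w k
    using that by (auto simp: words_def hwords_def)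
  note Mb = Mat_bound[OF x a finite_hwords[OF \<Lambda>] finite_hwords[OF \<Lambda>]]
  show ?thesis
  proof (cases "m = 0 \<or> n = 0")
    case True
    have "Mat \<Lambda> l a \<gamma> w v = ch \<gamma> (a w v)" if wv: "w \<in> hwords \<Lambda> m" "v \<in> hwords \<Lambda> n" for w v
    proof -
      have "w = [] \<or> v = []" using True wv by (auto simp: hwords_def)
      then show ?thesis unfolding Mat_def using sum_delta2[OF fin fin] inW wv mn by (simp add: coef_empty)
    qed
    then have "mat_bound (hwords \<Lambda> m) (hwords \<Lambda> n) (\<lambda>w v. ch \<gamma> (a w v)) C"
      using Mb by (subst mat_bound_cong[of _ _ _ "Mat \<Lambda> l a \<gamma>"]) auto
    then show ?thesis using C by (elim mat_bound_mono) simp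
  next
    case False
    then obtain m' n' where s: "m = Suc m'" "n = Suc n'" by (metis not0_implies_Suc)
    let ?B = "\<lambda>w v. if last w = last v then Mat \<Lambda> l a (\<gamma> + \<omega> (last w)) (butlast w) (butlast v) else 0"
    have eq: "ch \<gamma> (a w v) = Mat \<Lambda> l a \<gamma> w v - ?B w v" if wv: "w \<in> hwords \<Lambda> m" "v \<in> hwords \<Lambda> n" for w v
    proof -
      obtain w' i where w: "w = w' @ [i]" using wv s by (cases w rule: rev_cases) (auto simp: hwords_def)
      obtain v' k where v: "v = v' @ [k]" using wv s by (cases v rule: rev_cases) (auto simp: hwords_def)
      have "Mat \<Lambda> l a \<gamma> w v = ch \<gamma> (a w v) + (if i = k then Mat \<Lambda> l a (\<gamma> + \<omega> i) w' v' else 0)"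
        unfolding Mat_def w v coef_snoc sum.distrib
        using sum_delta2[OF fin fin, of "w' @ [i]" "v' @ [k]"] inW[OF wv(1) mn(1)] inW[OF wv(2) mn(2)]
        by (simp add: w v)
      then show ?thesis by (simp add: w v)
    qed
    have "mat_bound (hwords \<Lambda> m) (hwords \<Lambda> n) ?B C"
      unfolding s by (rule mat_bound_blocks[where B = "\<lambda>i. Mat \<Lambda> l a (\<gamma> + \<omega> i)", OF _ \<Lambda> C])
        (rule Mat_bound[OF x a finite_hwords[OF \<Lambda>] finite_hwords[OF \<Lambda>]])
    from mat_bound_diff[OF Mb this]
    have "mat_bound (hwords \<Lambda> m) (hwords \<Lambda> n) (\<lambda>w v. Mat \<Lambda> l a \<gamma> w v - ?B w v) (C + C)" .
    then show ?thesis
      by (rule iffD2[OF mat_bound_cong, rotated]) (rule eq)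
  qed
qed

lemma sum_words: "finite \<Lambda> \<Longrightarrow> (\<Sum>w\<in>words \<Lambda> l. f w) = (\<Sum>m\<le>l. \<Sum>w\<in>hwords \<Lambda> m. f w)"
  unfolding words_eq by (rule sum.UNION_disjoint) (auto simp: finite_hwords, auto simp: hwords_def)

text \<open>There are (l + 1)^2 bidegrees, each contributing at most 2 C. The factor is harmless
  because it is polynomial in the length bound and independent of the number of letters.\<close>

lemma norm_expand_le:
  assumes x: "fbound (expand \<Lambda> l a) C" and a: "\<And>\<mu> \<nu>. a \<mu> \<nu> \<in> A" and \<Lambda>: "finite \<Lambda>"
  shows "norm (expand \<Lambda> l a) \<le> 2 * (real l + 1)\<^sup>2 * C"
proof -
  have C: "0 \<le> C" using x by (simp add: fbound_def)
  have "expand \<Lambda> l a = (\<Sum>m\<le>l. \<Sum>n\<le>l. \<Sum>\<mu>\<in>hwords \<Lambda> m. \<Sum>\<nu>\<in>hwords \<Lambda> n. E \<mu> (a \<mu> \<nu>) \<nu>)"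
    unfolding expand_def sum_words[OF \<Lambda>] by (intro sum.cong refl sum.swap)
  also have "norm \<dots> \<le> (\<Sum>m\<le>l. \<Sum>n\<le>l. C + C)"
  proof (intro sum_norm_le)
    fix m n assume mn: "m \<in> {..l}" "n \<in> {..l}"
    show "norm (\<Sum>\<mu>\<in>hwords \<Lambda> m. \<Sum>\<nu>\<in>hwords \<Lambda> n. E \<mu> (a \<mu> \<nu>) \<nu>) \<le> C + C"
    proof (rule norm_homogeneous_le[where m = m and n = n])
      show "mat_bound (hwords \<Lambda> m) (hwords \<Lambda> n) (\<lambda>\<mu> \<nu>. ch \<gamma> (a \<mu> \<nu>)) (C + C)" for \<gamma>
        using mn by (intro homogeneous_part_bound[OF x a \<Lambda>]) auto
    qed (use C in \<open>simp_all add: hwords_def[of \<Lambda>] finite_hwords[OF \<Lambda>, unfolded hwords_def] a\<close>)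
  qed
  also have "\<dots> = 2 * (real l + 1)\<^sup>2 * C" by (simp add: power2_eq_square algebra_simps)
  finally show ?thesis .
qed

section \<open>The filtration by word length\<close>

lemma expand_add: "expand \<Lambda> l a + expand \<Lambda> l b = expand \<Lambda> l (\<lambda>\<mu> \<nu>. a \<mu> \<nu> + b \<mu> \<nu>)"
  by (simp add: expand_def E_add sum.distrib)

definition Espan :: "nat set \<Rightarrow> nat \<Rightarrow> 'b set" where
  "Espan \<Lambda> l = {expand \<Lambda> l a | a. \<forall>\<mu> \<nu>. a \<mu> \<nu> \<in> A}"

lemma Espan_add: "x \<in> Espan \<Lambda> l \<Longrightarrow> y \<in> Espan \<Lambda> l \<Longrightarrow> x + y \<in> Espan \<Lambda> l"
proof -
  assume "x \<in> Espan \<Lambda> l" "y \<in> Espan \<Lambda> l"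
  then obtain a b where "x = expand \<Lambda> l a" "y = expand \<Lambda> l b" "\<And>\<mu> \<nu>. a \<mu> \<nu> \<in> A" "\<And>\<mu> \<nu>. b \<mu> \<nu> \<in> A"
    by (auto simp: Espan_def)
  then show "x + y \<in> Espan \<Lambda> l"
    unfolding Espan_def using A_add by (auto simp: expand_add intro!: exI[of _ "\<lambda>\<mu> \<nu>. a \<mu> \<nu> + b \<mu> \<nu>"])
qed

lemma Espan_zero: "0 \<in> Espan \<Lambda> l"
  unfolding Espan_def by (auto simp: expand_def A_zero intro!: exI[of _ "\<lambda>_ _. 0"])

lemma Espan_sum: "(\<And>i. i \<in> I \<Longrightarrow> f i \<in> Espan \<Lambda> l) \<Longrightarrow> (\<Sum>i\<in>I. f i) \<in> Espan \<Lambda> l"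
  by (induction I rule: infinite_finite_induct) (auto simp: Espan_zero Espan_add)

lemma E_in_Espan:
  assumes \<Lambda>: "finite \<Lambda>" and "\<mu> \<in> words \<Lambda> l" "\<nu> \<in> words \<Lambda> l" "a \<in> A"
  shows "E \<mu> a \<nu> \<in> Espan \<Lambda> l"
proof -
  let ?a = "\<lambda>\<mu>' \<nu>'. if \<mu>' = \<mu> \<and> \<nu>' = \<nu> then a else 0"
  have "expand \<Lambda> l ?a = (\<Sum>\<mu>'\<in>words \<Lambda> l. if \<mu>' = \<mu> then \<Sum>\<nu>'\<in>words \<Lambda> l. if \<nu>' = \<nu> then E \<mu> a \<nu> else 0 else 0)"
    unfolding expand_def by (intro sum.cong refl) (auto intro!: sum.cong sum.neutral)
  also have "\<dots> = E \<mu> a \<nu>" using assms finite_words[OF \<Lambda>] by simp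
  finally show ?thesis unfolding Espan_def using assms(4) A_zero by (auto intro!: exI[of _ ?a])
qed

lemma words_append: "v \<in> words \<Lambda> k \<Longrightarrow> w \<in> words \<Lambda> l \<Longrightarrow> v @ w \<in> words \<Lambda> (k + l)"
  by (auto simp: words_def)

lemma words_mono: "w \<in> words \<Lambda> k \<Longrightarrow> \<Lambda> \<subseteq> \<Lambda>' \<Longrightarrow> k \<le> l \<Longrightarrow> w \<in> words \<Lambda>' l"
  by (auto simp: words_def)

lemma E_mult_in_Espan:
  assumes \<Lambda>: "finite \<Lambda>" and w: "\<mu> \<in> words \<Lambda> k" "\<nu> \<in> words \<Lambda> k" "\<mu>' \<in> words \<Lambda> l" "\<nu>' \<in> words \<Lambda> l"
    and ab: "a \<in> A" "b \<in> A"
  shows "E \<mu> a \<nu> * E \<mu>' b \<nu>' \<in> Espan \<Lambda> (k + l)"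
proof (cases rule: prefix_cases[of \<mu>' \<nu>])
  case (1 \<rho>)
  have "\<rho> \<in> words \<Lambda> l" using 1 w by (auto simp: words_def)
  then have "\<mu> @ \<rho> \<in> words \<Lambda> (k + l)" "\<nu>' \<in> words \<Lambda> (k + l)"
    using words_append[OF w(1)] words_mono[OF w(4)] by auto
  then show ?thesis
    unfolding 1 E_mult_prefix[OF ab(1)] by (intro E_in_Espan \<Lambda> A_mult sh_in ab)
next
  case (2 \<rho>)
  have r: "\<rho> \<in> words \<Lambda> k" using 2 w by (auto simp: words_def)
  then have "\<nu>' @ \<rho> \<in> words \<Lambda> (k + l)" "\<mu> \<in> words \<Lambda> (k + l)"
    using words_append[OF w(4) r] words_mono[OF w(1)] by (auto simp: add.commute)
  then show ?thesis
    unfolding 2 E_mult_prefix'[OF ab]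
    by (intro E_in_Espan \<Lambda> A_mult sh_in ab)
next
  case 3
  then show ?thesis using E_mult_zero[of \<mu>' \<nu>] Espan_zero by simp
qed

lemma Espan_mult:
  assumes \<Lambda>: "finite \<Lambda>" and "x \<in> Espan \<Lambda> k" "y \<in> Espan \<Lambda> l"
  shows "x * y \<in> Espan \<Lambda> (k + l)"
proof -
  obtain a b where x: "x = expand \<Lambda> k a" "\<And>\<mu> \<nu>. a \<mu> \<nu> \<in> A" and y: "y = expand \<Lambda> l b" "\<And>\<mu> \<nu>. b \<mu> \<nu> \<in> A"
    using assms by (auto simp: Espan_def)
  show ?thesis
    unfolding x y expand_def sum_distrib_left sum_distrib_right
    by (intro Espan_sum E_mult_in_Espan \<Lambda> x y)
qed

lemma Espan_star: assumes "x \<in> Espan \<Lambda> k" shows "star x \<in> Espan \<Lambda> k"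
proof -
  obtain a where x: "x = expand \<Lambda> k a" "\<And>\<mu> \<nu>. a \<mu> \<nu> \<in> A" using assms by (auto simp: Espan_def)
  have "star x = expand \<Lambda> k (\<lambda>\<mu> \<nu>. star (a \<nu> \<mu>))"
    unfolding x expand_def star_sum star_E[OF x(2)] by (rule sum.swap)
  then show ?thesis using x(2) by (auto simp: Espan_def A_star)
qed

text \<open>The length filtration grows polynomially in operator norm, so comparing norms of large powers
  removes the factor from \<open>norm_expand_le\<close>.\<close>

lemma norm_Espan_le:
  assumes \<Lambda>: "finite \<Lambda>" and x: "x \<in> Espan \<Lambda> l" "fbound x C"
  shows "norm x \<le> C"
proof -
  have "norm x ^ (2 ^ k) \<le> 2 * (2 ^ k * real l + 1)\<^sup>2 * C ^ (2 ^ k)" for k :: nat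
    using x
  proof (induction k arbitrary: x l C)
    case 0
    then obtain a where "x = expand \<Lambda> l a" "\<And>\<mu> \<nu>. a \<mu> \<nu> \<in> A" by (auto simp: Espan_def)
    then show ?case using norm_expand_le[of \<Lambda> l a C] 0 \<Lambda> by simp
  next
    case (Suc k)
    have "norm (star x * x) ^ (2 ^ k) \<le> 2 * (2 ^ k * real (l + l) + 1)\<^sup>2 * (C * C) ^ (2 ^ k)"
      by (rule Suc.IH[OF Espan_mult[OF \<Lambda> Espan_star] fbound_mult[OF fbound_star]]) (rule Suc.prems)+
    then show ?case by (simp add: cstar_identity power_mult[symmetric] power2_eq_square[of C, symmetric] algebra_simps)
  qed
  then show ?thesis
    by - (rule le_of_power_growth[of _ _ 2 "real l"], use x in \<open>simp_all add: fbound_def\<close>)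
qed

end

text \<open>The assumption says that the elements \<open>E \<mu> a \<nu>\<close> span a dense subspace; scalars are absorbed by \<open>a\<close>.\<close>

locale dense_core = core +
  assumes dense: "\<And>X. closed X \<Longrightarrow> 0 \<in> X \<Longrightarrow> (\<And>x y. x \<in> X \<Longrightarrow> y \<in> X \<Longrightarrow> x + y \<in> X) \<Longrightarrow>
    (\<And>\<mu> a \<nu>. a \<in> A \<Longrightarrow> E \<mu> a \<nu> \<in> X) \<Longrightarrow> X = UNIV"
begin

lemma Espan_mono:
  assumes "finite \<Lambda>'" "\<Lambda> \<subseteq> \<Lambda>'" "k \<le> l" and x: "x \<in> Espan \<Lambda> k"
  shows "x \<in> Espan \<Lambda>' l"
proof -
  obtain a where x: "x = expand \<Lambda> k a" "\<And>\<mu> \<nu>. a \<mu> \<nu> \<in> A" using x by (auto simp: Espan_def)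
  show ?thesis unfolding x expand_def
    by (intro Espan_sum E_in_Espan x assms(1)) (rule words_mono; use assms in simp)+
qed

lemma Espan_dense:
  assumes e: "e > 0" shows "\<exists>\<Lambda> l. finite \<Lambda> \<and> (\<exists>d\<in>Espan \<Lambda> l. norm (x - d) < e)"
proof -
  define D where "D = {d. \<exists>\<Lambda> l. finite \<Lambda> \<and> d \<in> Espan \<Lambda> l}"
  define X where "X = closure D"
  have "X = UNIV"
  proof (rule dense)
    show "closed X" "0 \<in> X" unfolding X_def D_def using Espan_zero[of "{}" 0]
      by (auto intro!: closure_subset[THEN subsetD] exI[of _ "{}::nat set"])
    fix x y assume xy: "x \<in> X" "y \<in> X"
    have *: "u + v \<in> D"
      if uv0: "u \<in> D" "v \<in> D" for u v
    proof -
      obtain \<Lambda> k \<Lambda>' l where uv: "finite \<Lambda>" "u \<in> Espan \<Lambda> k" "finite \<Lambda>'" "v \<in> Espan \<Lambda>' l" using uv0 by (auto simp: D_def)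
      have "u \<in> Espan (\<Lambda> \<union> \<Lambda>') (k + l)" "v \<in> Espan (\<Lambda> \<union> \<Lambda>') (k + l)"
        by (rule Espan_mono[OF _ _ _ uv(2)] Espan_mono[OF _ _ _ uv(4)]; use uv in simp)+
      then have "u + v \<in> Espan (\<Lambda> \<union> \<Lambda>') (k + l)" by (rule Espan_add)
      then show ?thesis using uv unfolding D_def by blast
    qed
    obtain f g where fg: "\<And>n. f n \<in> D" "f \<longlonglongrightarrow> x"
      "\<And>n. g n \<in> D" "g \<longlonglongrightarrow> y"
      using xy unfolding X_def closure_sequential by metis
    have "(\<lambda>n. f n + g n) \<longlonglongrightarrow> x + y" "\<And>n. f n + g n \<in> D"
      using *[OF fg(1,3)] tendsto_add[OF fg(2,4)] by auto
    then show "x + y \<in> X" unfolding X_def closure_sequential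
      by (intro exI[of _ "\<lambda>n. f n + g n"]) simp
  next
    fix \<mu> a \<nu> assume "a \<in> A"
    then have "E \<mu> a \<nu> \<in> Espan (set \<mu> \<union> set \<nu>) (length \<mu> + length \<nu>)"
      by (intro E_in_Espan) (auto simp: words_def)
    moreover have "finite (set \<mu> \<union> set \<nu>)" by simp
    ultimately show "E \<mu> a \<nu> \<in> X" unfolding X_def D_def by (intro closure_subset[THEN subsetD]) blast
  qed
  then have "x \<in> closure D" by (simp add: X_def)
  then obtain d where "d \<in> D" "dist d x < e"
    using e unfolding closure_approachable by metis
  then show ?thesis by (auto simp: D_def dist_norm norm_minus_commute)
qed

text \<open>If \<open>x\<close> acted as zero everywhere, an element \<open>d\<close> of the
  filtration within e = norm x / 3 of \<open>x\<close> would have Fock norm at most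
  \<open>e\<close>, hence norm at most \<open>e\<close> by \<open>norm_Espan_le\<close>, and
  \<open>norm x\<close> would be at most 2 e.\<close>

theorem fock_faithful:
  assumes x: "x \<noteq> 0"
  shows "\<exists>\<gamma> g. pf.snorm \<gamma> (x * g) > 0"
proof (rule ccontr)
  assume "\<not> ?thesis"
  then have z: "pf.snorm \<gamma> (x * g) = 0" for \<gamma> g
    using pf.snorm_nonneg[of \<gamma> "x * g"] by (metis less_le)
  define e where "e = norm x / 3"
  have e: "e > 0" using x by (simp add: e_def)
  obtain \<Lambda> l d where d: "finite \<Lambda>" "d \<in> Espan \<Lambda> l" "norm (x - d) < e" using Espan_dense[OF e, of x] by blast
  have "fbound d e" unfolding fbound_def
  proof (intro conjI allI)
    fix \<gamma> g
    have "pf.snorm \<gamma> (d * g) = pf.snorm \<gamma> (x * g - (x - d) * g)" by (simp add: algebra_simps)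
    also have "\<dots> \<le> pf.snorm \<gamma> (x * g) + pf.snorm \<gamma> ((x - d) * g)" by (rule pf.snorm_diff)
    also have "\<dots> \<le> norm (x - d) * pf.snorm \<gamma> g" using z pf.snorm_mult by simp
    also have "\<dots> \<le> e * pf.snorm \<gamma> g" using d by (intro mult_right_mono) auto
    finally show "pf.snorm \<gamma> (d * g) \<le> e * pf.snorm \<gamma> g" .
  qed (use e in simp)
  then have "norm d \<le> e" using norm_Espan_le d by blast
  then have "norm x \<le> e + e" using norm_triangle_ineq[of "x - d" d] d by simp
  then show False using x by (simp add: e_def)
qed

end

section \<open>Comparison and simplicity\<close>

text \<open>If the sum is below 1/2 the product is above 1/2: this converts the product bound of
  \<open>exhaustion\<close> into the sum needed in \<open>comparison_function\<close>. The bounds 0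
  and 1 are carried along for the induction.\<close>

lemma prod_list_one_minus_ge:
  fixes f :: "'c \<Rightarrow> real"
  assumes "\<And>w. w \<in> set ws \<Longrightarrow> 0 \<le> f w \<and> f w \<le> 1"
  shows "1 - sum_list (map f ws) \<le> prod_list (map (\<lambda>w. 1 - f w) ws)
    \<and> 0 \<le> prod_list (map (\<lambda>w. 1 - f w) ws) \<and> prod_list (map (\<lambda>w. 1 - f w) ws) \<le> 1"
  using assms
proof (induction ws)
  case (Cons w ws)
  define p where "p = prod_list (map (\<lambda>w. 1 - f w) ws)"
  have IH: "1 - sum_list (map f ws) \<le> p" "0 \<le> p" "p \<le> 1" using Cons by (auto simp: p_def)
  have w: "0 \<le> f w" "f w \<le> 1" using Cons.prems[of w] by auto
  have "f w * p \<le> f w" using w IH mult_left_mono[of p 1 "f w"] by simp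
  moreover have "f w * p \<ge> 0" using w IH by simp
  moreover have "(1 - f w) * p \<ge> 0" using w IH by (intro mult_nonneg_nonneg) auto
  ultimately show ?case using IH by (simp add: p_def[symmetric] algebra_simps)
qed simp

text \<open>Bernoulli's inequality gives (1 + n s)(1 - s)^n \<le> (1 - s^2)^n \<le> 1.\<close>

lemma mult_one_minus_power_le:
  fixes s :: real
  assumes "0 \<le> s" "s \<le> 1" and n: "n > 0"
  shows "s * (1 - s) ^ n \<le> 1 / real n"
proof -
  have "(1 + real n * s) * (1 - s) ^ n \<le> (1 + s) ^ n * (1 - s) ^ n"
    using Bernoulli_inequality[of s n] assms by (intro mult_right_mono) (auto simp: mult.commute)
  also have "\<dots> = (1 - s * s) ^ n" by (simp add: power_mult_distrib[symmetric] algebra_simps)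
  also have "\<dots> \<le> 1" using assms mult_le_one[of s s] by (intro power_le_one) auto
  finally have "(1 - s) ^ n + real n * (s * (1 - s) ^ n) \<le> 1" by (simp add: algebra_simps)
  moreover have "0 \<le> (1 - s) ^ n" using assms by simp
  ultimately have "real n * (s * (1 - s) ^ n) \<le> 1" by linarith
  then show ?thesis using n by (simp add: field_simps)
qed

context dense_core
begin

text \<open>Moving \<open>u\<close> past S_\<mu> translates it by \<open>osum \<mu>\<close>. So
  \<open>u\<close> is chosen as an approximate unit for the coefficients translated back by
  \<open>- osum \<mu>\<close>.\<close>

lemma approximate_unit_algebra:
  assumes e: "e > 0"
  shows "\<exists>u\<in>A. star u = u \<and> norm u \<le> 1 \<and> norm (x - u * x) < e"
proof -
  obtain \<Lambda> l d where d: "finite \<Lambda>" "d \<in> Espan \<Lambda> l" "norm (x - d) < e/3"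
    using Espan_dense[of "e/3" x] e by auto
  then obtain a where a: "d = expand \<Lambda> l a" "\<And>\<mu> \<nu>. a \<mu> \<nu> \<in> A" by (auto simp: Espan_def)
  note fin = finite_words[OF d(1), of l]
  define N where "N = real (card (words \<Lambda> l)) * real (card (words \<Lambda> l)) + 1"
  have N: "N > 0" by (simp add: N_def add_nonneg_pos)
  have "\<exists>u\<in>A. star u = u \<and> norm u \<le> 1 \<and> (\<forall>i\<in>words \<Lambda> l \<times> words \<Lambda> l.
      norm (sh (- osum (fst i)) (a (fst i) (snd i)) - u * sh (- osum (fst i)) (a (fst i) (snd i))) < e / (3 * N))"
    using fin a e N by (intro approximate_unit) (auto intro: sh_in)
  then obtain u where u: "u \<in> A" "star u = u" "norm u \<le> 1"
    and us: "\<And>\<mu> \<nu>. \<mu> \<in> words \<Lambda> l \<Longrightarrow> \<nu> \<in> words \<Lambda> l \<Longrightarrow>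
      norm (sh (- osum \<mu>) (a \<mu> \<nu>) - u * sh (- osum \<mu>) (a \<mu> \<nu>)) < e / (3 * N)" by force
  have term_le: "norm (E \<mu> (a \<mu> \<nu> - sh (osum \<mu>) u * a \<mu> \<nu>) \<nu>) \<le> e / (3 * N)"
    if "\<mu> \<in> words \<Lambda> l" "\<nu> \<in> words \<Lambda> l" for \<mu> \<nu>
  proof -
    have "sh (osum \<mu>) (sh (- osum \<mu>) (a \<mu> \<nu>) - u * sh (- osum \<mu>) (a \<mu> \<nu>)) = a \<mu> \<nu> - sh (osum \<mu>) u * a \<mu> \<nu>"
      using u a by (simp add: sh_diff sh_mult sh_in A_mult sh_sh sh_zero)
    then have "norm (a \<mu> \<nu> - sh (osum \<mu>) u * a \<mu> \<nu>) = norm (sh (- osum \<mu>) (a \<mu> \<nu>) - u * sh (- osum \<mu>) (a \<mu> \<nu>))"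
      using norm_sh[of "sh (- osum \<mu>) (a \<mu> \<nu>) - u * sh (- osum \<mu>) (a \<mu> \<nu>)" "osum \<mu>"] u a
      by (simp add: A_diff A_mult sh_in)
    then show ?thesis using us[OF that] by simp
  qed
  have "d - u * d = (\<Sum>\<mu>\<in>words \<Lambda> l. \<Sum>\<nu>\<in>words \<Lambda> l. E \<mu> (a \<mu> \<nu> - sh (osum \<mu>) u * a \<mu> \<nu>) \<nu>)"
  proof -
    have "u * E \<mu> (a \<mu> \<nu>) \<nu> = E \<mu> (sh (osum \<mu>) u * a \<mu> \<nu>) \<nu>" for \<mu> \<nu>
      using u(1) unfolding E_def by (simp add: Lw_comm mult_star_Lw star_mult)
    then show ?thesis unfolding a expand_def sum_distrib_left E_diff by (simp add: sum_subtractf)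
  qed
  then have "norm (d - u * d) \<le> (\<Sum>\<mu>\<in>words \<Lambda> l. \<Sum>\<nu>\<in>words \<Lambda> l. e / (3 * N))"
    by (simp only:) (intro sum_norm_le term_le)
  also have "\<dots> = (N - 1) * (e / (3 * N))" by (simp add: N_def)
  also have "\<dots> < e / 3" using N e by (simp add: field_simps)
  finally have 1: "norm (d - u * d) < e / 3" .
  have "norm (u * (x - d)) \<le> norm u * norm (x - d)" by (rule norm_mult_ineq)
  also have "\<dots> \<le> 1 * norm (x - d)" using u(3) by (intro mult_right_mono) auto
  finally have 2: "norm (u * (x - d)) < e / 3" using d by simp
  have "x - u * x = ((x - d) + (d - u * d)) - u * (x - d)" by (simp add: algebra_simps)
  also have "norm \<dots> \<le> (norm (x - d) + norm (d - u * d)) + norm (u * (x - d))"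
    by (intro order_trans[OF norm_triangle_ineq4] add_right_mono norm_triangle_ineq)
  also have "\<dots> < e" using d 1 2 by simp
  finally show ?thesis using u by blast
qed

lemma sh_0: "sh \<xi> 0 = 0"
  using sh_diff[OF A_zero A_zero, of \<xi>] by simp

text \<open>Compression by a generator \<open>S\<^sub>i\<close> that does not occur in (an approximation of) \<open>b\<close> maps \<open>b\<close> to its
  vacuum expectation, up to translation by \<open>\<omega> i\<close>.\<close>

lemma vacuum_expectation:
  "\<exists>h\<in>A. (\<forall>\<gamma>. ch \<gamma> h = ch \<gamma> b) \<and> (\<forall>e>0. \<exists>\<Lambda>. finite \<Lambda> \<and> (\<forall>i. i \<notin> \<Lambda> \<longrightarrow> (\<forall>y z.
     norm (star (L i y) * b * L i z - star y * sh (\<omega> i) h * z) \<le> e * norm y * norm z)))"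
  (is "?P b")
proof -
  define Q where "Q \<Lambda> b h e \<longleftrightarrow> (\<forall>i. i \<notin> \<Lambda> \<longrightarrow> (\<forall>y z.
     norm (star (L i y) * b * L i z - star y * sh (\<omega> i) h * z) \<le> e * norm y * norm z))" for \<Lambda> b h e
  define Pr where "Pr b h e \<longleftrightarrow> (\<exists>\<Lambda>. finite \<Lambda> \<and> Q \<Lambda> b h e)" for b h e
  define X where "X = {b. \<exists>h\<in>A. (\<forall>\<gamma>. ch \<gamma> h = ch \<gamma> b) \<and> (\<forall>e>0. Pr b h e)}"
  have Pr_add: "Pr (b + c) (h + k) (d + e)" if "Pr b h d" "Pr c k e" "h \<in> A" "k \<in> A" for b c h k d e
  proof -
    obtain \<Lambda> \<Lambda>' where fin: "finite \<Lambda>" "finite \<Lambda>'" and QQ: "Q \<Lambda> b h d" "Q \<Lambda>' c k e"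
      using \<open>Pr b h d\<close> \<open>Pr c k e\<close> unfolding Pr_def by blast
    have "norm (star (L i y) * (b + c) * L i z - star y * sh (\<omega> i) (h + k) * z) \<le> (d + e) * norm y * norm z"
      if "i \<notin> \<Lambda> \<union> \<Lambda>'" for i y z
    proof -
      have "star (L i y) * (b + c) * L i z - star y * sh (\<omega> i) (h + k) * z
        = (star (L i y) * b * L i z - star y * sh (\<omega> i) h * z)
          + (star (L i y) * c * L i z - star y * sh (\<omega> i) k * z)"
        using \<open>h \<in> A\<close> \<open>k \<in> A\<close> by (simp add: sh_add algebra_simps)
      also have "norm \<dots> \<le> d * norm y * norm z + e * norm y * norm z"
        using QQ that by (intro norm_triangle_mono) (simp_all add: Q_def)
      finally show ?thesis by (simp add: algebra_simps)
    qed
    then have "Q (\<Lambda> \<union> \<Lambda>') (b + c) (h + k) (d + e)" by (simp add: Q_def)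
    then show ?thesis using fin unfolding Pr_def by (intro exI[of _ "\<Lambda> \<union> \<Lambda>'"]) simp
  qed
  \<comment> \<open>A crude estimate that excludes no letters; it absorbs the approximation error
    when \<open>X\<close> is shown to be closed.\<close>
  have Pr_small: "Pr b h (norm b + norm h)" if "h \<in> A" for b h
    unfolding Pr_def Q_def
  proof (intro exI[of _ "{}"] conjI allI impI)
    fix i y z
    have 1: "norm (star (L i y) * b * L i z) \<le> norm y * norm b * norm z"
      using norm_mult_ineq[of "star (L i y) * b" "L i z"] norm_mult_ineq[of "star (L i y)" b]
      by (simp add: mult_right_mono order_trans)
    have 2: "norm (star y * sh (\<omega> i) h * z) \<le> norm y * norm h * norm z"
      using norm_mult_ineq[of "star y * sh (\<omega> i) h" z] norm_mult_ineq[of "star y" "sh (\<omega> i) h"]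
        norm_sh[OF that] by (simp add: mult_right_mono order_trans)
    show "norm (star (L i y) * b * L i z - star y * sh (\<omega> i) h * z) \<le> (norm b + norm h) * norm y * norm z"
      using norm_triangle_ineq4[of "star (L i y) * b * L i z" "star y * sh (\<omega> i) h * z"] 1 2
      by (simp add: algebra_simps)
  qed simp
  have "X = UNIV"
  proof (rule dense)
    have "Pr 0 0 e" if "e > 0" for e
      unfolding Pr_def Q_def by (intro exI[of _ "{}"]) (use that in \<open>simp add: sh_0\<close>)
    then show "0 \<in> X" unfolding X_def using A_zero by (auto intro!: bexI[of _ 0])
    fix b c assume "b \<in> X" "c \<in> X"
    then obtain h k where hk: "h \<in> A" "k \<in> A" "\<And>\<gamma>. ch \<gamma> h = ch \<gamma> b" "\<And>\<gamma>. ch \<gamma> k = ch \<gamma> c"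
      "\<And>e. e > 0 \<Longrightarrow> Pr b h e" "\<And>e. e > 0 \<Longrightarrow> Pr c k e" by (auto simp: X_def)
    have "Pr (b + c) (h + k) e" if "e > 0" for e
      using Pr_add[OF hk(5)[of "e/2"] hk(6)[of "e/2"] hk(1,2)] that by simp
    then show "b + c \<in> X" unfolding X_def using hk by (auto intro!: bexI[of _ "h + k"] simp: A_add pf.add)
  next
    fix \<mu> a \<nu> assume a: "a \<in> A"
    show "E \<mu> a \<nu> \<in> X"
    proof (cases "\<mu> = [] \<and> \<nu> = []")
      case True
      then have "E \<mu> a \<nu> = a" by (simp add: E_def star_star)
      moreover have "star (L i y) * a * L i z = star y * sh (\<omega> i) a * z" for i y z
        using a by (simp add: mult.assoc L_comm L_inner)
      ultimately show ?thesis unfolding X_def Pr_def Q_def using a by (auto intro!: bexI[of _ a] exI[of _ "{}"])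
    next
      case False
      have z: "star (L i y) * E \<mu> a \<nu> * L i z = 0" if i: "i \<notin> set \<mu> \<union> set \<nu>" for i y z
      proof (cases \<mu>)
        case Nil
        then obtain k v where "\<nu> = k # v" using False by (cases \<nu>) auto
        then show ?thesis using Nil i by (simp add: E_def mult.assoc L_inner)
      next
        case (Cons k v)
        then show ?thesis using i by (simp add: E_def L_inner)
      qed
      have "Pr (E \<mu> a \<nu>) 0 e" if "e > 0" for e
        unfolding Pr_def Q_def by (intro exI[of _ "set \<mu> \<union> set \<nu>"]) (use z that sh_0 in auto)
      then show ?thesis unfolding X_def using ch_E[OF a] False A_zero by (auto intro!: bexI[of _ 0])
    qed
  next
    show "closed X" unfolding closed_sequential_limits
    proof (intro allI impI, elim conjE)
      fix b' c assume b': "\<forall>n. b' n \<in> X" "b' \<longlonglongrightarrow> c"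
      then have "\<forall>n. \<exists>h. h \<in> A \<and> (\<forall>\<gamma>. ch \<gamma> h = ch \<gamma> (b' n)) \<and> (\<forall>e>0. Pr (b' n) h e)"
        unfolding X_def by blast
      then obtain h where h: "\<And>n. h n \<in> A" "\<And>n \<gamma>. ch \<gamma> (h n) = ch \<gamma> (b' n)"
        "\<And>n e. e > 0 \<Longrightarrow> Pr (b' n) (h n) e" by metis
      have hle: "norm (h n - h m) \<le> norm (b' n - b' m)" for n m
      proof (rule norm_A_le)
        fix \<gamma>
        have "ch \<gamma> (h n - h m) = ch \<gamma> (b' n - b' m)" by (simp add: pf.diff h)
        then show "cmod (ch \<gamma> (h n - h m)) \<le> norm (b' n - b' m)" by (metis pf.bnd)
      qed (simp_all add: A_diff h)
      have "Cauchy h"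
      proof (rule metric_CauchyI)
        fix e :: real assume "e > 0"
        then obtain N where "\<forall>m\<ge>N. \<forall>n\<ge>N. dist (b' m) (b' n) < e"
          using metric_CauchyD[OF LIMSEQ_imp_Cauchy[OF b'(2)]] by blast
        then show "\<exists>N. \<forall>m\<ge>N. \<forall>n\<ge>N. dist (h m) (h n) < e"
          using hle unfolding dist_norm by (meson le_less_trans)
      qed
      then obtain k where k: "h \<longlonglongrightarrow> k" using Cauchy_convergent convergent_def by blast
      have kA: "k \<in> A" using closed_sequentially[OF A_closed] h(1) k by blast
      have chk: "ch \<gamma> k = ch \<gamma> c" for \<gamma>
        using LIMSEQ_unique[OF pf.tendsto[OF k, of \<gamma>]] pf.tendsto[OF b'(2), of \<gamma>] by (simp add: h)
      have "Pr c k e" if e: "e > 0" for e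
      proof -
        have "(\<lambda>n. norm (c - b' n) + norm (k - h n)) \<longlonglongrightarrow> norm (c - c) + norm (k - k)"
          by (intro tendsto_intros b' k)
        then have "(\<lambda>n. norm (c - b' n) + norm (k - h n)) \<longlonglongrightarrow> 0" by simp
        then have "\<forall>\<^sub>F n in sequentially. norm (c - b' n) + norm (k - h n) < e/2"
          by (rule order_tendstoD(2)) (use e in simp)
        then obtain n where n: "norm (c - b' n) + norm (k - h n) < e/2"
          by (auto simp: eventually_sequentially)
        have "Pr (b' n + (c - b' n)) (h n + (k - h n)) (e/2 + (norm (c - b' n) + norm (k - h n)))"
          using e by (intro Pr_add h Pr_small A_diff kA) auto
        then have *: "Pr c k (e/2 + (norm (c - b' n) + norm (k - h n)))" by simp
        have mono: "Pr c k e" if "Pr c k d" "d \<le> e" for d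
        proof -
          have "d * norm y * norm z \<le> e * norm y * norm z" for y z :: 'a
            using that(2) by (intro mult_right_mono) auto
          then have "Q \<Lambda> c k d \<Longrightarrow> Q \<Lambda> c k e" for \<Lambda> unfolding Q_def using order_trans by blast
          then show ?thesis using that(1) unfolding Pr_def by blast
        qed
        show ?thesis by (rule mono[OF *]) (use n in simp)
      qed
      then show "c \<in> X" unfolding X_def using kA chk by blast
    qed
  qed
  then have "b \<in> X" by simp
  then show ?thesis by (simp only: X_def Pr_def Q_def mem_Collect_eq)
qed

end

text \<open>The letter \<open>k\<close> is prescribed in advance: density of the sums is inherited
  by their translate by \<open>\<omega> k\<close>, and this freedom is what makes orthogonal
  families of words possible. Closeness is measured on translates of elements, so no topology on the
  points is needed.\<close>

locale dense_orbit_core = dense_core +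
  assumes dense_orbit: "a \<in> A \<Longrightarrow> e > 0 \<Longrightarrow> \<exists>w. norm (sh (\<omega> k + osum w) a - sh \<xi> a) < e"
begin

section \<open>Comparison of positive elements\<close>

definition positive :: "'a \<Rightarrow> bool" where
  "positive h \<longleftrightarrow> h \<in> A \<and> star h = h \<and> (\<forall>\<gamma>. 0 \<le> Re (ch \<gamma> h))"

lemma positive_nonzero_orbit:
  assumes h: "h \<in> A" "h \<noteq> 0" shows "\<exists>w. ch (\<gamma> + osum w) h \<noteq> 0"
proof -
  obtain \<delta> where \<delta>: "ch \<delta> h \<noteq> 0" using A_eqI[OF h(1) A_zero] h(2) by auto
  obtain w where w: "norm (sh (\<omega> 0 + osum w) h - sh (\<delta> - \<gamma>) h) < cmod (ch \<delta> h)"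
    using dense_orbit[OF h(1), of "cmod (ch \<delta> h)" 0 "\<delta> - \<gamma>"] \<delta> by auto
  have "ch \<gamma> (sh (\<omega> 0 + osum w) h - sh (\<delta> - \<gamma>) h) = ch (\<gamma> + osum (0 # w)) h - ch \<delta> h"
    using h by (simp add: pf.diff ch_sh)
  then have "cmod (ch (\<gamma> + osum (0 # w)) h - ch \<delta> h) < cmod (ch \<delta> h)"
    using w pf.bnd[of \<gamma> "sh (\<omega> 0 + osum w) h - sh (\<delta> - \<gamma>) h"] by simp
  then have "ch (\<gamma> + osum (0 # w)) h \<noteq> 0" by auto
  then show ?thesis by blast
qed

text \<open>A compactness argument carried out with seminorms: the infimum \<open>q\<close> of the
  norms of \<open>a\<close> times all finite products of factors 1 - t_w is a C*-seminorm. If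
  \<open>q u > 0\<close>, then \<open>ch_complete\<close> supplies a point \<gamma> whose evaluation
  is bounded by \<open>q\<close>. Repeating one word w shows that \<open>q\<close> is at most
  \<open>norm c / n\<close> at \<open>t w * c\<close>, so every t_w vanishes at \<gamma>,
  contradicting density of the orbit.\<close>

lemma exhaustion:
  assumes h: "positive h" "h \<noteq> 0" and u: "u \<in> A" and e: "e > 0"
  shows "\<exists>ws. \<forall>\<gamma>. cmod (ch \<gamma> u) * prod_list (map (\<lambda>w. 1 - Re (ch (\<gamma> + osum w) h) / norm h) ws) \<le> e"
proof -
  note hA = h(1)[unfolded positive_def, THEN conjunct1]
  have M: "norm h > 0" using h by simp
  define t where "t w = complex_of_real (1 / norm h) *\<^sub>C sh (osum w) h" for w
  define \<tau> where "\<tau> w \<gamma> = Re (ch (\<gamma> + osum w) h) / norm h" for w \<gamma>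
  have tA: "t w \<in> A" for w using hA by (simp add: t_def A_scale sh_in)
  have cht: "ch \<gamma> (t w) = complex_of_real (\<tau> w \<gamma>)" for \<gamma> w
    using ch_selfadj[of h "\<gamma> + osum w"] h hA
    by (simp add: t_def pf.scale ch_sh \<tau>_def positive_def)
  have \<tau>: "0 \<le> \<tau> w \<gamma>" "\<tau> w \<gamma> \<le> 1" for w \<gamma>
  proof -
    show "0 \<le> \<tau> w \<gamma>" using h by (simp add: \<tau>_def positive_def)
    have "Re (ch (\<gamma> + osum w) h) \<le> norm h"
      using complex_Re_le_cmod pf.bnd order_trans by blast
    then show "\<tau> w \<gamma> \<le> 1" using M by (simp add: \<tau>_def)
  qed
  \<comment> \<open>\<open>km ws a\<close> is the product of all 1 - t_w applied to
    \<open>a\<close>, written without a unit; \<open>kp'\<close> is the scalar by which it acts at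
    \<gamma>.\<close>
  define km where "km ws a = foldr (\<lambda>w b. b - t w * b) ws a" for ws a
  define kp' where "kp' ws \<gamma> = prod_list (map (\<lambda>w. 1 - \<tau> w \<gamma>) ws)" for ws \<gamma>
  have kmA: "a \<in> A \<Longrightarrow> km ws a \<in> A" for ws a
    by (induction ws) (auto simp: km_def intro: A_diff A_mult tA)
  have chkm: "a \<in> A \<Longrightarrow> ch \<gamma> (km ws a) = complex_of_real (kp' ws \<gamma>) * ch \<gamma> a" for ws a \<gamma>
  proof (induction ws)
    case (Cons w ws)
    have "ch \<gamma> (km (w # ws) a) = ch \<gamma> (km ws a) - ch \<gamma> (t w) * ch \<gamma> (km ws a)"
      using kmA[OF Cons.prems, of ws] tA by (simp add: km_def pf.diff ch_mult)
    then show ?case using Cons by (simp add: cht kp'_def algebra_simps)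
  qed (simp add: km_def kp'_def)
  have kp': "0 \<le> kp' ws \<gamma>" "kp' ws \<gamma> \<le> 1" for ws \<gamma>
    using prod_list_one_minus_ge[of ws "\<lambda>w. \<tau> w \<gamma>"] \<tau> by (auto simp: kp'_def)
  have kpapp: "kp' (ws @ vs) \<gamma> = kp' ws \<gamma> * kp' vs \<gamma>" for ws vs \<gamma> by (simp add: kp'_def)
  have kmle: "norm (km ws a) \<le> norm a" if "a \<in> A" for ws a
  proof (rule norm_A_le[OF kmA[OF that]])
    fix \<gamma>
    have "cmod (ch \<gamma> (km ws a)) = kp' ws \<gamma> * cmod (ch \<gamma> a)"
      using kp'(1)[of ws \<gamma>] by (simp add: chkm[OF that] norm_mult)
    also have "\<dots> \<le> 1 * norm a" using kp' by (intro mult_mono pf.bnd) auto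
    finally show "cmod (ch \<gamma> (km ws a)) \<le> norm a" by simp
  qed simp
  define F where "F = range (\<lambda>ws a. norm (km ws a))"
  define q where "q a = (INF f\<in>F. f a)" for a
  have q: "cseminorm_on A q" unfolding q_def
  proof (rule cseminorm_on_INF)
    fix f assume "f \<in> F"
    then obtain ws where f: "f = (\<lambda>a. norm (km ws a))" by (auto simp: F_def)
    show "0 \<le> f x" for x by (simp add: f)
    have "km ws (c *\<^sub>C x) = c *\<^sub>C km ws x" if "x \<in> A" for x c
      by (rule A_eqI) (simp_all add: that kmA A_scale chkm pf.scale)
    then show "f (c *\<^sub>C x) = cmod c * f x" if "x \<in> A" for x c
      using that by (simp add: f norm_scaleC)
    have sq: "(norm (km ws x))\<^sup>2 = norm (km (ws @ ws) (star x * x))" if x: "x \<in> A" for x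
    proof -
      have "star (km ws x) * km ws x = km (ws @ ws) (star x * x)"
        by (rule A_eqI) (simp_all add: x A_mult A_star kmA ch_mult ch_star chkm kpapp)
      then show ?thesis by (simp add: cstar_identity[symmetric])
    qed
    show "\<exists>h\<in>F. \<forall>x\<in>A. h (star x * x) \<le> (f x)\<^sup>2"
      using sq by (auto simp: f F_def)
    show "\<exists>h\<in>F. \<forall>x\<in>A. (h x)\<^sup>2 \<le> f (star x * x)"
    proof (intro bexI[of _ "\<lambda>a. norm (km ws a)"] ballI)
      fix x assume x: "x \<in> A"
      have "km (ws @ ws) (star x * x) = km ws (km ws (star x * x))" by (simp add: km_def)
      then show "(norm (km ws x))\<^sup>2 \<le> f (star x * x)"
        using sq[OF x] kmle[OF kmA[OF A_mult[OF A_star[OF x] x]], of ws ws] by (simp add: f)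
    qed (simp add: F_def)
    fix g assume "g \<in> F"
    then obtain vs where g: "g = (\<lambda>a. norm (km vs a))" by (auto simp: F_def)
    show "\<exists>h\<in>F. \<forall>x\<in>A. \<forall>y\<in>A. h (x + y) \<le> f x + g y \<and> h (x * y) \<le> f x * g y"
    proof (intro bexI[of _ "\<lambda>a. norm (km (ws @ vs) a)"] ballI conjI)
      fix x y assume xy: "x \<in> A" "y \<in> A"
      have "km (ws @ vs) (x + y) = km vs (km ws x) + km ws (km vs y)"
        by (rule A_eqI) (simp_all add: xy A_add kmA chkm pf.add kpapp algebra_simps)
      then have "norm (km (ws @ vs) (x + y)) \<le> norm (km vs (km ws x)) + norm (km ws (km vs y))"
        by (simp add: norm_triangle_ineq)
      then show "norm (km (ws @ vs) (x + y)) \<le> f x + g y"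
        using kmle[OF kmA[OF xy(1)], of vs ws] kmle[OF kmA[OF xy(2)], of ws vs] by (simp add: f g)
      have "km (ws @ vs) (x * y) = km ws x * km vs y"
        by (rule A_eqI) (simp_all add: xy A_mult kmA chkm ch_mult kpapp)
      then show "norm (km (ws @ vs) (x * y)) \<le> f x * g y" by (simp add: f g norm_mult_ineq)
    qed (simp add: F_def)
  qed (simp add: F_def)
  have qle: "q a \<le> norm (km ws a)" for ws a
    unfolding q_def by (rule cINF_lower2[where x = "\<lambda>a. norm (km ws a)"])
      (auto simp: F_def intro: bdd_belowI[of _ 0])
  have "q u = 0"
  proof (rule ccontr)
    assume "q u \<noteq> 0"
    then have "q u > 0" using q_nonneg[OF q u] by simp
    then obtain \<gamma> where \<gamma>: "\<And>x. x \<in> A \<Longrightarrow> cmod (ch \<gamma> x) \<le> q x"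
      using ch_complete[OF q _ u] order_trans[OF qle[of _ "[]"]] by (force simp: km_def)
    obtain c where c: "c \<in> A" "ch \<gamma> c = 1" using ch_unit by blast
    have "\<tau> w \<gamma> = 0" for w
    proof -
      have le: "\<tau> w \<gamma> \<le> norm c * (1 / real (Suc n))" for n
      proof -
        have "\<tau> w \<gamma> = cmod (ch \<gamma> (t w * c))" using \<tau>(1)[of w \<gamma>] c tA by (simp add: ch_mult cht)
        also have "\<dots> \<le> q (t w * c)" by (rule \<gamma>) (intro A_mult tA c)
        also have "\<dots> \<le> norm (km (replicate (Suc n) w) (t w * c))" by (rule qle)
        also have "\<dots> \<le> norm c * (1 / real (Suc n))"
        proof (rule norm_A_le)
          fix \<delta>
          have "kp' (replicate (Suc n) w) \<delta> = (1 - \<tau> w \<delta>) ^ Suc n"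
            unfolding kp'_def map_replicate prod_list_replicate ..
          then have "cmod (ch \<delta> (km (replicate (Suc n) w) (t w * c)))
            = (\<tau> w \<delta> * (1 - \<tau> w \<delta>) ^ Suc n) * cmod (ch \<delta> c)"
            unfolding chkm[OF A_mult[OF tA c(1)]] ch_mult[OF tA c(1)] norm_mult cht norm_of_real
            using \<tau>[of w \<delta>] by simp
          also have "\<dots> \<le> (1 / real (Suc n)) * norm c"
            using \<tau>[of w \<delta>] mult_one_minus_power_le[of "\<tau> w \<delta>" "Suc n"]
            by (intro mult_mono pf.bnd) auto
          finally show "cmod (ch \<delta> (km (replicate (Suc n) w) (t w * c))) \<le> norm c * (1 / real (Suc n))"
            by (simp add: mult.commute)
        qed (auto intro!: kmA A_mult tA c)
        finally show ?thesis .
      qed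
      have "(\<lambda>n. norm c * (1 / real (Suc n))) \<longlonglongrightarrow> norm c * 0"
        using LIMSEQ_inverse_real_of_nat by (intro tendsto_intros) (simp add: inverse_eq_divide)
      then have "\<tau> w \<gamma> \<le> norm c * 0" using le by (intro LIMSEQ_le_const) auto
      then show ?thesis using \<tau>(1)[of w \<gamma>] by simp
    qed
    then have "ch (\<gamma> + osum w) h = 0" for w
      using ch_selfadj[of h "\<gamma> + osum w"] h M by (simp add: \<tau>_def positive_def)
    then show False using positive_nonzero_orbit[OF hA h(2), of \<gamma>] by simp
  qed
  then have "(INF f\<in>F. f u) < e" using e by (simp add: q_def)
  then obtain f where "f \<in> F" "f u < e"
    using cInf_lessD[of "(\<lambda>f. f u) ` F" e] by (auto simp: F_def)
  then obtain ws where ws: "norm (km ws u) < e" by (auto simp: F_def)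
  have "cmod (ch \<gamma> u) * kp' ws \<gamma> \<le> e" for \<gamma>
    using pf.bnd[of \<gamma> "km ws u"] ws kp'(1)[of ws \<gamma>] by (simp add: chkm[OF u] norm_mult mult.commute)
  then show ?thesis unfolding kp'_def \<tau>_def by blast
qed

text \<open>Let S be the sum of the normalised translates and \<open>c\<close> the quotient of
  \<open>u\<close> by the square root of M (S + d). The error at a point is |u|^2 d / (S + d). Where
  S \<ge> 1/2 it is at most \<open>e\<close> by the choice of \<open>d\<close>. Where S < 1/2 the
  product of the factors 1 - \<tau> is at least 1/2, and \<open>exhaustion\<close> with bound sqrt e
  / 2 forces |u|^2 \<le> e.\<close>

lemma comparison_function:
  assumes h: "positive h" "h \<noteq> 0" and u: "u \<in> A" and e: "e > 0"
  shows "\<exists>ws. \<exists>c\<in>A. norm ((\<Sum>i<length ws. star c * sh (osum (ws ! i)) h * c) - star u * u) \<le> e"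
proof -
  note hA = h(1)[unfolded positive_def, THEN conjunct1]
  define M where "M = norm h"
  have M: "M > 0" using h by (simp add: M_def)
  have "sqrt e / 2 > 0" using e by simp
  then obtain ws where ws: "\<And>\<gamma>. cmod (ch \<gamma> u) * prod_list (map (\<lambda>w. 1 - Re (ch (\<gamma> + osum w) h) / M) ws) \<le> sqrt e / 2"
    using exhaustion[OF h u] unfolding M_def by blast
  define s where "s = (\<Sum>i<length ws. complex_of_real (1 / M) *\<^sub>C sh (osum (ws ! i)) h)"
  have s: "s \<in> A" "star s = s"
    using hA h by (auto simp: s_def star_sum star_scaleC sh_star[symmetric] positive_def intro!: A_sum A_scale sh_in)
  define \<tau> where "\<tau> \<gamma> w = Re (ch (\<gamma> + osum w) h) / M" for \<gamma> w
  have \<tau>: "0 \<le> \<tau> \<gamma> w" "\<tau> \<gamma> w \<le> 1" for w \<gamma>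
  proof -
    show "0 \<le> \<tau> \<gamma> w" using h M by (simp add: \<tau>_def positive_def)
    have "Re (ch (\<gamma> + osum w) h) \<le> norm h"
      using complex_Re_le_cmod pf.bnd order_trans by blast
    then show "\<tau> \<gamma> w \<le> 1" using M by (simp add: \<tau>_def M_def)
  qed
  have chh: "ch (\<gamma> + osum w) h = complex_of_real (M * \<tau> \<gamma> w)" for \<gamma> w
    using ch_selfadj[of h "\<gamma> + osum w"] h M by (simp add: \<tau>_def positive_def)
  define S where "S \<gamma> = (\<Sum>i<length ws. \<tau> \<gamma> (ws ! i))" for \<gamma>
  have chs: "ch \<gamma> s = complex_of_real (S \<gamma>)" for \<gamma>
    using M hA by (simp add: s_def S_def pf.sum pf.scale ch_sh chh)
  have S0: "0 \<le> S \<gamma>" for \<gamma> unfolding S_def by (intro sum_nonneg \<tau>)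
  have Slist: "sum_list (map (\<tau> \<gamma>) ws) = S \<gamma>" for \<gamma>
    by (simp add: S_def sum_list_sum_nth atLeast0LessThan)
  define d where "d = e / (2 * ((norm u)\<^sup>2 + 1))"
  have U: "0 < (norm u)\<^sup>2 + 1" by (simp add: add_nonneg_pos)
  have d: "d > 0" using e U by (simp add: d_def)
  \<comment> \<open>\<open>r\<close> does not vanish at 0, so the functional calculus is applied to
    \<open>r - r 0\<close>; the constant is restored in \<open>c\<close> by a multiple of
    \<open>u\<close>.\<close>
  define r where "r x = 1 / sqrt (M * (\<bar>x\<bar> + d))" for x :: real
  have "continuous_on UNIV r" unfolding r_def using M d
    by (intro continuous_intros) (metis abs_ge_zero add_nonneg_pos less_irrefl mult_pos_pos real_sqrt_gt_zero)
  then obtain v where v: "v \<in> A" "\<And>\<gamma>. ch \<gamma> v = complex_of_real (r (S \<gamma>) - r 0)"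
    using functional_calculus[OF s continuous_on_diff[OF _ continuous_on_const], of r "r 0"] by (auto simp: chs)
  define c where "c = complex_of_real (r 0) *\<^sub>C u + v * u"
  have c: "c \<in> A" using u v by (simp add: c_def A_add A_scale A_mult)
  have chc: "ch \<gamma> c = complex_of_real (r (S \<gamma>)) * ch \<gamma> u" for \<gamma>
  proof -
    have "ch \<gamma> c = complex_of_real (r 0) * ch \<gamma> u + complex_of_real (r (S \<gamma>) - r 0) * ch \<gamma> u"
      unfolding c_def pf.add pf.scale ch_mult[OF v(1) u] v(2) ..
    then show ?thesis by (simp add: algebra_simps)
  qed
  have "norm ((\<Sum>i<length ws. star c * sh (osum (ws ! i)) h * c) - star u * u) \<le> e"
  proof (rule norm_A_le)
    fix \<gamma>
    define n where "n = (cmod (ch \<gamma> u))\<^sup>2"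
    have rS: "(r (S \<gamma>))\<^sup>2 = 1 / (M * (S \<gamma> + d))"
      using S0[of \<gamma>] M d by (simp add: r_def power_divide)
    have "ch \<gamma> (\<Sum>i<length ws. star c * sh (osum (ws ! i)) h * c)
      = (\<Sum>i<length ws. cnj (ch \<gamma> c) * ch \<gamma> c * complex_of_real (M * \<tau> \<gamma> (ws ! i)))"
      using c hA by (simp add: pf.sum ch_mult A_mult A_star sh_in ch_star ch_sh chh mult_ac)
    also have "\<dots> = cnj (ch \<gamma> c) * ch \<gamma> c * complex_of_real (M * S \<gamma>)"
      by (simp add: S_def sum_distrib_left)
    also have "cnj (ch \<gamma> c) * ch \<gamma> c = complex_of_real ((r (S \<gamma>))\<^sup>2 * n)"
      unfolding chc n_def complex_norm_square of_real_mult by (simp add: power2_eq_square mult_ac)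
    also have "complex_of_real ((r (S \<gamma>))\<^sup>2 * n) * complex_of_real (M * S \<gamma>) = complex_of_real (n * S \<gamma> / (S \<gamma> + d))"
      using M by (simp only: of_real_mult[symmetric] rS) simp
    finally have 1: "ch \<gamma> (\<Sum>i<length ws. star c * sh (osum (ws ! i)) h * c) = complex_of_real (n * S \<gamma> / (S \<gamma> + d))" .
    have 2: "ch \<gamma> (star u * u) = complex_of_real n"
      using u by (simp only: ch_mult A_star ch_star n_def complex_norm_square mult.commute)
    have "ch \<gamma> ((\<Sum>i<length ws. star c * sh (osum (ws ! i)) h * c) - star u * u)
      = complex_of_real (n * S \<gamma> / (S \<gamma> + d) - n)" by (simp only: pf.diff 1 2 of_real_diff)
    also have "n * S \<gamma> / (S \<gamma> + d) - n = - (n * d / (S \<gamma> + d))"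
      using S0[of \<gamma>] d by (simp add: field_simps)
    finally have eq: "cmod (ch \<gamma> ((\<Sum>i<length ws. star c * sh (osum (ws ! i)) h * c) - star u * u))
      = \<bar>n * d / (S \<gamma> + d)\<bar>" by (simp only: norm_of_real abs_minus_cancel)
    have n0: "0 \<le> n" by (simp add: n_def)
    have "n * d / (S \<gamma> + d) \<le> e"
    proof (cases "S \<gamma> \<ge> 1/2")
      case True
      have nU: "n \<le> (norm u)\<^sup>2" unfolding n_def using pf.bnd by (intro power_mono) auto
      have "n * d / (S \<gamma> + d) \<le> n * d / (1/2)"
        using True d n0 by (intro divide_left_mono) auto
      also have "\<dots> = n * (e / ((norm u)\<^sup>2 + 1))"
      proof -
        have "n * (e / (2 * k)) / (1/2) = n * (e / k)" for k :: real by simp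
        then show ?thesis unfolding d_def .
      qed
      also have "\<dots> \<le> ((norm u)\<^sup>2 + 1) * (e / ((norm u)\<^sup>2 + 1))"
        using nU e U by (intro mult_right_mono) auto
      also have "\<dots> = e" using U by simp
      finally show ?thesis .
    next
      case False
      define p where "p = prod_list (map (\<lambda>w. 1 - \<tau> \<gamma> w) ws)"
      have "1/2 \<le> p" using prod_list_one_minus_ge[of ws "\<tau> \<gamma>"] \<tau> Slist False by (simp add: p_def)
      moreover have "cmod (ch \<gamma> u) * p \<le> sqrt e / 2" using ws[of \<gamma>] by (simp add: p_def \<tau>_def)
      moreover have "cmod (ch \<gamma> u) * (1/2) \<le> cmod (ch \<gamma> u) * p"
        using \<open>1/2 \<le> p\<close> by (intro mult_left_mono) auto
      ultimately have "cmod (ch \<gamma> u) \<le> sqrt e" by simp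
      then have "n \<le> (sqrt e)\<^sup>2" unfolding n_def by (intro power_mono) auto
      then have "n \<le> e" using e by simp
      moreover have "n * d / (S \<gamma> + d) \<le> n"
        using n0 S0[of \<gamma>] d by (simp add: divide_le_eq mult_left_mono)
      ultimately show ?thesis by simp
    qed
    moreover have "0 \<le> n * d / (S \<gamma> + d)" using n0 d S0[of \<gamma>] by simp
    ultimately show "cmod (ch \<gamma> ((\<Sum>i<length ws. star c * sh (osum (ws ! i)) h * c) - star u * u)) \<le> e"
      unfolding eq by (simp only: abs_of_nonneg)
  qed (use c u hA e in \<open>auto intro!: A_diff A_sum A_mult A_star sh_in\<close>)
  then show ?thesis using c by blast
qed

text \<open>By density of the orbits the words can be given pairwise distinct first letters, which makes
  the isometries \<open>S\<^sub>\<nu>\<^sub>i\<close> orthogonal.\<close>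

lemma comparison_orthogonal:
  assumes h: "positive h" "h \<noteq> 0" and u: "u \<in> A" and e: "e > 0"
  shows "\<exists>n::nat. \<exists>c\<in>A. \<forall>\<xi>. \<exists>w. norm ((\<Sum>i<n. star c * sh (osum (i # w i)) (sh \<xi> h) * c) - star u * u) \<le> e"
proof -
  note hA = h(1)[unfolded positive_def, THEN conjunct1]
  obtain ws c where c: "c \<in> A"
    and ws: "norm ((\<Sum>i<length ws. star c * sh (osum (ws ! i)) h * c) - star u * u) \<le> e/2"
    using comparison_function[OF h u, of "e/2"] e by auto
  define n where "n = length ws"
  define d where "d = e / (2 * (real n * (norm c)\<^sup>2 + 1))"
  have K: "real n * (norm c)\<^sup>2 + 1 > 0" by (simp add: add_nonneg_pos)
  have d: "d > 0" using e K by (simp add: d_def)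
  \<comment> \<open>\<open>n\<close> and \<open>c\<close> are fixed before \<xi>: in
    \<open>comparison\<close> the translation \<xi> = \<open>\<omega> i\<close> is known only after
    a precision depending on \<open>n\<close> and \<open>c\<close> has been met.\<close>
  show ?thesis
  proof (intro exI[of _ n] bexI[OF _ c] allI)
    fix \<xi>
    have "\<exists>w. norm (sh (\<omega> i + osum w) (sh \<xi> h) - sh (osum (ws ! i)) h) < d" for i
      using dense_orbit[OF sh_in[OF hA] d, of i \<xi> "osum (ws ! i) - \<xi>"] hA by (simp add: sh_sh)
    then obtain w where w: "\<And>i. norm (sh (\<omega> i + osum (w i)) (sh \<xi> h) - sh (osum (ws ! i)) h) < d" by metis
    have "norm ((\<Sum>i<n. star c * sh (osum (i # w i)) (sh \<xi> h) * c) - (\<Sum>i<n. star c * sh (osum (ws ! i)) h * c))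
      \<le> (\<Sum>i<n. (norm c)\<^sup>2 * d)"
      unfolding sum_subtractf[symmetric]
    proof (rule sum_norm_le)
      fix i
      define y where "y = sh (osum (i # w i)) (sh \<xi> h) - sh (osum (ws ! i)) h"
      have "norm (star c * y * c) \<le> norm c * norm y * norm c"
        using norm_mult_ineq[of "star c * y" c] norm_mult_ineq[of "star c" y]
        by (simp add: mult_right_mono order_trans)
      also have "\<dots> \<le> norm c * d * norm c"
        using w[of i] by (intro mult_right_mono mult_left_mono) (auto simp: y_def)
      finally show "norm (star c * sh (osum (i # w i)) (sh \<xi> h) * c - star c * sh (osum (ws ! i)) h * c)
        \<le> (norm c)\<^sup>2 * d"
        by (simp add: y_def algebra_simps power2_eq_square)
    qed
    also have "\<dots> \<le> e/2"
    proof -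
      have "(\<Sum>i<n. (norm c)\<^sup>2 * d) = (real n * (norm c)\<^sup>2) * d" by simp
      also have "\<dots> \<le> (real n * (norm c)\<^sup>2 + 1) * d" using d by (intro mult_right_mono) auto
      also have "\<dots> = e/2"
      proof -
        have "k * (e / (2 * k)) = e / 2" if "k > 0" for k :: real using that by (simp add: field_simps)
        then show ?thesis unfolding d_def using K by blast
      qed
      finally show ?thesis .
    qed
    finally have 1: "norm ((\<Sum>i<n. star c * sh (osum (i # w i)) (sh \<xi> h) * c) - (\<Sum>i<n. star c * sh (osum (ws ! i)) h * c)) \<le> e/2" .
    have "norm ((\<Sum>i<n. star c * sh (osum (i # w i)) (sh \<xi> h) * c) - star u * u) \<le> e/2 + e/2"
      using norm_triangle_mono[OF 1 ws[folded n_def]] by simp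
    then show "\<exists>w. norm ((\<Sum>i<n. star c * sh (osum (i # w i)) (sh \<xi> h) * c) - star u * u) \<le> e" by auto
  qed
qed

lemma orthogonal_sum:
  assumes c: "c \<in> A" and a: "a \<in> A"
  shows "star (\<Sum>i<n. Lw (i # w i) c) * a * (\<Sum>i<n. Lw (i # w i) c) = (\<Sum>i<n. star c * sh (osum (i # w i)) a * c)"
proof -
  have "star (\<Sum>i<n. Lw (i # w i) c) * a * (\<Sum>i<n. Lw (i # w i) c)
    = (\<Sum>i<n. \<Sum>k<n. star (Lw (i # w i) c) * (a * Lw (k # w k) c))"
    unfolding star_sum sum_distrib_left sum_distrib_right mult.assoc by (rule sum.swap)
  also have "\<dots> = (\<Sum>i<n. \<Sum>k<n. if k = i then star c * sh (osum (i # w i)) a * c else 0)"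
  proof (rule sum.cong[OF refl], rule sum.cong[OF refl])
    fix i k
    have "star (Lw (i # w i) c) * (a * Lw (k # w k) c)
        = star (Lw (i # w i) c) * Lw (k # w k) (sh (osum (k # w k)) a * c)"
      by (subst Lw_comm[OF a]) simp
    also have "\<dots> = (if k = i then star c * sh (osum (i # w i)) a * c else 0)"
      using Lw_inner_same[of "i # w i"] by (auto simp: L_inner mult.assoc)
    finally show "star (Lw (i # w i) c) * (a * Lw (k # w k) c)
      = (if k = i then star c * sh (osum (i # w i)) a * c else 0)" .
  qed
  finally show ?thesis by simp
qed

lemma norm_orthogonal_sum:
  assumes c: "c \<in> A"
  shows "(norm (\<Sum>i<n. Lw (i # w i) c))\<^sup>2 \<le> real n * (norm c)\<^sup>2"
proof -
  define z where "z = (\<Sum>i<n. Lw (i # w i) c)"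
  have "star z * z = (\<Sum>i<n. \<Sum>k<n. if k = i then star c * c else 0)"
    unfolding z_def star_sum sum_distrib_left sum_distrib_right
  proof (subst sum.swap, rule sum.cong[OF refl], rule sum.cong[OF refl])
    fix i k
    show "star (Lw (i # w i) c) * Lw (k # w k) c = (if k = i then star c * c else 0)"
      using Lw_inner_same[of "i # w i"] by (auto simp: L_inner)
  qed
  then have "star z * z = (\<Sum>i<n. star c * c)" by simp
  then have "norm (star z * z) \<le> (\<Sum>i<n. (norm c)\<^sup>2)"
    by (metis (no_types, lifting) cstar_identity order_refl sum_norm_le)
  then show ?thesis by (simp add: cstar_identity z_def)
qed

text \<open>\<open>Z\<close> is g S_i z: by faithfulness \<open>g\<close> makes the vacuum
  expectation of \<open>star (x * g) * (x * g)\<close> nonzero, S_i reduces this element to a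
  function up to e/4, and \<open>z\<close> compares that function with \<open>star u * u\<close> up
  to another e/4. The square of \<open>norm z\<close> is at most \<open>K\<close>, which fixes the
  precision demanded of S_i.\<close>

theorem comparison:
  assumes x: "x \<noteq> 0" and u: "u \<in> A" and e: "e > 0"
  shows "\<exists>Z. norm (star (x * Z) * (x * Z) - star u * u) < e"
proof -
  obtain \<gamma> g where g: "pf.snorm \<gamma> (x * g) > 0" using fock_faithful[OF x] by blast
  define b where "b = star (x * g) * (x * g)"
  obtain h where h: "h \<in> A" "\<And>\<gamma>. ch \<gamma> h = ch \<gamma> b"
    and app: "\<And>e. e > 0 \<Longrightarrow> \<exists>\<Lambda>. finite \<Lambda> \<and> (\<forall>i. i \<notin> \<Lambda> \<longrightarrow> (\<forall>y z.
     norm (star (L i y) * b * L i z - star y * sh (\<omega> i) h * z) \<le> e * norm y * norm z))"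
    using vacuum_expectation[of b] by blast
  have "positive h" unfolding positive_def using h pf.pos[of _ "x * g"]
    by (auto intro!: selfadjI simp: b_def)
  moreover have "h \<noteq> 0"
  proof
    assume "h = 0"
    then have "ch \<gamma> b = 0" using h(2)[of \<gamma>] by simp
    then have "(pf.snorm \<gamma> (x * g))\<^sup>2 = 0" unfolding pf.snorm_sq by (simp add: b_def)
    then show False using g by simp
  qed
  ultimately obtain n c where c: "c \<in> A"
    and w: "\<And>\<xi>. \<exists>w. norm ((\<Sum>i<n. star c * sh (osum (i # w i)) (sh \<xi> h) * c) - star u * u) \<le> e/4"
    using comparison_orthogonal[of h u "e/4"] u e by auto
  define K where "K = real n * (norm c)\<^sup>2 + 1"
  have K: "K > 0" by (simp add: K_def add_nonneg_pos)
  then obtain \<Lambda> where \<Lambda>: "finite \<Lambda>" "\<And>i y z. i \<notin> \<Lambda> \<Longrightarrow>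
     norm (star (L i y) * b * L i z - star y * sh (\<omega> i) h * z) \<le> e / (4 * K) * norm y * norm z"
    using app[of "e / (4 * K)"] e by auto
  obtain i where i: "i \<notin> \<Lambda>" using \<Lambda>(1) ex_new_if_finite infinite_UNIV_nat by blast
  obtain w where w: "norm ((\<Sum>k<n. star c * sh (osum (k # w k)) (sh (\<omega> i) h) * c) - star u * u) \<le> e/4"
    using w by blast
  define z where "z = (\<Sum>k<n. Lw (k # w k) c)"
  define Z where "Z = g * L i z"
  have e1: "star (x * Z) * (x * Z) = star (L i z) * b * L i z"
    by (simp add: Z_def b_def star_mult mult.assoc)
  have n1: "norm (star (L i z) * b * L i z - star z * sh (\<omega> i) h * z) \<le> e / (4 * K) * norm z * norm z"
    by (rule \<Lambda>(2)[OF i])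
  have n2: "e / (4 * K) * norm z * norm z \<le> e/4"
  proof -
    have "norm z * norm z \<le> K"
      using norm_orthogonal_sum[OF c, of w n] by (simp add: z_def K_def power2_eq_square)
    then have "e / (4 * K) * (norm z * norm z) \<le> e / (4 * K) * K"
      using e K by (intro mult_left_mono) auto
    then show ?thesis using K by (simp add: mult.assoc)
  qed
  have e2: "star z * sh (\<omega> i) h * z = (\<Sum>k<n. star c * sh (osum (k # w k)) (sh (\<omega> i) h) * c)"
    unfolding z_def by (rule orthogonal_sum[OF c sh_in[OF h(1)]])
  have 1: "norm (star (x * Z) * (x * Z) - (\<Sum>k<n. star c * sh (osum (k # w k)) (sh (\<omega> i) h) * c)) \<le> e/4"
    unfolding e1 e2[symmetric] by (rule order_trans[OF n1 n2])
  have "norm (star (x * Z) * (x * Z) - star u * u) \<le> e/4 + e/4"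
    using norm_triangle_mono[OF 1 w] by simp
  then show ?thesis using e by (intro exI[of _ Z]) simp
qed

theorem simple: "simple_cstar TYPE('a)"
proof -
  obtain e0 where e0: "e0 \<in> A" "ch 0 e0 = 1" using ch_unit by blast
  have "e0 \<noteq> 0" using e0 by auto
  then have ne: "(UNIV :: 'a set) \<noteq> {0}" by auto
  have "I = {0} \<or> I = UNIV" if I: "closed_ideal I" for I :: "'a set"
  proof (cases "I = {0}")
    case False
    have cl: "closed I" and I0: "0 \<in> I" and Iadd: "\<And>x y. x \<in> I \<Longrightarrow> y \<in> I \<Longrightarrow> x + y \<in> I"
      and Il: "\<And>a x. x \<in> I \<Longrightarrow> a * x \<in> I" and Ir: "\<And>a x. x \<in> I \<Longrightarrow> x * a \<in> I"
      using I unfolding closed_ideal_def by auto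
    obtain x where x: "x \<in> I" "x \<noteq> 0" using False I0 by blast
    have clI: "y \<in> I" if "\<And>e. e > 0 \<Longrightarrow> \<exists>z\<in>I. norm (z - y) < e" for y
      using cl that by (metis closed_approachable dist_norm)
    have uu: "star u * u \<in> I" if u: "u \<in> A" for u
    proof (rule clI)
      fix e :: real assume "e > 0"
      then obtain Z where "norm (star (x * Z) * (x * Z) - star u * u) < e" using comparison[OF x(2) u] by blast
      then show "\<exists>z\<in>I. norm (z - star u * u) < e" using Il[OF Ir[OF x(1)]] by blast
    qed
    \<comment> \<open>\<open>comparison\<close> only places elements \<open>star u * u\<close> in
      the ideal, so \<open>a\<close> is approximated by \<open>u * u * a\<close> instead of
      \<open>u * a\<close>.\<close>
    have uua: "norm (a - u * u * a) < e"
      if u: "norm u \<le> 1" "norm (a - u * a) < e/2" for u a :: 'a and e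
    proof -
      have "a - u * u * a = (a - u * a) + u * (a - u * a)" by (simp add: algebra_simps)
      also have "norm \<dots> \<le> norm (a - u * a) + norm u * norm (a - u * a)"
        by (intro order_trans[OF norm_triangle_ineq] add_left_mono norm_mult_ineq)
      also have "\<dots> \<le> norm (a - u * a) + 1 * norm (a - u * a)"
        using u by (intro add_left_mono mult_right_mono) auto
      finally show ?thesis using u by simp
    qed
    have AI: "a \<in> I" if a: "a \<in> A" for a
    proof (rule clI)
      fix e :: real assume e: "e > 0"
      obtain u where u: "u \<in> A" "star u = u" "norm u \<le> 1" "norm (a - u * a) < e/2"
        using approximate_unit[of "{0::nat}" "\<lambda>_. a" "e/2"] a e by auto
      have "u * u * a \<in> I" using uu[OF u(1)] u(2) Ir by simp
      then show "\<exists>z\<in>I. norm (z - a) < e" using uua[OF u(3,4)] by (metis norm_minus_commute)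
    qed
    have "I = UNIV"
    proof (rule dense[OF cl I0 Iadd])
      fix \<mu> a \<nu> assume a: "a \<in> A"
      show "E \<mu> a \<nu> \<in> I"
      proof (rule clI)
        fix e :: real assume e: "e > 0"
        obtain u where u: "u \<in> A" "star u = u" "norm u \<le> 1" "norm (a - u * a) < e/2"
          using approximate_unit[of "{0::nat}" "\<lambda>_. a" "e/2"] a e by auto
        have "Lw \<mu> u * (a * star (Lw \<nu> u)) = E \<mu> (u * (a * u)) \<nu>"
          using u by (simp add: E_def Lw_mult mult_star_Lw[of a] mult_star_Lw[of u] star_mult mult.assoc)
        also have "u * (a * u) = u * u * a" using A_comm[OF a u(1)] by (simp add: mult.assoc)
        finally have "E \<mu> (u * u * a) \<nu> \<in> I" using Il[OF Ir[OF AI[OF a]]] by metis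
        moreover have "norm (E \<mu> (u * u * a) \<nu> - E \<mu> a \<nu>) < e"
          using uua[OF u(3,4)] norm_E[of \<mu> "u * u * a - a" \<nu>] by (simp add: E_diff norm_minus_commute)
        ultimately show "\<exists>z\<in>I. norm (z - E \<mu> a \<nu>) < e" by blast
      qed
    qed
    then show ?thesis by simp
  qed simp
  then show ?thesis using ne unfolding simple_cstar_def by blast
qed

end

section \<open>Projections\<close>

lemma projection_norm_le: assumes "projection (p :: 'a::cstar_algebra)" shows "norm p \<le> 1"
proof (cases "norm p = 0")
  case False
  have "norm p * norm p = norm p * 1"
    using assms cstar_identity[of p] by (simp add: projection_def power2_eq_square)
  then have "norm p = 1" using False mult_left_cancel by blast
  then show ?thesis by simp
qed simp

text \<open>An element \<open>c\<close> close to a projection \<open>p\<close> in the corner of \<open>p\<close> is invertible there, and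
  \<open>w = c\<^sup>-\<^sup>\<onehalf>\<close> is obtained from two fixed points.\<close>

lemma projection_perturb:
  fixes p c :: "'a::cstar_algebra"
  assumes p: "projection p" and c: "star c = c" "p * c = c" "c * p = c" "norm (p - c) < 1"
  shows "\<exists>w. p * w = w \<and> star w * c * w = p"
proof -
  have pp: "p * p = p" "star p = p" using p by (simp_all add: projection_def)
  define h where "h = p - c"
  have h: "norm h < 1" "star h = h" "p * h = h" "h * p = h"
    using c pp by (simp_all add: h_def star_diff algebra_simps)
  define C where "C = {k. p * k = k \<and> k * p = k}"
  have "closed C" unfolding C_def
    by (intro closed_Collect_conj closed_Collect_eq continuous_intros)
  moreover have "0 \<in> C" by (simp add: C_def)
  moreover have "(1/2) *\<^sub>R (h + k * k) \<in> C" if "k \<in> C" for k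
  proof -
    have "p * (k * k) = k * k" "k * k * p = k * k" using that by (simp_all add: C_def mult.assoc[symmetric]) (simp add: C_def mult.assoc)
    then show ?thesis using h by (simp add: C_def distrib_left distrib_right)
  qed
  ultimately obtain k where k: "k \<in> C" "star k = k" "2 *\<^sub>R k - k * k = h" "norm k < 1"
    using sqrt_fixpoint[OF h(1,2), of C] by blast
  \<comment> \<open>\<open>p - k\<close> is the square root of \<open>c\<close> in the corner of
    \<open>p\<close>, and its inverse there is the Neumann series p + k + k^2 + ..., found as the
    fixed point of \<open>p + k * w\<close>.\<close>
  define X where "X = {w. p * w = w}"
  have X: "complete X" unfolding X_def complete_eq_closed by (intro closed_Collect_eq continuous_intros)
  have "\<exists>!w\<in>X. p + k * w = w"
  proof (rule Banach_fix[OF X _ norm_ge_zero k(4)])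
    show "X \<noteq> {}" by (auto simp: X_def intro!: exI[of _ 0])
    show "(\<lambda>w. p + k * w) ` X \<subseteq> X" using k(1) pp by (auto simp: X_def C_def distrib_left mult.assoc[symmetric])
    fix x y
    have "(p + k * x) - (p + k * y) = k * (x - y)" by (simp add: algebra_simps)
    then show "dist (p + k * x) (p + k * y) \<le> norm k * dist x y"
      using norm_mult_ineq[of k "x - y"] by (simp add: dist_norm)
  qed
  then obtain w where w: "p * w = w" "p + k * w = w" by (auto simp: X_def)
  define e where "e = p - k"
  have ee: "e * e = c" "star e = e"
  proof -
    have "e * e = p - (2 *\<^sub>R k - k * k)" using k(1) pp by (simp add: e_def C_def algebra_simps scaleR_2)
    then show "e * e = c" using k by (simp add: h_def)
    show "star e = e" using k pp by (simp add: e_def star_diff)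
  qed
  have ew: "e * w = p" using w by (simp add: e_def algebra_simps)
  have "star w * c * w = star (e * w) * (e * w)"
    by (simp add: ee(1)[symmetric] star_mult ee(2) mult.assoc)
  then have "star w * c * w = p" using ew pp by simp
  then show ?thesis using w by blast
qed

lemma partial_isometry:
  fixes v p :: "'a::cstar_algebra"
  assumes p: "projection p" and v: "star v * v = p"
  shows "v * p = v" "projection (v * star v)"
proof -
  have pp: "p * p = p" "star p = p" using p by (simp_all add: projection_def)
  have "star (v - v * p) * (v - v * p) = star v * v - star v * v * p - p * (star v * v) + p * (star v * v) * p"
    by (simp add: star_diff star_mult pp algebra_simps)
  also have "\<dots> = 0" by (simp add: v pp)
  finally show vp: "v * p = v" by (simp add: star_mult_self_eq_0)
  have "v * star v * (v * star v) = v * (star v * v) * star v" by (simp add: mult.assoc)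
  then show "projection (v * star v)" by (simp add: projection_def star_mult star_star v vp)
qed

text \<open>Conjugation by \<open>v\<close> carries the corner of \<open>p\<close> onto that of
  \<open>v * star v\<close>, and with it the proper subprojection and the partial isometry.\<close>

lemma infinite_projection_transfer:
  fixes v p :: "'a::cstar_algebra"
  assumes p: "infinite_projection p" and v: "star v * v = p"
  shows "infinite_projection (v * star v)"
proof -
  obtain q w where q: "projection q" "p * q = q" "q \<noteq> p" "star w * w = p" "w * star w = q"
    and pp: "projection p" using p by (auto simp: infinite_projection_def)
  note vp = partial_isometry[OF pp v] and wp = partial_isometry[OF pp q(4)]
  have ps: "star p = p" "p * p = p" using pp by (simp_all add: projection_def)
  have qp: "q * p = q" using q(1,2) ps by (metis projection_def star_mult)
  have ppw: "p * w = w"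
  proof -
    have "w = w * (star w * w)" using q(4) wp by simp
    also have "\<dots> = q * w" by (simp add: q(5) mult.assoc[symmetric])
    finally show ?thesis using q(2) by (metis mult.assoc)
  qed
  define u where "u = v * w * star v"
  have 1: "star u * u = v * star v"
  proof -
    have "star u * u = v * (star w * ((star v * v) * w)) * star v" by (simp add: u_def star_mult star_star mult.assoc)
    also have "\<dots> = v * (star w * w) * star v" using ppw by (simp add: v)
    finally show ?thesis using q(4) vp(1) by simp
  qed
  have 2: "u * star u = v * q * star v"
  proof -
    have "u * star u = v * (w * (star v * v) * star w) * star v" by (simp add: u_def star_mult star_star mult.assoc)
    then show ?thesis using q(5) wp(1) by (simp add: v)
  qed
  have pr: "projection (v * q * star v)"
  proof -
    have "v * q * star v * (v * q * star v) = v * (q * (star v * v) * q) * star v" by (simp add: mult.assoc)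
    also have "\<dots> = v * q * star v" using q(1) by (simp add: v qp projection_def)
    finally show ?thesis using q(1) by (simp add: projection_def star_mult star_star mult.assoc)
  qed
  have 3: "v * star v * (v * q * star v) = v * q * star v"
  proof -
    have "v * star v * (v * q * star v) = v * (star v * v * q) * star v" by (simp add: mult.assoc)
    then show ?thesis by (simp add: v q(2))
  qed
  have 4: "v * q * star v \<noteq> v * star v"
  proof
    assume "v * q * star v = v * star v"
    then have "star v * (v * q * star v) * v = star v * (v * star v) * v" by simp
    then have "(star v * v) * q * (star v * v) = (star v * v) * (star v * v)" by (simp add: mult.assoc)
    then show False using q ps qp by (simp add: v)
  qed
  show ?thesis unfolding infinite_projection_def using vp(2) pr 1 2 3 4 by blast
qed

text \<open>The element lies below \<open>K\<close> times \<open>x * star x\<close>, which belongs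
  to \<open>H\<close>. The summand 1 in \<open>K\<close> makes the norm of Z star(Z) / K strictly
  less than 1, as \<open>one_minus_factor\<close> requires.\<close>

lemma hereditary_conjugate:
  fixes x Z :: "'a::cstar_algebra"
  assumes H: "hereditary_subalgebra H" and x: "x \<in> H"
  shows "x * Z * star (x * Z) \<in> H"
proof -
  define K where "K = (norm Z)\<^sup>2 + 1"
  have K: "K > 0" by (simp add: K_def add_nonneg_pos)
  define h where "h = complex_of_real (1 / K) *\<^sub>C (Z * star Z)"
  have "norm h = (norm Z)\<^sup>2 / K"
    unfolding h_def norm_scaleC cstar_identity' norm_of_real using K by simp
  then have "norm h < 1" using K by (simp add: K_def)
  moreover have "star h = h" by (simp add: h_def star_scaleC star_mult star_star)
  ultimately obtain k where k: "star k * k = star (star x) * star x - star (star x) * h * star x"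
    using one_minus_factor by blast
  have a: "x * star x \<in> H" using H x by (simp add: hereditary_subalgebra_def)
  define q where "q = x * h * star x"
  have "cstar_pos (x * star x - q)" unfolding cstar_pos_def
    using k by (intro exI[of _ k]) (simp add: q_def star_star)
  moreover have "cstar_pos q" unfolding cstar_pos_def
  proof (intro exI[of _ "complex_of_real (1 / sqrt K) *\<^sub>C star (x * Z)"])
    have "complex_of_real (1 / sqrt K) * complex_of_real (1 / sqrt K) = complex_of_real (1 / K)"
      using K by (simp only: of_real_mult[symmetric]) simp
    then show "q = star (complex_of_real (1 / sqrt K) *\<^sub>C star (x * Z)) * (complex_of_real (1 / sqrt K) *\<^sub>C star (x * Z))"
      by (simp add: q_def h_def star_scaleC star_star star_mult mult_scaleC_left mult_scaleC_right scaleC_scaleC mult.assoc)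
  qed
  ultimately have "q \<in> H" using H a unfolding hereditary_subalgebra_def by blast
  then have "complex_of_real K *\<^sub>C q \<in> H" using H by (simp add: hereditary_subalgebra_def)
  moreover have "complex_of_real K *\<^sub>C q = x * Z * star (x * Z)"
    using K by (simp add: q_def h_def star_mult mult_scaleC_left mult_scaleC_right scaleC_scaleC mult.assoc)
  ultimately show ?thesis by simp
qed

text \<open>If \<open>y\<close> satisfies \<open>(y\<^sup>* y) y = y\<close>, then \<open>v = y + (1 - y\<^sup>* y)\<^sup>\<onehalf>\<close> is an isometry in the unitization and
  \<open>1 - v v\<^sup>*\<close> is a projection in the algebra itself. Here \<open>1 - s = (1 - y\<^sup>* y)\<^sup>\<onehalf>\<close>, and the unit is
  avoided by letting \<open>v\<close> and \<open>v\<^sup>*\<close> act by \<open>V\<close> and \<open>W\<close>.\<close>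

lemma scaling_projection:
  fixes y s :: "'a::cstar_algebra"
  assumes y: "star y * y * y = y" and s: "star s = s" "2 *\<^sub>R s - s * s = star y * y"
    and b: "star y * b = 0" "s * b = b" "b \<noteq> 0"
  shows "\<exists>p. projection p \<and> (p::'a) \<noteq> 0"
proof -
  \<comment> \<open>\<open>r\<close> is (1 - s) y, and (1 - s)^2 = 1 - star(y) y annihilates
    \<open>y\<close> by hypothesis; hence \<open>r\<close> is 0 by the C*-identity.\<close>
  define r where "r = y - s * y"
  have sy: "s * y = y"
  proof -
    have "star r * r = star y * y - star y * (2 *\<^sub>R s - s * s) * y"
      by (simp add: r_def star_diff star_mult s(1) algebra_simps scaleR_2)
    also have "\<dots> = star y * (y - (star y * y * y))" by (simp add: s(2) algebra_simps)
    finally have "r = 0" using y by (simp add: star_mult_self_eq_0)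
    then show ?thesis by (simp add: r_def)
  qed
  have ys: "star y * s = star y" using sy s(1) by (metis star_mult)
  \<comment> \<open>The expansion of 1 - v star(v), in which the term (1 - s)^2 is replaced by 1 -
    star(y) y.\<close>
  define p where "p = star y * y - y * star y - (y - y * s) - (star y - s * star y)"
  define V where "V d = y * d + d - s * d" for d
  define W where "W d = star y * d + d - s * d" for d
  have WV: "W (V d) = d" for d
  proof -
    have "W (V d) = (star y * y) * d + star y * d - (star y * s) * d + y * d + d - s * d - (s * y) * d - s * d + (s * s) * d"
      by (simp add: W_def V_def algebra_simps)
    also have "\<dots> = (star y * y) * d - (2 *\<^sub>R s - s * s) * d + d"
      by (simp add: ys sy algebra_simps scaleR_2)
    finally show ?thesis by (simp add: s(2))
  qed
  have pd: "p * d = d - V (W d)" for d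
  proof -
    have "V (W d) = y * star y * d + (y - y * s) * d + (star y - s * star y) * d + d - (2 *\<^sub>R s - s * s) * d"
      by (simp add: W_def V_def algebra_simps scaleR_2)
    then show ?thesis by (simp add: s(2) p_def algebra_simps)
  qed
  have Vdiff: "V (d - e) = V d - V e" "W (d - e) = W d - W e" for d e
    by (simp_all add: V_def W_def algebra_simps)
  have "p * (p * d) = p * d" for d
    unfolding pd Vdiff WV by simp
  then have "(p * p - p) * star (p * p - p) = 0" by (simp add: mult.assoc left_diff_distrib)
  then have "norm (p * p - p) = 0" using cstar_identity'[of "p * p - p"] by simp
  then have "p * p = p" by simp
  moreover have "star p = p" by (simp add: p_def star_diff star_mult star_star s(1))
  ultimately have "projection p" by (simp add: projection_def)
  \<comment> \<open>The adjoint of the isometry annihilates \<open>b\<close>, so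
    \<open>p * b = b\<close>.\<close>
  moreover have "p \<noteq> 0"
  proof
    assume "p = 0"
    moreover have "W b = 0" using b by (simp add: W_def)
    ultimately show False using pd[of b] b(3) by (simp add: V_def)
  qed
  ultimately show ?thesis by blast
qed

section \<open>Existence of projections and pure infiniteness\<close>

definition clamp01 :: "real \<Rightarrow> real" where
  "clamp01 x = max 0 (min 1 x)"

lemma clamp01: "0 \<le> clamp01 x" "clamp01 x \<le> 1" "x \<le> 0 \<Longrightarrow> clamp01 x = 0" "1 \<le> x \<Longrightarrow> clamp01 x = 1"
  "clamp01 x > 0 \<Longrightarrow> x > 0"
  by (auto simp: clamp01_def)

lemma continuous_on_clamp01 [continuous_intros]:
  "continuous_on S f \<Longrightarrow> continuous_on S (\<lambda>x. clamp01 (f x))"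
  unfolding clamp01_def by (intro continuous_intros)

context dense_orbit_core
begin

text \<open>The functions \<open>g\<close>, \<open>h\<close>, \<open>f\<close> of a peaked
  \<open>a\<close> are supported where \<open>a\<close> exceeds 3/4, 1/2 and 1/4, and each later one
  equals 1 on the support of the one before. Comparing \<open>g * g\<close> with
  \<open>star f * f\<close> gives \<open>z\<close> such that the compression \<open>k\<close> of
  \<open>g * g\<close> is at least 3/4 where \<open>f\<close> is 1. After correction by a function
  of \<open>k\<close>, the element \<open>y = g z d\<close> starts with \<open>g\<close> while
  \<open>star y * y\<close> equals 1 on the support of \<open>h\<close>; this is the scaling
  relation \<open>star y * y * y = y\<close>.\<close>

lemma exists_projection: "\<exists>p. projection p \<and> (p::'a) \<noteq> 0"
proof -
  obtain e0 where e0: "e0 \<in> A" "ch 0 e0 = 1" using ch_unit by blast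
  define a where "a = complex_of_real (1 / (norm e0)\<^sup>2) *\<^sub>C (star e0 * e0)"
  have e00: "e0 \<noteq> 0" using e0 by auto
  then have a: "a \<in> A" "star a = a" "norm a = 1"
    using e0 by (simp_all add: a_def A_scale A_mult A_star star_scaleC star_mult star_star norm_scaleC cstar_identity norm_divide norm_power)
  obtain \<gamma>0 where \<gamma>0: "cmod (ch \<gamma>0 a) = 1"
    using ch_complete[OF norm_cseminorm_on _ a(1)] a(3) by auto
  have "0 \<le> Re (ch \<gamma> a)" for \<gamma>
    using pf.pos(1)[of \<gamma> e0] by (simp add: a_def pf.scale)
  then have \<gamma>1: "Re (ch \<gamma>0 a) = 1" using \<gamma>0 ch_selfadj[OF a(2), of \<gamma>0]
    by (metis abs_of_nonneg norm_of_real)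
  have fc: "\<exists>b\<in>A. star b = b \<and> (\<forall>\<gamma>. ch \<gamma> b = complex_of_real (clamp01 (4 * Re (ch \<gamma> a) - r)))" if "r \<ge> 0" for r
    by (rule functional_calculus[OF a(1,2), of "\<lambda>t. clamp01 (4 * t - r)"])
      (use that in \<open>auto intro!: continuous_intros clamp01(3)\<close>)
  obtain g where g: "g \<in> A" "star g = g" "\<And>\<gamma>. ch \<gamma> g = complex_of_real (clamp01 (4 * Re (ch \<gamma> a) - 3))"
    using fc[of 3] by auto
  obtain h where h: "h \<in> A" "star h = h" "\<And>\<gamma>. ch \<gamma> h = complex_of_real (clamp01 (4 * Re (ch \<gamma> a) - 2))"
    using fc[of 2] by auto
  obtain f where f: "f \<in> A" "star f = f" "\<And>\<gamma>. ch \<gamma> f = complex_of_real (clamp01 (4 * Re (ch \<gamma> a) - 1))"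
    using fc[of 1] by auto
  have hg: "h * g = g"
  proof (rule A_eqI)
    fix \<gamma> show "ch \<gamma> (h * g) = ch \<gamma> g"
    proof (cases "Re (ch \<gamma> a) > 3/4")
      case True
      then have "clamp01 (4 * Re (ch \<gamma> a) - 2) = 1" by (intro clamp01) simp
      then show ?thesis using g h by (simp add: ch_mult)
    next
      case False
      then have "clamp01 (4 * Re (ch \<gamma> a) - 3) = 0" by (intro clamp01) simp
      then show ?thesis using g h by (simp add: ch_mult)
    qed
  qed (use g h in \<open>auto intro: A_mult\<close>)
  have "positive (g * g)" unfolding positive_def using g by (simp add: A_mult star_mult ch_mult)
  moreover have "g * g \<noteq> 0"
  proof
    assume "g * g = 0"
    then have "ch \<gamma>0 g * ch \<gamma>0 g = 0" using g(1) ch_mult[of g g \<gamma>0] by simp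
    then show False by (simp add: g \<gamma>1 clamp01_def)
  qed
  ultimately obtain n c where c: "c \<in> A" and w: "\<And>\<xi>. \<exists>w. norm ((\<Sum>i<n. star c * sh (osum (i # w i)) (sh \<xi> (g * g)) * c) - star f * f) \<le> 1/4"
    using comparison_orthogonal[of "g * g" f "1/4"] f by auto
  have ggA: "g * g \<in> A" using g by (intro A_mult)
  obtain w where w: "norm ((\<Sum>i<n. star c * sh (osum (i # w i)) (g * g) * c) - star f * f) \<le> 1/4"
    using w[of 0] sh_zero[OF ggA] by auto
  define z where "z = (\<Sum>i<n. Lw (i # w i) c)"
  define k where "k = star z * (g * g) * z"
  have keq: "k = (\<Sum>i<n. star c * sh (osum (i # w i)) (g * g) * c)"
    unfolding k_def z_def by (rule orthogonal_sum[OF c ggA])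
  have k: "k \<in> A" "star k = k"
  proof -
    show "k \<in> A" unfolding keq by (intro A_sum A_mult A_star sh_in c g)
    show "star k = k" by (simp add: k_def star_mult star_star g mult.assoc)
  qed
  have k34: "Re (ch \<gamma> k) \<ge> 3/4" if "ch \<gamma> f = 1" for \<gamma>
  proof -
    have "cmod (ch \<gamma> (k - star f * f)) \<le> 1/4" using pf.bnd[of \<gamma> "k - star f * f"] w by (simp add: keq)
    moreover have "ch \<gamma> (k - star f * f) = ch \<gamma> k - 1" using that f by (simp add: pf.diff ch_mult)
    ultimately show ?thesis using abs_Re_le_cmod[of "ch \<gamma> k - 1"] by simp
  qed
  \<comment> \<open>The error 1/4 in the comparison keeps \<open>k\<close> at or above 3/4 wherever
    \<open>f\<close> is 1; there \<open>F\<close> is 1. It vanishes up to 1/4, so that it can be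
    divided by its argument.\<close>
  define F where "F t = clamp01 (2 * t - 1/2)" for t
  have F: "0 \<le> F t" "F t \<le> 1" "t \<le> 1/4 \<Longrightarrow> F t = 0" "3/4 \<le> t \<Longrightarrow> F t = 1" for t
    unfolding F_def by (rule clamp01, simp?)+
  have Fcont: "continuous_on UNIV F" unfolding F_def by (intro continuous_intros)
  \<comment> \<open>Chosen so that \<theta>(t)^2 t = F(t), which makes
    \<open>star y * y = d * k * d\<close> the function \<open>F\<close> of \<open>k\<close>. The
    maximum only takes effect where \<open>F\<close> vanishes.\<close>
  define \<theta> where "\<theta> t = sqrt (F t / max t (1/4))" for t
  have "continuous_on UNIV \<theta>" unfolding \<theta>_def
    by (intro continuous_intros Fcont) (auto simp: max_def)
  then obtain d where d: "d \<in> A" "star d = d" "\<And>\<gamma>. ch \<gamma> d = complex_of_real (\<theta> (Re (ch \<gamma> k)))"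
    using functional_calculus[OF k, of \<theta>] F(3)[of 0] by (auto simp: \<theta>_def)
  have "continuous_on UNIV (\<lambda>t. 1 - sqrt (1 - F t))" by (intro continuous_intros Fcont)
  then obtain s where s: "s \<in> A" "star s = s" "\<And>\<gamma>. ch \<gamma> s = complex_of_real (1 - sqrt (1 - F (Re (ch \<gamma> k))))"
    using functional_calculus[OF k, of "\<lambda>t. 1 - sqrt (1 - F t)"] F(3)[of 0] by auto
  define y where "y = g * z * d"
  have yy: "star y * y = d * k * d" by (simp add: y_def k_def star_mult d g mult.assoc)
  have \<theta>F: "\<theta> t * t * \<theta> t = F t" for t
  proof (cases "t \<le> 1/4")
    case False
    have "\<theta> t * t * \<theta> t = (sqrt (F t / t))\<^sup>2 * t"
      unfolding power2_eq_square using False by (simp add: \<theta>_def max_def mult_ac)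
    also have "(sqrt (F t / t))\<^sup>2 = F t / t" using False F(1)[of t] by simp
    finally show ?thesis using False by simp
  qed (simp add: \<theta>_def F)
  have chyy: "ch \<gamma> (star y * y) = complex_of_real (F (Re (ch \<gamma> k)))" for \<gamma>
  proof -
    have "ch \<gamma> (star y * y) = complex_of_real (\<theta> (Re (ch \<gamma> k)) * Re (ch \<gamma> k) * \<theta> (Re (ch \<gamma> k)))"
      using ch_selfadj[OF k(2), of \<gamma>] d k by (simp add: yy ch_mult A_mult)
    then show ?thesis by (simp only: \<theta>F)
  qed
  have yyA: "star y * y \<in> A" unfolding yy using d k by (intro A_mult)
  have F1: "F (Re (ch \<gamma> k)) = 1" if "ch \<gamma> h \<noteq> 0" for \<gamma>
  proof -
    have "clamp01 (4 * Re (ch \<gamma> a) - 2) > 0" using that clamp01(1)[of "4 * Re (ch \<gamma> a) - 2"] by (auto simp: h less_le)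
    then have "4 * Re (ch \<gamma> a) - 2 > 0" by (rule clamp01)
    then have "ch \<gamma> f = 1" unfolding f using clamp01(4)[of "4 * Re (ch \<gamma> a) - 1"] by simp
    then show ?thesis using k34 F(4) by blast
  qed
  have yyh: "(star y * y) * h = h"
  proof (rule A_eqI)
    fix \<gamma> show "ch \<gamma> (star y * y * h) = ch \<gamma> h"
      using F1[of \<gamma>] by (cases "ch \<gamma> h = 0") (simp_all only: ch_mult yyA h(1) chyy, simp_all)
  qed (use yyA h in \<open>auto intro: A_mult\<close>)
  have sh': "s * h = h"
  proof (rule A_eqI)
    fix \<gamma> show "ch \<gamma> (s * h) = ch \<gamma> h"
      using F1[of \<gamma>] s h(1) by (cases "ch \<gamma> h = 0") (simp_all add: ch_mult)
  qed (use s h in \<open>auto intro: A_mult\<close>)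
  have hy: "h * y = y" unfolding y_def by (simp add: mult.assoc[symmetric] hg)
  \<comment> \<open>The words in \<open>z\<close> begin with the letters below \<open>n\<close>, so
    the letter \<open>n\<close> gives a vector orthogonal to the range of \<open>z\<close>.\<close>
  define b where "b = h * L n (sh (\<omega> n) h)"
  show ?thesis
  proof (rule scaling_projection[of y s b])
    show "star y * y * y = y" using yyh hy by (metis mult.assoc)
    show "star s = s" by (rule s)
    show "2 *\<^sub>R s - s * s = star y * y"
    proof (rule A_eqI[OF A_diff[OF A_scaleR[OF s(1)] A_mult[OF s(1) s(1)]] yyA])
      fix \<gamma>
      define t where "t = sqrt (1 - F (Re (ch \<gamma> k)))"
      have "t * t = 1 - F (Re (ch \<gamma> k))" using F(2) by (simp add: t_def)
      then have "2 * (1 - t) - (1 - t) * (1 - t) = F (Re (ch \<gamma> k))" by (simp add: algebra_simps)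
      moreover have "ch \<gamma> (2 *\<^sub>R s - s * s) = complex_of_real (2 * (1 - t) - (1 - t) * (1 - t))"
        using s by (simp add: pf.diff ch_mult scaleR_scaleC pf.scale t_def)
      ultimately show "ch \<gamma> (2 *\<^sub>R s - s * s) = ch \<gamma> (star y * y)" by (simp only: chyy)
    qed
    have zL: "star z * L n x = 0" for x
      by (simp add: z_def star_sum sum_distrib_right L_inner)
    have "star y * b = d * (star z * ((g * h) * L n (sh (\<omega> n) h)))"
      by (simp add: y_def b_def star_mult d g mult.assoc)
    also have "\<dots> = 0" using zL g h by (simp add: L_comm A_mult)
    finally show "star y * b = 0" .
    show "s * b = b" by (simp add: b_def mult.assoc[symmetric] sh')
    show "b \<noteq> 0"
    proof
      assume "b = 0"
      then have "norm (sh (\<omega> n) h * sh (\<omega> n) h) = 0"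
        using norm_L[of n "sh (\<omega> n) h * sh (\<omega> n) h"] h by (simp add: b_def L_comm)
      then have "norm (sh (\<omega> n) (h * h)) = 0" using h by (simp add: sh_mult)
      then have "h * h = 0" using norm_sh[OF A_mult[OF h(1) h(1)]] by simp
      then have "ch \<gamma>0 h * ch \<gamma>0 h = 0" using h(1) ch_mult[of h h \<gamma>0] by simp
      then show False by (simp add: h \<gamma>1 clamp01_def)
    qed
  qed
qed

text \<open>\<open>comparison\<close> reaches \<open>star u * u\<close> up to 1/4 only. As
  \<open>u\<close> is an approximate unit for \<open>p\<close>, the corner element \<open>c\<close>
  satisfies norm (p - c) < 1/2 + 1/4, close enough for \<open>projection_perturb\<close> to make the
  equality exact.\<close>

lemma compress_to_projection:
  fixes x p :: 'a
  assumes x: "x \<noteq> 0" and p: "projection p"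
  shows "\<exists>Z. star (x * Z) * (x * Z) = p"
proof -
  have pp: "p * p = p" "star p = p" using p by (simp_all add: projection_def)
  note np = projection_norm_le[OF p]
  obtain u where u: "u \<in> A" "star u = u" "norm u \<le> 1" "norm (p - u * p) < 1/4"
    using approximate_unit_algebra[of "1/4" p] by auto
  obtain Z where Z: "norm (star (x * Z) * (x * Z) - star u * u) < 1/4"
    using comparison[OF x u(1), of "1/4"] by auto
  define Y where "Y = star (x * Z) * (x * Z)"
  define c where "c = p * Y * p"
  have sY: "star Y = Y" by (simp add: Y_def star_mult star_star)
  have contr: "norm (p * b * p) \<le> norm b" for b
  proof -
    have "norm (p * b * p) \<le> norm (p * b) * norm p" by (rule norm_mult_ineq)
    also have "\<dots> \<le> norm (p * b) * 1" using np by (intro mult_left_mono) auto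
    also have "norm (p * b) \<le> norm p * norm b" by (rule norm_mult_ineq)
    also have "\<dots> \<le> 1 * norm b" using np by (intro mult_right_mono) auto
    finally show ?thesis by simp
  qed
  have "p - c = (p - star (u * p) * (u * p)) - p * (Y - star u * u) * p"
    by (simp add: c_def star_mult pp u algebra_simps)
  also have "norm \<dots> \<le> norm (p - star (u * p) * (u * p)) + norm (Y - star u * u)"
    by (rule order_trans[OF norm_triangle_ineq4]) (intro add_left_mono contr)
  also have "norm (p - star (u * p) * (u * p)) \<le> 1/2"
  proof -
    have "p - star (u * p) * (u * p) = star p * (p - u * p) + star (p - u * p) * (u * p)"
      by (simp add: star_diff star_mult pp algebra_simps u)
    also have "norm \<dots> \<le> norm p * norm (p - u * p) + norm (p - u * p) * norm (u * p)"
      by (rule order_trans[OF norm_triangle_ineq])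
        (metis add_mono norm_mult_ineq norm_star)
    also have "\<dots> \<le> 1 * (1/4) + (1/4) * 1"
      using u np norm_mult_ineq[of u p] mult_mono[of "norm u" 1 "norm p" 1]
      by (intro add_mono mult_mono) auto
    finally show ?thesis by simp
  qed
  finally have "norm (p - c) < 1" using Z by (simp add: Y_def)
  moreover have "star c = c" "p * c = c" "c * p = c"
    by (simp_all add: c_def star_mult pp sY mult.assoc) (simp_all add: mult.assoc[symmetric] pp)
  ultimately obtain w where w: "p * w = w" "star w * c * w = p"
    using projection_perturb[OF p] by blast
  have "star (x * (Z * w)) * (x * (Z * w)) = star (p * w) * Y * (p * w)"
    by (simp add: w Y_def star_mult mult.assoc)
  also have "\<dots> = star w * c * w" by (simp add: c_def star_mult pp mult.assoc)
  finally show ?thesis using w by blast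
qed

text \<open>\<open>P 0\<close> and \<open>P 1\<close> are orthogonal copies of one nonzero
  projection. Their sum \<open>Q\<close> is compressed into \<open>P 0\<close>, so it is equivalent
  to a projection \<open>q\<close> below \<open>P 0\<close>, and \<open>P 1 * q = 0\<close> shows
  that \<open>q\<close> is proper.\<close>

lemma exists_infinite_projection: "\<exists>p. infinite_projection (p::'a)"
proof -
  obtain p :: 'a where p: "projection p" "p \<noteq> 0" using exists_projection by blast
  have pp: "p * p = p" "star p = p" using p by (simp_all add: projection_def)
  define V where "V i = L i p" for i
  define P where "P i = V i * star (V i)" for i
  have VV: "star (V i) * V k = (if i = k then p else 0)" for i k
    by (simp add: V_def L_inner pp)
  have Pp: "projection (P i)" for i unfolding P_def
    by (rule partial_isometry[OF p(1)]) (simp add: VV)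
  have PP: "P i * P k = (if i = k then P i else 0)" for i k
  proof (cases "i = k")
    case True
    then show ?thesis using Pp[of k] by (simp add: projection_def)
  next
    case False
    have "P i * P k = V i * (star (V i) * V k) * star (V k)" by (simp add: P_def mult.assoc)
    then show ?thesis using False by (simp add: VV)
  qed
  have nz: "P i \<noteq> 0" for i
  proof
    assume "P i = 0"
    then have "V i = 0" using cstar_identity'[of "V i"] by (simp add: P_def)
    then show False using VV[of i i] p(2) by simp
  qed
  define Q where "Q = P 0 + P 1"
  have "projection Q" using Pp[of 0] Pp[of 1]
    by (simp add: Q_def projection_def star_add distrib_left distrib_right PP)
  then obtain Z where Z: "star (P 0 * Z) * (P 0 * Z) = Q" using compress_to_projection[OF nz] by blast
  define q where "q = P 0 * Z * star (P 0 * Z)"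
  have "projection q" unfolding q_def by (rule partial_isometry[OF \<open>projection Q\<close> Z])
  moreover have "Q * q = q"
    by (simp add: q_def Q_def distrib_right mult.assoc[symmetric] PP)
  moreover have "q \<noteq> Q"
  proof
    assume "q = Q"
    then have "P 1 * q = P 1 * Q" by simp
    then have "P 1 = 0" by (simp add: q_def Q_def distrib_left mult.assoc[symmetric] PP)
    then show False using nz by simp
  qed
  ultimately show ?thesis unfolding infinite_projection_def
    using \<open>projection Q\<close> Z by (metis q_def)
qed

theorem purely_infinite: "purely_infinite TYPE('a)"
  unfolding purely_infinite_def
proof (intro allI impI, elim conjE)
  fix H :: "'a set" assume H: "hereditary_subalgebra H" "H \<noteq> {0}"
  then obtain x where x: "x \<in> H" "x \<noteq> 0" by (auto simp: hereditary_subalgebra_def)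
  obtain p :: 'a where p: "infinite_projection p" using exists_infinite_projection by blast
  then obtain Z where Z: "star (x * Z) * (x * Z) = p"
    using compress_to_projection[OF x(2)] by (auto simp: infinite_projection_def)
  show "\<exists>p\<in>H. infinite_projection p"
    using hereditary_conjugate[OF H(1) x(1)] infinite_projection_transfer[OF p Z] by blast
qed

end

context dense_core
begin

text \<open>The kernel of the Fock representation at \<open>0\<close> is the ideal witnessing non-simplicity.\<close>

theorem not_simple:
  assumes a: "a \<in> A" "a \<noteq> 0" and vanish: "\<And>w. ch (osum w) a = 0"
  shows "\<not> simple_cstar TYPE('a)"
proof -
  define I where "I = {x. \<forall>g. pf.snorm 0 (x * g) = 0}"
  have "closed_ideal I" unfolding closed_ideal_def
  proof (intro conjI ballI allI)
    have "I = (\<Inter>g. {x. pf.snorm 0 (x * g) = 0})" by (auto simp: I_def)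
    moreover have "closed {x. pf.snorm 0 (x * g) = 0}" for g
      by (intro closed_Collect_eq continuous_intros continuous_on_compose2[OF pf.snorm_cont[of UNIV]]) auto
    ultimately show "closed I" by auto
    show "0 \<in> I" by (simp add: I_def)
    fix x assume x: "x \<in> I"
    show "c *\<^sub>C x \<in> I" for c using x by (simp add: I_def mult_scaleC_left pf.snorm_scale)
    show "x * b \<in> I" for b using x by (simp add: I_def mult.assoc)
    show "b * x \<in> I" for b unfolding I_def
    proof (intro CollectI allI)
      fix g
      show "pf.snorm 0 (b * x * g) = 0"
        using pf.snorm_mult[of 0 b "x * g"] pf.snorm_nonneg[of 0 "b * (x * g)"] x
        by (auto simp: I_def mult.assoc simp del: pf.snorm_nonneg intro: antisym)
    qed
    fix y assume y: "y \<in> I"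
    show "x + y \<in> I" unfolding I_def
    proof (intro CollectI allI)
      fix g
      show "pf.snorm 0 ((x + y) * g) = 0"
        using pf.snorm_add[of 0 "x * g" "y * g"] pf.snorm_nonneg[of 0 "(x + y) * g"] x y
        by (auto simp: I_def distrib_right simp del: pf.snorm_nonneg intro: antisym)
    qed
  qed
  moreover have "a \<in> I"
  proof -
    have "{g. pf.snorm 0 (a * g) = 0} = UNIV"
    proof (rule dense)
      show "closed {g. pf.snorm 0 (a * g) = 0}"
        by (intro closed_Collect_eq continuous_intros continuous_on_compose2[OF pf.snorm_cont[of UNIV]]) auto
      show "0 \<in> {g. pf.snorm 0 (a * g) = 0}" by simp
      fix x y assume "x \<in> {g. pf.snorm 0 (a * g) = 0}" "y \<in> {g. pf.snorm 0 (a * g) = 0}"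
      then show "x + y \<in> {g. pf.snorm 0 (a * g) = 0}"
        using pf.snorm_add[of 0 "a * x" "a * y"] pf.snorm_nonneg[of 0 "a * (x + y)"]
        by (auto simp: distrib_left simp del: pf.snorm_nonneg intro: antisym)
    next
      fix \<mu> b \<nu> assume b: "b \<in> A"
      have eq: "a * E \<mu> b \<nu> = E \<mu> (sh (osum \<mu>) a * b) \<nu>"
        unfolding E_def using a by (simp add: Lw_comm mult_star_Lw star_mult)
      define c where "c = sh (osum \<mu>) a * b"
      have c: "c \<in> A" using a b by (simp add: c_def A_mult sh_in)
      have "star (E \<mu> c \<nu>) * E \<mu> c \<nu> = E \<nu> (star c * c) \<nu>" using c by (simp add: star_E E_mult_same A_star)
      \<comment> \<open>Only the empty \<nu> can contribute, and then \<open>c\<close> takes at 0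
        the value of \<open>a\<close> at \<open>osum \<mu>\<close> times that of
        \<open>b\<close>.\<close>
      moreover have "ch 0 (E \<nu> (star c * c) \<nu>) = 0"
        using c vanish[of \<mu>] a b by (simp add: ch_E A_mult A_star ch_mult sh_in c_def ch_sh)
      ultimately have "(pf.snorm 0 (E \<mu> c \<nu>))\<^sup>2 = 0" unfolding pf.snorm_sq by simp
      then show "E \<mu> b \<nu> \<in> {g. pf.snorm 0 (a * g) = 0}" by (simp add: eq c_def)
    qed
    then show ?thesis by (auto simp: I_def)
  qed
  moreover have "I \<noteq> UNIV"
  proof
    assume "I = UNIV"
    obtain e where e: "e \<in> A" "ch 0 e = 1" using ch_unit by blast
    have "pf.snorm 0 (e * e) = 0" using \<open>I = UNIV\<close> by (auto simp: I_def)
    then have "ch 0 (star (e * e) * (e * e)) = 0" using pf.snorm_sq_complex[of 0 "e * e"] by simp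
    then show False using e by (simp add: ch_mult A_mult A_star ch_star)
  qed
  ultimately show ?thesis using a(2) unfolding simple_cstar_def by auto
qed

end

section \<open>Compactly supported functions on a locally compact abelian group\<close>

lemma ccD: "f \<in> cc \<Longrightarrow> continuous_on UNIV f"
  by (simp add: cc_def)

lemma cc_support: "f \<in> cc \<Longrightarrow> \<exists>K. compact K \<and> (\<forall>t. t \<notin> K \<longrightarrow> f t = 0)"
  by (simp add: cc_def)

lemma ccI: "continuous_on UNIV f \<Longrightarrow> compact K \<Longrightarrow> (\<And>t. t \<notin> K \<Longrightarrow> f t = 0) \<Longrightarrow> f \<in> cc"
  by (auto simp: cc_def)

lemma cc_zero: "(\<lambda>_. 0) \<in> cc"
  by (rule ccI[of _ "{}"]) auto

lemma cc_add:
  fixes f :: "'g::topological_space \<Rightarrow> 'a::topological_monoid_add"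
  assumes "f \<in> cc" "g \<in> cc" shows "(\<lambda>t. f t + g t) \<in> cc"
proof -
  obtain K L where "compact K" "\<And>t. t \<notin> K \<Longrightarrow> f t = 0" "compact L" "\<And>t. t \<notin> L \<Longrightarrow> g t = 0"
    using assms[THEN cc_support] by blast
  then show ?thesis using assms[THEN ccD]
    by (intro ccI[of _ "K \<union> L"] continuous_intros compact_Un) auto
qed

lemma cc_map:
  assumes f: "f \<in> cc" and h: "continuous_on UNIV (\<lambda>t. h t (f t))" "\<And>t. h t 0 = 0"
  shows "(\<lambda>t. h t (f t)) \<in> cc"
proof -
  obtain K where "compact K" "\<And>t. t \<notin> K \<Longrightarrow> f t = 0" using cc_support[OF f] by blast
  then show ?thesis using h by (intro ccI[of _ K]) auto
qed

lemma cc_scaleR_right: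
  fixes f :: "'g::topological_space \<Rightarrow> 'a::real_normed_vector"
  shows "f \<in> cc \<Longrightarrow> (\<lambda>t. r *\<^sub>R f t) \<in> cc"
  by (rule cc_map[of f "\<lambda>_ x. r *\<^sub>R x"]) (auto intro: continuous_intros ccD)

lemma cc_scaleR_left:
  fixes a :: "'a::real_normed_vector"
  shows "f \<in> cc \<Longrightarrow> (\<lambda>t. f t *\<^sub>R a) \<in> cc"
  by (rule cc_map[of f "\<lambda>_ x. x *\<^sub>R a"]) (auto intro: continuous_intros ccD)

lemma cc_diff:
  fixes f :: "'g::topological_space \<Rightarrow> 'a::real_normed_vector"
  assumes "f \<in> cc" "g \<in> cc" shows "(\<lambda>t. f t - g t) \<in> cc"
  using cc_add[OF assms(1) cc_scaleR_right[OF assms(2), of "-1"]] by simp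

lemma cc_sum:
  fixes f :: "'i \<Rightarrow> 'g::topological_space \<Rightarrow> 'a::topological_comm_monoid_add"
  shows "(\<And>i. i \<in> I \<Longrightarrow> f i \<in> cc) \<Longrightarrow> (\<lambda>t. \<Sum>i\<in>I. f i t) \<in> cc"
  by (induction I rule: infinite_finite_induct) (auto intro: cc_zero cc_add)

lemma cc_bounded:
  fixes f :: "'g::topological_space \<Rightarrow> 'a::real_normed_vector"
  assumes "f \<in> cc" shows "\<exists>B>0. \<forall>t. norm (f t) \<le> B"
proof -
  obtain K where K: "compact K" "\<And>t. t \<notin> K \<Longrightarrow> f t = 0" using cc_support[OF assms] by blast
  have "compact (f ` K)" using K ccD[OF assms] by (intro compact_continuous_image) (auto intro: continuous_on_subset)
  then obtain B where B: "B > 0" "\<forall>y\<in>f ` K. norm y \<le> B" using compact_imp_bounded bounded_pos by blast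
  then have "norm (f t) \<le> B" for t using K(2)[of t] by (cases "t \<in> K") auto
  then show ?thesis using B by blast
qed

lemma compact_plus:
  fixes K L :: "'g::topological_monoid_add set"
  assumes "compact K" "compact L" shows "compact ((\<lambda>(s, t). s + t) ` (K \<times> L))"
  by (intro compact_continuous_image compact_Times assms)
    (auto simp: split_beta' intro!: continuous_intros)

lemma compact_uminus:
  fixes K :: "'g::topological_group_add set"
  assumes "compact K" shows "compact (uminus ` K)"
  by (intro compact_continuous_image assms continuous_on_minus continuous_on_id)

lemma cc_translate:
  fixes f :: "'g::topological_ab_group_add \<Rightarrow> 'a::{topological_space,zero}"
  assumes "f \<in> cc" shows "(\<lambda>t. f (t + a)) \<in> cc"
proof -
  obtain K where K: "compact K" "\<And>t. t \<notin> K \<Longrightarrow> f t = 0" using cc_support[OF assms] by blast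
  show ?thesis
  proof (rule ccI)
    show "continuous_on UNIV (\<lambda>t. f (t + a))"
      by (intro continuous_on_compose2[OF ccD[OF assms]] continuous_intros) auto
    show "compact ((\<lambda>t. t - a) ` K)"
      unfolding diff_conv_add_uminus by (intro compact_continuous_image K continuous_intros)
    show "f (t + a) = 0" if "t \<notin> (\<lambda>t. t - a) ` K" for t
      using that by (intro K(2)) (auto simp: image_iff)
  qed
qed

lemma cc_reflect:
  fixes f :: "'g::topological_ab_group_add \<Rightarrow> 'a::{topological_space,zero}"
  assumes "f \<in> cc" shows "(\<lambda>t. f (- t)) \<in> cc"
proof -
  obtain K where K: "compact K" "\<And>t. t \<notin> K \<Longrightarrow> f t = 0" using cc_support[OF assms] by blast
  show ?thesis
  proof (rule ccI[OF _ compact_uminus[OF K(1)]])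
    show "continuous_on UNIV (\<lambda>t. f (- t))"
      by (intro continuous_on_compose2[OF ccD[OF assms]] continuous_intros) auto
    show "f (- t) = 0" if "t \<notin> uminus ` K" for t
      using that by (intro K(2)) (force simp: image_iff)
  qed
qed

lemma continuous_on_diff_group [continuous_intros]:
  fixes f g :: "'x::topological_space \<Rightarrow> 'g::topological_ab_group_add"
  assumes "continuous_on S f" "continuous_on S g" shows "continuous_on S (\<lambda>x. f x - g x)"
  unfolding diff_conv_add_uminus by (intro continuous_on_add continuous_on_minus assms)

section \<open>Integration of compactly supported functions against a Haar measure\<close>

locale haar_group =
  fixes m :: "'g::{topological_ab_group_add,t2_space} measure"
  assumes lc: "locally_compact_space (euclidean :: 'g topology)" and haar: "haar_measure m"
begin

lemma sets_m [measurable_cong]: "sets m = sets borel"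
  using haar by (simp add: haar_measure_def)

lemma space_m [simp]: "space m = UNIV"
  using sets_eq_imp_space_eq[OF sets_m] by simp

lemma hausdorff_euclidean: "Hausdorff_space (euclidean :: 'g topology)"
  unfolding Hausdorff_space_def using hausdorff by (auto simp: disjnt_def)

lemma compact_nbhd:
  assumes "compact (K :: 'g set)" shows "\<exists>V C. open V \<and> compact C \<and> K \<subseteq> V \<and> V \<subseteq> C"
  using lc hausdorff_euclidean assms
  unfolding locally_compact_space_compact_closed_compact[OF disjI1[OF hausdorff_euclidean]]
  by (fastforce simp: open_openin[symmetric] compactin_euclidean_iff)

lemma bump:
  assumes K: "compact (K :: 'g set)" and V: "open V" "K \<subseteq> V"
  shows "\<exists>\<phi> :: 'g \<Rightarrow> real. continuous_on UNIV \<phi> \<and> (\<forall>t. 0 \<le> \<phi> t \<and> \<phi> t \<le> 1) \<and>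
    (\<forall>t\<in>K. \<phi> t = 1) \<and> (\<forall>t. t \<notin> V \<longrightarrow> \<phi> t = 0)"
proof -
  have "completely_regular_space (euclidean :: 'g topology)"
    by (rule locally_compact_regular_imp_completely_regular_space[OF lc disjI1[OF hausdorff_euclidean]])
  moreover have "compactin euclidean K" "closedin euclidean (- V)" "disjnt K (- V)"
    using K V by (auto simp: compactin_euclidean_iff disjnt_def)
  ultimately obtain f :: "'g \<Rightarrow> real" where f: "continuous_map euclidean (subtopology euclidean {0..1}) f"
    "f ` (- V) \<subseteq> {0}" "f ` K \<subseteq> {1}"
    using Urysohn_completely_regular_compact_closed[of 0 1 euclidean K "- V"] by auto
  then have "continuous_on UNIV f" "\<And>t. f t \<in> {0..1}"
    by (auto simp: continuous_map_in_subtopology)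
  then show ?thesis using f(2,3) by (intro exI[of _ f]) (auto simp: image_subset_iff)
qed

lemma emeasure_compact: "compact K \<Longrightarrow> emeasure m K < \<infinity>"
  using haar by (simp add: haar_measure_def)

lemma compact_sets: "compact (K::'g set) \<Longrightarrow> K \<in> sets m"
  by (simp add: sets_m borel_compact)

lemma cc_measurable:
  fixes f :: "'g \<Rightarrow> 'a::topological_space"
  shows "continuous_on UNIV f \<Longrightarrow> f \<in> borel_measurable m"
  using borel_measurable_continuous_onI[of f] measurable_cong_sets[OF sets_m refl] by blast

lemma cc_integrable:
  fixes f :: "'g \<Rightarrow> 'a::{banach,second_countable_topology}"
  assumes f: "f \<in> cc" shows "integrable m f"
proof -
  obtain K where K: "compact K" "\<And>t. t \<notin> K \<Longrightarrow> f t = 0" using cc_support[OF f] by blast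
  obtain B where "\<forall>t. norm (f t) \<le> B" using cc_bounded[OF f] by blast
  then show ?thesis
    using compact_sets[OF K(1)] cc_measurable[OF ccD[OF f]] emeasure_compact[OF K(1)] K(2)
    by (intro integrableI_bounded_set[of K _ _ B]) auto
qed

lemma cc_norm:
  fixes f :: "'g \<Rightarrow> 'a::real_normed_vector"
  shows "f \<in> cc \<Longrightarrow> (\<lambda>t. norm (f t)) \<in> cc"
  by (rule cc_map) (auto intro: continuous_intros ccD)

lemma integral_bound:
  fixes f :: "'g \<Rightarrow> 'a::{banach,second_countable_topology}"
  assumes f: "f \<in> cc" and K: "compact K" "\<And>t. t \<notin> K \<Longrightarrow> f t = 0" and b: "\<And>t. norm (f t) \<le> e"
  shows "norm (LINT t|m. f t) \<le> e * measure m K"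
proof -
  have "norm (LINT t|m. f t) \<le> (LINT t|m. e * indicator K t)"
  proof (rule order_trans[OF integral_norm_bound], rule integral_mono)
    show "integrable m (\<lambda>t. norm (f t))" using cc_integrable[OF f] by simp
    show "integrable m (\<lambda>t. e * indicator K t)"
      using compact_sets[OF K(1)] emeasure_compact[OF K(1)] by (intro integrable_mult_right) simp
    fix t show "norm (f t) \<le> e * indicator K t" using b[of t] K(2)[of t] by (auto simp: indicator_def)
  qed
  then show ?thesis using compact_sets[OF K(1)] by simp
qed

lemma integral_bound_real:
  assumes f: "f \<in> cc" and K: "compact K" "\<And>t. t \<notin> K \<Longrightarrow> f t = 0" and b: "\<And>t. \<bar>f t\<bar> \<le> e"
  shows "(LINT t|m. f t) \<le> e * measure m K"
  using integral_bound[OF f K, of e] b by simp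

lemma translate_emeasure: "B \<in> sets borel \<Longrightarrow> emeasure m ((+) t ` B) = emeasure m B"
  using haar unfolding haar_measure_def by blast

lemma translate_measurable: "(\<lambda>s. s + t) \<in> measurable m m"
  unfolding measurable_cong_sets[OF sets_m sets_m]
  by (rule borel_measurable_continuous_onI) (intro continuous_on_add continuous_on_id continuous_on_const)

lemma distr_translate: "distr m m (\<lambda>s. s + t) = m"
proof (rule measure_eqI)
  note meas = translate_measurable[of t]
  fix B assume "B \<in> sets (distr m m (\<lambda>s. s + t))"
  then have B: "B \<in> sets m" by simp
  have "(\<lambda>s. s + t) -` B = (+) (- t) ` B"
  proof (intro equalityI subsetI)
    fix s assume "s \<in> (\<lambda>s. s + t) -` B"
    then show "s \<in> (+) (- t) ` B" by (intro image_eqI[of _ _ "s + t"]) auto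
  qed auto
  then show "emeasure (distr m m (\<lambda>s. s + t)) B = emeasure m B"
    using B meas translate_emeasure[of B "- t"] by (simp add: emeasure_distr sets_m)
qed simp

lemma integral_translate:
  fixes f :: "'g \<Rightarrow> 'a::{banach,second_countable_topology}"
  assumes "continuous_on UNIV f"
  shows "(LINT s|m. f (s + t)) = (LINT s|m. f s)"
proof -
  note meas = translate_measurable[of t]
  show ?thesis using integral_distr[OF meas cc_measurable[OF assms]] by (simp add: distr_translate)
qed

lemma integral_translate':
  fixes f :: "'g \<Rightarrow> 'a::{banach,second_countable_topology}"
  assumes "continuous_on UNIV f"
  shows "(LINT s|m. f (s - t)) = (LINT s|m. f s)"
  using integral_translate[OF assms, of "- t"] by simp

text \<open>A finite subcover by the sets where a bump function exceeds 1/2 makes \<open>B\<close>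
  larger than 1/2 on \<open>K\<close>. Dividing by \<open>max (B t) (1/2)\<close> instead of
  \<open>B t\<close> keeps the functions continuous off \<open>K\<close> and does not change them on
  \<open>K\<close>.\<close>

lemma partition:
  assumes K: "compact (K :: 'g set)" and V: "open V" "K \<subseteq> V"
    and U: "\<And>s. s \<in> K \<Longrightarrow> open (U s) \<and> s \<in> U s"
  obtains I :: "'g set" and u :: "'g \<Rightarrow> 'g \<Rightarrow> real" where
    "finite I" "I \<subseteq> K" "\<And>i. continuous_on UNIV (u i)" "\<And>i t. 0 \<le> u i t"
    "\<And>i t. i \<in> I \<Longrightarrow> u i t \<noteq> 0 \<Longrightarrow> t \<in> U i \<and> t \<in> V"
    "\<And>t. (\<Sum>i\<in>I. u i t) \<le> 1" "\<And>t. t \<in> K \<Longrightarrow> (\<Sum>i\<in>I. u i t) = 1"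
proof -
  have "\<exists>\<phi> :: 'g \<Rightarrow> real. continuous_on UNIV \<phi> \<and> (\<forall>t. 0 \<le> \<phi> t \<and> \<phi> t \<le> 1) \<and>
    (s \<in> K \<longrightarrow> \<phi> s = 1 \<and> (\<forall>t. t \<notin> U s \<inter> V \<longrightarrow> \<phi> t = 0))" for s
  proof (cases "s \<in> K")
    case True
    then show ?thesis using bump[of "{s}" "U s \<inter> V"] U[OF True] V by auto
  qed (auto intro!: exI[of _ "\<lambda>_. 0"])
  then obtain b :: "'g \<Rightarrow> 'g \<Rightarrow> real" where b: "\<And>s. continuous_on UNIV (b s)" "\<And>s t. 0 \<le> b s t"
    "\<And>s. s \<in> K \<Longrightarrow> b s s = 1" "\<And>s t. s \<in> K \<Longrightarrow> t \<notin> U s \<inter> V \<Longrightarrow> b s t = 0" by metis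
  have "open {t. b s t > 1/2}" for s
    by (intro open_Collect_less continuous_intros b)
  then obtain I where I: "finite I" "I \<subseteq> K" "K \<subseteq> (\<Union>s\<in>I. {t. b s t > 1/2})"
    using compactE_image[OF K, of K "\<lambda>s. {t. b s t > 1/2}"] b(3) by force
  define B where "B t = (\<Sum>i\<in>I. b i t)" for t
  define u where "u i t = b i t / max (B t) (1/2)" for i t
  have B0: "0 \<le> B t" for t unfolding B_def by (intro sum_nonneg b)
  have Bc: "continuous_on UNIV B" unfolding B_def by (intro continuous_intros b)
  have sum: "(\<Sum>i\<in>I. u i t) = B t / max (B t) (1/2)" for t
    by (simp add: u_def B_def sum_divide_distrib)
  show thesis
  proof (rule that[OF I(1,2)])
    show "continuous_on UNIV (u i)" for i
      unfolding u_def by (intro continuous_intros b Bc) (auto simp: max_def)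
    show "0 \<le> u i t" for i t using b(2) by (auto simp: u_def intro!: divide_nonneg_nonneg)
    show "t \<in> U i \<and> t \<in> V" if "i \<in> I" "u i t \<noteq> 0" for i t
      using b(4)[of i t] that I(2) by (auto simp: u_def)
    show "(\<Sum>i\<in>I. u i t) \<le> 1" for t unfolding sum using B0[of t] by (simp add: divide_le_eq max_def)
    show "(\<Sum>i\<in>I. u i t) = 1" if t: "t \<in> K" for t
    proof -
      obtain s where s: "s \<in> I" "b s t > 1/2" using I(3) t by auto
      have "b s t \<le> B t" unfolding B_def using member_le_sum[OF s(1), of "\<lambda>i. b i t"] b(2) I(1) by simp
      then show ?thesis unfolding sum using s by (simp add: max_def)
    qed
  qed
qed

lemma integral_continuous:
  fixes F :: "'x::topological_space \<times> 'g \<Rightarrow> 'a::{banach,second_countable_topology}"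
  assumes F: "continuous_on UNIV F" and K: "compact K"
    and N: "open N" "x0 \<in> N" "\<And>x t. x \<in> N \<Longrightarrow> t \<notin> K \<Longrightarrow> F (x, t) = 0" and e: "e > 0"
  shows "\<exists>X. open X \<and> x0 \<in> X \<and> X \<subseteq> N \<and> (\<forall>x\<in>X. norm ((LINT t|m. F (x, t)) - (LINT t|m. F (x0, t))) < e)"
proof -
  define d where "d = e / (measure m K + 1)"
  have d: "d > 0" using e by (simp add: d_def add_nonneg_pos)
  obtain X0 where X0: "x0 \<in> X0" "open X0" "\<forall>x\<in>X0 \<inter> UNIV. \<forall>t\<in>K. dist (F (x, t)) (F (x0, t)) \<le> d"
    using continuous_on_prod_compactE[of UNIV K F x0 d] F K d by (auto intro: continuous_on_subset)
  have cc: "(\<lambda>t. F (x, t)) \<in> cc" if "x \<in> N" for x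
      by (rule ccI[OF _ K]) (use N(3)[OF that] in \<open>auto intro!: continuous_on_compose2[OF F] continuous_intros\<close>)
  have "norm ((LINT t|m. F (x, t)) - (LINT t|m. F (x0, t))) < e" if x: "x \<in> X0 \<inter> N" for x
  proof -
    have cx: "(\<lambda>t. F (x, t)) \<in> cc" "(\<lambda>t. F (x0, t)) \<in> cc" using cc x N by auto
    have "(LINT t|m. F (x, t)) - (LINT t|m. F (x0, t)) = (LINT t|m. F (x, t) - F (x0, t))"
      using cx by (simp add: cc_integrable Bochner_Integration.integral_diff)
    also have "norm \<dots> \<le> d * measure m K"
    proof (rule integral_bound[OF _ K])
      have "(\<lambda>t. F (x, t) + (- 1) *\<^sub>R F (x0, t)) \<in> cc"
        by (intro cc_add cx cc_map[OF cx(2)] continuous_intros ccD[OF cx(2)]) auto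
      then show "(\<lambda>t. F (x, t) - F (x0, t)) \<in> cc" by simp
      show z: "F (x, t) - F (x0, t) = 0" if "t \<notin> K" for t using N x that by simp
      show "norm (F (x, t) - F (x0, t)) \<le> d" for t
        using X0(3) x z[of t] d by (cases "t \<in> K") (auto simp: dist_norm)
    qed
    also have "\<dots> < d * (measure m K + 1)" using d by simp
    also have "\<dots> = e" by (simp add: d_def add_nonneg_eq_0_iff)
    finally show ?thesis .
  qed
  then show ?thesis using X0 N by (intro exI[of _ "X0 \<inter> N"]) auto
qed

lemma integral_continuous_on:
  fixes F :: "'x::topological_space \<times> 'g \<Rightarrow> 'a::{banach,second_countable_topology}"
  assumes F: "continuous_on UNIV F"
    and N: "\<And>x0. \<exists>N K. open N \<and> x0 \<in> N \<and> compact K \<and> (\<forall>x\<in>N. \<forall>t. t \<notin> K \<longrightarrow> F (x, t) = 0)"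
  shows "continuous_on UNIV (\<lambda>x. LINT t|m. F (x, t))"
  unfolding continuous_on_def
proof (intro ballI)
  fix x0
  obtain N K where "open N" "x0 \<in> N" "compact K" "\<And>x t. x \<in> N \<Longrightarrow> t \<notin> K \<Longrightarrow> F (x, t) = 0"
    using N by metis
  note X = integral_continuous[OF F this(3,1,2,4)]
  show "((\<lambda>x. LINT t|m. F (x, t)) \<longlongrightarrow> (LINT t|m. F (x0, t))) (at x0 within UNIV)"
  proof (rule tendstoI)
    fix e :: real assume "e > 0"
    then obtain X where "open X" "x0 \<in> X" "\<forall>x\<in>X. norm ((LINT t|m. F (x, t)) - (LINT t|m. F (x0, t))) < e"
      using X by metis
    then show "\<forall>\<^sub>F x in at x0 within UNIV. dist (LINT t|m. F (x, t)) (LINT t|m. F (x0, t)) < e"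
      unfolding eventually_at_topological dist_norm by blast
  qed
qed

lemma integral_cc:
  fixes F :: "'g \<times> 'g \<Rightarrow> 'a::{banach,second_countable_topology}"
  assumes F: "continuous_on UNIV F" and K: "compact K" "compact L"
    and z: "\<And>s t. s \<notin> K \<or> t \<notin> L \<Longrightarrow> F (s, t) = 0"
  shows "(\<lambda>s. LINT t|m. F (s, t)) \<in> cc"
proof (rule ccI[OF _ K(1)])
  show "continuous_on UNIV (\<lambda>s. LINT t|m. F (s, t))"
    by (rule integral_continuous_on[OF F]) (use K(2) z in blast)
  show "(LINT t|m. F (s, t)) = 0" if "s \<notin> K" for s using z that by simp
qed

lemma integral_diff_bound:
  fixes f g :: "'g \<Rightarrow> 'a::{banach,second_countable_topology}"
  assumes "f \<in> cc" "g \<in> cc" and C: "compact C" "\<And>t. t \<notin> C \<Longrightarrow> f t = 0" "\<And>t. t \<notin> C \<Longrightarrow> g t = 0"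
    and d: "\<And>t. norm (f t - g t) \<le> d"
  shows "norm ((LINT t|m. f t) - (LINT t|m. g t)) \<le> d * measure m C"
proof -
  have "(\<lambda>t. f t + (- 1) *\<^sub>R g t) \<in> cc"
    by (intro cc_add assms cc_map[OF assms(2)] continuous_intros ccD[OF assms(2)]) auto
  then have "(\<lambda>t. f t - g t) \<in> cc" by simp
  then have "norm (LINT t|m. f t - g t) \<le> d * measure m C"
    by (rule integral_bound[OF _ C(1)]) (use C d in auto)
  then show ?thesis using assms(1,2) by (simp add: cc_integrable)
qed

text \<open>Fubini without \<open>\<sigma>\<close>-finiteness: \<open>F\<close> is uniformly approximated by sums \<open>\<Sum>\<^sub>i u\<^sub>i(s) F(s\<^sub>i, t)\<close>.\<close>

lemma fubini:
  fixes F :: "'g \<times> 'g \<Rightarrow> 'a::{banach,second_countable_topology}"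
  assumes F: "continuous_on UNIV F" and K: "compact K" "compact L"
    and z: "\<And>s t. s \<notin> K \<or> t \<notin> L \<Longrightarrow> F (s, t) = 0"
  shows "(LINT s|m. LINT t|m. F (s, t)) = (LINT t|m. LINT s|m. F (s, t))"
proof -
  obtain V C where V: "open V" "compact C" "K \<subseteq> V" "V \<subseteq> C" using compact_nbhd[OF K(1)] by blast
  define M where "M = measure m C * measure m L + 1"
  have M: "M > 0" by (simp add: M_def add_nonneg_pos)
  have F': "continuous_on UNIV (\<lambda>(t, s). F (s, t))"
    by (auto simp: split_beta' intro!: continuous_on_compose2[OF F] continuous_intros)
  have sl1: "(\<lambda>t. F (s, t)) \<in> cc" for s
    by (rule ccI[OF _ K(2)]) (use z in \<open>auto intro!: continuous_on_compose2[OF F] continuous_intros\<close>)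
  have sl2: "(\<lambda>s. F (s, t)) \<in> cc" for t
    by (rule ccI[OF _ K(1)]) (use z in \<open>auto intro!: continuous_on_compose2[OF F] continuous_intros\<close>)
  have c1: "(\<lambda>s. LINT t|m. F (s, t)) \<in> cc" by (rule integral_cc[OF F K z])
  have c2: "(\<lambda>t. LINT s|m. F (s, t)) \<in> cc"
    using integral_cc[OF F' K(2,1)] z by auto
  have *: "norm ((LINT s|m. LINT t|m. F (s, t)) - (LINT t|m. LINT s|m. F (s, t))) \<le> e" if e: "e > 0" for e
  proof -
    define d where "d = e / (2 * M)"
    have d: "d > 0" using e M by (simp add: d_def)
    have "\<exists>X. s \<in> X \<and> open X \<and> (\<forall>s'\<in>X. \<forall>t\<in>L. dist (F (s', t)) (F (s, t)) \<le> d)" for s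
    proof -
      obtain X where "s \<in> X" "open X" "\<forall>x\<in>X \<inter> UNIV. \<forall>t\<in>L. dist (F (x, t)) (F (s, t)) \<le> d"
        by (rule continuous_on_prod_compactE[OF continuous_on_subset[OF F subset_UNIV] K(2) UNIV_I d])
      then show ?thesis by blast
    qed
    then obtain U where U: "\<And>s. s \<in> U s \<and> open (U s)" "\<And>s s' t. s' \<in> U s \<Longrightarrow> t \<in> L \<Longrightarrow> dist (F (s', t)) (F (s, t)) \<le> d"
      by metis
    obtain I :: "'g set" and u :: "'g \<Rightarrow> 'g \<Rightarrow> real" where I: "finite I" "I \<subseteq> K"
      and u: "\<And>i. continuous_on UNIV (u i)" "\<And>i t. 0 \<le> u i t"
        "\<And>i t. i \<in> I \<Longrightarrow> u i t \<noteq> 0 \<Longrightarrow> t \<in> U i \<and> t \<in> V"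
        "\<And>t. (\<Sum>i\<in>I. u i t) \<le> 1" "\<And>t. t \<in> K \<Longrightarrow> (\<Sum>i\<in>I. u i t) = 1"
      by (rule partition[OF K(1) V(1,3), of U]) (use U(1) in auto)
    define G where "G s t = (\<Sum>i\<in>I. u i s *\<^sub>R F (i, t))" for s t
    have app: "norm (F (s, t) - G s t) \<le> d" for s t
    proof (cases "t \<in> L")
      case False
      then show ?thesis using z d by (simp add: G_def)
    next
      case True
      have "F (s, t) - G s t = (\<Sum>i\<in>I. u i s *\<^sub>R (F (s, t) - F (i, t)))"
      proof (cases "s \<in> K")
        case True
        then have "F (s, t) = (\<Sum>i\<in>I. u i s) *\<^sub>R F (s, t)" using u(5) by simp
        also have "\<dots> = (\<Sum>i\<in>I. u i s *\<^sub>R F (s, t))" by (rule scaleR_sum_left)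
        finally show ?thesis by (simp add: G_def scaleR_diff_right sum_subtractf)
      next
        case False
        then show ?thesis using z by (simp add: G_def sum_negf)
      qed
      also have "norm \<dots> \<le> (\<Sum>i\<in>I. u i s * d)"
      proof (rule sum_norm_le)
        fix i assume i: "i \<in> I"
        show "norm (u i s *\<^sub>R (F (s, t) - F (i, t))) \<le> u i s * d"
          using u(3)[OF i, of s] U(2)[of s i t] True u(2)[of i s]
          by (cases "u i s = 0") (auto simp: dist_norm intro!: mult_left_mono)
      qed
      also have "\<dots> = (\<Sum>i\<in>I. u i s) * d" by (simp add: sum_distrib_right)
      also have "\<dots> \<le> 1 * d" using u(4) d by (intro mult_right_mono) auto
      finally show ?thesis by simp
    qed
    have uC: "u i s = 0" if "i \<in> I" "s \<notin> C" for i s using u(3)[OF that(1), of s] V that by auto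
    have ucc: "u i \<in> cc" if "i \<in> I" for i by (rule ccI[OF u(1) V(2)]) (rule uC[OF that])
    have G1: "(\<lambda>s. G s t) \<in> cc" for t unfolding G_def
    proof (rule cc_sum)
      fix i assume "i \<in> I"
      then show "(\<lambda>s. u i s *\<^sub>R F (i, t)) \<in> cc" by (intro cc_scaleR_left ucc)
    qed
    have G2: "(\<lambda>t. G s t) \<in> cc" for s unfolding G_def
    proof (rule cc_sum)
      fix i
      show "(\<lambda>t. u i s *\<^sub>R F (i, t)) \<in> cc" by (rule cc_scaleR_right[OF sl1])
    qed
    have iG2: "(LINT t|m. G s t) = (\<Sum>i\<in>I. u i s *\<^sub>R (LINT t|m. F (i, t)))" for s
      unfolding G_def by (subst Bochner_Integration.integral_sum) (auto simp: cc_integrable[OF sl1])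
    have iG1: "(LINT s|m. G s t) = (\<Sum>i\<in>I. (LINT s|m. u i s) *\<^sub>R F (i, t))" for t
      unfolding G_def by (subst Bochner_Integration.integral_sum) (auto simp: cc_integrable[OF ucc] intro!: sum.cong)
    have G12: "(LINT s|m. LINT t|m. G s t) = (LINT t|m. LINT s|m. G s t)"
      unfolding iG1 iG2
      by (subst (1 2) Bochner_Integration.integral_sum) (auto simp: cc_integrable[OF ucc] cc_integrable[OF sl1] intro!: sum.cong)
    have i1: "(\<lambda>s. LINT t|m. G s t) \<in> cc" unfolding iG2
    proof (rule cc_sum)
      fix i assume "i \<in> I"
      then show "(\<lambda>s. u i s *\<^sub>R (LINT t|m. F (i, t))) \<in> cc" by (intro cc_scaleR_left ucc)
    qed
    have i2: "(\<lambda>t. LINT s|m. G s t) \<in> cc" unfolding iG1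
    proof (rule cc_sum)
      fix i
      show "(\<lambda>t. (LINT s|m. u i s) *\<^sub>R F (i, t)) \<in> cc" by (rule cc_scaleR_right[OF sl1])
    qed
    have GL: "G s t = 0" if "t \<notin> L" for s t using that z by (simp add: G_def)
    have GC: "G s t = 0" if "s \<notin> C" for s t using that uC by (simp add: G_def)
    have FC: "F (s, t) = 0" if "s \<notin> C" for s t using that z V by auto
    have "norm ((LINT s|m. LINT t|m. F (s, t)) - (LINT s|m. LINT t|m. G s t)) \<le> (d * measure m L) * measure m C"
    proof (rule integral_diff_bound[OF c1 i1 V(2)])
      fix s show "norm ((LINT t|m. F (s, t)) - (LINT t|m. G s t)) \<le> d * measure m L"
        by (rule integral_diff_bound[OF sl1 G2 K(2)]) (use z GL app in auto)
    qed (use FC GC in auto)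
    moreover have "norm ((LINT t|m. LINT s|m. F (s, t)) - (LINT t|m. LINT s|m. G s t)) \<le> (d * measure m C) * measure m L"
    proof (rule integral_diff_bound[OF c2 i2 K(2)])
      fix t show "norm ((LINT s|m. F (s, t)) - (LINT s|m. G s t)) \<le> d * measure m C"
        by (rule integral_diff_bound[OF sl2 G1 V(2)]) (use FC GC app in auto)
    qed (use z GL in auto)
    moreover have "norm ((LINT s|m. LINT t|m. F (s, t)) - (LINT t|m. LINT s|m. F (s, t)))
      \<le> norm ((LINT s|m. LINT t|m. F (s, t)) - (LINT s|m. LINT t|m. G s t))
        + norm ((LINT t|m. LINT s|m. F (s, t)) - (LINT t|m. LINT s|m. G s t))"
      using norm_triangle_ineq4[of "(LINT s|m. LINT t|m. F (s, t)) - (LINT s|m. LINT t|m. G s t)"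
        "(LINT t|m. LINT s|m. F (s, t)) - (LINT t|m. LINT s|m. G s t)"] unfolding G12 by simp
    ultimately have "norm ((LINT s|m. LINT t|m. F (s, t)) - (LINT t|m. LINT s|m. F (s, t)))
      \<le> (d * measure m L) * measure m C + (d * measure m C) * measure m L" by linarith
    also have "\<dots> = 2 * d * (measure m C * measure m L)" by (simp add: algebra_simps)
    also have "\<dots> \<le> 2 * d * M" using d by (intro mult_left_mono) (auto simp: M_def)
    also have "\<dots> = e" using M by (simp add: d_def)
    finally show ?thesis .
  qed
  have "norm ((LINT s|m. LINT t|m. F (s, t)) - (LINT t|m. LINT s|m. F (s, t))) \<le> 0"
    by (rule field_le_epsilon) (simp add: *)
  then show ?thesis by simp
qed

text \<open>Inner regularity of the whole space yields a compact set of positive measure, whose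
  indicator is dominated by a bump function.\<close>

lemma positive_integral_exists:
  "\<exists>\<phi> :: 'g \<Rightarrow> real. \<phi> \<in> cc \<and> (\<forall>t. 0 \<le> \<phi> t) \<and> (LINT t|m. \<phi> t) > 0"
proof -
  have ne: "emeasure m UNIV \<noteq> 0" using haar unfolding haar_measure_def by blast
  have "\<forall>U. open U \<longrightarrow> emeasure m U = (SUP K\<in>{K. compact K \<and> K \<subseteq> U}. emeasure m K)"
    using haar unfolding haar_measure_def by blast
  then have sup: "emeasure m UNIV = (SUP K\<in>{K. compact K \<and> K \<subseteq> UNIV}. emeasure m K)" by blast
  have "\<exists>K. compact K \<and> emeasure m K \<noteq> 0"
  proof (rule ccontr)
    assume "\<not> ?thesis"
    then have "(SUP K\<in>{K. compact K \<and> K \<subseteq> UNIV}. emeasure m K) = 0"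
      by (intro antisym SUP_least) auto
    then show False using ne sup by simp
  qed
  then obtain K where K: "compact K" "emeasure m K \<noteq> 0" by blast
  obtain V C where V: "open V" "compact C" "K \<subseteq> V" "V \<subseteq> C" using compact_nbhd[OF K(1)] by blast
  obtain \<phi> :: "'g \<Rightarrow> real" where \<phi>: "continuous_on UNIV \<phi>" "\<And>t. 0 \<le> \<phi> t" "\<And>t. t \<in> K \<Longrightarrow> \<phi> t = 1"
    "\<And>t. t \<notin> V \<Longrightarrow> \<phi> t = 0" using bump[OF K(1) V(1,3)] by blast
  have cc: "\<phi> \<in> cc" by (rule ccI[OF \<phi>(1) V(2)]) (use \<phi>(4) V in auto)
  have "measure m K = (LINT t|m. indicator K t)" using compact_sets[OF K(1)] by simp
  also have "\<dots> \<le> (LINT t|m. \<phi> t)"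
  proof (rule integral_mono[OF _ cc_integrable[OF cc]])
    show "integrable m (indicator K :: 'g \<Rightarrow> real)"
      using compact_sets[OF K(1)] emeasure_compact[OF K(1)] by simp
  qed (auto simp: indicator_def \<phi>)
  finally have "measure m K \<le> (LINT t|m. \<phi> t)" .
  moreover have "measure m K > 0"
    using K emeasure_compact[OF K(1)] by (simp add: measure_def enn2real_positive_iff less_top zero_less_iff_neq_zero)
  ultimately show ?thesis using cc \<phi> by (intro exI[of _ \<phi>]) auto
qed

text \<open>The uniqueness argument for Haar measure: the product of the integrals of \<phi> and of
  the reflected \<open>f\<close> is the double integral of \<phi>(s) f(s - t). Interchanging the
  integrals, substituting s + t for s and interchanging again turns it into the product of the
  integrals of \<phi> and \<open>f\<close>.\<close>

lemma integral_reflect: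
  fixes f :: "'g \<Rightarrow> 'a::{banach,second_countable_topology}"
  assumes f: "f \<in> cc"
  shows "(LINT t|m. f (- t)) = (LINT t|m. f t)"
proof -
  obtain \<phi> :: "'g \<Rightarrow> real" where \<phi>: "\<phi> \<in> cc" "(LINT t|m. \<phi> t) > 0" using positive_integral_exists by blast
  obtain K L where K: "compact K" "\<And>t. t \<notin> K \<Longrightarrow> \<phi> t = 0" and L: "compact L" "\<And>t. t \<notin> L \<Longrightarrow> f t = 0"
    using cc_support[OF \<phi>(1)] cc_support[OF f] by blast
  note cf = ccD[OF f] and c\<phi> = ccD[OF \<phi>(1)]
  have "(LINT t|m. \<phi> t) *\<^sub>R (LINT t|m. f (- t)) = (LINT s|m. \<phi> s *\<^sub>R (LINT t|m. f (- t)))"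
    using \<phi> by (simp add: cc_integrable)
  also have "\<dots> = (LINT s|m. LINT t|m. \<phi> s *\<^sub>R f (s - t))"
  proof (rule Bochner_Integration.integral_cong[OF refl])
    fix s
    have "(LINT t|m. f (- t)) = (LINT t|m. f (- (t - s)))"
      by (rule integral_translate'[symmetric]) (intro ccD cc_reflect f)
    then show "\<phi> s *\<^sub>R (LINT t|m. f (- t)) = (LINT t|m. \<phi> s *\<^sub>R f (s - t))" by simp
  qed
  also have "\<dots> = (LINT t|m. LINT s|m. \<phi> s *\<^sub>R f (s - t))"
  proof -
    have "continuous_on UNIV (\<lambda>(s, t). \<phi> s *\<^sub>R f (s - t))"
      by (auto simp: split_beta' intro!: continuous_intros continuous_on_compose2[OF cf] continuous_on_compose2[OF c\<phi>])
    moreover have "(\<lambda>(s, t). \<phi> s *\<^sub>R f (s - t)) (s, t) = 0"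
      if "s \<notin> K \<or> t \<notin> (\<lambda>(s, t). s + t) ` (K \<times> uminus ` L)" for s t
    proof (rule ccontr)
      assume "\<not> ?thesis"
      then have "s \<in> K" "s - t \<in> L" using K(2)[of s] L(2)[of "s - t"] by auto
      then have "(\<lambda>(s, t). s + t) (s, - (s - t)) \<in> (\<lambda>(s, t). s + t) ` (K \<times> uminus ` L)" by blast
      then show False using that \<open>s \<in> K\<close> by simp
    qed
    ultimately show ?thesis
      using fubini[of "\<lambda>(s, t). \<phi> s *\<^sub>R f (s - t)" K "(\<lambda>(s, t). s + t) ` (K \<times> uminus ` L)"]
        compact_plus[OF K(1) compact_uminus[OF L(1)]] K(1) by simp
  qed
  also have "\<dots> = (LINT t|m. LINT s|m. \<phi> (s + t) *\<^sub>R f s)"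
  proof (rule Bochner_Integration.integral_cong[OF refl])
    fix t
    have "(LINT s|m. \<phi> (s + t) *\<^sub>R f (s + t - t)) = (LINT s|m. \<phi> s *\<^sub>R f (s - t))"
      by (rule integral_translate)
        (intro continuous_intros continuous_on_compose2[OF cf] continuous_on_compose2[OF c\<phi>]; simp)
    then show "(LINT s|m. \<phi> s *\<^sub>R f (s - t)) = (LINT s|m. \<phi> (s + t) *\<^sub>R f s)" by simp
  qed
  also have "\<dots> = (LINT s|m. LINT t|m. \<phi> (s + t) *\<^sub>R f s)"
  proof -
    have "continuous_on UNIV (\<lambda>(s, t). \<phi> (s + t) *\<^sub>R f s)"
      by (auto simp: split_beta' intro!: continuous_intros continuous_on_compose2[OF cf] continuous_on_compose2[OF c\<phi>])
    moreover have "(\<lambda>(s, t). \<phi> (s + t) *\<^sub>R f s) (s, t) = 0"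
      if "s \<notin> L \<or> t \<notin> (\<lambda>(s, t). s + t) ` (K \<times> uminus ` L)" for s t
    proof (rule ccontr)
      assume "\<not> ?thesis"
      then have "s + t \<in> K" "s \<in> L" using K(2)[of "s + t"] L(2)[of s] by auto
      then have "(\<lambda>(s, t). s + t) (s + t, - s) \<in> (\<lambda>(s, t). s + t) ` (K \<times> uminus ` L)" by blast
      then show False using that \<open>s \<in> L\<close> by simp
    qed
    ultimately show ?thesis
      using fubini[of "\<lambda>(s, t). \<phi> (s + t) *\<^sub>R f s" L "(\<lambda>(s, t). s + t) ` (K \<times> uminus ` L)"]
        compact_plus[OF K(1) compact_uminus[OF L(1)]] L(1) by simp
  qed
  also have "\<dots> = (LINT s|m. (LINT t|m. \<phi> t) *\<^sub>R f s)"
  proof (rule Bochner_Integration.integral_cong[OF refl])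
    fix s
    have "(LINT t|m. \<phi> (t + s)) = (LINT t|m. \<phi> t)" by (rule integral_translate[OF c\<phi>])
    moreover have "integrable m (\<lambda>t. \<phi> (t + s))" by (intro cc_integrable cc_translate \<phi>)
    ultimately show "(LINT t|m. \<phi> (s + t) *\<^sub>R f s) = (LINT t|m. \<phi> t) *\<^sub>R f s"
      by (simp add: add.commute)
  qed
  also have "\<dots> = (LINT t|m. \<phi> t) *\<^sub>R (LINT t|m. f t)" by simp
  finally show ?thesis using \<phi>(2) by simp
qed

lemma L1_translate_continuous:
  fixes f :: "'g \<Rightarrow> 'a::{real_normed_vector}"
  assumes f: "f \<in> cc" and e: "e > 0"
  shows "\<exists>X. open X \<and> t0 \<in> X \<and> (\<forall>t\<in>X. (LINT s|m. norm (f (s - t) - f (s - t0))) < e)"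
proof -
  obtain L where L: "compact L" "\<And>t. t \<notin> L \<Longrightarrow> f t = 0" using cc_support[OF f] by blast
  obtain V C where V: "open V" "compact C" "{t0} \<subseteq> V" "V \<subseteq> C" using compact_nbhd[of "{t0}"] by auto
  define F where "F = (\<lambda>(t, s). norm (f (s - t) - f (s - t0)))"
  have "continuous_on UNIV F" unfolding F_def split_beta'
    by (intro continuous_intros continuous_on_compose2[OF ccD[OF f]]) auto
  moreover have "compact ((\<lambda>(s, t). s + t) ` (L \<times> C))" by (rule compact_plus[OF L(1) V(2)])
  moreover have "F (t, s) = 0" if t: "t \<in> V" and s: "s \<notin> (\<lambda>(s, t). s + t) ` (L \<times> C)" for t s
  proof -
    have "s - x \<notin> L" if "x \<in> C" for x
    proof
      assume "s - x \<in> L"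
      then have "(s - x, x) \<in> L \<times> C" using that by simp
      then show False using s by (force simp: image_iff)
    qed
    then have "s - t \<notin> L" "s - t0 \<notin> L" using t V by auto
    then show ?thesis by (simp add: F_def L(2))
  qed
  ultimately have "\<exists>X. open X \<and> t0 \<in> X \<and> X \<subseteq> V \<and>
      (\<forall>t\<in>X. norm ((LINT s|m. F (t, s)) - (LINT s|m. F (t0, s))) < e)"
    using V(1,3) e by (intro integral_continuous) auto
  then obtain X where X: "open X" "t0 \<in> X"
    "\<forall>t\<in>X. norm ((LINT s|m. F (t, s)) - (LINT s|m. F (t0, s))) < e" by (elim exE conjE)
  have "(LINT s|m. norm (f (s - t) - f (s - t0))) < e" if "t \<in> X" for t
  proof -
    have "(LINT s|m. F (t0, s)) = 0" by (simp add: F_def)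
    then have "\<bar>LINT s|m. F (t, s)\<bar> < e" using bspec[OF X(3) that] by simp
    then show ?thesis by (simp add: F_def)
  qed
  then show ?thesis using X by blast
qed

end

section \<open>The Cuntz algebra and its vacuum state\<close>

locale cuntz =
  fixes S :: "nat \<Rightarrow> 'o::{cstar_algebra, real_normed_algebra_1}"
  assumes cuntz: "is_cuntz_infinity S"
begin

lemma S_rel: "star (S i) * S k = (if i = k then 1 else 0)"
  using cuntz by (simp add: is_cuntz_infinity_def)

lemma norm_S [simp]: "norm (S i) = 1"
proof -
  have "(norm (S i))\<^sup>2 = 1" using S_rel[of i i] by (simp add: cstar_identity[symmetric])
  then show ?thesis using norm_ge_zero[of "S i"] by (simp add: power2_eq_1_iff)
qed

definition Sw :: "nat list \<Rightarrow> 'o" where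
  "Sw w = prod_list (map S w)"

lemma Sw_simps [simp]: "Sw [] = 1" "Sw (i # w) = S i * Sw w" "Sw (v @ w) = Sw v * Sw w"
  by (simp_all add: Sw_def)

lemma Sw_append: "star (Sw v) * Sw (v @ w) = Sw w"
proof (induction v)
  case (Cons i v)
  have "star (Sw (i # v)) * Sw ((i # v) @ w) = star (Sw v) * ((star (S i) * S i) * Sw (v @ w))"
    by (simp add: star_mult mult.assoc)
  then show ?case using Cons by (simp add: S_rel)
qed simp

lemma Sw_prefix_cases:
  obtains \<rho> where "w = v @ \<rho>" "star (Sw v) * Sw w = Sw \<rho>"
  | \<rho> where "\<rho> \<noteq> []" "v = w @ \<rho>" "star (Sw v) * Sw w = star (Sw \<rho>)"
  | "v \<noteq> w" "star (Sw v) * Sw w = 0"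
proof -
  have "(\<exists>\<rho>. w = v @ \<rho>) \<or> (\<exists>\<rho>. \<rho> \<noteq> [] \<and> v = w @ \<rho>) \<or> v \<noteq> w \<and> star (Sw v) * Sw w = 0"
  proof (induction v arbitrary: w)
    case (Cons i v)
    show ?case
    proof (cases w)
      case w: (Cons k u)
      have "star (Sw (i # v)) * Sw w = star (Sw v) * ((star (S i) * S k) * Sw u)"
        by (simp add: w star_mult mult.assoc)
      then show ?thesis using Cons.IH[of u] by (auto simp: w S_rel)
    qed simp
  qed simp
  then consider "\<exists>\<rho>. w = v @ \<rho>" | "\<exists>\<rho>. \<rho> \<noteq> [] \<and> v = w @ \<rho>" | "v \<noteq> w" "star (Sw v) * Sw w = 0" by blast
  then show thesis
  proof cases
    case 1
    then obtain \<rho> where "w = v @ \<rho>" by blast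
    then show thesis using that(1)[of \<rho>] Sw_append[of v \<rho>] by simp
  next
    case 2
    then obtain \<rho> where r: "\<rho> \<noteq> []" "v = w @ \<rho>" by blast
    have "star (star (Sw w) * Sw (w @ \<rho>)) = star (Sw \<rho>)" by (simp only: Sw_append)
    then have "star (Sw v) * Sw w = star (Sw \<rho>)" unfolding r(2) star_mult star_star .
    then show thesis using that(2) r by blast
  qed (use that(3) in blast)
qed

text \<open>Adjoint letters are moved to the right by cancelling them against the generator that
  follows.\<close>

lemma letters_reduce:
  "prod_list (map (eval_letter S) w) = 0 \<or> (\<exists>\<mu> \<nu>. prod_list (map (eval_letter S) w) = Sw \<mu> * star (Sw \<nu>))"
proof (induction w)
  case Nil
  show ?case by (auto intro!: exI[of _ "[]"])
next
  case (Cons l w)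
  show ?case
  proof (cases "prod_list (map (eval_letter S) w) = 0")
    case False
    then obtain \<mu> \<nu> where w: "prod_list (map (eval_letter S) w) = Sw \<mu> * star (Sw \<nu>)" using Cons by blast
    show ?thesis
    proof (cases l)
      case (Gen i)
      then have "prod_list (map (eval_letter S) (l # w)) = Sw (i # \<mu>) * star (Sw \<nu>)"
        by (simp add: w mult.assoc)
      then show ?thesis by blast
    next
      case (Adj i)
      show ?thesis
      proof (cases \<mu>)
        case Nil
        have "prod_list (map (eval_letter S) (l # w)) = Sw [] * star (Sw (\<nu> @ [i]))"
          by (simp add: Adj w Nil star_mult)
        then show ?thesis by blast
      next
        case (Cons k \<mu>')
        have "prod_list (map (eval_letter S) (l # w)) = (star (S i) * S k) * (Sw \<mu>' * star (Sw \<nu>))"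
          by (simp add: Adj w Cons mult.assoc)
        then have "prod_list (map (eval_letter S) (l # w)) = 0
            \<or> prod_list (map (eval_letter S) (l # w)) = Sw \<mu>' * star (Sw \<nu>)"
          by (simp add: S_rel)
        then show ?thesis by blast
      qed
    qed
  qed simp
qed

lemma dense_words:
  assumes X: "closed X" "0 \<in> X" "\<And>x y. x \<in> X \<Longrightarrow> y \<in> X \<Longrightarrow> x + y \<in> X"
    and W: "\<And>c \<mu> \<nu>. c *\<^sub>C (Sw \<mu> * star (Sw \<nu>)) \<in> X"
  shows "X = UNIV"
proof -
  have sum: "(\<Sum>w\<in>I. f w) \<in> X" if "\<And>w. w \<in> I \<Longrightarrow> f w \<in> X" for I and f :: "letter list \<Rightarrow> 'o"
    using that by (induction I rule: infinite_finite_induct) (auto intro: X)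
  have "free_eval S f \<in> X" for f
    unfolding free_eval_def
  proof (rule sum)
    fix w
    show "f w *\<^sub>C prod_list (map (eval_letter S) w) \<in> X" using letters_reduce[of w] W X(2) by auto
  qed
  then have "closure (free_eval S ` free_alg) \<subseteq> X" by (intro closure_minimal X) auto
  then show ?thesis using cuntz by (auto simp: is_cuntz_infinity_def)
qed

text \<open>Convergence of the compressions by S_i to a scalar as \<open>i\<close> leaves all finite
  sets. The vacuum state is defined as this limit, so it needs no prior Fock representation.\<close>

definition vlim :: "'o \<Rightarrow> complex \<Rightarrow> bool" where
  "vlim x c \<longleftrightarrow> (\<forall>e>0. \<exists>\<Lambda>. finite \<Lambda> \<and> (\<forall>i. i \<notin> \<Lambda> \<longrightarrow> norm (star (S i) * x * S i - c *\<^sub>C 1) < e))"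

lemma vlim_bound:
  assumes "vlim x c" shows "cmod c \<le> norm x"
proof (rule field_le_epsilon)
  fix e :: real assume "e > 0"
  then obtain \<Lambda> where \<Lambda>: "finite \<Lambda>" "\<And>i. i \<notin> \<Lambda> \<Longrightarrow> norm (star (S i) * x * S i - c *\<^sub>C 1) < e"
    using assms unfolding vlim_def by metis
  obtain i where i: "i \<notin> \<Lambda>" using ex_new_if_finite[OF infinite_UNIV_nat \<Lambda>(1)] by blast
  have "norm (star (S i) * x * S i) \<le> norm (star (S i) * x) * norm (S i)" by (rule norm_mult_ineq)
  also have "\<dots> \<le> norm x" using norm_mult_ineq[of "star (S i)" x] by simp
  finally have "norm (star (S i) * x * S i) \<le> norm x" .
  moreover have "norm (c *\<^sub>C (1::'o)) - norm (star (S i) * x * S i) \<le> norm (star (S i) * x * S i - c *\<^sub>C 1)"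
    by (metis norm_minus_commute norm_triangle_ineq2)
  ultimately show "cmod c \<le> norm x + e" using \<Lambda>(2)[OF i] by (simp add: norm_scaleC)
qed

lemma vlim_add:
  assumes x: "vlim x c" and y: "vlim y d" shows "vlim (x + y) (c + d)"
  unfolding vlim_def
proof (intro allI impI)
  fix e :: real assume e: "e > 0"
  then have e2: "e/2 > 0" by simp
  obtain \<Lambda> where \<Lambda>: "finite \<Lambda>" "\<And>i. i \<notin> \<Lambda> \<Longrightarrow> norm (star (S i) * x * S i - c *\<^sub>C 1) < e/2"
    using x e2 unfolding vlim_def by metis
  obtain \<Lambda>' where \<Lambda>': "finite \<Lambda>'" "\<And>i. i \<notin> \<Lambda>' \<Longrightarrow> norm (star (S i) * y * S i - d *\<^sub>C 1) < e/2"
    using y e2 unfolding vlim_def by metis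
  show "\<exists>\<Lambda>. finite \<Lambda> \<and> (\<forall>i. i \<notin> \<Lambda> \<longrightarrow> norm (star (S i) * (x + y) * S i - (c + d) *\<^sub>C 1) < e)"
  proof (intro exI[of _ "\<Lambda> \<union> \<Lambda>'"] conjI allI impI)
    fix i assume i: "i \<notin> \<Lambda> \<union> \<Lambda>'"
    have "star (S i) * (x + y) * S i - (c + d) *\<^sub>C 1
      = (star (S i) * x * S i - c *\<^sub>C 1) + (star (S i) * y * S i - d *\<^sub>C 1)"
      by (simp add: algebra_simps scaleC_add_left)
    also have "norm \<dots> \<le> norm (star (S i) * x * S i - c *\<^sub>C 1) + norm (star (S i) * y * S i - d *\<^sub>C 1)"
      by (rule norm_triangle_ineq)
    also have "\<dots> < e" using \<Lambda>(2)[of i] \<Lambda>'(2)[of i] i by simp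
    finally show "norm (star (S i) * (x + y) * S i - (c + d) *\<^sub>C 1) < e" .
  qed (use \<Lambda> \<Lambda>' in simp)
qed

lemma vlim_scale:
  assumes x: "vlim x c" shows "vlim (d *\<^sub>C x) (d * c)"
  unfolding vlim_def
proof (intro allI impI)
  fix e :: real assume e: "e > 0"
  have "e / (cmod d + 1) > 0" using e by (simp add: add_nonneg_pos)
  then obtain \<Lambda> where \<Lambda>: "finite \<Lambda>" "\<And>i. i \<notin> \<Lambda> \<Longrightarrow> norm (star (S i) * x * S i - c *\<^sub>C 1) < e / (cmod d + 1)"
    using x unfolding vlim_def by metis
  have "norm (star (S i) * (d *\<^sub>C x) * S i - (d * c) *\<^sub>C 1) < e" if "i \<notin> \<Lambda>" for i
  proof -
    have "star (S i) * (d *\<^sub>C x) * S i - (d * c) *\<^sub>C 1 = d *\<^sub>C (star (S i) * x * S i - c *\<^sub>C 1)"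
      by (simp add: mult_scaleC_left mult_scaleC_right scaleC_diff_right scaleC_scaleC)
    then have "norm (star (S i) * (d *\<^sub>C x) * S i - (d * c) *\<^sub>C 1) \<le> cmod d * (e / (cmod d + 1))"
      unfolding norm_scaleC by (simp only: norm_scaleC) (intro mult_left_mono less_imp_le \<Lambda>(2) that norm_ge_zero)
    also have "\<dots> < (cmod d + 1) * (e / (cmod d + 1))" using e by (intro mult_strict_right_mono) (auto simp: add_nonneg_pos)
    also have "\<dots> = e" by (simp add: add_nonneg_eq_0_iff)
    finally show ?thesis .
  qed
  then show "\<exists>\<Lambda>. finite \<Lambda> \<and> (\<forall>i. i \<notin> \<Lambda> \<longrightarrow> norm (star (S i) * (d *\<^sub>C x) * S i - (d * c) *\<^sub>C 1) < e)"
    using \<Lambda>(1) by blast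
qed

lemma vlim_unique: "vlim x c \<Longrightarrow> vlim x d \<Longrightarrow> c = d"
  using vlim_bound[of "x + (-1) *\<^sub>C x" "c + (-1) * d"] vlim_add[of x c "(-1) *\<^sub>C x" "(-1) * d"] vlim_scale[of x d "-1"]
  by simp

lemma vlim_word: "vlim (Sw \<mu> * star (Sw \<nu>)) (if \<mu> = [] \<and> \<nu> = [] then 1 else 0)"
proof -
  have "star (S i) * (Sw \<mu> * star (Sw \<nu>)) * S i = (if \<mu> = [] \<and> \<nu> = [] then 1 else 0)"
    if i: "i \<notin> set \<mu> \<union> set \<nu>" for i
  proof (cases \<mu>)
    case Nil
    show ?thesis
    proof (cases \<nu>)
      case \<nu>: (Cons k v)
      have "star (S i) * (Sw \<mu> * star (Sw \<nu>)) * S i = star (S i) * (star (Sw v) * (star (S k) * S i))"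
        by (simp add: Nil \<nu> star_mult mult.assoc)
      then show ?thesis using i \<nu> by (auto simp: S_rel)
    qed (use Nil in \<open>simp add: S_rel\<close>)
  next
    case (Cons k v)
    have "star (S i) * (Sw \<mu> * star (Sw \<nu>)) * S i = (star (S i) * S k) * (Sw v * star (Sw \<nu>) * S i)"
      by (simp add: Cons mult.assoc)
    then show ?thesis using i Cons by (auto simp: S_rel)
  qed
  then show ?thesis unfolding vlim_def by (intro allI impI exI[of _ "set \<mu> \<union> set \<nu>"]) auto
qed

text \<open>Compressions of a fixed word are constant for all but finitely many \<open>i\<close>,
  and \<open>vlim_bound\<close> turns convergent sequences of elements into Cauchy sequences of
  limits; so the elements that have a limit form a closed subspace containing all words.\<close>

lemma vlim_exists: "\<exists>c. vlim x c"
proof -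
  have "{x. \<exists>c. vlim x c} = UNIV"
  proof (rule dense_words)
    show "closed {x. \<exists>c. vlim x c}" unfolding closed_sequential_limits
    proof (intro allI impI, elim conjE)
      fix x l assume x: "\<forall>n. x n \<in> {x. \<exists>c. vlim x c}" "x \<longlonglongrightarrow> l"
      then obtain c where c: "\<And>n. vlim (x n) (c n)" by (auto simp: choice_iff)
      have "vlim (x n - x k) (c n - c k)" for n k
        using vlim_add[OF c[of n] vlim_scale[OF c[of k], of "-1"]] by simp
      then have cle: "cmod (c n - c k) \<le> norm (x n - x k)" for n k by (rule vlim_bound)
      have "Cauchy c"
      proof (rule metric_CauchyI)
        fix e :: real assume "e > 0"
        then obtain N where "\<forall>m\<ge>N. \<forall>n\<ge>N. dist (x m) (x n) < e"
          using metric_CauchyD[OF LIMSEQ_imp_Cauchy[OF x(2)]] by metis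
        then show "\<exists>N. \<forall>m\<ge>N. \<forall>n\<ge>N. dist (c m) (c n) < e"
          using cle unfolding dist_norm by (meson le_less_trans)
      qed
      then obtain d where d: "c \<longlonglongrightarrow> d" using Cauchy_convergent convergent_def by metis
      have "vlim l d" unfolding vlim_def
      proof (intro allI impI)
        fix e :: real assume e: "e > 0"
        have "(\<lambda>n. norm (l - x n) + cmod (c n - d)) \<longlonglongrightarrow> norm (l - l) + cmod (d - d)"
          by (intro tendsto_intros x d)
        then have "(\<lambda>n. norm (l - x n) + cmod (c n - d)) \<longlonglongrightarrow> 0" by simp
        then have "\<forall>\<^sub>F n in sequentially. norm (l - x n) + cmod (c n - d) < e/2"
          by (rule order_tendstoD(2)) (use e in simp)
        then obtain n where n: "norm (l - x n) + cmod (c n - d) < e/2"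
          by (auto simp: eventually_sequentially)
        have "e/2 > 0" using e by simp
        then obtain \<Lambda> where \<Lambda>: "finite \<Lambda>" "\<And>i. i \<notin> \<Lambda> \<Longrightarrow> norm (star (S i) * x n * S i - c n *\<^sub>C 1) < e/2"
          using c[of n] unfolding vlim_def by metis
        have "norm (star (S i) * l * S i - d *\<^sub>C 1) < e" if i: "i \<notin> \<Lambda>" for i
        proof -
          have "star (S i) * l * S i - d *\<^sub>C 1 = star (S i) * (l - x n) * S i
            + (star (S i) * x n * S i - c n *\<^sub>C 1) + (c n - d) *\<^sub>C 1"
            by (simp add: algebra_simps scaleC_diff_left)
          also have "norm \<dots> \<le> norm (star (S i) * (l - x n) * S i)
            + norm (star (S i) * x n * S i - c n *\<^sub>C 1) + norm ((c n - d) *\<^sub>C (1::'o))"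
            by (intro order_trans[OF norm_triangle_ineq] add_right_mono norm_triangle_ineq)
          also have "norm (star (S i) * (l - x n) * S i) \<le> norm (l - x n)"
            using norm_mult_ineq[of "star (S i) * (l - x n)" "S i"] norm_mult_ineq[of "star (S i)" "l - x n"] by simp
          finally show ?thesis using \<Lambda>(2)[OF i] n by (simp add: norm_scaleC)
        qed
        then show "\<exists>\<Lambda>. finite \<Lambda> \<and> (\<forall>i. i \<notin> \<Lambda> \<longrightarrow> norm (star (S i) * l * S i - d *\<^sub>C 1) < e)"
          using \<Lambda>(1) by blast
      qed
      then show "l \<in> {x. \<exists>c. vlim x c}" by blast
    qed
    have "vlim 0 0" unfolding vlim_def by auto
    then show "0 \<in> {x. \<exists>c. vlim x c}" by blast
    show "c *\<^sub>C (Sw \<mu> * star (Sw \<nu>)) \<in> {x. \<exists>c. vlim x c}" for c \<mu> \<nu>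
      using vlim_scale[OF vlim_word] by blast
  qed (use vlim_add in blast)
  then show ?thesis by auto
qed

definition vac :: "'o \<Rightarrow> complex" where
  "vac x = (THE c. vlim x c)"

lemma vlim_vac: "vlim x (vac x)"
  unfolding vac_def using vlim_exists[of x] vlim_unique by (metis theI)

lemma vac_eqI: "vlim x c \<Longrightarrow> vac x = c"
  using vlim_vac vlim_unique by blast

lemma vac_add: "vac (x + y) = vac x + vac y"
  by (intro vac_eqI vlim_add vlim_vac)

lemma vac_scale: "vac (c *\<^sub>C x) = c * vac x"
  by (intro vac_eqI vlim_scale vlim_vac)

lemma vac_bound: "cmod (vac x) \<le> norm x"
  by (rule vlim_bound[OF vlim_vac])

lemma vac_word: "vac (Sw \<mu> * star (Sw \<nu>)) = (if \<mu> = [] \<and> \<nu> = [] then 1 else 0)"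
  by (rule vac_eqI[OF vlim_word])

lemma vac_sum: "vac (\<Sum>i\<in>I. f i) = (\<Sum>i\<in>I. vac (f i))"
proof -
  have "vac 0 = 0" using vac_scale[of 0 0] by simp
  then show ?thesis by (induction I rule: infinite_finite_induct) (auto simp: vac_add)
qed

lemma vac_cont: "continuous_on A vac"
  by (rule linear_continuous_on)
    (rule bounded_linear_intro[of _ 1],
     auto simp: vac_add vac_bound scaleR_scaleC[where 'a='o] vac_scale scaleR_conv_of_real)

lemma vac_gram:
  "vac (star (Sw \<mu> * star (Sw \<nu>)) * (Sw \<mu>' * star (Sw \<nu>'))) = (if \<nu> = [] \<and> \<nu>' = [] \<and> \<mu> = \<mu>' then 1 else 0)"
proof -
  have e: "star (Sw \<mu> * star (Sw \<nu>)) * (Sw \<mu>' * star (Sw \<nu>')) = Sw \<nu> * (star (Sw \<mu>) * Sw \<mu>') * star (Sw \<nu>')"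
    by (simp add: star_mult star_star mult.assoc)
  show ?thesis
  proof (cases rule: Sw_prefix_cases[of \<mu>' \<mu>])
    case (1 \<rho>)
    then have "star (Sw \<mu> * star (Sw \<nu>)) * (Sw \<mu>' * star (Sw \<nu>')) = Sw (\<nu> @ \<rho>) * star (Sw \<nu>')"
      unfolding e by simp
    then show ?thesis using 1 by (simp only: vac_word) auto
  next
    case (2 \<rho>)
    then have "star (Sw \<mu> * star (Sw \<nu>)) * (Sw \<mu>' * star (Sw \<nu>')) = Sw \<nu> * star (Sw (\<nu>' @ \<rho>))"
      unfolding e by (simp add: star_mult mult.assoc)
    then show ?thesis using 2 by (simp only: vac_word) auto
  next
    case 3
    then have "star (Sw \<mu> * star (Sw \<nu>)) * (Sw \<mu>' * star (Sw \<nu>')) = 0" unfolding e by simp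
    then show ?thesis using 3 vac_scale[of 0 0] by simp
  qed
qed

section \<open>Positivity of the vacuum state\<close>

definition wcomb :: "(nat list \<times> nat list) set \<Rightarrow> (nat list \<times> nat list \<Rightarrow> complex) \<Rightarrow> 'o" where
  "wcomb P c = (\<Sum>p\<in>P. c p *\<^sub>C (Sw (fst p) * star (Sw (snd p))))"

lemma wcomb_extend:
  assumes "finite Q" "P \<subseteq> Q"
  shows "wcomb P c = wcomb Q (\<lambda>p. if p \<in> P then c p else 0)"
  unfolding wcomb_def by (rule sum.mono_neutral_cong_left) (use assms in auto)

text \<open>By \<open>vac_gram\<close> the words with empty second component are orthonormal for
  \<open>vac\<close> and all others are null vectors.\<close>

lemma vac_wcomb_pos:
  assumes "finite P"
  shows "vac (star (wcomb P c) * wcomb P c) = complex_of_real (\<Sum>p\<in>P. if snd p = [] then (cmod (c p))\<^sup>2 else 0)"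
proof -
  have "vac (star (wcomb P c) * wcomb P c) = (\<Sum>p\<in>P. \<Sum>q\<in>P. (c q * cnj (c p))
      * vac (star (Sw (fst p) * star (Sw (snd p))) * (Sw (fst q) * star (Sw (snd q)))))"
    unfolding wcomb_def star_sum sum_distrib_left sum_distrib_right star_scaleC
    by (subst sum.swap) (simp add: vac_sum mult_scaleC_left mult_scaleC_right vac_scale mult_ac)
  also have "\<dots> = (\<Sum>p\<in>P. \<Sum>q\<in>P. if q = p then (if snd p = [] then c p * cnj (c p) else 0) else 0)"
  proof (rule sum.cong[OF refl], rule sum.cong[OF refl])
    fix p q :: "nat list \<times> nat list"
    show "c q * cnj (c p) * vac (star (Sw (fst p) * star (Sw (snd p))) * (Sw (fst q) * star (Sw (snd q))))
      = (if q = p then (if snd p = [] then c p * cnj (c p) else 0) else 0)"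
      unfolding vac_gram by (cases p; cases q) auto
  qed
  also have "\<dots> = (\<Sum>p\<in>P. if snd p = [] then complex_of_real ((cmod (c p))\<^sup>2) else 0)"
    using assms by (simp only: sum.delta complex_norm_square) simp
  finally show ?thesis by (simp add: if_distrib[of complex_of_real] cong: if_cong)
qed

lemma vac_pos: "0 \<le> Re (vac (star x * x))" "Im (vac (star x * x)) = 0"
proof -
  define D where "D = {wcomb P c | P c. finite P}"
  have "closure D = UNIV"
  proof (rule dense_words)
    have D0: "0 \<in> D" unfolding D_def by (auto simp: wcomb_def intro!: exI[of _ "{}"])
    then show "closed (closure D)" "0 \<in> closure D" using closure_subset by auto
    have Dadd: "u + v \<in> D" if u: "u \<in> D" and v: "v \<in> D" for u v
    proof -
      obtain P c Q d where "finite P" "finite Q" and e: "u = wcomb P c" "v = wcomb Q d"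
        using u v unfolding D_def by blast
      then have f: "finite (P \<union> Q)" by simp
      have "u + v = wcomb (P \<union> Q) (\<lambda>p. (if p \<in> P then c p else 0) + (if p \<in> Q then d p else 0))"
        using wcomb_extend[OF f, of P c] wcomb_extend[OF f, of Q d]
        unfolding e by (simp add: wcomb_def scaleC_add_left sum.distrib)
      then show ?thesis unfolding D_def using f by blast
    qed
    fix x y assume "x \<in> closure D" "y \<in> closure D"
    then obtain f g where "\<forall>n. f n \<in> D" "f \<longlonglongrightarrow> x" "\<forall>n. g n \<in> D" "g \<longlonglongrightarrow> y"
      unfolding closure_sequential by metis
    then have "\<forall>n. f n + g n \<in> D" "(\<lambda>n. f n + g n) \<longlonglongrightarrow> x + y" using Dadd by (auto intro: tendsto_add)
    then show "x + y \<in> closure D" unfolding closure_sequential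
      by (intro exI[of _ "\<lambda>n. f n + g n"]) simp
  next
    fix c \<mu> \<nu>
    have "c *\<^sub>C (Sw \<mu> * star (Sw \<nu>)) = wcomb {(\<mu>, \<nu>)} (\<lambda>_. c)" by (simp add: wcomb_def)
    then have "c *\<^sub>C (Sw \<mu> * star (Sw \<nu>)) \<in> D" unfolding D_def by blast
    then show "c *\<^sub>C (Sw \<mu> * star (Sw \<nu>)) \<in> closure D" using closure_subset by blast
  qed
  then have x: "x \<in> closure D" by simp
  have cont: "continuous_on UNIV (\<lambda>x. vac (star x * x))"
    by (intro continuous_on_compose2[OF vac_cont[of UNIV]] continuous_intros) auto
  have "closed {x. 0 \<le> Re (vac (star x * x)) \<and> Im (vac (star x * x)) = 0}"
    by (intro closed_Collect_conj closed_Collect_le closed_Collect_eq continuous_intros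
        continuous_on_Re continuous_on_Im cont)
  moreover have "D \<subseteq> {x. 0 \<le> Re (vac (star x * x)) \<and> Im (vac (star x * x)) = 0}"
    unfolding D_def by (auto simp: vac_wcomb_pos intro!: sum_nonneg)
  ultimately have "closure D \<subseteq> {x. 0 \<le> Re (vac (star x * x)) \<and> Im (vac (star x * x)) = 0}"
    by (intro closure_minimal)
  then show "0 \<le> Re (vac (star x * x))" "Im (vac (star x * x)) = 0" using x by auto
qed

sublocale vac: positive_functional vac
  by unfold_locales (simp_all add: vac_add vac_scale vac_pos vac_bound)

lemma vac_one: "vac 1 = 1"
  using vac_word[of "[]" "[]"] by simp

lemma vac_star: "vac (star x) = cnj (vac x)"
  using vac.hermitian[of x 1] by simp

lemma vac_S_left: "vac (S i * x) = 0"
proof -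
  have "{x. vac (S i * x) = 0} = UNIV"
  proof (rule dense_words)
    show "closed {x. vac (S i * x) = 0}"
      by (intro closed_Collect_eq continuous_intros continuous_on_compose2[OF vac_cont[of UNIV]]) auto
    show "0 \<in> {x. vac (S i * x) = 0}" by simp
    show "c *\<^sub>C (Sw \<mu> * star (Sw \<nu>)) \<in> {x. vac (S i * x) = 0}" for c \<mu> \<nu>
      using vac_word[of "i # \<mu>" \<nu>] by (simp add: mult_scaleC_right vac_scale mult.assoc)
  qed (auto simp: distrib_left vac_add)
  then show ?thesis by auto
qed

end

section \<open>Quasi-free actions\<close>

locale quasi_free = cuntz S + haar_group m
  for S :: "nat \<Rightarrow> 'o::{cstar_algebra, real_normed_algebra_1, second_countable_topology}"
    and m :: "'g::{topological_ab_group_add,t2_space} measure" +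
  fixes \<omega> :: "nat \<Rightarrow> 'g dual" and \<alpha> :: "'g \<Rightarrow> 'o \<Rightarrow> 'o"
  assumes qf: "is_quasi_free_action S \<omega> \<alpha>"
begin

lemma al_add: "\<alpha> t (x + y) = \<alpha> t x + \<alpha> t y"
  and al_scale: "\<alpha> t (c *\<^sub>C x) = c *\<^sub>C \<alpha> t x"
  and al_mult: "\<alpha> t (x * y) = \<alpha> t x * \<alpha> t y"
  and al_star: "\<alpha> t (star x) = star (\<alpha> t x)"
  and al_bij: "bij (\<alpha> t)"
  and al_comp: "\<alpha> (s + t) x = \<alpha> s (\<alpha> t x)"
  and al_cont1: "continuous_on UNIV (\<lambda>t. \<alpha> t x)"
  and al_S: "\<alpha> t (S i) = pairing t (\<omega> i) *\<^sub>C S i"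
  using qf by (auto simp: is_quasi_free_action_def cstar_action_def star_automorphism_def)

lemma al_one: "\<alpha> t 1 = 1"
proof -
  obtain x where "\<alpha> t x = 1" using al_bij[of t] by (metis bij_pointE)
  then show ?thesis using al_mult[of t x 1] by simp
qed

lemma al_zero: "\<alpha> 0 x = x"
  using al_comp[of 0 0 x] bij_is_inj[OF al_bij[of 0]] by (metis add.right_neutral injD)

lemma al_minus: "\<alpha> (- t) (\<alpha> t x) = x" "\<alpha> t (\<alpha> (- t) x) = x"
  using al_comp[of "- t" t x] al_comp[of t "- t" x] by (simp_all add: al_zero)

lemma al_diff: "\<alpha> t (x - y) = \<alpha> t x - \<alpha> t y"
  using al_add[of t x "(-1) *\<^sub>C y"] al_scale[of t "-1" y] by simp

lemma al_zero_right [simp]: "\<alpha> t 0 = 0"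
  using al_scale[of t 0 0] by simp

lemma norm_al: "norm (\<alpha> t x) = norm x"
proof (rule antisym)
  have *: "norm (\<alpha> t x) \<le> norm x" for t x
    by (rule star_hom_contractive) (simp_all add: al_one al_add al_scale al_mult al_star)
  show "norm (\<alpha> t x) \<le> norm x" by (rule *)
  show "norm x \<le> norm (\<alpha> t x)" using *[of "- t" "\<alpha> t x"] by (simp add: al_minus)
qed

lemma al_bounded_linear: "bounded_linear (\<alpha> t)"
  by (rule bounded_linear_intro[of _ 1])
    (auto simp: al_add norm_al scaleR_scaleC[where 'a='o] al_scale)

text \<open>Strong continuity becomes joint continuity because each automorphism is
  isometric.\<close>

lemma al_cont:
  fixes f :: "'x::topological_space \<Rightarrow> 'g" and g :: "'x \<Rightarrow> 'o"
  assumes f: "continuous_on X f" and g: "continuous_on X g"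
  shows "continuous_on X (\<lambda>x. \<alpha> (f x) (g x))"
  unfolding continuous_on_def
proof
  fix x0 assume x0: "x0 \<in> X"
  show "((\<lambda>x. \<alpha> (f x) (g x)) \<longlongrightarrow> \<alpha> (f x0) (g x0)) (at x0 within X)"
  proof -
    have "continuous_on X (\<lambda>x. \<alpha> (f x) (g x0))"
      by (rule continuous_on_compose2[OF al_cont1 f]) auto
    then have 1: "((\<lambda>x. \<alpha> (f x) (g x0)) \<longlongrightarrow> \<alpha> (f x0) (g x0)) (at x0 within X)"
      using x0 by (simp add: continuous_on_def)
    have "((\<lambda>x. g x - g x0) \<longlongrightarrow> 0) (at x0 within X)"
      using g x0 by (simp add: continuous_on_def LIM_zero_iff)
    then have "((\<lambda>x. norm (g x - g x0)) \<longlongrightarrow> 0) (at x0 within X)" by (rule tendsto_norm_zero)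
    then have "((\<lambda>x. norm (\<alpha> (f x) (g x) - \<alpha> (f x) (g x0))) \<longlongrightarrow> 0) (at x0 within X)"
      by (simp add: al_diff[symmetric] norm_al)
    then have "((\<lambda>x. \<alpha> (f x) (g x) - \<alpha> (f x) (g x0)) \<longlongrightarrow> 0) (at x0 within X)"
      by (rule tendsto_norm_zero_cancel)
    from tendsto_add[OF 1 this] show ?thesis by simp
  qed
qed

lemma pairing_cont: "continuous_on X f \<Longrightarrow> continuous_on X (\<lambda>x. pairing (f x) \<gamma>)"
  unfolding pairing_def by (rule continuous_on_compose2[OF char_of_facts(1)]) auto

lemma pairing_simps [simp]:
  "pairing (s + t) \<gamma> = pairing s \<gamma> * pairing t \<gamma>" "cmod (pairing t \<gamma>) = 1"
  "pairing 0 \<gamma> = 1" "pairing t 0 = 1" "pairing t (\<gamma> + \<delta>) = pairing t \<gamma> * pairing t \<delta>"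
  "pairing t (- \<gamma>) = cnj (pairing t \<gamma>)" "pairing (- t) \<gamma> = cnj (pairing t \<gamma>)"
proof -
  have a: "pairing (s + t) \<gamma> = pairing s \<gamma> * pairing t \<gamma>" for s t by (simp add: pairing_def char_of_facts)
  have b: "cmod (pairing t \<gamma>) = 1" for t by (simp add: pairing_def char_of_facts)
  have c: "pairing 0 \<gamma> = 1"
  proof -
    have "pairing 0 \<gamma> \<noteq> 0" using b[of 0] by auto
    then show ?thesis using a[of 0 0] by simp
  qed
  show "pairing t 0 = 1" "pairing t (\<gamma> + \<delta>) = pairing t \<gamma> * pairing t \<delta>" "pairing t (- \<gamma>) = cnj (pairing t \<gamma>)"
    by (simp_all add: pairing_def char_of_zero char_of_plus char_of_uminus)
  show "pairing (s + t) \<gamma> = pairing s \<gamma> * pairing t \<gamma>" "cmod (pairing t \<gamma>) = 1" "pairing 0 \<gamma> = 1"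
    by (fact a b c)+
  have "pairing t \<gamma> * pairing (- t) \<gamma> = 1" using a[of t "- t"] c by simp
  moreover have "pairing t \<gamma> * cnj (pairing t \<gamma>) = 1"
    using complex_norm_square[of "pairing t \<gamma>"] b[of t] by simp
  ultimately show "pairing (- t) \<gamma> = cnj (pairing t \<gamma>)"
    by (metis mult.commute mult.left_neutral mult.assoc)
qed

lemma pairing_cnj [simp]: "cnj (pairing t \<gamma>) * pairing t \<gamma> = 1" "pairing t \<gamma> * cnj (pairing t \<gamma>) = 1"
  using complex_norm_square[of "pairing t \<gamma>"] by (simp_all add: mult.commute)

lemma al_Sw: "\<alpha> t (Sw w) = pairing t (word_sum \<omega> w) *\<^sub>C Sw w"
  by (induction w)
    (simp_all add: word_sum_def al_one al_mult al_S mult_scaleC_left mult_scaleC_right scaleC_scaleC mult.commute)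

lemma vac_al: "vac (\<alpha> t x) = vac x"
proof -
  have "{x. vac (\<alpha> t x) = vac x} = UNIV"
  proof (rule dense_words)
    show "closed {x. vac (\<alpha> t x) = vac x}"
      by (intro closed_Collect_eq continuous_on_compose2[OF vac_cont[of UNIV]] al_cont continuous_intros vac_cont) auto
    show "c *\<^sub>C (Sw \<mu> * star (Sw \<nu>)) \<in> {x. vac (\<alpha> t x) = vac x}" for c \<mu> \<nu>
      by (auto simp: al_scale al_mult al_star al_Sw star_scaleC mult_scaleC_left mult_scaleC_right
          scaleC_scaleC vac_scale vac_word word_sum_def)
  qed (auto simp: al_add vac_add)
  then show ?thesis by auto
qed

lemma snorm_al: "vac.snorm (\<alpha> t x) = vac.snorm x"
  by (simp add: vac.snorm_def al_star[symmetric] al_mult[symmetric] vac_al)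

end

section \<open>Covariant representations on the vacuum space\<close>

text \<open>\<open>Rep \<gamma> f\<close> is the integrated form of the covariant representation in which the algebra acts by left
  multiplication on the GNS space of \<open>vac\<close> and \<open>t\<close> acts by \<open>\<langle>t | \<gamma>\<rangle> \<alpha>\<^sub>t\<close>.\<close>

context quasi_free
begin

definition Rep :: "'g dual \<Rightarrow> ('g \<Rightarrow> 'o) \<Rightarrow> 'o \<Rightarrow> 'o" where
  "Rep \<gamma> f b = (LINT t|m. pairing t \<gamma> *\<^sub>C (f t * \<alpha> t b))"

lemma Rep_integrand:
  assumes f: "f \<in> cc" shows "(\<lambda>t. pairing t \<gamma> *\<^sub>C (f t * \<alpha> t b)) \<in> cc"
  by (rule cc_map[OF f, of "\<lambda>t x. pairing t \<gamma> *\<^sub>C (x * \<alpha> t b)"])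
    (auto intro!: continuous_intros pairing_cont al_cont ccD[OF f])

lemmas Rep_integrable = cc_integrable[OF Rep_integrand]

lemma cc_mult_in:
  assumes f: "f \<in> cc" and g: "g \<in> cc" shows "cc_mult m \<alpha> f g \<in> cc"
proof -
  obtain K L where K: "compact K" "\<And>t. t \<notin> K \<Longrightarrow> f t = 0" and L: "compact L" "\<And>t. t \<notin> L \<Longrightarrow> g t = 0"
    using cc_support[OF f] cc_support[OF g] by blast
  have "(\<lambda>t. LINT s|m. (\<lambda>(t, s). f s * \<alpha> s (g (t - s))) (t, s)) \<in> cc"
  proof (rule integral_cc[of _ "(\<lambda>(s, t). s + t) ` (K \<times> L)" K])
    show "continuous_on UNIV (\<lambda>(t, s). f s * \<alpha> s (g (t - s)))"
      unfolding split_beta'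
      by (intro continuous_intros al_cont continuous_on_compose2[OF ccD[OF f]]
          continuous_on_compose2[OF ccD[OF g]]) auto
    fix t s assume "t \<notin> (\<lambda>(s, t). s + t) ` (K \<times> L) \<or> s \<notin> K"
    then have "s \<notin> K \<or> t - s \<notin> L"
    proof
      assume t: "t \<notin> (\<lambda>(s, t). s + t) ` (K \<times> L)"
      show ?thesis
      proof (rule ccontr)
        assume "\<not> ?thesis"
        then have "(\<lambda>(s, t). s + t) (s, t - s) \<in> (\<lambda>(s, t). s + t) ` (K \<times> L)" by blast
        then show False using t by simp
      qed
    qed simp
    then show "(\<lambda>(t, s). f s * \<alpha> s (g (t - s))) (t, s) = 0" using K(2)[of s] L(2)[of "t - s"] by auto
  qed (intro compact_plus K L)+
  then show ?thesis by (simp add: cc_mult_def[abs_def])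
qed

lemma cc_star_in:
  assumes f: "f \<in> cc" shows "cc_star \<alpha> f \<in> cc"
  unfolding cc_star_def[abs_def]
  by (rule cc_map[OF cc_reflect[OF f], of "\<lambda>t x. \<alpha> t (star x)"])
    (simp_all add: al_cont continuous_on_star ccD[OF cc_reflect[OF f]] continuous_on_id)

lemma cc_scaleC: "f \<in> cc \<Longrightarrow> (\<lambda>t. c *\<^sub>C f t) \<in> cc" for f :: "'g \<Rightarrow> 'o"
  by (rule cc_map[of f "\<lambda>_ x. c *\<^sub>C x"]) (auto intro: continuous_intros ccD)

lemma Rep_add: "f \<in> cc \<Longrightarrow> g \<in> cc \<Longrightarrow> Rep \<gamma> (\<lambda>t. f t + g t) b = Rep \<gamma> f b + Rep \<gamma> g b"
  by (simp add: Rep_def distrib_right scaleC_add_right Rep_integrable)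

lemma Rep_scale:
  assumes f: "f \<in> cc" shows "Rep \<gamma> (\<lambda>t. c *\<^sub>C f t) b = c *\<^sub>C Rep \<gamma> f b"
proof -
  have "Rep \<gamma> (\<lambda>t. c *\<^sub>C f t) b = (LINT t|m. c *\<^sub>C (pairing t \<gamma> *\<^sub>C (f t * \<alpha> t b)))"
    by (simp add: Rep_def mult_scaleC_left scaleC_scaleC mult.commute)
  also have "\<dots> = c *\<^sub>C Rep \<gamma> f b"
    unfolding Rep_def by (rule integral_bounded_linear[OF bounded_linear_scaleC_right Rep_integrable[OF f]])
  finally show ?thesis .
qed

lemma Rep_mult:
  assumes f: "f \<in> cc" and g: "g \<in> cc"
  shows "Rep \<gamma> (cc_mult m \<alpha> f g) b = Rep \<gamma> f (Rep \<gamma> g b)"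
proof -
  obtain K L where K: "compact K" "\<And>t. t \<notin> K \<Longrightarrow> f t = 0" and L: "compact L" "\<And>t. t \<notin> L \<Longrightarrow> g t = 0"
    using cc_support[OF f] cc_support[OF g] by blast
  define F where "F = (\<lambda>(t, s). pairing t \<gamma> *\<^sub>C (f s * \<alpha> s (g (t - s)) * \<alpha> t b))"
  have Fc: "continuous_on UNIV F" unfolding F_def split_beta'
    by (intro continuous_intros pairing_cont al_cont continuous_on_compose2[OF ccD[OF f]]
          continuous_on_compose2[OF ccD[OF g]]) auto
  have F0: "F (t, s) = 0" if "t \<notin> (\<lambda>(s, t). s + t) ` (K \<times> L) \<or> s \<notin> K" for t s
  proof -
    have "s \<notin> K \<or> t - s \<notin> L"
    proof (rule ccontr)
      assume "\<not> ?thesis"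
      then have "(\<lambda>(s, t). s + t) (s, t - s) \<in> (\<lambda>(s, t). s + t) ` (K \<times> L)" "s \<in> K" by blast+
      then show False using that by simp
    qed
    then show ?thesis using K(2)[of s] L(2)[of "t - s"] by (auto simp: F_def)
  qed
  have blin: "bounded_linear (\<lambda>x. pairing t \<gamma> *\<^sub>C (x * \<alpha> t b))" for t
    by (intro bounded_linear_compose[OF bounded_linear_scaleC_right bounded_linear_mult_left])
  have ig: "integrable m (\<lambda>s. f s * \<alpha> s (g (t - s)))" for t
  proof (rule cc_integrable, rule cc_map[OF f, of "\<lambda>s x. x * \<alpha> s (g (t - s))"])
    show "continuous_on UNIV (\<lambda>s. f s * \<alpha> s (g (t - s)))"
      by (intro continuous_intros al_cont ccD[OF f] continuous_on_compose2[OF ccD[OF g]]) auto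
  qed simp
  have "Rep \<gamma> (cc_mult m \<alpha> f g) b = (LINT t|m. LINT s|m. F (t, s))"
    unfolding Rep_def cc_mult_def F_def
    by (intro Bochner_Integration.integral_cong refl)
      (simp add: integral_bounded_linear[OF blin ig, symmetric])
  also have "\<dots> = (LINT s|m. LINT t|m. F (t, s))"
    by (rule fubini[OF Fc compact_plus[OF K(1) L(1)] K(1) F0])
  also have "\<dots> = Rep \<gamma> f (Rep \<gamma> g b)"
    unfolding Rep_def[of \<gamma> f]
  proof (intro Bochner_Integration.integral_cong refl)
    fix s
    have bl: "bounded_linear (\<lambda>x. pairing s \<gamma> *\<^sub>C (f s * \<alpha> s x))"
      by (intro bounded_linear_compose[OF bounded_linear_scaleC_right]
          bounded_linear_compose[OF bounded_linear_mult_right] al_bounded_linear)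
    have "(LINT t|m. F (t, s)) = (LINT t|m. F (t + s, s))"
      by (rule integral_translate[symmetric])
        (auto intro!: continuous_on_compose2[OF Fc] continuous_intros)
    also have "\<dots> = (LINT t|m. pairing s \<gamma> *\<^sub>C (f s * \<alpha> s (pairing t \<gamma> *\<^sub>C (g t * \<alpha> t b))))"
    proof (intro Bochner_Integration.integral_cong refl)
      fix t
      have "\<alpha> (t + s) b = \<alpha> s (\<alpha> t b)" by (metis add.commute al_comp)
      then show "F (t + s, s) = pairing s \<gamma> *\<^sub>C (f s * \<alpha> s (pairing t \<gamma> *\<^sub>C (g t * \<alpha> t b)))"
        by (simp add: F_def al_scale al_mult mult_scaleC_right scaleC_scaleC mult.assoc mult.commute)
    qed
    also have "\<dots> = pairing s \<gamma> *\<^sub>C (f s * \<alpha> s (Rep \<gamma> g b))"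
      unfolding Rep_def by (rule integral_bounded_linear[OF bl Rep_integrable[OF g]])
    finally show "(LINT t|m. F (t, s)) = pairing s \<gamma> *\<^sub>C (f s * \<alpha> s (Rep \<gamma> g b))" .
  qed
  finally show ?thesis .
qed

lemma vac_inner_bounded_linear:
  "bounded_linear (\<lambda>x. vac (star b * x))" "bounded_linear (\<lambda>x. vac (star x * b))"
  by (intro bounded_linear_compose[OF vac.bounded_linear] bounded_linear_mult_right)
    (intro bounded_linear_compose[OF vac.bounded_linear]
      bounded_linear_compose[OF bounded_linear_mult_left bounded_linear_star])

text \<open>The substitution of -t for t is \<open>integral_reflect\<close>, and the automorphism is
  moved from one side of the inner product to the other by invariance of \<open>vac\<close>.\<close>

lemma Rep_adjoint:
  assumes f: "f \<in> cc"
  shows "vac (star (Rep \<gamma> f a) * b) = vac (star a * Rep \<gamma> (cc_star \<alpha> f) b)"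
proof -
  define h where "h t = vac (star (pairing t \<gamma> *\<^sub>C (f t * \<alpha> t a)) * b)" for t
  have h: "h \<in> cc" unfolding h_def
    by (rule cc_map[OF Rep_integrand[OF f, of \<gamma> a], of "\<lambda>_ x. vac (star x * b)"])
      (auto intro!: continuous_on_compose2[OF vac_cont[of UNIV]] continuous_on_mult continuous_on_star
        continuous_on_const ccD[OF Rep_integrand[OF f]])
  have "vac (star (Rep \<gamma> f a) * b) = (LINT t|m. h t)"
    unfolding Rep_def h_def by (rule integral_bounded_linear[OF vac_inner_bounded_linear(2) Rep_integrable[OF f], symmetric])
  also have "\<dots> = (LINT t|m. h (- t))" by (rule integral_reflect[OF h, symmetric])
  also have "\<dots> = (LINT t|m. vac (star a * (pairing t \<gamma> *\<^sub>C (cc_star \<alpha> f t * \<alpha> t b))))"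
  proof (intro Bochner_Integration.integral_cong refl)
    fix t
    have "h (- t) = pairing t \<gamma> * vac (star (\<alpha> (- t) a) * star (f (- t)) * b)"
      by (simp add: h_def star_scaleC star_mult mult_scaleC_left vac_scale)
    also have "vac (star (\<alpha> (- t) a) * star (f (- t)) * b) = vac (\<alpha> t (star (\<alpha> (- t) a) * star (f (- t)) * b))"
      by (simp add: vac_al)
    also have "\<alpha> t (star (\<alpha> (- t) a) * star (f (- t)) * b) = star a * (cc_star \<alpha> f t * \<alpha> t b)"
      by (simp add: al_mult al_star al_minus cc_star_def mult.assoc)
    finally show "h (- t) = vac (star a * (pairing t \<gamma> *\<^sub>C (cc_star \<alpha> f t * \<alpha> t b)))"
      by (simp add: mult_scaleC_right vac_scale)
  qed
  also have "\<dots> = vac (star a * Rep \<gamma> (cc_star \<alpha> f) b)"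
    unfolding Rep_def
    by (rule integral_bounded_linear[OF vac_inner_bounded_linear(1) Rep_integrable[OF cc_star_in[OF f]]])
  finally show ?thesis .
qed

lemma Rep_bound:
  assumes f: "f \<in> cc"
  shows "vac.snorm (Rep \<gamma> f b) \<le> (LINT t|m. norm (f t)) * vac.snorm b"
proof -
  define c where "c = Rep \<gamma> f b"
  have int: "integrable m (\<lambda>t. vac (star c * (pairing t \<gamma> *\<^sub>C (f t * \<alpha> t b))))"
    by (rule integrable_bounded_linear[OF vac_inner_bounded_linear(1) Rep_integrable[OF f]])
  have intn: "integrable m (\<lambda>t. norm (f t))" by (intro cc_integrable cc_norm f)
  have "complex_of_real ((vac.snorm c)\<^sup>2) = vac (star c * Rep \<gamma> f b)" by (simp only: vac.snorm_sq_complex c_def)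
  also have "\<dots> = (LINT t|m. vac (star c * (pairing t \<gamma> *\<^sub>C (f t * \<alpha> t b))))"
    unfolding Rep_def by (rule integral_bounded_linear[OF vac_inner_bounded_linear(1) Rep_integrable[OF f], symmetric])
  finally have "(vac.snorm c)\<^sup>2 = norm (LINT t|m. vac (star c * (pairing t \<gamma> *\<^sub>C (f t * \<alpha> t b))))"
    by (metis norm_of_real abs_power2)
  also have "\<dots> \<le> (LINT t|m. norm (vac (star c * (pairing t \<gamma> *\<^sub>C (f t * \<alpha> t b)))))"
    by (rule integral_norm_bound)
  also have "\<dots> \<le> (LINT t|m. norm (f t) * (vac.snorm c * vac.snorm b))"
  proof (rule integral_mono)
    show "integrable m (\<lambda>t. norm (vac (star c * (pairing t \<gamma> *\<^sub>C (f t * \<alpha> t b)))))" using int by simp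
    show "integrable m (\<lambda>t. norm (f t) * (vac.snorm c * vac.snorm b))" using intn by simp
    fix t
    have "norm (vac (star c * (pairing t \<gamma> *\<^sub>C (f t * \<alpha> t b)))) \<le> vac.snorm c * vac.snorm (pairing t \<gamma> *\<^sub>C (f t * \<alpha> t b))"
      by (rule vac.cauchy_schwarz)
    also have "vac.snorm (pairing t \<gamma> *\<^sub>C (f t * \<alpha> t b)) \<le> norm (f t) * vac.snorm b"
      using vac.snorm_mult[of "f t" "\<alpha> t b"] by (simp add: vac.snorm_scale snorm_al)
    finally show "norm (vac (star c * (pairing t \<gamma> *\<^sub>C (f t * \<alpha> t b)))) \<le> norm (f t) * (vac.snorm c * vac.snorm b)"
      by (simp add: mult_left_mono mult.left_commute)
  qed
  also have "\<dots> = (LINT t|m. norm (f t)) * (vac.snorm c * vac.snorm b)" by simp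
  finally have *: "vac.snorm c * vac.snorm c \<le> vac.snorm c * ((LINT t|m. norm (f t)) * vac.snorm b)"
    by (simp add: power2_eq_square algebra_simps)
  have L0: "0 \<le> (LINT t|m. norm (f t))" by (rule Bochner_Integration.integral_nonneg) simp
  have "vac.snorm c \<le> (LINT t|m. norm (f t)) * vac.snorm b"
  proof (cases "vac.snorm c = 0")
    case True
    then show ?thesis using L0 by simp
  next
    case False
    then have "vac.snorm c > 0" using vac.snorm_nonneg[of c] by linarith
    then show ?thesis using * by simp
  qed
  then show ?thesis by (simp add: c_def)
qed

text \<open>The operator norm on the GNS space of \<open>vac\<close>. As a C*-seminorm dominated by
  the L1-norm it is a candidate in the universal property of the crossed product.\<close>

definition repnorm :: "'g dual \<Rightarrow> ('g \<Rightarrow> 'o) \<Rightarrow> real" where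
  "repnorm \<gamma> f = (SUP b\<in>{b. vac.snorm b \<le> 1}. vac.snorm (Rep \<gamma> f b))"

lemma Rep_scale_right: "f \<in> cc \<Longrightarrow> Rep \<gamma> f (c *\<^sub>C b) = c *\<^sub>C Rep \<gamma> f b"
  using Rep_scale[of f \<gamma> c b] by (simp add: Rep_def al_scale mult_scaleC_left mult_scaleC_right)

lemma L1_nonneg: "0 \<le> (LINT t|m. norm (f t :: 'c::real_normed_vector))"
  by (rule Bochner_Integration.integral_nonneg) simp

lemma repnorm_le:
  assumes "\<And>b. vac.snorm (Rep \<gamma> f b) \<le> C * vac.snorm b" "0 \<le> C"
  shows "repnorm \<gamma> f \<le> C"
  unfolding repnorm_def
proof (rule cSUP_least)
  show "{b::'o. vac.snorm b \<le> 1} \<noteq> {}" by (auto intro!: exI[of _ 0])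
  fix b assume "b \<in> {b. vac.snorm b \<le> 1}"
  then have "C * vac.snorm b \<le> C * 1" using assms(2) by (intro mult_left_mono) auto
  then show "vac.snorm (Rep \<gamma> f b) \<le> C" using assms(1)[of b] by simp
qed

lemma repnorm_ge:
  assumes f: "f \<in> cc" shows "vac.snorm (Rep \<gamma> f b) \<le> repnorm \<gamma> f * vac.snorm b"
proof (cases "vac.snorm b = 0")
  case True
  then show ?thesis using Rep_bound[OF f, of \<gamma> b] by simp
next
  case False
  then have p: "vac.snorm b > 0" using vac.snorm_nonneg[of b] by linarith
  let ?b = "complex_of_real (1 / vac.snorm b) *\<^sub>C b"
  have bdd: "bdd_above ((\<lambda>b. vac.snorm (Rep \<gamma> f b)) ` {b. vac.snorm b \<le> 1})"
  proof (rule bdd_aboveI2)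
    fix b assume "b \<in> {b. vac.snorm b \<le> 1}"
    then have "(LINT t|m. norm (f t)) * vac.snorm b \<le> (LINT t|m. norm (f t)) * 1"
      using L1_nonneg by (intro mult_left_mono) auto
    then show "vac.snorm (Rep \<gamma> f b) \<le> (LINT t|m. norm (f t))" using Rep_bound[OF f, of \<gamma> b] by simp
  qed
  have "vac.snorm (Rep \<gamma> f ?b) \<le> repnorm \<gamma> f"
    unfolding repnorm_def by (rule cSUP_upper[OF _ bdd]) (use p in \<open>simp add: vac.snorm_scale norm_divide\<close>)
  moreover have "vac.snorm (Rep \<gamma> f ?b) = vac.snorm (Rep \<gamma> f b) / vac.snorm b"
    using p by (simp add: Rep_scale_right[OF f] vac.snorm_scale norm_divide)
  ultimately show ?thesis using p by (simp add: divide_le_eq)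
qed

lemma repnorm_nonneg: assumes f: "f \<in> cc" shows "0 \<le> repnorm \<gamma> f"
proof -
  have "vac.snorm 1 = 1" by (simp add: vac.snorm_def vac_one)
  then have "vac.snorm (Rep \<gamma> f 1) \<le> repnorm \<gamma> f" using repnorm_ge[OF f, of \<gamma> 1] by simp
  then show ?thesis by (rule order_trans[OF vac.snorm_nonneg])
qed

lemma repnorm_L1: "f \<in> cc \<Longrightarrow> repnorm \<gamma> f \<le> (LINT t|m. norm (f t))"
  by (rule repnorm_le) (simp_all add: Rep_bound L1_nonneg)

lemma repnorm_star_le: assumes f: "f \<in> cc" shows "repnorm \<gamma> (cc_star \<alpha> f) \<le> repnorm \<gamma> f"
proof (rule repnorm_le[OF _ repnorm_nonneg[OF f]])
  fix b
  let ?c = "Rep \<gamma> (cc_star \<alpha> f) b"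
  have "vac.snorm ?c * vac.snorm ?c = Re (vac (star (Rep \<gamma> f ?c) * b))"
    using vac.snorm_sq[of ?c] Rep_adjoint[OF f, of \<gamma> ?c b] by (simp add: power2_eq_square)
  also have "\<dots> \<le> vac.snorm (Rep \<gamma> f ?c) * vac.snorm b"
    using vac.cauchy_schwarz complex_Re_le_cmod order_trans by blast
  also have "\<dots> \<le> (repnorm \<gamma> f * vac.snorm ?c) * vac.snorm b"
    by (intro mult_right_mono repnorm_ge f) simp
  finally have *: "vac.snorm ?c * vac.snorm ?c \<le> vac.snorm ?c * (repnorm \<gamma> f * vac.snorm b)"
    by (simp add: algebra_simps)
  show "vac.snorm ?c \<le> repnorm \<gamma> f * vac.snorm b"
  proof (cases "vac.snorm ?c = 0")
    case True
    then show ?thesis using repnorm_nonneg[OF f] by simp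
  next
    case False
    then have "vac.snorm ?c > 0" using vac.snorm_nonneg[of ?c] by linarith
    then show ?thesis using * by simp
  qed
qed

lemma repnorm_cstar_seminorm: "cstar_seminorm cc (cc_mult m \<alpha>) (cc_star \<alpha>) (repnorm \<gamma>)"
  unfolding cstar_seminorm_def
proof (intro conjI ballI allI)
  fix f g :: "'g \<Rightarrow> 'o" assume f: "f \<in> cc" and g: "g \<in> cc"
  show "repnorm \<gamma> (\<lambda>x. f x + g x) \<le> repnorm \<gamma> f + repnorm \<gamma> g"
  proof (rule repnorm_le)
    fix b
    show "vac.snorm (Rep \<gamma> (\<lambda>x. f x + g x) b) \<le> (repnorm \<gamma> f + repnorm \<gamma> g) * vac.snorm b"
      unfolding Rep_add[OF f g] distrib_right
      by (rule order_trans[OF vac.snorm_add add_mono[OF repnorm_ge[OF f] repnorm_ge[OF g]]])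
  qed (intro add_nonneg_nonneg repnorm_nonneg f g)
  show m: "repnorm \<gamma> (cc_mult m \<alpha> f g) \<le> repnorm \<gamma> f * repnorm \<gamma> g" if f: "f \<in> cc" and g: "g \<in> cc" for f g
  proof (rule repnorm_le)
    fix b
    have "vac.snorm (Rep \<gamma> f (Rep \<gamma> g b)) \<le> repnorm \<gamma> f * vac.snorm (Rep \<gamma> g b)" by (rule repnorm_ge[OF f])
    also have "\<dots> \<le> repnorm \<gamma> f * (repnorm \<gamma> g * vac.snorm b)"
      by (intro mult_left_mono repnorm_ge g repnorm_nonneg f)
    finally show "vac.snorm (Rep \<gamma> (cc_mult m \<alpha> f g) b) \<le> repnorm \<gamma> f * repnorm \<gamma> g * vac.snorm b"
      by (simp add: Rep_mult[OF f g] mult.assoc)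
  qed (intro mult_nonneg_nonneg repnorm_nonneg f g)
next
  fix c and f :: "'g \<Rightarrow> 'o" assume f: "f \<in> cc"
  have le: "repnorm \<gamma> (\<lambda>x. c *\<^sub>C f x) \<le> cmod c * repnorm \<gamma> f" if f: "f \<in> cc" for c f
  proof (rule repnorm_le)
    fix b
    show "vac.snorm (Rep \<gamma> (\<lambda>x. c *\<^sub>C f x) b) \<le> cmod c * repnorm \<gamma> f * vac.snorm b"
      unfolding Rep_scale[OF f] vac.snorm_scale mult.assoc by (intro mult_left_mono repnorm_ge f) simp
  qed (intro mult_nonneg_nonneg repnorm_nonneg f norm_ge_zero)
  show "repnorm \<gamma> (\<lambda>x. c *\<^sub>C f x) = cmod c * repnorm \<gamma> f"
  proof (cases "c = 0")
    case True
    then show ?thesis using le[OF f, of 0] repnorm_nonneg[OF cc_scaleC[OF f], of \<gamma> 0] by simp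
  next
    case False
    have "repnorm \<gamma> (\<lambda>x. inverse c *\<^sub>C (c *\<^sub>C f x)) \<le> cmod (inverse c) * repnorm \<gamma> (\<lambda>x. c *\<^sub>C f x)"
      by (rule le[OF cc_scaleC[OF f]])
    then have "cmod c * repnorm \<gamma> f \<le> repnorm \<gamma> (\<lambda>x. c *\<^sub>C f x)"
      using False by (simp add: scaleC_scaleC norm_inverse norm_divide field_simps)
    then show ?thesis using le[OF f, of c] by simp
  qed
next
  fix f :: "'g \<Rightarrow> 'o" assume f: "f \<in> cc"
  note fs = cc_star_in[OF f]
  have "repnorm \<gamma> (cc_mult m \<alpha> (cc_star \<alpha> f) f) \<le> repnorm \<gamma> (cc_star \<alpha> f) * repnorm \<gamma> f"
  proof (rule repnorm_le)
    fix b
    have "vac.snorm (Rep \<gamma> (cc_star \<alpha> f) (Rep \<gamma> f b)) \<le> repnorm \<gamma> (cc_star \<alpha> f) * vac.snorm (Rep \<gamma> f b)"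
      by (rule repnorm_ge[OF fs])
    also have "\<dots> \<le> repnorm \<gamma> (cc_star \<alpha> f) * (repnorm \<gamma> f * vac.snorm b)"
      by (intro mult_left_mono repnorm_ge f repnorm_nonneg fs)
    finally show "vac.snorm (Rep \<gamma> (cc_mult m \<alpha> (cc_star \<alpha> f) f) b) \<le> repnorm \<gamma> (cc_star \<alpha> f) * repnorm \<gamma> f * vac.snorm b"
      by (simp add: Rep_mult[OF fs f] mult.assoc)
  qed (intro mult_nonneg_nonneg repnorm_nonneg f fs)
  also have "\<dots> \<le> repnorm \<gamma> f * repnorm \<gamma> f"
    by (intro mult_right_mono repnorm_star_le repnorm_nonneg f)
  finally have 1: "repnorm \<gamma> (cc_mult m \<alpha> (cc_star \<alpha> f) f) \<le> (repnorm \<gamma> f)\<^sup>2" by (simp add: power2_eq_square)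
  define C where "C = repnorm \<gamma> (cc_mult m \<alpha> (cc_star \<alpha> f) f)"
  have C0: "0 \<le> C" unfolding C_def by (intro repnorm_nonneg cc_mult_in fs f)
  have "repnorm \<gamma> f \<le> sqrt C"
  proof (rule repnorm_le)
    fix b
    have "(vac.snorm (Rep \<gamma> f b))\<^sup>2 = Re (vac (star b * Rep \<gamma> (cc_mult m \<alpha> (cc_star \<alpha> f) f) b))"
      unfolding vac.snorm_sq Rep_adjoint[OF f] Rep_mult[OF fs f] ..
    also have "\<dots> \<le> vac.snorm b * vac.snorm (Rep \<gamma> (cc_mult m \<alpha> (cc_star \<alpha> f) f) b)"
      using vac.cauchy_schwarz complex_Re_le_cmod order_trans by blast
    also have "\<dots> \<le> vac.snorm b * (C * vac.snorm b)"
      unfolding C_def by (intro mult_left_mono repnorm_ge cc_mult_in fs f) simp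
    also have "\<dots> = (sqrt C * vac.snorm b)\<^sup>2" using C0 by (simp add: power2_eq_square)
    finally show "vac.snorm (Rep \<gamma> f b) \<le> sqrt C * vac.snorm b"
      by (rule power2_le_imp_le) (use C0 in simp)
  qed (use C0 in simp)
  then have "(repnorm \<gamma> f)\<^sup>2 \<le> (sqrt C)\<^sup>2" by (intro power_mono repnorm_nonneg f)
  then have "(repnorm \<gamma> f)\<^sup>2 \<le> C" using C0 by simp
  then show "repnorm \<gamma> (cc_mult m \<alpha> (cc_star \<alpha> f) f) = (repnorm \<gamma> f)\<^sup>2" using 1 by (simp add: C_def)
qed

end

section \<open>Characters of the convolution algebra\<close>

context haar_group
begin

definition conv :: "('g \<Rightarrow> complex) \<Rightarrow> ('g \<Rightarrow> complex) \<Rightarrow> 'g \<Rightarrow> complex" where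
  "conv \<phi> \<psi> t = (LINT s|m. \<phi> s * \<psi> (t - s))"

lemma sum_set_mem: "s \<in> K \<Longrightarrow> t - s \<in> L \<Longrightarrow> (t::'g) \<in> (\<lambda>(s, t). s + t) ` (K \<times> L)"
  by (rule image_eqI[of _ _ "(s, t - s)"]) auto

lemma cc_times:
  fixes f g :: "'g \<Rightarrow> complex"
  assumes f: "f \<in> cc" and g: "continuous_on UNIV g" shows "(\<lambda>t. f t * g t) \<in> cc"
  by (rule cc_map[OF f, of "\<lambda>t x. x * g t"]) (auto intro: continuous_intros ccD[OF f] g)

lemma conv_in:
  assumes f: "\<phi> \<in> cc" and g: "\<psi> \<in> cc" shows "conv \<phi> \<psi> \<in> cc"
proof -
  obtain K L where K: "compact K" "\<And>t. t \<notin> K \<Longrightarrow> \<phi> t = 0" and L: "compact L" "\<And>t. t \<notin> L \<Longrightarrow> \<psi> t = 0"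
    using cc_support[OF f] cc_support[OF g] by blast
  have "(\<lambda>t. LINT s|m. (\<lambda>(t, s). \<phi> s * \<psi> (t - s)) (t, s)) \<in> cc"
  proof (rule integral_cc[of _ "(\<lambda>(s, t). s + t) ` (K \<times> L)" K])
    show "continuous_on UNIV (\<lambda>(t, s). \<phi> s * \<psi> (t - s))"
      unfolding split_beta'
      by (intro continuous_intros continuous_on_compose2[OF ccD[OF f]]
          continuous_on_compose2[OF ccD[OF g]]) auto
    fix t s assume "t \<notin> (\<lambda>(s, t). s + t) ` (K \<times> L) \<or> s \<notin> K"
    then have "s \<notin> K \<or> t - s \<notin> L" using sum_set_mem by blast
    then show "(\<lambda>(t, s). \<phi> s * \<psi> (t - s)) (t, s) = 0" using K(2)[of s] L(2)[of "t - s"] by auto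
  qed (intro compact_plus K L)+
  then show ?thesis by (simp add: conv_def[abs_def])
qed

lemma conv_integrand:
  fixes \<phi> \<psi> :: "'g \<Rightarrow> complex"
  assumes f: "\<phi> \<in> cc" and g: "\<psi> \<in> cc" shows "(\<lambda>s. \<phi> s * \<psi> (t - s)) \<in> cc"
proof (rule cc_times[OF f])
  show "continuous_on UNIV (\<lambda>s. \<psi> (t - s))"
    by (rule continuous_on_compose2[OF ccD[OF g]]) (auto intro: continuous_intros)
qed

lemma conv_commute:
  assumes f: "\<phi> \<in> cc" and g: "\<psi> \<in> cc" shows "conv \<phi> \<psi> = conv \<psi> \<phi>"
proof
  fix t
  define h where "h s = \<phi> s * \<psi> (t - s)" for s
  have h: "h \<in> cc" unfolding h_def by (rule conv_integrand[OF f g])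
  have "(LINT s|m. h s) = (LINT s|m. h (- s))" by (rule integral_reflect[OF h, symmetric])
  also have "\<dots> = (LINT s|m. h (- (s - t)))"
    by (rule integral_translate'[symmetric]) (rule ccD[OF cc_reflect[OF h]])
  finally show "conv \<phi> \<psi> t = conv \<psi> \<phi> t" by (simp add: conv_def h_def mult.commute)
qed

lemma cc_shift: "f \<in> cc \<Longrightarrow> (\<lambda>s. f (s - t)) \<in> cc" for f :: "'g \<Rightarrow> complex"
  using cc_translate[of f "- t"] by simp

lemma conv_shift:
  assumes f: "\<phi> \<in> cc" and g: "\<psi> \<in> cc"
  shows "conv (\<lambda>s. \<phi> (s - t)) \<psi> = conv \<phi> (\<lambda>s. \<psi> (s - t))"
proof
  fix r
  have "(LINT s|m. \<phi> (s - t) * \<psi> (r - t - (s - t))) = (LINT s|m. \<phi> s * \<psi> (r - t - s))"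
    by (rule integral_translate'[OF ccD[OF conv_integrand[OF f g]], of t])
  moreover have "r - t - (s - t) = r - s" "r - t - s = r - s - t" for s by (simp_all add: algebra_simps)
  ultimately show "conv (\<lambda>s. \<phi> (s - t)) \<psi> r = conv \<phi> (\<lambda>s. \<psi> (s - t)) r" by (simp add: conv_def)
qed

lemma cc_uniform_translate:
  fixes f :: "'g \<Rightarrow> complex"
  assumes f: "f \<in> cc" and e: "e > 0"
  shows "\<exists>X. open X \<and> s \<in> X \<and> (\<forall>s'\<in>X. \<forall>r. cmod (f (r - s') - f (r - s)) \<le> e)"
proof -
  obtain L where L: "compact L" "\<And>t. t \<notin> L \<Longrightarrow> f t = 0" using cc_support[OF f] by blast
  obtain V C where V: "open V" "compact C" "{s} \<subseteq> V" "V \<subseteq> C" using compact_nbhd[of "{s}"] by auto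
  define R where "R = (\<lambda>(s, t). s + t) ` (C \<times> L)"
  have R: "compact R" unfolding R_def by (rule compact_plus[OF V(2) L(1)])
  have z: "f (r - s') = 0" if "s' \<in> C" "r \<notin> R" for s' r
    using sum_set_mem[of s' C r L] that L(2)[of "r - s'"] by (auto simp: R_def)
  obtain X where X: "s \<in> X" "open X" "\<forall>x\<in>X \<inter> UNIV. \<forall>r\<in>R.
      dist ((\<lambda>(s, r). f (r - s)) (x, r)) ((\<lambda>(s, r). f (r - s)) (s, r)) \<le> e"
  proof (rule continuous_on_prod_compactE[OF _ R UNIV_I e])
    show "continuous_on (UNIV \<times> R) (\<lambda>(s, r). f (r - s))"
      unfolding split_beta' by (intro continuous_on_compose2[OF ccD[OF f]] continuous_intros) auto
  qed
  have "cmod (f (r - s') - f (r - s)) \<le> e" if s': "s' \<in> X \<inter> V" for s' r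
  proof (cases "r \<in> R")
    case True
    then show ?thesis using X(3) s' by (auto simp: dist_norm)
  next
    case False
    moreover have "s' \<in> C" "s \<in> C" using s' V by auto
    ultimately show ?thesis using z e by simp
  qed
  then show ?thesis using X V by (intro exI[of _ "X \<inter> V"]) auto
qed

text \<open>A value of modulus above 1 would have unbounded powers, all of them again values of
  \<open>g\<close>; applied to t and -t this gives modulus 1.\<close>

lemma pairing_unimodular:
  fixes g :: "'g \<Rightarrow> complex"
  assumes add: "\<And>s t. g (s + t) = g s * g t" and b: "\<And>t. cmod (g t) \<le> M" and z: "g 0 = 1"
  shows "cmod (g t) = 1"
proof -
  have le: "cmod (g t) \<le> 1" for t
  proof (rule ccontr)
    assume "\<not> ?thesis"
    then have "1 < cmod (g t)" by simp
    then obtain n where n: "M < cmod (g t) ^ n" using real_arch_pow by blast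
    have "g (((+) t ^^ k) 0) = g t ^ k" for k by (induction k) (simp_all add: z add)
    then have "cmod (g t) ^ n = cmod (g (((+) t ^^ n) 0))" by (simp add: norm_power)
    then show False using b n by (metis not_le)
  qed
  have "g t * g (- t) = 1" using add[of t "- t"] z by simp
  then have "cmod (g t) * cmod (g (- t)) = 1" by (metis norm_mult norm_one)
  moreover have "cmod (g t) * cmod (g (- t)) \<le> cmod (g t) * 1" using le by (intro mult_left_mono) auto
  ultimately show ?thesis using le[of t] by simp
qed

text \<open>The character is \<open>\<gamma>(t) = K(\<tau>\<^sub>t \<psi>) / K \<psi>\<close>; the formula for \<open>K\<close> follows by approximating
  \<open>\<phi> * \<psi>\<close> by linear combinations of translates of \<open>\<psi>\<close>.\<close>

theorem convolution_character:
  fixes K :: "('g \<Rightarrow> complex) \<Rightarrow> complex"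
  assumes K_add: "\<And>\<phi> \<psi>. \<phi> \<in> cc \<Longrightarrow> \<psi> \<in> cc \<Longrightarrow> K (\<lambda>t. \<phi> t + \<psi> t) = K \<phi> + K \<psi>"
    and K_scale: "\<And>c \<phi>. \<phi> \<in> cc \<Longrightarrow> K (\<lambda>t. c * \<phi> t) = c * K \<phi>"
    and K_conv: "\<And>\<phi> \<psi>. \<phi> \<in> cc \<Longrightarrow> \<psi> \<in> cc \<Longrightarrow> K (conv \<phi> \<psi>) = K \<phi> * K \<psi>"
    and K_bound: "\<And>\<phi>. \<phi> \<in> cc \<Longrightarrow> cmod (K \<phi>) \<le> (LINT t|m. cmod (\<phi> t))"
    and \<psi>: "\<psi> \<in> cc" "K \<psi> \<noteq> 0"
  shows "\<exists>\<gamma>. \<forall>\<phi>\<in>cc. K \<phi> = (LINT t|m. pairing t \<gamma> * \<phi> t)"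
proof -
  have K_diff: "K (\<lambda>t. \<phi> t - \<theta> t) = K \<phi> - K \<theta>" if "\<phi> \<in> cc" "\<theta> \<in> cc" for \<phi> \<theta>
  proof -
    have "(\<lambda>t. (-1) * \<theta> t) \<in> cc"
      using cc_map[OF that(2), of "\<lambda>_ x. (-1) * x"] ccD[OF that(2)] by (auto intro: continuous_intros)
    then show ?thesis using K_add[OF that(1), of "\<lambda>t. (-1) * \<theta> t"] K_scale[OF that(2), of "-1"] by simp
  qed
  define g where "g t = K (\<lambda>s. \<psi> (s - t)) / K \<psi>" for t
  have g: "K (\<lambda>s. \<phi> (s - t)) = g t * K \<phi>" if "\<phi> \<in> cc" for \<phi> t
  proof -
    have "K (\<lambda>s. \<phi> (s - t)) * K \<psi> = K \<phi> * K (\<lambda>s. \<psi> (s - t))"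
      using K_conv[OF cc_shift[OF that] \<psi>(1), of t] K_conv[OF that cc_shift[OF \<psi>(1)], of t]
        conv_shift[OF that \<psi>(1), of t] by simp
    then show ?thesis using \<psi>(2) by (simp add: g_def field_simps)
  qed
  have g_add: "g (s + t) = g s * g t" for s t
  proof -
    have "(\<lambda>r. \<psi> (r - (s + t))) = (\<lambda>r. (\<lambda>r. \<psi> (r - t)) (r - s))" by (simp add: algebra_simps)
    then have "K (\<lambda>r. \<psi> (r - (s + t))) = g s * K (\<lambda>r. \<psi> (r - t))"
      using g[OF cc_shift[OF \<psi>(1)], of s t] by simp
    then have "g (s + t) = (g s * K (\<lambda>r. \<psi> (r - t))) / K \<psi>" by (simp add: g_def)
    also have "\<dots> = g s * g t" by (simp add: g_def[of t])
    finally show ?thesis .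
  qed
  have g0: "g 0 = 1" using \<psi>(2) by (simp add: g_def)
  have g_bound: "cmod (g t) \<le> (LINT s|m. cmod (\<psi> s)) / cmod (K \<psi>)" for t
  proof -
    have "cmod (K (\<lambda>s. \<psi> (s - t))) \<le> (LINT s|m. cmod (\<psi> (s - t)))" by (rule K_bound[OF cc_shift[OF \<psi>(1)]])
    also have "\<dots> = (LINT s|m. cmod (\<psi> s))" by (rule integral_translate'[OF ccD[OF cc_norm[OF \<psi>(1)]]])
    finally show ?thesis using \<psi>(2) by (simp add: g_def norm_divide divide_right_mono)
  qed
  have g_cont: "continuous_on UNIV g"
    unfolding continuous_on_def
  proof (intro ballI tendstoI)
    fix t0 and e :: real assume "e > 0"
    then have "e * cmod (K \<psi>) > 0" using \<psi>(2) by simp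
    then obtain X where X: "open X" "t0 \<in> X" "\<forall>t\<in>X. (LINT s|m. cmod (\<psi> (s - t) - \<psi> (s - t0))) < e * cmod (K \<psi>)"
      using L1_translate_continuous[OF \<psi>(1)] by metis
    have "dist (g t) (g t0) < e" if t: "t \<in> X" for t
    proof -
      have "g t - g t0 = K (\<lambda>s. \<psi> (s - t) - \<psi> (s - t0)) / K \<psi>"
        using K_diff[OF cc_shift[OF \<psi>(1)] cc_shift[OF \<psi>(1)], of t t0] by (simp add: g_def diff_divide_distrib)
      moreover have "(\<lambda>s. \<psi> (s - t) - \<psi> (s - t0)) \<in> cc"
        by (intro cc_diff cc_shift \<psi>)
      then have "cmod (K (\<lambda>s. \<psi> (s - t) - \<psi> (s - t0))) < e * cmod (K \<psi>)"
        using K_bound X(3) t by (meson le_less_trans)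
      ultimately show ?thesis using \<psi>(2) by (simp add: dist_norm norm_divide divide_less_eq)
    qed
    then show "\<forall>\<^sub>F t in at t0 within UNIV. dist (g t) (g t0) < e"
      unfolding eventually_at_topological using X(1,2) by blast
  qed
  have g1: "cmod (g t) = 1" for t by (rule pairing_unimodular[OF g_add g_bound g0])
  define \<gamma> :: "'g dual" where "\<gamma> = Abs_dual g"
  have \<gamma>: "pairing t \<gamma> = g t" for t
    unfolding pairing_def \<gamma>_def using g_cont g_add g1 by (subst Abs_dual_inverse) auto
  have "K \<phi> = (LINT t|m. pairing t \<gamma> * \<phi> t)" if \<phi>: "\<phi> \<in> cc" for \<phi>
  proof -
    obtain K0 L where K0: "compact K0" "\<And>t. t \<notin> K0 \<Longrightarrow> \<phi> t = 0" and L: "compact L" "\<And>t. t \<notin> L \<Longrightarrow> \<psi> t = 0"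
      using cc_support[OF \<phi>] cc_support[OF \<psi>(1)] by blast
    obtain V C where V: "open V" "compact C" "K0 \<subseteq> V" "V \<subseteq> C" using compact_nbhd[OF K0(1)] by blast
    define R where "R = (\<lambda>(s, t). s + t) ` (C \<times> L)"
    have R: "compact R" unfolding R_def by (rule compact_plus[OF V(2) L(1)])
    define N where "N = (LINT t|m. cmod (\<phi> t))"
    define G where "G = (LINT t|m. g t * \<phi> t)"
    have app: "cmod (K \<phi> * K \<psi> - G * K \<psi>) \<le> e * (N * measure m R + N * cmod (K \<psi>))" if e: "e > 0" for e
    proof -
      have "\<exists>X. open X \<and> s \<in> X \<and> (\<forall>s'\<in>X. \<forall>r. cmod (\<psi> (r - s') - \<psi> (r - s)) \<le> e) \<and> (\<forall>s'\<in>X. cmod (g s' - g s) \<le> e)" for s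
      proof -
        obtain X where X: "open X" "s \<in> X" "\<forall>s'\<in>X. \<forall>r. cmod (\<psi> (r - s') - \<psi> (r - s)) \<le> e"
          using cc_uniform_translate[OF \<psi>(1) e, of s] by (elim exE conjE)
        have o: "open {s'. cmod (g s' - g s) < e}"
          by (intro open_Collect_less continuous_intros g_cont)
        show ?thesis
          by (rule exI[of _ "X \<inter> {s'. cmod (g s' - g s) < e}"]) (use X o e in auto)
      qed
      then obtain U where U: "\<And>s. open (U s) \<and> s \<in> U s" "\<And>s s' r. s' \<in> U s \<Longrightarrow> cmod (\<psi> (r - s') - \<psi> (r - s)) \<le> e"
        "\<And>s s'. s' \<in> U s \<Longrightarrow> cmod (g s' - g s) \<le> e" by metis
      obtain I :: "'g set" and u :: "'g \<Rightarrow> 'g \<Rightarrow> real" where I: "finite I" "I \<subseteq> K0"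
        and u: "\<And>i. continuous_on UNIV (u i)" "\<And>i t. 0 \<le> u i t"
          "\<And>i t. i \<in> I \<Longrightarrow> u i t \<noteq> 0 \<Longrightarrow> t \<in> U i \<and> t \<in> V"
          "\<And>t. (\<Sum>i\<in>I. u i t) \<le> 1" "\<And>t. t \<in> K0 \<Longrightarrow> (\<Sum>i\<in>I. u i t) = 1"
        by (rule partition[OF K0(1) V(1,3), of U]) (use U(1) in auto)
      define v where "v i s = \<phi> s * complex_of_real (u i s)" for i s
      have v: "v i \<in> cc" for i unfolding v_def by (rule cc_times[OF \<phi>]) (intro continuous_intros u)
      have vsum: "\<phi> s = (\<Sum>i\<in>I. v i s)" for s
        using u(5)[of s] K0(2)[of s]
        by (cases "s \<in> K0") (simp_all add: v_def sum_distrib_left[symmetric] of_real_sum[symmetric] del: of_real_sum)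
      have normv: "(\<Sum>i\<in>I. cmod (v i s)) \<le> cmod (\<phi> s)" for s
      proof -
        have "(\<Sum>i\<in>I. cmod (v i s)) = cmod (\<phi> s) * (\<Sum>i\<in>I. u i s)"
          using u(2) by (simp add: v_def norm_mult sum_distrib_left)
        also have "\<dots> \<le> cmod (\<phi> s) * 1" using u(4) by (intro mult_left_mono) auto
        finally show ?thesis by simp
      qed
      have est: "cmod (\<Sum>i\<in>I. LINT s|m. v i s * h i s) \<le> e * N"
        if h: "\<And>i. i \<in> I \<Longrightarrow> continuous_on UNIV (h i)" "\<And>i s. i \<in> I \<Longrightarrow> s \<in> U i \<Longrightarrow> cmod (h i s) \<le> e"
        for h :: "'g \<Rightarrow> 'g \<Rightarrow> complex"
      proof -
        have int: "integrable m (\<lambda>s. v i s * h i s)" if "i \<in> I" for i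
          by (rule cc_integrable[OF cc_times[OF v h(1)[OF that]]])
        have "(\<Sum>i\<in>I. LINT s|m. v i s * h i s) = (LINT s|m. (\<Sum>i\<in>I. v i s * h i s))"
          by (rule Bochner_Integration.integral_sum[symmetric]) (rule int)
        also have "cmod \<dots> \<le> (LINT s|m. cmod (\<Sum>i\<in>I. v i s * h i s))" by (rule integral_norm_bound)
        also have "\<dots> \<le> (LINT s|m. e * cmod (\<phi> s))"
        proof (rule integral_mono)
          show "integrable m (\<lambda>s. cmod (\<Sum>i\<in>I. v i s * h i s))" using int by simp
          show "integrable m (\<lambda>s. e * cmod (\<phi> s))" using cc_integrable[OF \<phi>] by simp
          fix s
          have "cmod (\<Sum>i\<in>I. v i s * h i s) \<le> (\<Sum>i\<in>I. e * cmod (v i s))"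
          proof (rule sum_norm_le)
            fix i assume i: "i \<in> I"
            show "cmod (v i s * h i s) \<le> e * cmod (v i s)"
            proof (cases "u i s = 0")
              case False
              then have "cmod (h i s) \<le> e" using u(3)[OF i] h(2)[OF i] by blast
              then show ?thesis by (simp add: norm_mult mult.commute mult_right_mono)
            qed (simp add: v_def)
          qed
          also have "\<dots> \<le> e * cmod (\<phi> s)"
            using normv[of s] e by (simp add: sum_distrib_left[symmetric])
          finally show "cmod (\<Sum>i\<in>I. v i s * h i s) \<le> e * cmod (\<phi> s)" .
        qed
        also have "\<dots> = e * N" by (simp add: N_def)
        finally show ?thesis .
      qed
      \<comment> \<open>\<phi> is cut into pieces \<open>v i\<close> concentrated near
        \<open>i\<close>, and in \<phi> * \<psi> each translate of \<psi> is frozen at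
        \<open>i\<close>. The value of \<open>K\<close> at \<open>H\<close> is known, and
        \<open>H\<close> approximates the convolution uniformly with support in the fixed compact
        set \<open>R\<close>, hence in the L1-norm.\<close>
      define H where "H r = (\<Sum>i\<in>I. (LINT s|m. v i s) * \<psi> (r - i))" for r
      have Hi: "(\<lambda>r. c * \<psi> (r - i)) \<in> cc" for c i
        by (rule cc_map[OF cc_shift[OF \<psi>(1), of i], of "\<lambda>_ x. c * x"])
          (simp_all add: continuous_on_mult_left ccD[OF cc_shift[OF \<psi>(1)]])
      have H: "H \<in> cc" unfolding H_def[abs_def] by (rule cc_sum) (rule Hi)
      have K0': "K (\<lambda>_. 0) = 0" using K_scale[OF \<psi>(1), of 0] by simp
      have KH: "K H = (\<Sum>i\<in>I. (LINT s|m. v i s) * (g i * K \<psi>))"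
      proof -
        have "K (\<lambda>r. \<Sum>i\<in>J. (LINT s|m. v i s) * \<psi> (r - i)) = (\<Sum>i\<in>J. (LINT s|m. v i s) * (g i * K \<psi>))"
          if "finite J" for J
          using that
        proof (induction J rule: finite_induct)
          case (insert i J)
          have "(\<lambda>r. \<Sum>i\<in>J. (LINT s|m. v i s) * \<psi> (r - i)) \<in> cc" by (rule cc_sum) (rule Hi)
          then show ?case using insert K_add[OF Hi] K_scale[OF cc_shift[OF \<psi>(1)]] g[OF \<psi>(1)] by simp
        qed (simp add: K0')
        then show ?thesis using I(1) by (simp add: H_def[abs_def])
      qed
      have int1: "integrable m (\<lambda>s. v i s * \<psi> (r - s))" "integrable m (\<lambda>s. v i s * g s)"
        "integrable m (v i)" for i r
        using cc_integrable[OF conv_integrand[OF v \<psi>(1)]] cc_integrable[OF cc_times[OF v g_cont]] cc_integrable[OF v]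
        by auto
      have diffconv: "conv \<phi> \<psi> r - H r = (\<Sum>i\<in>I. LINT s|m. v i s * (\<psi> (r - s) - \<psi> (r - i)))" for r
      proof -
        have "conv \<phi> \<psi> r = (\<Sum>i\<in>I. LINT s|m. v i s * \<psi> (r - s))"
          unfolding conv_def vsum sum_distrib_right by (rule Bochner_Integration.integral_sum) (rule int1)
        then show ?thesis using int1
          by (simp add: H_def right_diff_distrib sum_subtractf)
      qed
      have R0: "conv \<phi> \<psi> r - H r = 0" if r: "r \<notin> R" for r
      proof -
        have "\<psi> (r - s) = 0" if "s \<in> C" for s
          using sum_set_mem[of s C r L] that r L(2)[of "r - s"] by (auto simp: R_def)
        moreover have "\<phi> s = 0" if "s \<notin> C" for s using K0(2)[of s] that V by auto
        ultimately have z: "\<phi> s * \<psi> (r - s) = 0" for s by (cases "s \<in> C") auto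
        moreover have "\<psi> (r - i) = 0" if "i \<in> I" for i using \<open>\<And>s. s \<in> C \<Longrightarrow> \<psi> (r - s) = 0\<close> that I V by auto
        moreover have "conv \<phi> \<psi> r = (LINT s|m. 0)"
          unfolding conv_def by (rule Bochner_Integration.integral_cong[OF refl]) (rule z)
        ultimately show ?thesis by (simp add: H_def)
      qed
      have cH: "(\<lambda>r. conv \<phi> \<psi> r - H r) \<in> cc"
        by (intro cc_diff conv_in H \<phi> \<psi>)
      have "cmod (K \<phi> * K \<psi> - K H) \<le> (LINT r|m. cmod (conv \<phi> \<psi> r - H r))"
        using K_bound[OF cH] K_diff[OF conv_in[OF \<phi> \<psi>(1)] H] K_conv[OF \<phi> \<psi>(1)] by simp
      also have "\<dots> \<le> (e * N) * measure m R"
      proof (rule integral_bound_real[OF cc_norm[OF cH] R])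
        fix r
        show "\<bar>cmod (conv \<phi> \<psi> r - H r)\<bar> \<le> e * N"
          unfolding diffconv abs_norm_cancel
        proof (rule est)
          show "continuous_on UNIV (\<lambda>s. \<psi> (r - s) - \<psi> (r - i))" for i
            by (intro continuous_intros continuous_on_compose2[OF ccD[OF \<psi>(1)]]) auto
        qed (rule U(2))
      qed (use R0 in auto)
      finally have 1: "cmod (K \<phi> * K \<psi> - K H) \<le> (e * N) * measure m R" .
      have "G = (\<Sum>i\<in>I. LINT s|m. v i s * g s)"
        unfolding G_def vsum sum_distrib_left mult.commute[of "g _"]
        by (rule Bochner_Integration.integral_sum) (rule int1)
      then have "(\<Sum>i\<in>I. (LINT s|m. v i s) * g i) - G = (\<Sum>i\<in>I. LINT s|m. v i s * (g i - g s))"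
        using int1 by (simp add: right_diff_distrib sum_subtractf)
      also have "cmod \<dots> \<le> e * N"
      proof (rule est)
        show "continuous_on UNIV (\<lambda>s. g i - g s)" for i by (intro continuous_intros g_cont)
        show "cmod (g i - g s) \<le> e" if "s \<in> U i" for i s using U(3)[OF that] by (simp add: norm_minus_commute)
      qed
      finally have "cmod (((\<Sum>i\<in>I. (LINT s|m. v i s) * g i) - G) * K \<psi>) \<le> (e * N) * cmod (K \<psi>)"
        by (simp add: norm_mult mult_right_mono)
      moreover have "((\<Sum>i\<in>I. (LINT s|m. v i s) * g i) - G) * K \<psi> = K H - G * K \<psi>"
        by (simp add: KH left_diff_distrib sum_distrib_right mult.assoc)
      ultimately have 2: "cmod (K H - G * K \<psi>) \<le> (e * N) * cmod (K \<psi>)" by simp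
      have "cmod ((K \<phi> * K \<psi> - K H) + (K H - G * K \<psi>)) \<le> (e * N) * measure m R + (e * N) * cmod (K \<psi>)"
        by (rule norm_triangle_mono[OF 1 2])
      then show ?thesis by (simp add: algebra_simps)
    qed
    have "cmod (K \<phi> * K \<psi> - G * K \<psi>) \<le> 0"
    proof (rule tendsto_lowerbound)
      show "((\<lambda>e. e * (N * measure m R + N * cmod (K \<psi>))) \<longlongrightarrow> 0) (at_right 0)"
        by (rule tendsto_mult_left_zero) (rule tendsto_ident_at)
      show "\<forall>\<^sub>F e in at_right 0. cmod (K \<phi> * K \<psi> - G * K \<psi>) \<le> e * (N * measure m R + N * cmod (K \<psi>))"
        using app by (auto simp: eventually_at_filter)
    qed simp
    then have "K \<phi> = G" using \<psi>(2) by simp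
    then show ?thesis by (simp add: G_def \<gamma>)
  qed
  then show ?thesis by blast
qed

end

section \<open>The crossed product\<close>

locale crossed = quasi_free S m \<omega> \<alpha>
  for S :: "nat \<Rightarrow> 'o::{cstar_algebra, real_normed_algebra_1, second_countable_topology}"
    and m :: "'g::{topological_ab_group_add,t2_space} measure"
    and \<omega> :: "nat \<Rightarrow> 'g dual" and \<alpha> :: "'g \<Rightarrow> 'o \<Rightarrow> 'o" +
  fixes j :: "('g \<Rightarrow> 'o) \<Rightarrow> 'b::cstar_algebra"
  assumes cp: "is_crossed_product m \<alpha> j"
begin

lemma j_add: "f \<in> cc \<Longrightarrow> g \<in> cc \<Longrightarrow> j (\<lambda>t. f t + g t) = j f + j g"
  and j_scale: "f \<in> cc \<Longrightarrow> j (\<lambda>t. c *\<^sub>C f t) = c *\<^sub>C j f"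
  and j_mult: "f \<in> cc \<Longrightarrow> g \<in> cc \<Longrightarrow> j (cc_mult m \<alpha> f g) = j f * j g"
  and j_star: "f \<in> cc \<Longrightarrow> j (cc_star \<alpha> f) = star (j f)"
  and j_dense: "closure (j ` cc) = UNIV"
  and j_L1: "f \<in> cc \<Longrightarrow> norm (j f) \<le> (LINT t|m. norm (f t))"
  using cp unfolding is_crossed_product_def by simp_all

lemma j_max:
  "cstar_seminorm cc (cc_mult m \<alpha>) (cc_star \<alpha>) p \<Longrightarrow> (\<And>f. f \<in> cc \<Longrightarrow> p f \<le> (LINT t|m. norm (f t))) \<Longrightarrow>
    f \<in> cc \<Longrightarrow> p f \<le> norm (j f)"
  using cp unfolding is_crossed_product_def by blast

lemma j_diff: assumes "f \<in> cc" "g \<in> cc" shows "j (\<lambda>t. f t - g t) = j f - j g"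
  using j_add[OF assms(1) cc_scaleC[OF assms(2), of "-1"]] j_scale[OF assms(2), of "-1"] by simp

lemma j_zero: "j (\<lambda>_. 0) = 0"
  using j_scale[OF cc_zero, of 0] by simp

lemma j_induct:
  assumes "closed X" "\<And>f. f \<in> cc \<Longrightarrow> j f \<in> X" shows "x \<in> X"
  using closure_minimal[of "j ` cc" X] assms j_dense by auto

lemma j_induct2:
  fixes P :: "'b \<Rightarrow> 'b \<Rightarrow> bool"
  assumes "\<And>y. closed {x. P x y}" "\<And>x. closed {y. P x y}" "\<And>f g. f \<in> cc \<Longrightarrow> g \<in> cc \<Longrightarrow> P (j f) (j g)"
  shows "P x y"
proof -
  have 1: "x \<in> {x. P x (j g)}" if "g \<in> cc" for g
    by (rule j_induct[OF assms(1)]) (simp add: assms(3) that)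
  have "y \<in> {y. P x y}" by (rule j_induct[OF assms(2)]) (use 1 in simp)
  then show ?thesis by simp
qed

lemma j_approx: assumes "e > 0" shows "\<exists>f\<in>cc. norm (j f - x) < e"
proof -
  have "x \<in> closure (j ` cc)" by (simp only: j_dense UNIV_I)
  then show ?thesis using assms unfolding closure_approachable dist_norm by blast
qed

text \<open>Extension by continuity from the dense image of \<open>cc\<close>. The relation
  \<open>R\<close> is the closure of the graph; the bound makes it single-valued, although
  \<open>j\<close> need not be injective.\<close>

lemma extend:
  fixes T :: "('g \<Rightarrow> 'o) \<Rightarrow> 'c::cstar_algebra"
  assumes add: "\<And>f g. f \<in> cc \<Longrightarrow> g \<in> cc \<Longrightarrow> T (\<lambda>t. f t + g t) = T f + T g"
    and scale: "\<And>c f. f \<in> cc \<Longrightarrow> T (\<lambda>t. c *\<^sub>C f t) = c *\<^sub>C T f"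
    and bound: "\<And>f. f \<in> cc \<Longrightarrow> norm (T f) \<le> norm (j f)"
  shows "\<exists>T'. (\<forall>f\<in>cc. T' (j f) = T f) \<and> (\<forall>x y. T' (x + y) = T' x + T' y) \<and>
    (\<forall>c x. T' (c *\<^sub>C x) = c *\<^sub>C T' x) \<and> (\<forall>x. norm (T' x) \<le> norm x)"
proof -
  have diff: "T (\<lambda>t. f t - g t) = T f - T g" if "f \<in> cc" "g \<in> cc" for f g
    using add[OF that(1) cc_scaleC[OF that(2), of "-1"]] scale[OF that(2), of "-1"] by simp
  define R where "R x y \<longleftrightarrow> (\<forall>e>0. \<exists>f\<in>cc. norm (j f - x) < e \<and> norm (T f - y) < e)" for x y
  have R_j: "R (j f) (T f)" if "f \<in> cc" for f
    unfolding R_def using that by (auto intro!: bexI[of _ f])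
  have R_add: "R (x + x') (y + y')" if xy: "R x y" "R x' y'" for x x' y y'
    unfolding R_def
  proof (intro allI impI)
    fix e :: real assume "e > 0"
    then have "e/2 > 0" by simp
    then obtain f g where fg: "f \<in> cc" "norm (j f - x) < e/2" "norm (T f - y) < e/2"
      "g \<in> cc" "norm (j g - x') < e/2" "norm (T g - y') < e/2"
      using xy unfolding R_def by metis
    have "norm ((j f - x) + (j g - x')) < e" "norm ((T f - y) + (T g - y')) < e"
      using norm_triangle_ineq[of "j f - x" "j g - x'"] norm_triangle_ineq[of "T f - y" "T g - y'"] fg by linarith+
    then show "\<exists>f\<in>cc. norm (j f - (x + x')) < e \<and> norm (T f - (y + y')) < e"
      using fg by (intro bexI[of _ "\<lambda>t. f t + g t"]) (auto simp: j_add add algebra_simps intro: cc_add)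
  qed
  have R_scale: "R (c *\<^sub>C x) (c *\<^sub>C y)" if xy: "R x y" for c x y
    unfolding R_def
  proof (intro allI impI)
    fix e :: real assume e: "e > 0"
    have c1: "cmod c + 1 > 0" by (simp add: add_nonneg_pos)
    then have "e / (cmod c + 1) > 0" using e by simp
    then obtain f where f: "f \<in> cc" "norm (j f - x) < e / (cmod c + 1)" "norm (T f - y) < e / (cmod c + 1)"
      using xy unfolding R_def by metis
    have *: "cmod c * r < e" if "r < e / (cmod c + 1)" "0 \<le> r" for r
    proof -
      have "cmod c * r \<le> (cmod c + 1) * r" using that by (intro mult_right_mono) auto
      also have "\<dots> < e" using that c1 by (simp add: field_simps)
      finally show ?thesis .
    qed
    show "\<exists>f\<in>cc. norm (j f - c *\<^sub>C x) < e \<and> norm (T f - c *\<^sub>C y) < e"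
      using f by (intro bexI[of _ "\<lambda>t. c *\<^sub>C f t"])
        (auto simp: j_scale scale scaleC_diff_right[symmetric] norm_scaleC intro!: * cc_scaleC)
  qed
  have R_bound: "norm y \<le> norm x" if xy: "R x y" for x y
  proof (rule field_le_epsilon)
    fix e :: real assume "e > 0"
    then have "e/2 > 0" by simp
    then obtain f where f: "f \<in> cc" "norm (j f - x) < e/2" "norm (T f - y) < e/2"
      using xy unfolding R_def by metis
    then show "norm y \<le> norm x + e"
      using bound[OF f(1)] norm_triangle_ineq2[of "j f" x] norm_triangle_ineq2[of y "T f"]
        norm_minus_commute[of y "T f"] by linarith
  qed
  have R_unique: "y = y'" if "R x y" "R x y'" for x y y'
    using R_bound[OF R_add[OF that(1) R_scale[OF that(2), of "-1"]]] by simp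
  have R_total: "\<exists>y. R x y" for x
  proof -
    have "\<exists>f\<in>cc. norm (j f - x) < inverse (real (Suc n))" for n by (rule j_approx) simp
    then obtain f where f: "\<And>n. f n \<in> cc" "\<And>n. norm (j (f n) - x) < inverse (real (Suc n))" by metis
    have bd: "norm (T (f n) - T (f k)) \<le> inverse (real (Suc n)) + inverse (real (Suc k))" for n k
    proof -
      have "norm (T (f n) - T (f k)) \<le> norm (j (f n) - j (f k))"
        using bound[OF cc_diff[OF f(1) f(1)], of n k] by (simp add: diff j_diff f)
      also have "j (f n) - j (f k) = (j (f n) - x) - (j (f k) - x)" by simp
      also have "norm \<dots> \<le> norm (j (f n) - x) + norm (j (f k) - x)" by (rule norm_triangle_ineq4)
      finally show ?thesis using f(2)[of n] f(2)[of k] by linarith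
    qed
    have small: "\<exists>N. \<forall>n\<ge>N. inverse (real (Suc n)) < e" if e0: "e > 0" for e
    proof -
      obtain N where N: "inverse (real (Suc N)) < e" using reals_Archimedean[OF e0] by blast
      have "inverse (real (Suc n)) \<le> inverse (real (Suc N))" if "N \<le> n" for n
        using that by (intro le_imp_inverse_le) auto
      then show ?thesis using N by (meson le_less_trans)
    qed
    have "Cauchy (\<lambda>n. T (f n))"
    proof (rule metric_CauchyI)
      fix e :: real assume "e > 0"
      then obtain N where N: "\<forall>n\<ge>N. inverse (real (Suc n)) < e/2" using small[of "e/2"] by auto
      have "dist (T (f n)) (T (f k)) < e" if "n \<ge> N" "k \<ge> N" for n k
      proof -
        have "inverse (real (Suc n)) < e/2" "inverse (real (Suc k)) < e/2" using N that by blast+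
        then show ?thesis using bd[of n k] unfolding dist_norm by linarith
      qed
      then show "\<exists>N. \<forall>n\<ge>N. \<forall>k\<ge>N. dist (T (f n)) (T (f k)) < e" by blast
    qed
    then obtain y where y: "(\<lambda>n. T (f n)) \<longlonglongrightarrow> y" using Cauchy_convergent convergent_def by metis
    have "R x y" unfolding R_def
    proof (intro allI impI)
      fix e :: real assume e: "e > 0"
      obtain N where N: "\<forall>n\<ge>N. inverse (real (Suc n)) < e" using small[OF e] by blast
      obtain M where M: "\<forall>n\<ge>M. norm (T (f n) - y) < e" using LIMSEQ_D[OF y e] by blast
      have "inverse (real (Suc (max N M))) < e" using N by (meson max.cobounded1)
      then have "norm (j (f (max N M)) - x) < e" using f(2)[of "max N M"] by linarith
      moreover have "norm (T (f (max N M)) - y) < e" using M by (meson max.cobounded2)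
      ultimately show "\<exists>f\<in>cc. norm (j f - x) < e \<and> norm (T f - y) < e" using f(1) by blast
    qed
    then show ?thesis by blast
  qed
  define T' where "T' x = (THE y. R x y)" for x
  have T': "R x (T' x)" for x
    unfolding T'_def using R_total[of x] R_unique by (metis theI)
  show ?thesis
  proof (intro exI[of _ T'] conjI ballI allI)
    show "T' (j f) = T f" if "f \<in> cc" for f by (rule R_unique[OF T' R_j[OF that]])
    show "T' (x + y) = T' x + T' y" for x y by (rule R_unique[OF T' R_add[OF T' T']])
    show "T' (c *\<^sub>C x) = c *\<^sub>C T' x" for c x by (rule R_unique[OF T' R_scale[OF T']])
    show "norm (T' x) \<le> norm x" for x by (rule R_bound[OF T'])
  qed
qed

subsection \<open>Vacuum functionals\<close>

lemma vac_Rep: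
  assumes f: "f \<in> cc" shows "vac (Rep \<gamma> f b) = (LINT t|m. pairing t \<gamma> * vac (f t * \<alpha> t b))"
proof -
  have "vac (Rep \<gamma> f b) = (LINT t|m. vac (pairing t \<gamma> *\<^sub>C (f t * \<alpha> t b)))"
    unfolding Rep_def by (rule integral_bounded_linear[OF vac.bounded_linear Rep_integrable[OF f], symmetric])
  then show ?thesis by (simp add: vac_scale)
qed

text \<open>By the Cauchy-Schwarz inequality the functional is bounded by
  \<open>repnorm \<gamma>\<close>, which maximality of the crossed product norm bounds by the norm
  of \<open>j f\<close>.\<close>

lemma vf_exists: "\<exists>T. (\<forall>f\<in>cc. T (j f) = vac (Rep \<gamma> f 1)) \<and> (\<forall>x y. T (x + y) = T x + T y) \<and>
    (\<forall>c x. T (c *\<^sub>C x) = c * T x) \<and> (\<forall>x. cmod (T x) \<le> norm x)"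
proof -
  have "\<exists>T. (\<forall>f\<in>cc. T (j f) = vac (Rep \<gamma> f 1)) \<and> (\<forall>x y. T (x + y) = T x + T y) \<and>
    (\<forall>c x. T (c *\<^sub>C x) = c *\<^sub>C T x) \<and> (\<forall>x. cmod (T x) \<le> norm x)"
  proof (rule extend)
    fix f g :: "'g \<Rightarrow> 'o" and c assume f: "f \<in> cc"
    show "vac (Rep \<gamma> (\<lambda>t. c *\<^sub>C f t) 1) = c *\<^sub>C vac (Rep \<gamma> f 1)"
      by (simp add: Rep_scale f vac_scale scaleC_complex_def)
    show "vac (Rep \<gamma> (\<lambda>t. f t + g t) 1) = vac (Rep \<gamma> f 1) + vac (Rep \<gamma> g 1)" if "g \<in> cc"
      by (simp add: Rep_add f that vac_add)
    have s1: "vac.snorm 1 = 1" by (simp add: vac.snorm_def vac_one)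
    have "cmod (vac (star 1 * Rep \<gamma> f 1)) \<le> vac.snorm 1 * vac.snorm (Rep \<gamma> f 1)" by (rule vac.cauchy_schwarz)
    then have "cmod (vac (Rep \<gamma> f 1)) \<le> repnorm \<gamma> f" using repnorm_ge[OF f, of \<gamma> 1] by (simp add: s1)
    also have "\<dots> \<le> norm (j f)" by (rule j_max[OF repnorm_cstar_seminorm repnorm_L1 f])
    finally show "cmod (vac (Rep \<gamma> f 1)) \<le> norm (j f)" .
  qed
  then show ?thesis by (simp add: scaleC_complex_def)
qed

definition vf :: "'g dual \<Rightarrow> 'b \<Rightarrow> complex" where
  "vf \<gamma> = (SOME T. (\<forall>f\<in>cc. T (j f) = vac (Rep \<gamma> f 1)) \<and> (\<forall>x y. T (x + y) = T x + T y) \<and>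
    (\<forall>c x. T (c *\<^sub>C x) = c * T x) \<and> (\<forall>x. cmod (T x) \<le> norm x))"

lemma vf_j: "f \<in> cc \<Longrightarrow> vf \<gamma> (j f) = vac (Rep \<gamma> f 1)"
  and vf_add: "vf \<gamma> (x + y) = vf \<gamma> x + vf \<gamma> y"
  and vf_scale: "vf \<gamma> (c *\<^sub>C x) = c * vf \<gamma> x"
  and vf_bound: "cmod (vf \<gamma> x) \<le> norm x"
  using someI_ex[OF vf_exists[of \<gamma>]] unfolding vf_def[symmetric] by simp_all

lemma vf_cont: "continuous_on X (vf \<gamma>)"
  by (rule linear_continuous_on)
    (rule bounded_linear_intro[of _ 1],
     auto simp: vf_add vf_bound scaleR_scaleC[where 'a='b] vf_scale scaleR_conv_of_real)

lemma vf_comp_cont: "continuous_on X f \<Longrightarrow> continuous_on X (\<lambda>x. vf \<gamma> (f x))"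
  by (rule continuous_on_compose2[OF vf_cont[of UNIV]]) auto

lemma vf_pos: "0 \<le> Re (vf \<gamma> (star x * x)) \<and> Im (vf \<gamma> (star x * x)) = 0"
proof -
  have "x \<in> {x. 0 \<le> Re (vf \<gamma> (star x * x)) \<and> Im (vf \<gamma> (star x * x)) = 0}"
  proof (rule j_induct)
    show "closed {x. 0 \<le> Re (vf \<gamma> (star x * x)) \<and> Im (vf \<gamma> (star x * x)) = 0}"
      by (intro closed_Collect_conj closed_Collect_le closed_Collect_eq continuous_on_Re continuous_on_Im
          vf_comp_cont continuous_on_mult continuous_on_star continuous_on_id continuous_on_const)
    fix f :: "'g \<Rightarrow> 'o" assume f: "f \<in> cc"
    note fs = cc_star_in[OF f]
    have "vf \<gamma> (star (j f) * j f) = vf \<gamma> (j (cc_mult m \<alpha> (cc_star \<alpha> f) f))"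
      by (simp add: j_mult[OF fs f] j_star[OF f])
    also have "\<dots> = vac (star 1 * Rep \<gamma> (cc_star \<alpha> f) (Rep \<gamma> f 1))"
      by (simp add: vf_j[OF cc_mult_in[OF fs f]] Rep_mult[OF fs f])
    also have "\<dots> = vac (star (Rep \<gamma> f 1) * Rep \<gamma> f 1)" by (rule Rep_adjoint[OF f, symmetric])
    finally show "j f \<in> {x. 0 \<le> Re (vf \<gamma> (star x * x)) \<and> Im (vf \<gamma> (star x * x)) = 0}"
      by (simp add: vac_pos)
  qed
  then show ?thesis by simp
qed

lemma vf_star: "vf \<gamma> (star x) = cnj (vf \<gamma> x)"
proof -
  have "x \<in> {x. vf \<gamma> (star x) = cnj (vf \<gamma> x)}"
  proof (rule j_induct)
    show "closed {x. vf \<gamma> (star x) = cnj (vf \<gamma> x)}"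
      by (intro closed_Collect_eq continuous_on_cnj vf_comp_cont continuous_on_star continuous_on_id)
    fix f :: "'g \<Rightarrow> 'o" assume f: "f \<in> cc"
    have "vf \<gamma> (star (j f)) = vac (star 1 * Rep \<gamma> (cc_star \<alpha> f) 1)"
      by (simp add: j_star[OF f, symmetric] vf_j[OF cc_star_in[OF f]])
    also have "\<dots> = vac (star (Rep \<gamma> f 1) * 1)" by (rule Rep_adjoint[OF f, symmetric])
    finally show "j f \<in> {x. vf \<gamma> (star x) = cnj (vf \<gamma> x)}" by (simp add: vac_star vf_j[OF f])
  qed
  then show ?thesis by simp
qed

subsection \<open>Left multiplication by the generators\<close>

lemma cc_left_mult: "f \<in> cc \<Longrightarrow> (\<lambda>t. a * f t) \<in> cc" for f :: "'g \<Rightarrow> 'o"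
  by (rule cc_map[of f "\<lambda>_ x. a * x"]) (auto intro: continuous_intros ccD)

lemma gen_inner_cc:
  "cc_mult m \<alpha> (cc_star \<alpha> (\<lambda>t. S i * f t)) (\<lambda>t. S k * g t)
    = (if i = k then cc_mult m \<alpha> (cc_star \<alpha> f) g else (\<lambda>_. 0))"
proof -
  have "cc_star \<alpha> (\<lambda>t. S i * f t) s * \<alpha> s (S k * g (t - s))
      = (if i = k then cc_star \<alpha> f s * \<alpha> s (g (t - s)) else 0)" for s t
  proof -
    have "cc_star \<alpha> (\<lambda>t. S i * f t) s * \<alpha> s (S k * g (t - s)) = \<alpha> s (star (f (- s)) * (star (S i) * S k) * g (t - s))"
      by (simp only: cc_star_def al_mult star_mult mult.assoc)
    then show ?thesis by (cases "i = k") (simp_all add: S_rel cc_star_def al_mult al_one)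
  qed
  then show ?thesis by (auto simp: cc_mult_def[abs_def] fun_eq_iff)
qed

lemma gen_inner_j:
  assumes f: "f \<in> cc" and g: "g \<in> cc"
  shows "star (j (\<lambda>t. S i * f t)) * j (\<lambda>t. S k * g t) = (if i = k then star (j f) * j g else 0)"
proof -
  have "star (j (\<lambda>t. S i * f t)) * j (\<lambda>t. S k * g t) = j (cc_mult m \<alpha> (cc_star \<alpha> (\<lambda>t. S i * f t)) (\<lambda>t. S k * g t))"
    by (simp add: j_mult cc_star_in cc_left_mult f g j_star)
  then show ?thesis by (simp add: gen_inner_cc j_mult cc_star_in f g j_star j_zero)
qed

text \<open>Left multiplication by an isometry preserves the inner products in
  \<open>gen_inner_j\<close>, so it is isometric on the dense image of \<open>cc\<close>.\<close>

lemma LS_exists: "\<exists>T. (\<forall>f\<in>cc. T (j f) = j (\<lambda>t. S i * f t)) \<and> (\<forall>x y. T (x + y) = T x + T y) \<and>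
    (\<forall>c x. T (c *\<^sub>C x) = c *\<^sub>C T x) \<and> (\<forall>x. norm (T x) \<le> norm x)"
proof (rule extend)
  fix f g :: "'g \<Rightarrow> 'o" and c assume f: "f \<in> cc"
  show "j (\<lambda>t. S i * (f t + g t)) = j (\<lambda>t. S i * f t) + j (\<lambda>t. S i * g t)" if "g \<in> cc"
    using j_add[OF cc_left_mult[OF f] cc_left_mult[OF that]] by (simp add: distrib_left)
  show "j (\<lambda>t. S i * c *\<^sub>C f t) = c *\<^sub>C j (\<lambda>t. S i * f t)"
    using j_scale[OF cc_left_mult[OF f]] by (simp add: mult_scaleC_right)
  have "(norm (j (\<lambda>t. S i * f t)))\<^sup>2 = (norm (j f))\<^sup>2"
    using gen_inner_j[OF f f, of i i] by (simp add: cstar_identity[symmetric])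
  then show "norm (j (\<lambda>t. S i * f t)) \<le> norm (j f)" by (simp add: power2_eq_iff_nonneg)
qed

definition LS :: "nat \<Rightarrow> 'b \<Rightarrow> 'b" where
  "LS i = (SOME T. (\<forall>f\<in>cc. T (j f) = j (\<lambda>t. S i * f t)) \<and> (\<forall>x y. T (x + y) = T x + T y) \<and>
    (\<forall>c x. T (c *\<^sub>C x) = c *\<^sub>C T x) \<and> (\<forall>x. norm (T x) \<le> norm x))"

lemma LS_j: "f \<in> cc \<Longrightarrow> LS i (j f) = j (\<lambda>t. S i * f t)"
  and LS_add: "LS i (x + y) = LS i x + LS i y"
  and LS_scale: "LS i (c *\<^sub>C x) = c *\<^sub>C LS i x"
  and LS_bound: "norm (LS i x) \<le> norm x"
  using someI_ex[OF LS_exists[of i]] unfolding LS_def[symmetric] by simp_all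

lemma LS_comp_cont: "continuous_on X f \<Longrightarrow> continuous_on X (\<lambda>x. LS i (f x))"
  by (rule continuous_on_compose2[OF linear_continuous_on[of "LS i" UNIV]])
    (auto intro!: bounded_linear_intro[of _ 1] simp: LS_add LS_bound scaleR_scaleC[where 'a='b] LS_scale)

lemma LS_mult: "LS i x * y = LS i (x * y)"
proof (rule j_induct2[of "\<lambda>x y. LS i x * y = LS i (x * y)"])
  show "closed {x. LS i x * y = LS i (x * y)}" "closed {y. LS i x * y = LS i (x * y)}" for x y
    by (intro closed_Collect_eq continuous_on_mult LS_comp_cont continuous_on_id continuous_on_const)+
  fix f g :: "'g \<Rightarrow> 'o" assume f: "f \<in> cc" and g: "g \<in> cc"
  have "cc_mult m \<alpha> (\<lambda>t. S i * f t) g t = S i * cc_mult m \<alpha> f g t" for t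
  proof -
    have "integrable m (\<lambda>s. f s * \<alpha> s (g (t - s)))"
      by (rule cc_integrable, rule cc_map[OF f, of "\<lambda>s x. x * \<alpha> s (g (t - s))"])
        (auto intro!: continuous_intros al_cont ccD[OF f] continuous_on_compose2[OF ccD[OF g]])
    then show ?thesis by (simp add: cc_mult_def mult.assoc)
  qed
  then have "cc_mult m \<alpha> (\<lambda>t. S i * f t) g = (\<lambda>t. S i * cc_mult m \<alpha> f g t)" by (rule ext)
  then show "LS i (j f) * j g = LS i (j f * j g)"
    by (simp add: LS_j f g j_mult[symmetric] cc_left_mult cc_mult_in)
qed

lemma LS_inner: "star (LS i x) * LS k y = (if i = k then star x * y else 0)"
proof (rule j_induct2[of "\<lambda>x y. star (LS i x) * LS k y = (if i = k then star x * y else 0)"])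
  show "closed {x. star (LS i x) * LS k y = (if i = k then star x * y else 0)}"
    "closed {y. star (LS i x) * LS k y = (if i = k then star x * y else 0)}" for x y
    by (cases "i = k"; simp; intro closed_Collect_eq continuous_on_mult continuous_on_star LS_comp_cont
        continuous_on_id continuous_on_const)+
qed (simp add: LS_j gen_inner_j)

lemma vf_LS: "vf \<gamma> (LS i x) = 0"
proof -
  have "x \<in> {x. vf \<gamma> (LS i x) = 0}"
  proof (rule j_induct)
    show "closed {x. vf \<gamma> (LS i x) = 0}"
      by (intro closed_Collect_eq vf_comp_cont LS_comp_cont continuous_on_id continuous_on_const)
    fix f :: "'g \<Rightarrow> 'o" assume f: "f \<in> cc"
    have "vf \<gamma> (LS i (j f)) = (LINT t|m. pairing t \<gamma> * vac (S i * f t * \<alpha> t 1))"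
      by (simp add: LS_j[OF f] vf_j[OF cc_left_mult[OF f]] vac_Rep[OF cc_left_mult[OF f]])
    then show "j f \<in> {x. vf \<gamma> (LS i x) = 0}" by (simp add: mult.assoc vac_S_left)
  qed
  then show ?thesis by simp
qed

subsection \<open>The dual action\<close>

lemma cc_pairing: "f \<in> cc \<Longrightarrow> (\<lambda>t. pairing t \<xi> *\<^sub>C f t) \<in> cc" for f :: "'g \<Rightarrow> 'o"
  by (rule cc_map[of f "\<lambda>t x. pairing t \<xi> *\<^sub>C x"]) (simp_all add: continuous_on_scaleC pairing_cont ccD)

lemma pairing_cc_mult:
  assumes f: "f \<in> cc" and g: "g \<in> cc"
  shows "cc_mult m \<alpha> (\<lambda>t. pairing t \<xi> *\<^sub>C f t) (\<lambda>t. pairing t \<xi> *\<^sub>C g t) = (\<lambda>t. pairing t \<xi> *\<^sub>C cc_mult m \<alpha> f g t)"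
proof
  fix t
  have int: "integrable m (\<lambda>s. f s * \<alpha> s (g (t - s)))"
    by (rule cc_integrable, rule cc_map[OF f, of "\<lambda>s x. x * \<alpha> s (g (t - s))"])
      (auto intro!: continuous_intros al_cont ccD[OF f] continuous_on_compose2[OF ccD[OF g]])
  have p: "pairing s \<xi> * pairing (t - s) \<xi> = pairing t \<xi>" for s
    using pairing_simps(1)[of s "t - s" \<xi>] by simp
  then have p': "pairing (t - s) \<xi> * pairing s \<xi> = pairing t \<xi>" for s by (simp add: mult.commute)
  have "cc_mult m \<alpha> (\<lambda>t. pairing t \<xi> *\<^sub>C f t) (\<lambda>t. pairing t \<xi> *\<^sub>C g t) t
    = (LINT s|m. pairing t \<xi> *\<^sub>C (f s * \<alpha> s (g (t - s))))"
    by (simp add: cc_mult_def al_scale mult_scaleC_left mult_scaleC_right scaleC_scaleC p p')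
  then show "cc_mult m \<alpha> (\<lambda>t. pairing t \<xi> *\<^sub>C f t) (\<lambda>t. pairing t \<xi> *\<^sub>C g t) t = pairing t \<xi> *\<^sub>C cc_mult m \<alpha> f g t"
    by (simp add: cc_mult_def integral_bounded_linear[OF bounded_linear_scaleC_right int])
qed

lemma pairing_cc_star: "cc_star \<alpha> (\<lambda>t. pairing t \<xi> *\<^sub>C f t) = (\<lambda>t. pairing t \<xi> *\<^sub>C cc_star \<alpha> f t)"
  by (simp add: cc_star_def[abs_def] star_scaleC al_scale)

text \<open>Multiplying functions by a character is a *-automorphism of the convolution algebra that
  preserves the L1-norm. The norm pulled back along it is therefore an admissible C*-seminorm, and
  maximality makes the map contractive.\<close>

lemma dact_exists: "\<exists>T. (\<forall>f\<in>cc. T (j f) = j (\<lambda>t. pairing t \<xi> *\<^sub>C f t)) \<and> (\<forall>x y. T (x + y) = T x + T y) \<and>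
    (\<forall>c x. T (c *\<^sub>C x) = c *\<^sub>C T x) \<and> (\<forall>x. norm (T x) \<le> norm x)"
proof (rule extend)
  fix f g :: "'g \<Rightarrow> 'o" and c assume f: "f \<in> cc"
  show add: "j (\<lambda>t. pairing t \<xi> *\<^sub>C (f t + g t)) = j (\<lambda>t. pairing t \<xi> *\<^sub>C f t) + j (\<lambda>t. pairing t \<xi> *\<^sub>C g t)"
    if "g \<in> cc" using j_add[OF cc_pairing[OF f] cc_pairing[OF that]] by (simp add: scaleC_add_right)
  show scale: "j (\<lambda>t. pairing t \<xi> *\<^sub>C c *\<^sub>C f t) = c *\<^sub>C j (\<lambda>t. pairing t \<xi> *\<^sub>C f t)"
    using j_scale[OF cc_pairing[OF f], of c \<xi>] by (simp add: scaleC_scaleC mult.commute)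
  show "norm (j (\<lambda>t. pairing t \<xi> *\<^sub>C f t)) \<le> norm (j f)"
  proof (rule j_max[where p = "\<lambda>f. norm (j (\<lambda>t. pairing t \<xi> *\<^sub>C f t))", OF _ _ f])
    show "cstar_seminorm cc (cc_mult m \<alpha>) (cc_star \<alpha>) (\<lambda>f. norm (j (\<lambda>t. pairing t \<xi> *\<^sub>C f t)))"
      unfolding cstar_seminorm_def
    proof (intro conjI ballI allI)
      fix f g :: "'g \<Rightarrow> 'o" and c assume f: "f \<in> cc"
      note pf = cc_pairing[OF f, of \<xi>]
      show "norm (j (\<lambda>t. pairing t \<xi> *\<^sub>C c *\<^sub>C f t)) = cmod c * norm (j (\<lambda>t. pairing t \<xi> *\<^sub>C f t))"
        using j_scale[OF pf, of c] by (simp add: scaleC_scaleC mult.commute norm_scaleC)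
      show "norm (j (\<lambda>t. pairing t \<xi> *\<^sub>C cc_mult m \<alpha> (cc_star \<alpha> f) f t)) = (norm (j (\<lambda>t. pairing t \<xi> *\<^sub>C f t)))\<^sup>2"
        unfolding pairing_cc_mult[OF cc_star_in[OF f] f, symmetric] pairing_cc_star[symmetric]
        using j_mult[OF cc_star_in[OF pf] pf] j_star[OF pf] by (simp add: cstar_identity)
      assume g: "g \<in> cc"
      note pg = cc_pairing[OF g, of \<xi>]
      show "norm (j (\<lambda>t. pairing t \<xi> *\<^sub>C (f t + g t))) \<le> norm (j (\<lambda>t. pairing t \<xi> *\<^sub>C f t)) + norm (j (\<lambda>t. pairing t \<xi> *\<^sub>C g t))"
        using j_add[OF pf pg] by (simp add: scaleC_add_right norm_triangle_ineq)
      show "norm (j (\<lambda>t. pairing t \<xi> *\<^sub>C cc_mult m \<alpha> f g t)) \<le> norm (j (\<lambda>t. pairing t \<xi> *\<^sub>C f t)) * norm (j (\<lambda>t. pairing t \<xi> *\<^sub>C g t))"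
        unfolding pairing_cc_mult[OF f g, symmetric] using j_mult[OF pf pg] by (simp add: norm_mult_ineq)
    qed
    show "norm (j (\<lambda>t. pairing t \<xi> *\<^sub>C f t)) \<le> (LINT t|m. norm (f t))" if "f \<in> cc" for f
      using j_L1[OF cc_pairing[OF that], of \<xi>] by (simp add: norm_scaleC)
  qed
qed

definition dact :: "'g dual \<Rightarrow> 'b \<Rightarrow> 'b" where
  "dact \<xi> = (SOME T. (\<forall>f\<in>cc. T (j f) = j (\<lambda>t. pairing t \<xi> *\<^sub>C f t)) \<and> (\<forall>x y. T (x + y) = T x + T y) \<and>
    (\<forall>c x. T (c *\<^sub>C x) = c *\<^sub>C T x) \<and> (\<forall>x. norm (T x) \<le> norm x))"

lemma dact_j: "f \<in> cc \<Longrightarrow> dact \<xi> (j f) = j (\<lambda>t. pairing t \<xi> *\<^sub>C f t)"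
  and dact_add: "dact \<xi> (x + y) = dact \<xi> x + dact \<xi> y"
  and dact_scale: "dact \<xi> (c *\<^sub>C x) = c *\<^sub>C dact \<xi> x"
  and dact_bound: "norm (dact \<xi> x) \<le> norm x"
  using someI_ex[OF dact_exists[of \<xi>]] unfolding dact_def[symmetric] by simp_all

lemma dact_comp_cont: "continuous_on X f \<Longrightarrow> continuous_on X (\<lambda>x. dact \<xi> (f x))"
  by (rule continuous_on_compose2[OF linear_continuous_on[of "dact \<xi>" UNIV]])
    (auto intro!: bounded_linear_intro[of _ 1] simp: dact_add dact_bound scaleR_scaleC[where 'a='b] dact_scale)

lemma vf_dact: "vf \<gamma> (dact \<xi> x) = vf (\<gamma> + \<xi>) x"
proof -
  have "x \<in> {x. vf \<gamma> (dact \<xi> x) = vf (\<gamma> + \<xi>) x}"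
  proof (rule j_induct)
    show "closed {x. vf \<gamma> (dact \<xi> x) = vf (\<gamma> + \<xi>) x}"
      by (intro closed_Collect_eq vf_comp_cont dact_comp_cont continuous_on_id)
    fix f :: "'g \<Rightarrow> 'o" assume f: "f \<in> cc"
    show "j f \<in> {x. vf \<gamma> (dact \<xi> x) = vf (\<gamma> + \<xi>) x}"
      by (simp add: dact_j[OF f] vf_j f cc_pairing vac_Rep mult_scaleC_left vac_scale mult.assoc)
  qed
  then show ?thesis by simp
qed

subsection \<open>The copy of the group algebra\<close>

lemma cc_coeff:
  fixes x :: 'o
  assumes "\<phi> \<in> cc" shows "(\<lambda>t. \<phi> t *\<^sub>C x) \<in> cc"
  by (rule cc_map[OF assms, of "\<lambda>_ c. c *\<^sub>C x"]) (simp_all add: continuous_on_scaleC ccD[OF assms])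

lemma cc_pairing_times: "\<phi> \<in> cc \<Longrightarrow> (\<lambda>t. pairing t \<xi> * \<phi> t) \<in> cc" for \<phi> :: "'g \<Rightarrow> complex"
  using cc_times[of \<phi> "\<lambda>t. pairing t \<xi>"] by (simp add: pairing_cont mult.commute)

lemma cc_const_times: "\<phi> \<in> cc \<Longrightarrow> (\<lambda>t. c * \<phi> t) \<in> cc" for \<phi> :: "'g \<Rightarrow> complex"
  using cc_times[of \<phi> "\<lambda>_. c"] by (simp add: mult.commute)

lemma cc_adj: fixes \<phi> :: "'g \<Rightarrow> complex" assumes "\<phi> \<in> cc" shows "(\<lambda>t. cnj (\<phi> (- t))) \<in> cc"
  by (rule cc_map[OF cc_reflect[OF assms], of "\<lambda>_. cnj"])
    (simp_all add: continuous_on_cnj ccD[OF cc_reflect[OF assms]])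

definition lam :: "('g \<Rightarrow> complex) \<Rightarrow> 'b" where
  "lam \<phi> = j (\<lambda>t. \<phi> t *\<^sub>C 1)"

text \<open>The Fourier transform with the character itself in place of its conjugate, to agree with
  \<open>Rep\<close>.\<close>

definition ft :: "('g \<Rightarrow> complex) \<Rightarrow> 'g dual \<Rightarrow> complex" where
  "ft \<phi> \<gamma> = (LINT t|m. pairing t \<gamma> * \<phi> t)"

lemma lam_add: "\<phi> \<in> cc \<Longrightarrow> \<psi> \<in> cc \<Longrightarrow> lam (\<lambda>t. \<phi> t + \<psi> t) = lam \<phi> + lam \<psi>"
  unfolding lam_def by (simp add: j_add[symmetric] cc_coeff scaleC_add_left)

lemma lam_scale: "\<phi> \<in> cc \<Longrightarrow> lam (\<lambda>t. c * \<phi> t) = c *\<^sub>C lam \<phi>"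
  unfolding lam_def by (simp add: j_scale[symmetric] cc_coeff scaleC_scaleC)

lemma lam_diff: "\<phi> \<in> cc \<Longrightarrow> \<psi> \<in> cc \<Longrightarrow> lam (\<lambda>t. \<phi> t - \<psi> t) = lam \<phi> - lam \<psi>"
  unfolding lam_def by (simp add: j_diff[symmetric] cc_coeff scaleC_diff_left)

lemma lam_L1: "\<phi> \<in> cc \<Longrightarrow> norm (lam \<phi>) \<le> (LINT t|m. cmod (\<phi> t))"
  using j_L1[OF cc_coeff, of \<phi> 1] by (simp add: lam_def norm_scaleC)

lemma lam_mult:
  assumes f: "\<phi> \<in> cc" and g: "\<psi> \<in> cc" shows "lam \<phi> * lam \<psi> = lam (conv \<phi> \<psi>)"
proof -
  have "cc_mult m \<alpha> (\<lambda>t. \<phi> t *\<^sub>C 1) (\<lambda>t. \<psi> t *\<^sub>C 1) t = conv \<phi> \<psi> t *\<^sub>C (1::'o)" for t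
  proof -
    have "cc_mult m \<alpha> (\<lambda>t. \<phi> t *\<^sub>C 1) (\<lambda>t. \<psi> t *\<^sub>C 1) t = (LINT s|m. (\<phi> s * \<psi> (t - s)) *\<^sub>C (1::'o))"
      by (simp add: cc_mult_def al_scale al_one mult_scaleC_left scaleC_scaleC)
    also have "\<dots> = conv \<phi> \<psi> t *\<^sub>C 1" unfolding conv_def
      by (rule integral_bounded_linear[OF bounded_bilinear.bounded_linear_left[OF bounded_bilinear_scaleC]
          cc_integrable[OF conv_integrand[OF f g]]])
    finally show ?thesis .
  qed
  then have "cc_mult m \<alpha> (\<lambda>t. \<phi> t *\<^sub>C 1) (\<lambda>t. \<psi> t *\<^sub>C 1) = (\<lambda>t. conv \<phi> \<psi> t *\<^sub>C (1::'o))" by (rule ext)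
  then show ?thesis unfolding lam_def by (simp add: j_mult[symmetric] cc_coeff f g)
qed

lemma lam_star: "\<phi> \<in> cc \<Longrightarrow> star (lam \<phi>) = lam (\<lambda>t. cnj (\<phi> (- t)))"
  unfolding lam_def by (simp add: j_star[symmetric] cc_coeff cc_star_def[abs_def] star_scaleC al_scale al_one)

lemma Rep_lam: assumes f: "\<phi> \<in> cc" shows "Rep \<gamma> (\<lambda>t. \<phi> t *\<^sub>C 1) 1 = ft \<phi> \<gamma> *\<^sub>C 1"
proof -
  have "Rep \<gamma> (\<lambda>t. \<phi> t *\<^sub>C 1) 1 = (LINT t|m. (pairing t \<gamma> * \<phi> t) *\<^sub>C (1::'o))"
    by (simp add: Rep_def al_one scaleC_scaleC)
  also have "\<dots> = ft \<phi> \<gamma> *\<^sub>C 1" unfolding ft_def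
    by (rule integral_bounded_linear[OF bounded_bilinear.bounded_linear_left[OF bounded_bilinear_scaleC]
        cc_integrable[OF cc_pairing_times[OF f]]])
  finally show ?thesis .
qed

lemma vf_lam: "\<phi> \<in> cc \<Longrightarrow> vf \<gamma> (lam \<phi>) = ft \<phi> \<gamma>"
  unfolding lam_def by (simp add: vf_j cc_coeff Rep_lam vac_scale vac_one)

lemma vf_lam_mult:
  assumes f: "\<phi> \<in> cc" and g: "\<psi> \<in> cc" shows "vf \<gamma> (lam \<phi> * lam \<psi>) = vf \<gamma> (lam \<phi>) * vf \<gamma> (lam \<psi>)"
proof -
  note F = cc_coeff[OF f, of 1] and G = cc_coeff[OF g, of 1]
  have "vf \<gamma> (lam \<phi> * lam \<psi>) = vac (Rep \<gamma> (cc_mult m \<alpha> (\<lambda>t. \<phi> t *\<^sub>C 1) (\<lambda>t. \<psi> t *\<^sub>C 1)) 1)"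
    unfolding lam_def j_mult[OF F G, symmetric] by (rule vf_j[OF cc_mult_in[OF F G]])
  also have "\<dots> = ft \<psi> \<gamma> * ft \<phi> \<gamma>"
    by (simp add: Rep_mult[OF F G] Rep_lam f g Rep_scale_right[OF F] vac_scale vac_one)
  finally show ?thesis by (simp add: vf_lam f g)
qed

lemma dact_lam: "\<phi> \<in> cc \<Longrightarrow> dact \<xi> (lam \<phi>) = lam (\<lambda>t. pairing t \<xi> * \<phi> t)"
  unfolding lam_def by (simp add: dact_j cc_coeff scaleC_scaleC)

text \<open>The image of the group C*-algebra, which the functionals \<open>vf \<gamma>\<close>
  identify with continuous functions on the dual group vanishing at infinity.\<close>

definition galg :: "'b set" where
  "galg = closure (lam ` cc)"

lemma lam_in_galg: "\<phi> \<in> cc \<Longrightarrow> lam \<phi> \<in> galg"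
  unfolding galg_def by (rule subsetD[OF closure_subset]) simp

lemma galg_induct:
  assumes "a \<in> galg" "closed X" "\<And>\<phi>. \<phi> \<in> cc \<Longrightarrow> lam \<phi> \<in> X" shows "a \<in> X"
proof -
  have "galg \<subseteq> X" unfolding galg_def by (rule closure_minimal[OF image_subsetI assms(2)]) (rule assms(3))
  then show ?thesis using assms(1) by blast
qed

lemma galg_induct2:
  assumes ab: "a \<in> galg" "b \<in> galg" and cl: "\<And>y. closed {x. P x y}" "\<And>x. closed {y. P x y}"
    and lam: "\<And>\<phi> \<psi>. \<phi> \<in> cc \<Longrightarrow> \<psi> \<in> cc \<Longrightarrow> P (lam \<phi>) (lam \<psi>)"
  shows "P a b"
proof -
  have 1: "a \<in> {x. P x (lam \<psi>)}" if "\<psi> \<in> cc" for \<psi>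
    by (rule galg_induct[OF ab(1) cl(1)]) (simp add: lam that)
  have "b \<in> {y. P a y}" by (rule galg_induct[OF ab(2) cl(2)]) (use 1 in simp)
  then show ?thesis by simp
qed

lemma galg_closed: "closed galg"
  by (simp add: galg_def)

lemma closed_galg_vimage: "continuous_on UNIV f \<Longrightarrow> closed {x. f x \<in> galg}"
  using closed_vimage[OF galg_closed, of f] by (simp add: vimage_def)

lemma galg_approx: assumes a: "a \<in> galg" and e: "e > 0" shows "\<exists>\<phi>\<in>cc. norm (a - lam \<phi>) < e"
  using a e unfolding galg_def closure_approachable dist_norm by (metis imageE norm_minus_commute)

sublocale comm_star_subalgebra galg
proof
  show "0 \<in> galg" using lam_in_galg[OF cc_zero] lam_scale[OF cc_zero, of 0] by simp
  fix x y :: 'b and c assume x: "x \<in> galg"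
  have "x \<in> {x. c *\<^sub>C x \<in> galg}"
    by (rule galg_induct[OF x closed_galg_vimage])
      (auto simp: lam_scale[symmetric] cc_const_times intro!: lam_in_galg continuous_intros)
  then show "c *\<^sub>C x \<in> galg" by simp
  have "x \<in> {x. star x \<in> galg}"
    by (rule galg_induct[OF x closed_galg_vimage])
      (auto simp: lam_star cc_adj intro!: lam_in_galg continuous_intros)
  then show "star x \<in> galg" by simp
  assume y: "y \<in> galg"
  show "x + y \<in> galg"
    by (rule galg_induct2[OF x y closed_galg_vimage closed_galg_vimage])
      (auto simp: lam_add[symmetric] cc_add intro!: lam_in_galg continuous_intros)
  show "x * y \<in> galg"
    by (rule galg_induct2[OF x y closed_galg_vimage closed_galg_vimage])
      (auto simp: lam_mult intro!: lam_in_galg conv_in continuous_intros)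
  show "x * y = y * x"
  proof (rule galg_induct2[OF x y])
    show "lam \<phi> * lam \<psi> = lam \<psi> * lam \<phi>" if "\<phi> \<in> cc" "\<psi> \<in> cc" for \<phi> \<psi>
      by (simp add: lam_mult that conv_commute[OF that])
  qed (intro closed_Collect_eq continuous_intros)+
qed

text \<open>This is the assumption \<open>ch_complete\<close> of \<open>core\<close>. A character of
  the subalgebra restricts to an L1-bounded character of the convolution algebra, so by
  \<open>convolution_character\<close> it is evaluation of the Fourier transform at some \<gamma>;
  density of the functions extends the identity to the closure.\<close>

lemma galg_character:
  assumes q: "cseminorm_on galg q" and le: "\<And>x. x \<in> galg \<Longrightarrow> q x \<le> norm x" and a: "a \<in> galg" "q a > 0"
  shows "\<exists>\<gamma>. (\<forall>x\<in>galg. cmod (vf \<gamma> x) \<le> q x) \<and> cmod (vf \<gamma> a) = q a"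
proof -
  obtain \<kappa> where \<kappa>: "\<And>x y. x \<in> galg \<Longrightarrow> y \<in> galg \<Longrightarrow> \<kappa> (x + y) = \<kappa> x + (\<kappa> y :: complex)"
    "\<And>c x. x \<in> galg \<Longrightarrow> \<kappa> (c *\<^sub>C x) = c * \<kappa> x"
    "\<And>x y. x \<in> galg \<Longrightarrow> y \<in> galg \<Longrightarrow> \<kappa> (x * y) = \<kappa> x * \<kappa> y"
    "\<And>x. x \<in> galg \<Longrightarrow> cmod (\<kappa> x) \<le> q x" "cmod (\<kappa> a) = q a"
    using character_exists[OF q a] by blast
  have \<kappa>_le: "cmod (\<kappa> x) \<le> norm x" if "x \<in> galg" for x using \<kappa>(4)[OF that] le[OF that] by linarith
  have \<kappa>_diff: "\<kappa> (x - y) = \<kappa> x - \<kappa> y" if "x \<in> galg" "y \<in> galg" for x y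
    using \<kappa>(1)[OF that(1) A_scale[OF that(2)], of "-1"] \<kappa>(2)[OF that(2), of "-1"] by simp
  have "\<exists>\<psi>\<in>cc. \<kappa> (lam \<psi>) \<noteq> 0"
  proof (rule ccontr)
    assume "\<not> ?thesis"
    then have z: "\<And>\<psi>. \<psi> \<in> cc \<Longrightarrow> \<kappa> (lam \<psi>) = 0" by blast
    obtain \<phi> where \<phi>: "\<phi> \<in> cc" "norm (a - lam \<phi>) < q a" using galg_approx[OF a] by blast
    have "cmod (\<kappa> (a - lam \<phi>)) \<le> norm (a - lam \<phi>)" by (rule \<kappa>_le[OF A_diff[OF a(1) lam_in_galg[OF \<phi>(1)]]])
    then show False using \<phi> \<kappa>(5) by (simp add: \<kappa>_diff a lam_in_galg z)
  qed
  then obtain \<psi> where \<psi>: "\<psi> \<in> cc" "\<kappa> (lam \<psi>) \<noteq> 0" by blast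
  have "\<exists>\<gamma>. \<forall>\<phi>\<in>cc. \<kappa> (lam \<phi>) = (LINT t|m. pairing t \<gamma> * \<phi> t)"
  proof (rule convolution_character[where K = "\<lambda>\<phi>. \<kappa> (lam \<phi>)", OF _ _ _ _ \<psi>])
    show "cmod (\<kappa> (lam \<phi>)) \<le> (LINT t|m. cmod (\<phi> t))" if "\<phi> \<in> cc" for \<phi>
      using \<kappa>_le[OF lam_in_galg[OF that]] lam_L1[OF that] by linarith
  qed (simp_all add: lam_add lam_scale \<kappa> lam_in_galg lam_mult[symmetric])
  then obtain \<gamma> where \<gamma>: "\<And>\<phi>. \<phi> \<in> cc \<Longrightarrow> \<kappa> (lam \<phi>) = vf \<gamma> (lam \<phi>)" by (auto simp: vf_lam ft_def)
  have "\<kappa> x = vf \<gamma> x" if x: "x \<in> galg" for x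
  proof -
    have "cmod (\<kappa> x - vf \<gamma> x) \<le> 0 + e" if e: "e > 0" for e
    proof -
      obtain \<phi> where \<phi>: "\<phi> \<in> cc" "norm (x - lam \<phi>) < e/2" using galg_approx[OF x, of "e/2"] e by auto
      have "\<kappa> x - vf \<gamma> x = \<kappa> (x - lam \<phi>) - vf \<gamma> (x - lam \<phi>)"
        using vf_add[of \<gamma> "x - lam \<phi>" "lam \<phi>"] by (simp add: \<kappa>_diff x lam_in_galg \<phi> \<gamma>)
      also have "cmod \<dots> \<le> cmod (\<kappa> (x - lam \<phi>)) + cmod (vf \<gamma> (x - lam \<phi>))" by (rule norm_triangle_ineq4)
      finally show ?thesis
        using \<kappa>_le[OF A_diff[OF x lam_in_galg[OF \<phi>(1)]]] vf_bound[of \<gamma> "x - lam \<phi>"] \<phi>(2) by linarith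
    qed
    then have "cmod (\<kappa> x - vf \<gamma> x) \<le> 0" by (rule field_le_epsilon)
    then show ?thesis by simp
  qed
  then show ?thesis using \<kappa>(4,5) a by (intro exI[of _ \<gamma>]) auto
qed

text \<open>A nonnegative bump function times the conjugate character, divided by its
  integral.\<close>

lemma ft_unit: "\<exists>\<phi>\<in>cc. ft \<phi> \<gamma> = 1"
proof -
  obtain \<phi> :: "'g \<Rightarrow> real" where \<phi>: "\<phi> \<in> cc" "(LINT t|m. \<phi> t) > 0" using positive_integral_exists by blast
  define c where "c = (LINT t|m. \<phi> t)"
  define \<psi> where "\<psi> t = complex_of_real (\<phi> t)" for t
  have \<psi>: "\<psi> \<in> cc" unfolding \<psi>_def
    by (rule cc_map[OF \<phi>(1), of "\<lambda>_. complex_of_real"]) (auto intro!: continuous_intros ccD[OF \<phi>(1)])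
  have I: "(LINT t|m. \<psi> t) = complex_of_real c" by (simp add: \<psi>_def c_def)
  let ?f = "\<lambda>t. inverse (complex_of_real c) * (pairing t (- \<gamma>) * \<psi> t)"
  have "?f \<in> cc" by (intro cc_const_times cc_pairing_times \<psi>)
  moreover have "pairing t \<gamma> * ?f t = inverse (complex_of_real c) * \<psi> t" for t
    using pairing_cnj(2)[of t \<gamma>] by (simp add: mult_ac)
  then have "ft ?f \<gamma> = inverse (complex_of_real c) * (LINT t|m. \<psi> t)"
    unfolding ft_def by (simp only: integral_mult_right_zero)
  then have "ft ?f \<gamma> = 1" using \<phi>(2) by (simp add: I c_def[symmetric])
  ultimately show ?thesis by blast
qed

lemma LS_comm: assumes a: "a \<in> galg" shows "a * LS i x = LS i (dact (\<omega> i) a * x)"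
proof -
  have "a \<in> {a. \<forall>x. a * LS i x = LS i (dact (\<omega> i) a * x)}"
  proof (rule galg_induct[OF a])
    show "closed {a. \<forall>x. a * LS i x = LS i (dact (\<omega> i) a * x)}"
      by (intro closed_Collect_all closed_Collect_eq continuous_intros LS_comp_cont dact_comp_cont)
    fix \<phi> :: "'g \<Rightarrow> complex" assume \<phi>: "\<phi> \<in> cc"
    have "x \<in> {x. lam \<phi> * LS i x = LS i (dact (\<omega> i) (lam \<phi>) * x)}" for x
    proof (rule j_induct)
      show "closed {x. lam \<phi> * LS i x = LS i (dact (\<omega> i) (lam \<phi>) * x)}"
        by (intro closed_Collect_eq continuous_intros LS_comp_cont)
      fix f :: "'g \<Rightarrow> 'o" assume f: "f \<in> cc"
      note F = cc_coeff[OF \<phi>, of 1] and G = cc_coeff[OF cc_pairing_times[OF \<phi>], of "\<omega> i" 1]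
      have "cc_mult m \<alpha> (\<lambda>t. \<phi> t *\<^sub>C 1) (\<lambda>t. S i * f t) t
          = S i * cc_mult m \<alpha> (\<lambda>t. (pairing t (\<omega> i) * \<phi> t) *\<^sub>C 1) f t" for t
      proof -
        have int: "integrable m (\<lambda>s. (pairing s (\<omega> i) * \<phi> s) *\<^sub>C \<alpha> s (f (t - s)))"
          by (rule cc_integrable, rule cc_map[OF cc_pairing_times[OF \<phi>], of "\<lambda>s c. c *\<^sub>C \<alpha> s (f (t - s))"])
            (auto intro!: continuous_intros al_cont ccD[OF cc_pairing_times[OF \<phi>]]
              continuous_on_compose2[OF ccD[OF f]])
        have "cc_mult m \<alpha> (\<lambda>t. \<phi> t *\<^sub>C 1) (\<lambda>t. S i * f t) t
            = (LINT s|m. S i * ((pairing s (\<omega> i) * \<phi> s) *\<^sub>C \<alpha> s (f (t - s))))"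
          by (simp add: cc_mult_def al_mult al_S mult_scaleC_left mult_scaleC_right scaleC_scaleC mult.commute)
        then show ?thesis using int by (simp add: cc_mult_def mult_scaleC_left)
      qed
      then have "cc_mult m \<alpha> (\<lambda>t. \<phi> t *\<^sub>C 1) (\<lambda>t. S i * f t)
          = (\<lambda>t. S i * cc_mult m \<alpha> (\<lambda>t. (pairing t (\<omega> i) * \<phi> t) *\<^sub>C 1) f t)" by (rule ext)
      then have "lam \<phi> * LS i (j f) = LS i (lam (\<lambda>t. pairing t (\<omega> i) * \<phi> t) * j f)"
        unfolding lam_def by (simp add: LS_j f F G j_mult[symmetric] cc_left_mult cc_mult_in)
      then show "j f \<in> {x. lam \<phi> * LS i x = LS i (dact (\<omega> i) (lam \<phi>) * x)}" by (simp add: dact_lam[OF \<phi>])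
    qed
    then show "lam \<phi> \<in> {a. \<forall>x. a * LS i x = LS i (dact (\<omega> i) a * x)}" by simp
  qed
  then show ?thesis by simp
qed

sublocale core galg vf dact LS \<omega>
proof
  show "closed galg" by (rule galg_closed)
  show "vf \<gamma> (x + y) = vf \<gamma> x + vf \<gamma> y" "vf \<gamma> (c *\<^sub>C x) = c * vf \<gamma> x"
    "0 \<le> Re (vf \<gamma> (star x * x))" "Im (vf \<gamma> (star x * x)) = 0" "cmod (vf \<gamma> x) \<le> norm x"
    "vf \<gamma> (star x) = cnj (vf \<gamma> x)" "vf \<gamma> (LS i x) = 0" for \<gamma> x y c i
    using vf_pos[of \<gamma> x] by (simp_all add: vf_add vf_scale vf_bound vf_star vf_LS)
  show "vf \<gamma> (a * b) = vf \<gamma> a * vf \<gamma> b" if "a \<in> galg" "b \<in> galg" for \<gamma> a b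
    by (rule galg_induct2[OF that])
      (auto simp: vf_lam_mult intro!: closed_Collect_eq continuous_intros vf_comp_cont)
  show "\<exists>\<gamma>. (\<forall>x\<in>galg. cmod (vf \<gamma> x) \<le> q x) \<and> cmod (vf \<gamma> a) = q a"
    if "cseminorm_on galg q" "\<And>x. x \<in> galg \<Longrightarrow> q x \<le> norm x" "a \<in> galg" "q a > 0" for q a
    by (rule galg_character) fact+
  show "\<exists>e\<in>galg. vf \<gamma> e = 1" for \<gamma> using ft_unit[of \<gamma>] lam_in_galg vf_lam by metis
  show "dact \<xi> a \<in> galg" if "a \<in> galg" for \<xi> a
  proof -
    have "a \<in> {a. dact \<xi> a \<in> galg}"
      by (rule galg_induct[OF that closed_galg_vimage])
        (auto simp: dact_lam cc_pairing_times intro!: lam_in_galg dact_comp_cont continuous_intros)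
    then show ?thesis by simp
  qed
  show "vf \<gamma> (dact \<xi> a) = vf (\<gamma> + \<xi>) a" for \<gamma> \<xi> a by (rule vf_dact)
  show "LS i (x + y) = LS i x + LS i y" "LS i (c *\<^sub>C x) = c *\<^sub>C LS i x" "LS i x * y = LS i (x * y)"
    "star (LS i x) * LS k y = (if i = k then star x * y else 0)" for i k x y c
    by (rule LS_add LS_scale LS_mult LS_inner)+
  show "a * LS i x = LS i (dact (\<omega> i) a * x)" if "a \<in> galg" for a i x by (rule LS_comm[OF that])
qed

end

text \<open>Compactness of \<open>K\<close> leaves a uniform margin between the attained distances
  and \<open>d\<close>, within which \<gamma> can be moved.\<close>

lemma open_uniform_nbhd:
  fixes \<delta> :: "'g::topological_ab_group_add dual"
  assumes K: "compact K" shows "open {\<gamma>. \<forall>t\<in>K. cmod (char_of \<gamma> t - char_of \<delta> t) < d}"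
  unfolding open_dual_def
proof (intro ballI)
  fix \<gamma> assume \<gamma>: "\<gamma> \<in> {\<gamma>. \<forall>t\<in>K. cmod (char_of \<gamma> t - char_of \<delta> t) < d}"
  have "\<exists>r>0. \<forall>t\<in>K. cmod (char_of \<gamma> t - char_of \<delta> t) + r \<le> d"
  proof (cases "K = {}")
    case True
    then show ?thesis by (intro exI[of _ 1]) simp
  next
    case False
    have "continuous_on K (\<lambda>t. cmod (char_of \<gamma> t - char_of \<delta> t))"
      by (intro continuous_intros continuous_on_subset[OF char_of_facts(1)]) auto
    then obtain t0 where "t0 \<in> K" "\<forall>t\<in>K. cmod (char_of \<gamma> t - char_of \<delta> t) \<le> cmod (char_of \<gamma> t0 - char_of \<delta> t0)"
      using continuous_attains_sup[OF K False] by blast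
    then show ?thesis using \<gamma> by (intro exI[of _ "d - cmod (char_of \<gamma> t0 - char_of \<delta> t0)"]) auto
  qed
  then obtain r where r: "r > 0" "\<And>t. t \<in> K \<Longrightarrow> cmod (char_of \<gamma> t - char_of \<delta> t) + r \<le> d" by blast
  have "{\<xi>. \<forall>t\<in>K. cmod (char_of \<xi> t - char_of \<gamma> t) < r} \<subseteq> {\<gamma>. \<forall>t\<in>K. cmod (char_of \<gamma> t - char_of \<delta> t) < d}"
  proof (intro subsetI CollectI ballI)
    fix \<xi> t assume "\<xi> \<in> {\<xi>. \<forall>t\<in>K. cmod (char_of \<xi> t - char_of \<gamma> t) < r}" and t: "t \<in> K"
    then have "cmod (char_of \<xi> t - char_of \<gamma> t) < r" by simp
    then show "cmod (char_of \<xi> t - char_of \<delta> t) < d"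
      using r(2)[OF t] norm_diff_triangle_ineq[of "char_of \<xi> t" "char_of \<gamma> t" "char_of \<gamma> t" "char_of \<delta> t"]
        norm_triangle_ineq[of "char_of \<xi> t - char_of \<gamma> t" "char_of \<gamma> t - char_of \<delta> t"] by simp
  qed
  then show "\<exists>K' e. compact K' \<and> e > 0 \<and> {\<xi>. \<forall>t\<in>K'. cmod (char_of \<xi> t - char_of \<gamma> t) < e}
      \<subseteq> {\<gamma>. \<forall>t\<in>K. cmod (char_of \<gamma> t - char_of \<delta> t) < d}"
    using K r(1) by blast
qed

context crossed
begin

subsection \<open>Density of the elementary elements\<close>

lemma Lw_j: "f \<in> cc \<Longrightarrow> Lw w (j f) = j (\<lambda>t. Sw w * f t)"
  by (induction w) (simp_all add: LS_j cc_left_mult mult.assoc)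

text \<open>The factor \<open>pairing t (word_sum \<omega> \<nu>)\<close> cancels the scalar that
  arises when the adjoint of S_\<nu> is moved across the group element \<open>t\<close>.\<close>

lemma E_lam:
  assumes \<phi>: "\<phi> \<in> cc"
  shows "E \<mu> (lam (\<lambda>t. pairing t (word_sum \<omega> \<nu>) * \<phi> t)) \<nu> = j (\<lambda>t. \<phi> t *\<^sub>C (Sw \<mu> * star (Sw \<nu>)))"
proof -
  let ?p = "\<lambda>t. pairing t (word_sum \<omega> \<nu>)"
  have p\<phi>: "(\<lambda>t. ?p t * \<phi> t) \<in> cc" by (rule cc_pairing_times[OF \<phi>])
  define \<psi> where "\<psi> t = cnj (?p (- t) * \<phi> (- t))" for t
  have \<psi>: "\<psi> \<in> cc" unfolding \<psi>_def by (rule cc_adj[OF p\<phi>])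
  have "star (lam (\<lambda>t. ?p t * \<phi> t)) = j (\<lambda>t. \<psi> t *\<^sub>C 1)"
    unfolding lam_star[OF p\<phi>] \<psi>_def[abs_def] by (simp add: lam_def)
  then have 1: "Lw \<nu> (star (lam (\<lambda>t. ?p t * \<phi> t))) = j (\<lambda>t. \<psi> t *\<^sub>C Sw \<nu>)"
    by (simp add: Lw_j cc_coeff \<psi> mult_scaleC_right)
  have pc: "cnj (?p t) * (?p t * z) = z" for t z
    using pairing_cnj(1)[of t "word_sum \<omega> \<nu>"] by (metis mult.assoc mult_1)
  have "cc_star \<alpha> (\<lambda>t. \<psi> t *\<^sub>C Sw \<nu>) t = \<phi> t *\<^sub>C star (Sw \<nu>)" for t
    by (simp add: cc_star_def star_scaleC al_scale al_star al_Sw scaleC_scaleC \<psi>_def pc mult_ac)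
  then have "cc_star \<alpha> (\<lambda>t. \<psi> t *\<^sub>C Sw \<nu>) = (\<lambda>t. \<phi> t *\<^sub>C star (Sw \<nu>))" by (rule ext)
  then show ?thesis
    by (simp add: E_def 1 j_star[OF cc_coeff[OF \<psi>], symmetric] Lw_j cc_coeff \<phi> mult_scaleC_right)
qed

lemma j_coeff_cont:
  assumes \<phi>: "\<phi> \<in> cc" shows "continuous_on UNIV (\<lambda>x. j (\<lambda>t. \<phi> t *\<^sub>C x))"
proof (rule linear_continuous_on[OF bounded_linear_intro[of _ "LINT t|m. cmod (\<phi> t)"]])
  note C = cc_coeff[OF \<phi>]
  show "j (\<lambda>t. \<phi> t *\<^sub>C (x + y)) = j (\<lambda>t. \<phi> t *\<^sub>C x) + j (\<lambda>t. \<phi> t *\<^sub>C y)" for x y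
    using j_add[OF C[of x] C[of y]] by (simp add: scaleC_add_right)
  show "j (\<lambda>t. \<phi> t *\<^sub>C r *\<^sub>R x) = r *\<^sub>R j (\<lambda>t. \<phi> t *\<^sub>C x)" for r x
    using j_scale[OF C[of x], of "complex_of_real r"]
    by (simp add: scaleR_scaleC[where 'a='b] scaleR_scaleC[where 'a='o] scaleC_scaleC mult.commute)
  show "norm (j (\<lambda>t. \<phi> t *\<^sub>C x)) \<le> norm x * (LINT t|m. cmod (\<phi> t))" for x
    using j_L1[OF C[of x]] by (simp add: norm_scaleC mult.commute)
qed

text \<open>For fixed \<phi> the map from \<open>x\<close> to \<open>j\<close> of \<phi> x is
  continuous, so density of words in the Cuntz algebra handles constant coefficients. A general
  function is within \<open>d\<close> of a sum of bump functions times its own values, all supported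
  in one compact set, which makes the L1-error small.\<close>

lemma elementary_dense:
  assumes X: "closed X" "0 \<in> X" and add: "\<And>x y. x \<in> X \<Longrightarrow> y \<in> X \<Longrightarrow> x + y \<in> X"
    and E: "\<And>\<mu> a \<nu>. a \<in> galg \<Longrightarrow> E \<mu> a \<nu> \<in> X"
  shows "X = UNIV"
proof -
  define Y where "Y = {x. \<forall>\<phi>\<in>cc. j (\<lambda>t. \<phi> t *\<^sub>C x) \<in> X}"
  have "Y = UNIV"
  proof (rule dense_words)
    have "Y = (\<Inter>\<phi>\<in>cc. {x. j (\<lambda>t. \<phi> t *\<^sub>C x) \<in> X})" by (auto simp: Y_def)
    moreover have "closed {x. j (\<lambda>t. \<phi> t *\<^sub>C x) \<in> X}" if "\<phi> \<in> cc" for \<phi>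
      using closed_vimage[OF X(1) j_coeff_cont[OF that]] by (simp add: vimage_def)
    ultimately show "closed Y" by (simp add: closed_INT)
    show "0 \<in> Y" by (simp add: Y_def j_zero X)
    fix x y assume x: "x \<in> Y" and y: "y \<in> Y"
    have "j (\<lambda>t. \<phi> t *\<^sub>C (x + y)) \<in> X" if "\<phi> \<in> cc" for \<phi>
      using j_add[OF cc_coeff cc_coeff, OF that that, of x y] add x y that
      by (simp add: scaleC_add_right Y_def)
    then show "x + y \<in> Y" by (simp add: Y_def)
  next
    fix c \<mu> \<nu>
    have "j (\<lambda>t. \<phi> t *\<^sub>C c *\<^sub>C (Sw \<mu> * star (Sw \<nu>))) \<in> X" if \<phi>: "\<phi> \<in> cc" for \<phi>
    proof -
      have "j (\<lambda>t. (c * \<phi> t) *\<^sub>C (Sw \<mu> * star (Sw \<nu>))) \<in> X"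
        unfolding E_lam[OF cc_const_times[OF \<phi>], symmetric]
        by (rule E[OF lam_in_galg[OF cc_pairing_times[OF cc_const_times[OF \<phi>]]]])
      then show ?thesis by (simp add: scaleC_scaleC mult.commute)
    qed
    then show "c *\<^sub>C (Sw \<mu> * star (Sw \<nu>)) \<in> Y" by (simp add: Y_def)
  qed
  then have Y: "j (\<lambda>t. \<phi> t *\<^sub>C x) \<in> X" if "\<phi> \<in> cc" for \<phi> x using that by (auto simp: Y_def)
  have "j f \<in> X" if f: "f \<in> cc" for f
  proof -
    obtain K where K: "compact K" "\<And>t. t \<notin> K \<Longrightarrow> f t = 0" using cc_support[OF f] by blast
    obtain V C where V: "open V" "compact C" "K \<subseteq> V" "V \<subseteq> C" using compact_nbhd[OF K(1)] by blast
    have "\<exists>y\<in>X. dist y (j f) < e" if e: "e > 0" for e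
    proof -
      define d where "d = e / (measure m C + 1)"
      have d: "d > 0" using e by (simp add: d_def add_nonneg_pos)
      define U where "U s = {t. norm (f t - f s) < d}" for s
      have U: "open (U s) \<and> s \<in> U s" for s
        using d by (auto simp: U_def intro!: open_Collect_less continuous_intros ccD[OF f])
      obtain I u where u: "finite I" "I \<subseteq> K" "\<And>i. continuous_on UNIV (u i)" "\<And>i t. 0 \<le> (u i t :: real)"
        "\<And>i t. i \<in> I \<Longrightarrow> u i t \<noteq> 0 \<Longrightarrow> t \<in> U i \<and> t \<in> V"
        "\<And>t. (\<Sum>i\<in>I. u i t) \<le> 1" "\<And>t. t \<in> K \<Longrightarrow> (\<Sum>i\<in>I. u i t) = 1"
        by (rule partition[OF K(1) V(1) V(3), of U]) (use U in blast)+
      define v where "v i t = complex_of_real (u i t)" for i t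
      have v: "v i \<in> cc" if i: "i \<in> I" for i
      proof (rule ccI[OF _ V(2)])
        show "continuous_on UNIV (v i)" unfolding v_def by (intro continuous_intros u)
        show "v i t = 0" if "t \<notin> C" for t using u(5)[OF i, of t] that V by (auto simp: v_def)
      qed
      define g where "g t = (\<Sum>i\<in>I. v i t *\<^sub>C f i)" for t
      have g: "g \<in> cc" unfolding g_def by (intro cc_sum cc_coeff v)
      have "j (\<lambda>t. \<Sum>i\<in>J. v i t *\<^sub>C f i) \<in> X" if "finite J" "J \<subseteq> I" for J
        using that
      proof (induction J rule: finite_induct)
        case (insert i J)
        have "(\<lambda>t. v i t *\<^sub>C f i) \<in> cc" "(\<lambda>t. \<Sum>i\<in>J. v i t *\<^sub>C f i) \<in> cc"
          using insert by (auto intro!: cc_coeff cc_sum v)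
        from j_add[OF this] show ?case using insert Y[OF v, of i "f i"] by (auto intro!: add)
      qed (simp add: j_zero X)
      then have gX: "j g \<in> X" using u(1) by (simp add: g_def[abs_def])
      have ne: "norm (g t - f t) \<le> d" for t
      proof -
        have "f t = (\<Sum>i\<in>I. v i t *\<^sub>C f t)"
        proof (cases "t \<in> K")
          case True
          then show ?thesis using u(7)[OF True]
            by (simp add: v_def[abs_def] scaleC_sum_left[symmetric] of_real_sum[symmetric] del: of_real_sum)
        qed (simp add: K)
        then have "norm (g t - f t) = norm (\<Sum>i\<in>I. v i t *\<^sub>C (f i - f t))"
          by (simp add: g_def scaleC_diff_right sum_subtractf)
        also have "\<dots> \<le> (\<Sum>i\<in>I. u i t * d)"
        proof (rule sum_norm_le)
          fix i assume i: "i \<in> I"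
          show "norm (v i t *\<^sub>C (f i - f t)) \<le> u i t * d"
          proof (cases "u i t = 0")
            case False
            then have "norm (f i - f t) \<le> d" using u(5)[OF i False] by (simp add: U_def norm_minus_commute)
            then show ?thesis using u(4)[of i t] by (simp add: v_def norm_scaleC mult_left_mono)
          qed (simp add: v_def)
        qed
        also have "\<dots> = (\<Sum>i\<in>I. u i t) * d" by (simp add: sum_distrib_right)
        also have "\<dots> \<le> 1 * d" by (rule mult_right_mono[OF u(6)]) (use d in simp)
        finally show ?thesis by simp
      qed
      have gf: "(\<lambda>t. g t - f t) \<in> cc" by (rule cc_diff[OF g f])
      have "norm (j g - j f) \<le> (LINT t|m. norm (g t - f t))"
        using j_L1[OF gf] by (simp add: j_diff g f)
      also have "\<dots> \<le> d * measure m C"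
      proof (rule integral_bound_real[OF cc_norm[OF gf] V(2)])
        fix t
        show "\<bar>norm (g t - f t)\<bar> \<le> d" using ne by simp
        assume "t \<notin> C"
        then have "v i t = 0" if "i \<in> I" for i using u(5)[OF that, of t] V by (auto simp: v_def)
        then show "norm (g t - f t) = 0" using \<open>t \<notin> C\<close> K(2)[of t] V by (auto simp: g_def)
      qed
      also have "\<dots> < d * (measure m C + 1)" using d by simp
      also have "\<dots> = e" by (simp add: d_def add_nonneg_eq_0_iff)
      finally show ?thesis using gX by (auto simp: dist_norm)
    qed
    then have "j f \<in> closure X" unfolding closure_approachable by blast
    then show ?thesis using X(1) by simp
  qed
  then show ?thesis using j_induct[OF X(1)] by blast
qed

sublocale dense_core galg vf dact LS \<omega>
  by unfold_locales (rule elementary_dense)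

subsection \<open>Dense and non-dense orbits\<close>

lemma dact_dist:
  assumes \<phi>: "\<phi> \<in> cc" and d: "\<And>t. \<phi> t \<noteq> 0 \<Longrightarrow> cmod (pairing t \<xi> - pairing t \<xi>') \<le> d"
  shows "norm (dact \<xi> (lam \<phi>) - dact \<xi>' (lam \<phi>)) \<le> d * (LINT t|m. cmod (\<phi> t))"
proof -
  let ?f = "\<lambda>t. pairing t \<xi> * \<phi> t - pairing t \<xi>' * \<phi> t"
  have c: "?f \<in> cc" by (intro cc_diff cc_pairing_times \<phi>)
  have "norm (dact \<xi> (lam \<phi>) - dact \<xi>' (lam \<phi>)) \<le> (LINT t|m. cmod (?f t))"
    using lam_L1[OF c] by (simp add: dact_lam \<phi> lam_diff cc_pairing_times)
  also have "\<dots> \<le> (LINT t|m. d * cmod (\<phi> t))"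
  proof (rule integral_mono)
    show "integrable m (\<lambda>t. cmod (?f t))" "integrable m (\<lambda>t. d * cmod (\<phi> t))"
      using cc_integrable[OF cc_norm[OF c]] cc_integrable[OF cc_norm[OF \<phi>]] by simp_all
    show "cmod (?f t) \<le> d * cmod (\<phi> t)" for t
      using d[of t] by (cases "\<phi> t = 0") (simp_all add: left_diff_distrib[symmetric] norm_mult mult_right_mono)
  qed
  finally show ?thesis by simp
qed

text \<open>On \<open>lam \<phi>\<close> the dual action depends only on the characters over the
  compact support of \<phi>, so closeness in the compact-open topology suffices. Density is used at
  \<open>\<xi> - \<omega> k\<close>, which frees the first letter.\<close>

lemma orbit_approx:
  assumes D: "UNIV = closure {word_sum \<omega> \<mu> | \<mu>. True}" and a: "a \<in> galg" and e: "e > 0"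
  shows "\<exists>w. norm (dact (\<omega> k + osum w) a - dact \<xi> a) < e"
proof -
  obtain \<phi> where \<phi>: "\<phi> \<in> cc" "norm (a - lam \<phi>) < e/3" using galg_approx[OF a, of "e/3"] e by auto
  obtain K where K: "compact K" "\<And>t. t \<notin> K \<Longrightarrow> \<phi> t = 0" using cc_support[OF \<phi>(1)] by blast
  define N where "N = (LINT t|m. cmod (\<phi> t))"
  have N: "0 \<le> N" unfolding N_def by (rule L1_nonneg)
  define d where "d = e / (3 * (N + 1))"
  have d: "d > 0" using e N by (simp add: d_def)
  let ?B = "{\<gamma>. \<forall>t\<in>K. cmod (char_of \<gamma> t - char_of (\<xi> - \<omega> k) t) < d}"
  have "\<xi> - \<omega> k \<in> ?B" using d by simp
  moreover have "\<xi> - \<omega> k \<in> closure {word_sum \<omega> \<mu> | \<mu>. True}" using D by blast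
  ultimately have "?B \<inter> {word_sum \<omega> \<mu> | \<mu>. True} \<noteq> {}"
    using open_Int_closure_eq_empty[OF open_uniform_nbhd[OF K(1), of "\<xi> - \<omega> k" d]] by blast
  then obtain w where w: "\<And>t. t \<in> K \<Longrightarrow> cmod (pairing t (word_sum \<omega> w) - pairing t (\<xi> - \<omega> k)) < d"
    unfolding pairing_def by blast
  have close: "cmod (pairing t (\<omega> k + osum w) - pairing t \<xi>) \<le> d" if "\<phi> t \<noteq> 0" for t
  proof -
    have "pairing t \<xi> = pairing t (\<omega> k) * pairing t (\<xi> - \<omega> k)"
      using pairing_simps(5)[of t "\<omega> k" "\<xi> - \<omega> k"] by simp
    then have "pairing t (\<omega> k + osum w) - pairing t \<xi>
        = pairing t (\<omega> k) * (pairing t (word_sum \<omega> w) - pairing t (\<xi> - \<omega> k))"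
      by (simp add: osum_def word_sum_def right_diff_distrib)
    then have "cmod (pairing t (\<omega> k + osum w) - pairing t \<xi>) = cmod (pairing t (word_sum \<omega> w) - pairing t (\<xi> - \<omega> k))"
      by (simp only: norm_mult pairing_simps mult_1)
    moreover have "t \<in> K" using that K(2) by blast
    ultimately show ?thesis using w[of t] by simp
  qed
  have dd: "norm (dact \<eta> a - dact \<eta> (lam \<phi>)) < e/3" for \<eta>
  proof -
    have "dact \<eta> a - dact \<eta> (lam \<phi>) = dact \<eta> (a - lam \<phi>)" using dact_add[of \<eta> "a - lam \<phi>" "lam \<phi>"] by simp
    then show ?thesis using dact_bound[of \<eta> "a - lam \<phi>"] \<phi>(2) by simp
  qed
  have "norm (dact (\<omega> k + osum w) (lam \<phi>) - dact \<xi> (lam \<phi>)) \<le> d * N"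
    unfolding N_def by (rule dact_dist[OF \<phi>(1) close])
  also have "\<dots> \<le> e/3" using N e by (simp add: d_def field_simps)
  finally have "norm ((dact (\<omega> k + osum w) a - dact (\<omega> k + osum w) (lam \<phi>))
      + (dact (\<omega> k + osum w) (lam \<phi>) - dact \<xi> (lam \<phi>)) - (dact \<xi> a - dact \<xi> (lam \<phi>))) < e"
    using dd[of "\<omega> k + osum w"] dd[of \<xi>]
      norm_triangle_ineq4[of "(dact (\<omega> k + osum w) a - dact (\<omega> k + osum w) (lam \<phi>))
      + (dact (\<omega> k + osum w) (lam \<phi>) - dact \<xi> (lam \<phi>))" "dact \<xi> a - dact \<xi> (lam \<phi>)"]
      norm_triangle_ineq[of "dact (\<omega> k + osum w) a - dact (\<omega> k + osum w) (lam \<phi>)"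
        "dact (\<omega> k + osum w) (lam \<phi>) - dact \<xi> (lam \<phi>)"] by linarith
  then show ?thesis by (intro exI[of _ w]) (simp add: algebra_simps)
qed

lemma dense_imp_simple:
  assumes D: "UNIV = closure {word_sum \<omega> \<mu> | \<mu>. True}"
  shows "simple_cstar TYPE('b)" "purely_infinite TYPE('b)"
proof -
  interpret dense_orbit_core galg vf dact LS \<omega>
    by unfold_locales (rule orbit_approx[OF D])
  show "simple_cstar TYPE('b)" by (rule simple)
  show "purely_infinite TYPE('b)" by (rule purely_infinite)
qed

lemma ft_translate:
  assumes \<phi>: "\<phi> \<in> cc" shows "ft (\<lambda>s. \<phi> (s - t)) \<gamma> = pairing t \<gamma> * ft \<phi> \<gamma>"
proof -
  have "continuous_on UNIV (\<lambda>s. pairing (s + t) \<gamma> * \<phi> s)"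
    by (intro continuous_intros pairing_cont ccD[OF \<phi>])
  from integral_translate'[OF this, of t]
  have "ft (\<lambda>s. \<phi> (s - t)) \<gamma> = (LINT s|m. pairing t \<gamma> * (pairing s \<gamma> * \<phi> s))"
    by (simp add: ft_def mult_ac)
  then show ?thesis by (simp add: ft_def)
qed

lemma ft_bound: "\<phi> \<in> cc \<Longrightarrow> cmod (ft \<phi> \<gamma>) \<le> (LINT t|m. cmod (\<phi> t))"
  using vf_bound[of \<gamma> "lam \<phi>"] lam_L1[of \<phi>] by (simp add: vf_lam)

lemma ft_diff: "\<phi> \<in> cc \<Longrightarrow> \<psi> \<in> cc \<Longrightarrow> ft (\<lambda>t. \<phi> t - \<psi> t) \<gamma> = ft \<phi> \<gamma> - ft \<psi> \<gamma>"
  unfolding ft_def using cc_integrable[OF cc_pairing_times] by (simp add: right_diff_distrib)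

text \<open>If a basic neighbourhood of \<open>\<delta>\<close> misses all \<open>\<omega>\<^sub>\<mu>\<close>, the positive part of
  \<open>\<eta> x\<^sup>* x - \<Sum> c\<^sub>i\<^sup>* c\<^sub>i - d\<^sup>* d\<close> is nonzero at \<open>\<delta>\<close> and vanishes at all \<open>\<omega>\<^sub>\<mu>\<close>: where the transform of \<open>x\<close>
  is small the term \<open>d = x\<^sup>2 - x\<close> dominates, elsewhere one of the \<open>c\<^sub>i\<close> does.\<close>

lemma simple_imp_dense:
  assumes "simple_cstar TYPE('b)" shows "UNIV = closure {word_sum \<omega> \<mu> | \<mu>. True}"
proof (rule ccontr)
  let ?W = "{word_sum \<omega> \<mu> | \<mu>. True}"
  assume "UNIV \<noteq> closure ?W"
  then obtain \<delta> where \<delta>: "\<delta> \<in> - closure ?W" by blast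
  have "open (- closure ?W)" using closed_closure[of ?W] by (simp only: closed_def)
  then have "\<exists>K e. compact K \<and> e > 0 \<and> {\<gamma>. \<forall>t\<in>K. cmod (char_of \<gamma> t - char_of \<delta> t) < e} \<subseteq> - closure ?W"
    using \<delta> unfolding open_dual_def by (rule bspec)
  then obtain K e where K: "compact K" "e > 0"
    "{\<gamma>. \<forall>t\<in>K. cmod (char_of \<gamma> t - char_of \<delta> t) < e} \<subseteq> - closure ?W" by (elim exE conjE)
  have far: "\<exists>t\<in>K. e \<le> cmod (pairing t (word_sum \<omega> \<mu>) - pairing t \<delta>)" for \<mu>
  proof (rule ccontr)
    assume "\<not> ?thesis"
    then have "word_sum \<omega> \<mu> \<in> {\<gamma>. \<forall>t\<in>K. cmod (char_of \<gamma> t - char_of \<delta> t) < e}"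
      by (auto simp: pairing_def not_le)
    then have "word_sum \<omega> \<mu> \<notin> closure ?W" using K(3) by blast
    moreover have "word_sum \<omega> \<mu> \<in> closure ?W" by (rule subsetD[OF closure_subset]) blast
    ultimately show False by contradiction
  qed
  obtain \<phi> where \<phi>: "\<phi> \<in> cc" "ft \<phi> \<delta> = 1" using ft_unit by blast
  define \<tau> where "\<tau> t s = \<phi> (s - t)" for t s
  have \<tau>: "\<tau> t \<in> cc" for t unfolding \<tau>_def by (rule cc_shift[OF \<phi>(1)])
  have ft_\<tau>: "ft (\<tau> t) \<gamma> = pairing t \<gamma> * ft \<phi> \<gamma>" for t \<gamma>
    unfolding \<tau>_def by (rule ft_translate[OF \<phi>(1)])
  \<comment> \<open>The translates of \<phi> are L1-close locally, so finitely many points of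
    \<open>K\<close> can replace all of \<open>K\<close>. The bound e/8 leaves, where the transform
    of \<phi> is at least 1/2 in modulus, more than half of the separation \<open>e\<close>.\<close>
  have "\<exists>X. open X \<and> t \<in> X \<and> (\<forall>s\<in>X. (LINT r|m. cmod (\<tau> s r - \<tau> t r)) < e/8)" for t
    unfolding \<tau>_def by (rule L1_translate_continuous[OF \<phi>(1)]) (use K(2) in simp)
  then obtain X where X: "\<And>t. open (X t)" "\<And>t. t \<in> X t"
    "\<And>s t. s \<in> X t \<Longrightarrow> (LINT r|m. cmod (\<tau> s r - \<tau> t r)) < e/8" by metis
  obtain I where I: "I \<subseteq> K" "finite I" "K \<subseteq> (\<Union>t\<in>I. X t)"
    by (rule compactE_image[OF K(1), of K X]) (use X in auto)
  have near: "cmod (pairing s \<gamma> - pairing t \<gamma>) * cmod (ft \<phi> \<gamma>) \<le> e/8" if "s \<in> X t" for s t \<gamma>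
  proof -
    have "cmod ((pairing s \<gamma> - pairing t \<gamma>) * ft \<phi> \<gamma>) = cmod (ft (\<lambda>r. \<tau> s r - \<tau> t r) \<gamma>)"
      by (simp add: ft_diff \<tau> ft_\<tau> left_diff_distrib)
    also have "\<dots> \<le> e/8" using ft_bound[OF cc_diff[OF \<tau> \<tau>], of s t \<gamma>] X(3)[OF that] by linarith
    finally show ?thesis by (simp add: norm_mult)
  qed
  define x where "x = lam \<phi>"
  define c where "c i = lam (\<tau> i) - pairing i \<delta> *\<^sub>C x" for i
  define d where "d = x * x - x"
  \<comment> \<open>Two regions are served: 1/4 where the transform A of \<phi> satisfies |A| < 1/2
    and so |A - 1| \<ge> 1/2, and e^2/4 elsewhere, where some \<open>c i\<close> has modulus at
    least (e/2) |A|.\<close>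
  define \<eta> where "\<eta> = min (1/4) (e\<^sup>2/4)"
  have \<eta>: "\<eta> > 0" "\<eta> \<le> 1/4" "\<eta> \<le> e\<^sup>2/4" using K(2) by (auto simp: \<eta>_def)
  have xA: "x \<in> galg" "c i \<in> galg" "d \<in> galg" for i
    unfolding x_def c_def d_def using \<phi> \<tau> by (auto intro!: lam_in_galg A_mult A_diff A_scale)
  define h where "h = complex_of_real \<eta> *\<^sub>C (star x * x) - (\<Sum>i\<in>I. star (c i) * c i) - star d * d"
  have sumA: "(\<Sum>i\<in>I. star (c i) * c i) \<in> galg"
    using I(2) by (induction I rule: finite_induct) (auto intro!: A_zero A_add A_mult A_star xA)
  have hA: "h \<in> galg" unfolding h_def by (intro A_diff A_scale A_mult A_star xA sumA)
  have hs: "star h = h" by (simp add: h_def star_diff star_scaleC star_mult star_star star_sum)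
  have sq: "vf \<gamma> (star y * y) = complex_of_real ((cmod (vf \<gamma> y))\<^sup>2)" if "y \<in> galg" for y \<gamma>
    unfolding ch_mult[OF A_star[OF that] that] vf_star by (metis complex_norm_square mult.commute)
  have vc: "vf \<gamma> (c i) = (pairing i \<gamma> - pairing i \<delta>) * ft \<phi> \<gamma>" for i \<gamma>
    by (simp add: c_def x_def pf.diff pf.scale vf_lam \<tau> \<phi> ft_\<tau> left_diff_distrib)
  have vd: "vf \<gamma> d = (ft \<phi> \<gamma> - 1) * ft \<phi> \<gamma>" for \<gamma>
    unfolding d_def pf.diff ch_mult[OF xA(1) xA(1)] by (simp add: x_def vf_lam \<phi> algebra_simps)
  have vh: "Re (vf \<gamma> h) = \<eta> * (cmod (ft \<phi> \<gamma>))\<^sup>2 - (\<Sum>i\<in>I. (cmod ((pairing i \<gamma> - pairing i \<delta>) * ft \<phi> \<gamma>))\<^sup>2)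
      - (cmod ((ft \<phi> \<gamma> - 1) * ft \<phi> \<gamma>))\<^sup>2" for \<gamma>
    by (simp add: h_def pf.diff pf.scale pf.sum sq xA vc vd del: norm_mult) (simp add: x_def vf_lam \<phi>)
  have "continuous_on UNIV (max (0::real))"
    by (intro continuous_on_max continuous_on_const continuous_on_id)
  then obtain a where a: "a \<in> galg" "\<And>\<gamma>. vf \<gamma> a = complex_of_real (max 0 (Re (vf \<gamma> h)))"
    using functional_calculus[OF hA hs, of "max 0"] by auto
  have "vf \<delta> a \<noteq> 0" using \<eta> by (simp add: a(2) vh \<phi>)
  then have a0: "a \<noteq> 0" by auto
  have "vf (osum w) a = 0" for w
  proof -
    let ?\<gamma> = "osum w"
    have "Re (vf ?\<gamma> h) \<le> 0"
    proof (cases "cmod (ft \<phi> ?\<gamma>) < 1/2")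
      case True
      then have "1/2 \<le> cmod (ft \<phi> ?\<gamma> - 1)" using norm_triangle_ineq2[of 1 "ft \<phi> ?\<gamma>"] by (simp add: norm_minus_commute)
      then have "(1/2)\<^sup>2 \<le> (cmod (ft \<phi> ?\<gamma> - 1))\<^sup>2" by (intro power_mono) auto
      then have "\<eta> * (cmod (ft \<phi> ?\<gamma>))\<^sup>2 \<le> (cmod (ft \<phi> ?\<gamma> - 1))\<^sup>2 * (cmod (ft \<phi> ?\<gamma>))\<^sup>2"
        using \<eta>(2) by (intro mult_right_mono) (auto simp: power2_eq_square)
      moreover have "0 \<le> (\<Sum>i\<in>I. (cmod ((pairing i ?\<gamma> - pairing i \<delta>) * ft \<phi> ?\<gamma>))\<^sup>2)" by (intro sum_nonneg) simp
      ultimately show ?thesis unfolding vh norm_mult power_mult_distrib by linarith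
    next
      case False
      let ?A = "cmod (ft \<phi> ?\<gamma>)"
      obtain s where s: "s \<in> K" "e \<le> cmod (pairing s ?\<gamma> - pairing s \<delta>)"
        using far[of w] unfolding osum_def word_sum_def by blast
      obtain i where i: "i \<in> I" "s \<in> X i" using s(1) I(3) by blast
      have 1: "cmod (pairing s ?\<gamma> - pairing i ?\<gamma>) * ?A \<le> e/8" by (rule near[OF i(2)])
      have 2: "cmod (pairing s \<delta> - pairing i \<delta>) \<le> e/8" using near[OF i(2), of \<delta>] by (simp add: \<phi>)
      have "pairing s ?\<gamma> - pairing s \<delta>
          = (pairing s ?\<gamma> - pairing i ?\<gamma>) + (pairing i ?\<gamma> - pairing i \<delta>) - (pairing s \<delta> - pairing i \<delta>)" by simp
      then have "e \<le> cmod (pairing s ?\<gamma> - pairing i ?\<gamma>) + cmod (pairing i ?\<gamma> - pairing i \<delta>) + e/8"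
        using s(2) 2 norm_triangle_ineq4[of "(pairing s ?\<gamma> - pairing i ?\<gamma>) + (pairing i ?\<gamma> - pairing i \<delta>)" "pairing s \<delta> - pairing i \<delta>"]
          norm_triangle_ineq[of "pairing s ?\<gamma> - pairing i ?\<gamma>" "pairing i ?\<gamma> - pairing i \<delta>"] by simp
      then have "e * ?A \<le> (cmod (pairing s ?\<gamma> - pairing i ?\<gamma>) + cmod (pairing i ?\<gamma> - pairing i \<delta>) + e/8) * ?A"
        by (intro mult_right_mono) auto
      then have "e * ?A \<le> e/8 + cmod (pairing i ?\<gamma> - pairing i \<delta>) * ?A + e/8 * ?A"
        using 1 by (simp add: distrib_right)
      moreover have "e/8 \<le> e/4 * ?A" using False K(2) by (simp add: field_simps)
      moreover have "0 \<le> e * ?A" using K(2) by simp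
      ultimately have "e/2 * ?A \<le> cmod (pairing i ?\<gamma> - pairing i \<delta>) * ?A" by (simp add: field_simps)
      then have "(e/2 * ?A)\<^sup>2 \<le> (cmod (pairing i ?\<gamma> - pairing i \<delta>) * ?A)\<^sup>2"
        using K(2) by (intro power_mono) auto
      also have "\<dots> = (cmod ((pairing i ?\<gamma> - pairing i \<delta>) * ft \<phi> ?\<gamma>))\<^sup>2" by (simp add: norm_mult)
      also have "\<dots> \<le> (\<Sum>i\<in>I. (cmod ((pairing i ?\<gamma> - pairing i \<delta>) * ft \<phi> ?\<gamma>))\<^sup>2)"
        using I(2) by (intro member_le_sum[OF i(1)]) auto
      finally have "e\<^sup>2/4 * ?A\<^sup>2 \<le> (\<Sum>i\<in>I. (cmod ((pairing i ?\<gamma> - pairing i \<delta>) * ft \<phi> ?\<gamma>))\<^sup>2)"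
        by (simp add: power_mult_distrib power_divide)
      moreover have "\<eta> * ?A\<^sup>2 \<le> e\<^sup>2/4 * ?A\<^sup>2" by (rule mult_right_mono[OF \<eta>(3)]) simp
      moreover have "0 \<le> (cmod ((ft \<phi> ?\<gamma> - 1) * ft \<phi> ?\<gamma>))\<^sup>2" by simp
      ultimately show ?thesis unfolding vh by linarith
    qed
    then show ?thesis by (simp add: a(2))
  qed
  then show False using not_simple[OF a(1) a0] assms by blast
qed

end

theorem proposition5p2:
  fixes \<omega> :: "nat \<Rightarrow> 'g::{topological_ab_group_add, t2_space} dual"
    and m :: "'g measure"
    and S :: "nat \<Rightarrow> 'o::{cstar_algebra, real_normed_algebra_1, second_countable_topology}"
    and \<alpha> :: "'g \<Rightarrow> 'o \<Rightarrow> 'o"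
    and j :: "('g \<Rightarrow> 'o) \<Rightarrow> 'b::cstar_algebra"
  assumes "locally_compact_space (euclidean :: 'g topology)"
    and "haar_measure m"
    and "is_cuntz_infinity S"
    and "is_quasi_free_action S \<omega> \<alpha>"
    and "is_crossed_product m \<alpha> j"
  shows "(UNIV = closure {word_sum \<omega> \<mu> | \<mu>. True} \<longleftrightarrow> simple_cstar TYPE('b)) \<and>
    (simple_cstar TYPE('b) \<longleftrightarrow> simple_cstar TYPE('b) \<and> purely_infinite TYPE('b))"
proof -
  interpret crossed S m \<omega> \<alpha> j
    by unfold_locales (fact assms)+
  show ?thesis using dense_imp_simple simple_imp_dense by blast
qed

end
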